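(* Let $X$ be a smooth manifold and $n\geq 1$. The action $\hat{\mathrm{H}}^3(X)\times\hat{\mathrm{H}}^1(X,\mathbb{TD}_\kappa)\to\hat{\mathrm{H}}^1(X,\mathbb{TD}_\kappa)$ of the degree three differential cohomology of $X$ on the adjusted differential cohomology with values in the T-duality 2-group $\mathbb{TD}$ has the following properties: (i) It acts transitively in the fibres of the projection $\hat{\mathrm{H}}^1(X,\mathbb{TD}_\kappa)\to\mathrm{Bun}^\nabla_{\mathbb{T}^n}(X)\times\mathrm{Bun}^\nabla_{\mathbb{T}^n}(X)$. (ii) The stabilizer of each element in the fibre over $(\xi,\hat\xi)\in\mathrm{Bun}^\nabla_{\mathbb{T}^n}(X)\times\mathrm{Bun}^\nabla_{\mathbb{T}^n}(X)$ with curvature pair $(F,\hat F)$ is the subgroup $\mathcal{F}_{F,\hat F}:=\{\mathcal{I}_{y\hat F+\hat yF}\;|\;y,\hat y\in\mathbb{R}^n\}\subseteq\hat{\mathrm{H}}^3(X)$. In particular, the quotient $\hat{\mathrm{H}}^3(X)/\mathcal{F}_{F,\hat F}$ acts freely and transitively on the fibre over $(\xi,\hat\xi)$.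
   Context: $\mathbb{T}=\mathbb{R}/\mathbb{Z}$, $\mathbb{T}^n=\mathbb{R}^n/\mathbb{Z}^n$, $\theta$ is the Maurer-Cartan form (so $f^*\theta=df$ for a map $f$ to $\mathbb{T}$ or $\mathbb{R}^n$); products of $\mathbb{R}^n$-valued quantities are standard inner products. All sets of classes below are direct limits over refinements of open covers $\{U_i\}$ of $X$. \textbf{Differential cohomology.} $\hat{\mathrm{H}}^3(X)$ is the group of equivalence classes of Deligne 2-cocycles $(B_i,A_{ij},c_{ijk})$, $B_i\in\Omega^2(U_i)$, $A_{ij}\in\Omega^1(U_i\cap U_j)$, $c_{ijk}:U_i\cap U_j\cap U_k\to\mathbb{T}$ smooth, in the sign convention $B_j+dA_{ij}=B_i$, $A_{ik}=A_{ij}+A_{jk}-c_{ijk}^*\theta$, $c_{jkl}+c_{ijl}=c_{ijk}+c_{ikl}$; two cocycles are equivalent if there are $C_i\in\Omega^1(U_i)$ and smooth $d_{ij}:U_i\cap U_j\to\mathbb{T}$ with $B_i'=B_i+dC_i$, $A_{ij}'=A_{ij}+C_i-C_j-d_{ij}^*\theta$, $c'_{ijk}=c_{ijk}+d_{ik}-d_{ij}-d_{jk}$. This group is isomorphic to the group of isomorphism classes of bundle gerbes with connection over $X$; for $\beta\in\Omega^2(X)$, the trivial bundle gerbe $\mathcal{I}_\beta$ with connection given by $\beta$ is represented by $(\beta,0,0)$. \textbf{Adjusted differential cohomology.} An adjusted differential $\mathbb{TD}$-cocycle is a tuple $(A_i,\hat A_i,R_i,\varphi_{ij},a_{ij},\hat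 a_{ij},m_{ijk},\hat m_{ijk},t_{ijk})$ with $A_i,\hat A_i\in\Omega^1(U_i,\mathbb{R}^n)$, $R_i\in\Omega^2(U_i)$, $\varphi_{ij}\in\Omega^1(U_i\cap U_j)$, smooth $a_{ij},\hat a_{ij}:U_i\cap U_j\to\mathbb{R}^n$, $m_{ijk},\hat m_{ijk}\in\mathbb{Z}^n$, smooth $t_{ijk}:U_i\cap U_j\cap U_k\to\mathbb{T}$, such that, with $\hat F|_{U_i}=d\hat A_i$: $a_{ik}=m_{ijk}+a_{ij}+a_{jk}$, $\hat a_{ik}=\hat m_{ijk}+\hat a_{ij}+\hat a_{jk}$, $t_{ikl}+t_{ijk}-m_{ijk}\hat a_{kl}=t_{ijl}+t_{jkl}$, $A_j=A_i-a_{ij}^*\theta$, $\hat A_j=\hat A_i-\hat a_{ij}^*\theta$, $\varphi_{ik}-\hat A_km_{ijk}=\varphi_{jk}+\varphi_{ij}-t_{ijk}^*\theta$, $R_j+d\varphi_{ij}=R_i+a_{ij}\hat F$. Two such cocycles (unprimed and primed) are equivalent if there is a tuple $(\phi_i,p_i,\hat p_i,z_{ij},\hat z_{ij},e_{ij})$ with $\phi_i\in\Omega^1(U_i)$, smooth $p_i,\hat p_i:U_i\to\mathbb{R}^n$, $z_{ij},\hat z_{ij}\in\mathbb{Z}^n$, smooth $e_{ij}:U_i\cap U_j\to\mathbb{T}$ such that $a'_{ij}+p_i=z_{ij}+p_j+a_{ij}$, $\hat a'_{ij}+\hat p_i=\hat z_{ij}+\hat p_j+\hat a_{ij}$, $t'_{ijk}+e_{ij}-\hat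 a'_{jk}z_{ij}+e_{jk}=e_{ik}+t_{ijk}-\hat p_km_{ijk}$, $A'_i=A_i-p_i^*\theta$, $\hat A'_i=\hat A_i-\hat p_i^*\theta$, $\varphi'_{ij}+\phi_i-z_{ij}\hat A'_j=\phi_j+\varphi_{ij}-e_{ij}^*\theta$, $R'_i+d\phi_i=R_i+p_i\hat F$. The set of equivalence classes is $\hat{\mathrm{H}}^1(X,\mathbb{TD}_\kappa)$. \textbf{Action and projection.} The action is induced by $(B_i,A_{ij},c_{ijk})\cdot(A_i,\hat A_i,R_i,\varphi_{ij},a_{ij},\hat a_{ij},m_{ijk},\hat m_{ijk},t_{ijk})=(A_i,\hat A_i,R_i+B_i,\varphi_{ij}+A_{ij},a_{ij},\hat a_{ij},m_{ijk},\hat m_{ijk},t_{ijk}+c_{ijk})$. $\mathrm{Bun}^\nabla_{\mathbb{T}^n}(X)$ is the set of isomorphism classes of principal $\mathbb{T}^n$-bundles with connection over $X$; the projection sends a cocycle to the bundles with connection with local data $(A_i,a_{ij})$ and $(\hat A_i,\hat a_{ij})$, and their curvatures are $F|_{U_i}=dA_i$, $\hat F|_{U_i}=d\hat A_i$, in $\Omega^2(X,\mathbb{R}^n)$.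
   Formalization: Part (ii) and the final "in particular" are stated for connected X only; for disconnected X, e.g. two disjoint 2-spheres with F=0 and F̂ of integral 1 on each, the stabilizer is larger than the subgroup given. Part (i) is stated for every X. *)

theory Defs
  imports "HOL-Analysis.Analysis" "HOL-Algebra.Group_Action"
begin

section \<open>The circle \<open>\<real>/\<int>\<close> and tori\<close>

quotient_type circle = real / "\<lambda>x y. x - y \<in> \<int>"
proof (rule equivpI)
  show "reflp (\<lambda>x y::real. x - y \<in> \<int>)" by (simp add: reflp_def)
  show "symp (\<lambda>x y::real. x - y \<in> \<int>)"
    by (rule sympI) (metis Ints_minus minus_diff_eq)
  show "transp (\<lambda>x y::real. x - y \<in> \<int>)"
    by (rule transpI) (metis Ints_add add_diff_eq diff_add_cancel)
qed

lift_definition circle_of :: "real \<Rightarrow> circle" is "\<lambda>x. x" .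

instantiation circle :: ab_group_add
begin

lift_definition zero_circle :: circle is 0 .

lift_definition plus_circle :: "circle \<Rightarrow> circle \<Rightarrow> circle" is "(+)"
  by (metis Ints_add add_diff_add)

lift_definition uminus_circle :: "circle \<Rightarrow> circle" is uminus
  by (metis Ints_minus minus_diff_minus)

lift_definition minus_circle :: "circle \<Rightarrow> circle \<Rightarrow> circle" is "(-)"
  by (metis Ints_diff diff_diff_eq2 diff_add_eq diff_diff_add add.commute)

instance
  by standard (transfer; simp)+

end

definition torus_of :: "real^'n \<Rightarrow> circle^'n" where
  "torus_of v = (\<chi> i. circle_of (v $ i))"

definition lattice :: "(real^'n) set" where
  "lattice = {v. \<forall>i. v $ i \<in> \<int>}"


section \<open>Smooth manifolds\<close>

primrec times_diff_on ::
  "nat \<Rightarrow> 'a::real_normed_vector set \<Rightarrow> ('a \<Rightarrow> 'b::real_normed_vector) \<Rightarrow> bool" where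
  "times_diff_on 0 S f \<longleftrightarrow> continuous_on S f"
| "times_diff_on (Suc k) S f \<longleftrightarrow>
     (\<forall>x\<in>S. f differentiable (at x)) \<and>
     (\<forall>v. times_diff_on k S (\<lambda>x. frechet_derivative f (at x) v))"

text \<open>Used for open subsets of finite-dimensional spaces only, where continuity of all iterated
  directional derivatives is the usual notion of smoothness.\<close>

definition smooth_on ::
  "'a::real_normed_vector set \<Rightarrow> ('a \<Rightarrow> 'b::real_normed_vector) \<Rightarrow> bool" where
  "smooth_on S f \<longleftrightarrow> (\<forall>k. times_diff_on k S f)"

text \<open>
  A manifold is given by an atlas; its underlying space is the union of the chart domains, an open
  subset of a Hausdorff second countable space.  A normed space has the Heine-Borel property iff it
  is finite-dimensional, so the sort \<open>{real_normed_vector, heine_borel}\<close> of the model space \<open>'e\<close>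
  comprises the Euclidean spaces and also the zero-dimensional space, which the class of Euclidean
  spaces excludes.
\<close>

type_synonym ('x, 'e) chart = "'x set \<times> ('x \<Rightarrow> 'e)"
type_synonym ('x, 'e) atlas = "('x, 'e) chart set"

abbreviation cdom :: "('x, 'e) chart \<Rightarrow> 'x set" where
  "cdom c \<equiv> fst c"

abbreviation cmap :: "('x, 'e) chart \<Rightarrow> 'x \<Rightarrow> 'e" where
  "cmap c \<equiv> snd c"

abbreviation cinv :: "('x, 'e) chart \<Rightarrow> 'e \<Rightarrow> 'x" where
  "cinv c \<equiv> inv_into (fst c) (snd c)"

definition points :: "('x, 'e) atlas \<Rightarrow> 'x set" where
  "points M = (\<Union>c\<in>M. cdom c)"

definition smooth_manifold ::
  "('x::{t2_space,second_countable_topology}, 'e::{real_normed_vector,heine_borel}) atlas \<Rightarrow> bool"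
where
  "smooth_manifold M \<longleftrightarrow>
     (\<forall>c\<in>M. open (cdom c) \<and> open (cmap c ` cdom c) \<and>
        homeomorphism (cdom c) (cmap c ` cdom c) (cmap c) (cinv c)) \<and>
     (\<forall>c\<in>M. \<forall>c'\<in>M. smooth_on (cmap c ` (cdom c \<inter> cdom c')) (cmap c' \<circ> cinv c))"

definition smooth_fun ::
  "('x, 'e::real_normed_vector) atlas \<Rightarrow> 'x set \<Rightarrow> ('x \<Rightarrow> 'b::real_normed_vector) \<Rightarrow> bool" where
  "smooth_fun M U f \<longleftrightarrow> (\<forall>c\<in>M. smooth_on (cmap c ` (U \<inter> cdom c)) (f \<circ> cinv c))"

definition smooth_map ::
  "('x::topological_space, 'e::real_normed_vector) atlas \<Rightarrow>
   ('y::topological_space, 'f::real_normed_vector) atlas \<Rightarrow> 'x set \<Rightarrow> ('x \<Rightarrow> 'y) \<Rightarrow> bool" where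
  "smooth_map M N U f \<longleftrightarrow>
     continuous_on U f \<and> f ` U \<subseteq> points N \<and>
     (\<forall>c\<in>M. \<forall>c'\<in>N. smooth_on (cmap c ` (U \<inter> cdom c \<inter> f -` cdom c')) (cmap c' \<circ> f \<circ> cinv c))"

text \<open>The projections \<open>\<real> \<rightarrow> \<real>/\<int>\<close> and \<open>\<real>\<^sup>n \<rightarrow> \<real>\<^sup>n/\<int>\<^sup>n\<close> are local diffeomorphisms, so a map to the circle
  or the torus is smooth iff it has smooth lifts locally.\<close>

definition circle_lift ::
  "('x::topological_space, 'e::real_normed_vector) atlas \<Rightarrow> ('x \<Rightarrow> circle) \<Rightarrow> 'x set \<Rightarrow> ('x \<Rightarrow> real) \<Rightarrow> bool"
where
  "circle_lift M f V g \<longleftrightarrow>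
     open V \<and> V \<subseteq> points M \<and> smooth_fun M V g \<and> (\<forall>y\<in>V. f y = circle_of (g y))"

definition smooth_circle ::
  "('x::topological_space, 'e::real_normed_vector) atlas \<Rightarrow> 'x set \<Rightarrow> ('x \<Rightarrow> circle) \<Rightarrow> bool" where
  "smooth_circle M U f \<longleftrightarrow> (\<forall>x\<in>U. \<exists>V g. x \<in> V \<and> V \<subseteq> U \<and> circle_lift M f V g)"

definition smooth_torus ::
  "('x::topological_space, 'e::real_normed_vector) atlas \<Rightarrow> 'x set \<Rightarrow> ('x \<Rightarrow> circle^'n) \<Rightarrow> bool" where
  "smooth_torus M U f \<longleftrightarrow> (\<forall>i. smooth_circle M U (\<lambda>x. f x $ i))"

definition times_euclidean :: "('x, 'e) atlas \<Rightarrow> ('x \<times> 'b, 'e \<times> 'b) atlas" where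
  "times_euclidean M = (\<lambda>c. (cdom c \<times> UNIV, \<lambda>(x, v). (cmap c x, v))) ` M"


section \<open>Differential forms of degree one and two\<close>

text \<open>
  A form is given by its coordinate representations: \<open>\<omega> c x\<close> is the (multi)linear form on the model
  space that represents, in the chart \<open>c\<close>, the value of \<open>\<omega>\<close> at the point \<open>x\<close>.  The
  representations are related by the derivatives of the coordinate changes.  Values outside the
  relevant domains are irrelevant, so equality of forms on \<open>U\<close> means equality over \<open>coords M U\<close>.
\<close>

type_synonym ('x, 'e, 'b) form1 = "('x, 'e) chart \<Rightarrow> 'x \<Rightarrow> 'e \<Rightarrow> 'b"
type_synonym ('x, 'e, 'b) form2 = "('x, 'e) chart \<Rightarrow> 'x \<Rightarrow> 'e \<Rightarrow> 'e \<Rightarrow> 'b"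

definition coords :: "('x, 'e) atlas \<Rightarrow> 'x set \<Rightarrow> (('x, 'e) chart \<times> 'x) set" where
  "coords M U = {(c, x). c \<in> M \<and> x \<in> U \<inter> cdom c}"

definition transition ::
  "('x, 'e::real_normed_vector) chart \<Rightarrow> ('x, 'e) chart \<Rightarrow> 'x \<Rightarrow> 'e \<Rightarrow> 'e" where
  "transition c c' x = frechet_derivative (cmap c' \<circ> cinv c) (at (cmap c x))"

definition is_form1 ::
  "('x, 'e::real_normed_vector) atlas \<Rightarrow> 'x set \<Rightarrow> ('x, 'e, 'b::real_normed_vector) form1 \<Rightarrow> bool" where
  "is_form1 M U \<omega> \<longleftrightarrow>
     (\<forall>(c, x) \<in> coords M U. linear (\<omega> c x)) \<and>
     (\<forall>c\<in>M. \<forall>v. smooth_on (cmap c ` (U \<inter> cdom c)) (\<lambda>y. \<omega> c (cinv c y) v)) \<and>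
     (\<forall>(c, x) \<in> coords M U. \<forall>c'\<in>M. x \<in> cdom c' \<longrightarrow>
        (\<forall>v. \<omega> c x v = \<omega> c' x (transition c c' x v)))"

definition is_form2 ::
  "('x, 'e::real_normed_vector) atlas \<Rightarrow> 'x set \<Rightarrow> ('x, 'e, 'b::real_normed_vector) form2 \<Rightarrow> bool" where
  "is_form2 M U \<omega> \<longleftrightarrow>
     (\<forall>(c, x) \<in> coords M U.
        (\<forall>v. linear (\<omega> c x v)) \<and> (\<forall>w. linear (\<lambda>v. \<omega> c x v w)) \<and> (\<forall>v. \<omega> c x v v = 0)) \<and>
     (\<forall>c\<in>M. \<forall>v w. smooth_on (cmap c ` (U \<inter> cdom c)) (\<lambda>y. \<omega> c (cinv c y) v w)) \<and>
     (\<forall>(c, x) \<in> coords M U. \<forall>c'\<in>M. x \<in> cdom c' \<longrightarrow>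
        (\<forall>v w. \<omega> c x v w = \<omega> c' x (transition c c' x v) (transition c c' x w)))"

definition d0 :: "('x \<Rightarrow> 'b) \<Rightarrow> ('x, 'e::real_normed_vector, 'b::real_normed_vector) form1" where
  "d0 f c x v = frechet_derivative (f \<circ> cinv c) (at (cmap c x)) v"

definition d1 ::
  "('x, 'e::real_normed_vector, 'b::real_normed_vector) form1 \<Rightarrow> ('x, 'e, 'b) form2" where
  "d1 \<omega> c x v w =
     frechet_derivative (\<lambda>y. \<omega> c (cinv c y) w) (at (cmap c x)) v -
     frechet_derivative (\<lambda>y. \<omega> c (cinv c y) v) (at (cmap c x)) w"

text \<open>The pullback \<open>f\<^sup>*\<theta>\<close> of the Maurer-Cartan form along a smooth map to the circle is the
  differential of any local lift of \<open>f\<close>.\<close>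

definition mc ::
  "('x::topological_space, 'e::real_normed_vector) atlas \<Rightarrow> ('x \<Rightarrow> circle) \<Rightarrow> ('x, 'e, real) form1" where
  "mc M f c x v = d0 (SOME g. \<exists>V. x \<in> V \<and> circle_lift M f V g) c x v"

text \<open>For a form \<open>\<omega>\<close> on \<open>N\<close> the choice of the chart \<open>c'\<close> does not matter.\<close>

definition pullback1 ::
  "('y, 'f::real_normed_vector) atlas \<Rightarrow> ('x \<Rightarrow> 'y) \<Rightarrow> ('y, 'f, 'b) form1 \<Rightarrow>
   ('x, 'e::real_normed_vector, 'b) form1" where
  "pullback1 N f \<omega> c x v =
     (let c' = (SOME c'. c' \<in> N \<and> f x \<in> cdom c')
      in \<omega> c' (f x) (frechet_derivative (cmap c' \<circ> f \<circ> cinv c) (at (cmap c x)) v))"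


section \<open>Open covers\<close>

text \<open>Covers are indexed by their own members.  Every indexed open cover is refined by a
  self-indexed one, so direct limits over refinements are not affected.\<close>

definition open_cover :: "('x::topological_space, 'e) atlas \<Rightarrow> 'x set set \<Rightarrow> bool" where
  "open_cover M \<U> \<longleftrightarrow> (\<forall>U\<in>\<U>. open U) \<and> \<Union>\<U> = points M"

definition refinement :: "'x set set \<Rightarrow> 'x set set \<Rightarrow> ('x set \<Rightarrow> 'x set) \<Rightarrow> bool" where
  "refinement \<V> \<U> r \<longleftrightarrow> (\<forall>V\<in>\<V>. r V \<in> \<U> \<and> V \<subseteq> r V)"


section \<open>Differential cohomology\<close>

record ('x, 'e) deligne =
  DB :: "'x set \<Rightarrow> ('x, 'e, real) form2"
  DA :: "'x set \<Rightarrow> 'x set \<Rightarrow> ('x, 'e, real) form1"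
  Dc :: "'x set \<Rightarrow> 'x set \<Rightarrow> 'x set \<Rightarrow> 'x \<Rightarrow> circle"

definition deligne_cocycle ::
  "('x::topological_space, 'e::real_normed_vector) atlas \<Rightarrow> 'x set set \<Rightarrow> ('x, 'e) deligne \<Rightarrow> bool" where
  "deligne_cocycle M \<U> g \<longleftrightarrow>
     (\<forall>i\<in>\<U>. is_form2 M i (DB g i)) \<and>
     (\<forall>i\<in>\<U>. \<forall>j\<in>\<U>. is_form1 M (i \<inter> j) (DA g i j)) \<and>
     (\<forall>i\<in>\<U>. \<forall>j\<in>\<U>. \<forall>k\<in>\<U>. smooth_circle M (i \<inter> j \<inter> k) (Dc g i j k)) \<and>
     (\<forall>i\<in>\<U>. \<forall>j\<in>\<U>. \<forall>(c, x) \<in> coords M (i \<inter> j). \<forall>v w.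
        DB g j c x v w + d1 (DA g i j) c x v w = DB g i c x v w) \<and>
     (\<forall>i\<in>\<U>. \<forall>j\<in>\<U>. \<forall>k\<in>\<U>. \<forall>(c, x) \<in> coords M (i \<inter> j \<inter> k). \<forall>v.
        DA g i k c x v = DA g i j c x v + DA g j k c x v - mc M (Dc g i j k) c x v) \<and>
     (\<forall>i\<in>\<U>. \<forall>j\<in>\<U>. \<forall>k\<in>\<U>. \<forall>l\<in>\<U>. \<forall>x \<in> i \<inter> j \<inter> k \<inter> l.
        Dc g j k l x + Dc g i j l x = Dc g i j k x + Dc g i k l x)"

definition deligne_equiv ::
  "('x::topological_space, 'e::real_normed_vector) atlas \<Rightarrow> 'x set set \<Rightarrow>
   ('x, 'e) deligne \<Rightarrow> ('x, 'e) deligne \<Rightarrow> bool" where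
  "deligne_equiv M \<U> g g' \<longleftrightarrow>
     (\<exists>(C :: 'x set \<Rightarrow> ('x, 'e, real) form1) (e :: 'x set \<Rightarrow> 'x set \<Rightarrow> 'x \<Rightarrow> circle).
        (\<forall>i\<in>\<U>. is_form1 M i (C i)) \<and>
        (\<forall>i\<in>\<U>. \<forall>j\<in>\<U>. smooth_circle M (i \<inter> j) (e i j)) \<and>
        (\<forall>i\<in>\<U>. \<forall>(c, x) \<in> coords M i. \<forall>v w.
           DB g' i c x v w = DB g i c x v w + d1 (C i) c x v w) \<and>
        (\<forall>i\<in>\<U>. \<forall>j\<in>\<U>. \<forall>(c, x) \<in> coords M (i \<inter> j). \<forall>v.
           DA g' i j c x v = DA g i j c x v + C i c x v - C j c x v - mc M (e i j) c x v) \<and>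
        (\<forall>i\<in>\<U>. \<forall>j\<in>\<U>. \<forall>k\<in>\<U>. \<forall>x \<in> i \<inter> j \<inter> k.
           Dc g' i j k x = Dc g i j k x + e i k x - e i j x - e j k x))"

definition deligne_pull :: "('x set \<Rightarrow> 'x set) \<Rightarrow> ('x, 'e) deligne \<Rightarrow> ('x, 'e) deligne" where
  "deligne_pull r g =
     \<lparr>DB = \<lambda>i. DB g (r i), DA = \<lambda>i j. DA g (r i) (r j), Dc = \<lambda>i j k. Dc g (r i) (r j) (r k)\<rparr>"

definition deligne_cocycles ::
  "('x::topological_space, 'e::real_normed_vector) atlas \<Rightarrow> ('x set set \<times> ('x, 'e) deligne) set" where
  "deligne_cocycles M = {(\<U>, g). open_cover M \<U> \<and> deligne_cocycle M \<U> g}"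

definition deligne_rel ::
  "('x::topological_space, 'e::real_normed_vector) atlas \<Rightarrow>
   (('x set set \<times> ('x, 'e) deligne) \<times> ('x set set \<times> ('x, 'e) deligne)) set" where
  "deligne_rel M =
     {((\<U>, g), (\<U>', g')). (\<U>, g) \<in> deligne_cocycles M \<and> (\<U>', g') \<in> deligne_cocycles M \<and>
        (\<exists>\<V> r r'. open_cover M \<V> \<and> refinement \<V> \<U> r \<and> refinement \<V> \<U>' r' \<and>
           deligne_equiv M \<V> (deligne_pull r g) (deligne_pull r' g'))}"

definition deligne_add :: "('x, 'e) deligne \<Rightarrow> ('x, 'e) deligne \<Rightarrow> ('x, 'e) deligne" where
  "deligne_add g h =
     \<lparr>DB = \<lambda>i c x v w. DB g i c x v w + DB h i c x v w,
      DA = \<lambda>i j c x v. DA g i j c x v + DA h i j c x v,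
      Dc = \<lambda>i j k x. Dc g i j k x + Dc h i j k x\<rparr>"

text \<open>The class of the trivial bundle gerbe with connection given by \<open>\<beta>\<close>, on the one-element
  cover.\<close>

definition trivial_gerbe ::
  "('x::topological_space, 'e::real_normed_vector) atlas \<Rightarrow> ('x, 'e, real) form2 \<Rightarrow>
   ('x set set \<times> ('x, 'e) deligne) set" where
  "trivial_gerbe M \<beta> = deligne_rel M ``
     {({points M}, \<lparr>DB = \<lambda>i. \<beta>, DA = \<lambda>i j c x v. 0, Dc = \<lambda>i j k x. 0\<rparr>)}"

text \<open>Any two classes have representatives on a common cover, hence the product of two classes
  below is a single class.\<close>

definition H3 ::
  "('x::topological_space, 'e::real_normed_vector) atlas \<Rightarrow>
   ('x set set \<times> ('x, 'e) deligne) set monoid" where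
  "H3 M =
     \<lparr>carrier = deligne_cocycles M // deligne_rel M,
      mult = \<lambda>K L. deligne_rel M `` {(\<U>, deligne_add g h) | \<U> g h. (\<U>, g) \<in> K \<and> (\<U>, h) \<in> L},
      one = trivial_gerbe M (\<lambda>c x v w. 0)\<rparr>"


section \<open>Adjusted differential cohomology\<close>

text \<open>The hatted components carry the suffix \<open>h\<close>.  The integer components are stored as vectors of
  \<open>lattice\<close>.\<close>

record ('x, 'e, 'n) td =
  tA :: "'x set \<Rightarrow> ('x, 'e, real^'n) form1"
  tAh :: "'x set \<Rightarrow> ('x, 'e, real^'n) form1"
  tR :: "'x set \<Rightarrow> ('x, 'e, real) form2"
  tphi :: "'x set \<Rightarrow> 'x set \<Rightarrow> ('x, 'e, real) form1"
  ta :: "'x set \<Rightarrow> 'x set \<Rightarrow> 'x \<Rightarrow> real^'n"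
  tah :: "'x set \<Rightarrow> 'x set \<Rightarrow> 'x \<Rightarrow> real^'n"
  tm :: "'x set \<Rightarrow> 'x set \<Rightarrow> 'x set \<Rightarrow> real^'n"
  tmh :: "'x set \<Rightarrow> 'x set \<Rightarrow> 'x set \<Rightarrow> real^'n"
  tt :: "'x set \<Rightarrow> 'x set \<Rightarrow> 'x set \<Rightarrow> 'x \<Rightarrow> circle"

definition td_cocycle ::
  "('x::topological_space, 'e::real_normed_vector) atlas \<Rightarrow> 'x set set \<Rightarrow>
   ('x, 'e, 'n::finite) td \<Rightarrow> bool" where
  "td_cocycle M \<U> z \<longleftrightarrow>
     (\<forall>i\<in>\<U>. is_form1 M i (tA z i) \<and> is_form1 M i (tAh z i) \<and> is_form2 M i (tR z i)) \<and>
     (\<forall>i\<in>\<U>. \<forall>j\<in>\<U>. is_form1 M (i \<inter> j) (tphi z i j) \<and>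
        smooth_fun M (i \<inter> j) (ta z i j) \<and> smooth_fun M (i \<inter> j) (tah z i j)) \<and>
     (\<forall>i\<in>\<U>. \<forall>j\<in>\<U>. \<forall>k\<in>\<U>. tm z i j k \<in> lattice \<and> tmh z i j k \<in> lattice \<and>
        smooth_circle M (i \<inter> j \<inter> k) (tt z i j k)) \<and>
     (\<forall>i\<in>\<U>. \<forall>j\<in>\<U>. \<forall>k\<in>\<U>. \<forall>x \<in> i \<inter> j \<inter> k.
        ta z i k x = tm z i j k + ta z i j x + ta z j k x \<and>
        tah z i k x = tmh z i j k + tah z i j x + tah z j k x) \<and>
     (\<forall>i\<in>\<U>. \<forall>j\<in>\<U>. \<forall>k\<in>\<U>. \<forall>l\<in>\<U>. \<forall>x \<in> i \<inter> j \<inter> k \<inter> l.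
        tt z i k l x + tt z i j k x - circle_of (tm z i j k \<bullet> tah z k l x) =
        tt z i j l x + tt z j k l x) \<and>
     (\<forall>i\<in>\<U>. \<forall>j\<in>\<U>. \<forall>(c, x) \<in> coords M (i \<inter> j). \<forall>v.
        tA z j c x v = tA z i c x v - d0 (ta z i j) c x v \<and>
        tAh z j c x v = tAh z i c x v - d0 (tah z i j) c x v) \<and>
     (\<forall>i\<in>\<U>. \<forall>j\<in>\<U>. \<forall>k\<in>\<U>. \<forall>(c, x) \<in> coords M (i \<inter> j \<inter> k). \<forall>v.
        tphi z i k c x v - tAh z k c x v \<bullet> tm z i j k =
        tphi z j k c x v + tphi z i j c x v - mc M (tt z i j k) c x v) \<and>
     (\<forall>i\<in>\<U>. \<forall>j\<in>\<U>. \<forall>(c, x) \<in> coords M (i \<inter> j). \<forall>v w.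
        tR z j c x v w + d1 (tphi z i j) c x v w =
        tR z i c x v w + ta z i j x \<bullet> d1 (tAh z i) c x v w)"

definition td_equiv ::
  "('x::topological_space, 'e::real_normed_vector) atlas \<Rightarrow> 'x set set \<Rightarrow>
   ('x, 'e, 'n::finite) td \<Rightarrow> ('x, 'e, 'n) td \<Rightarrow> bool" where
  "td_equiv M \<U> z z' \<longleftrightarrow>
     (\<exists>(\<phi> :: 'x set \<Rightarrow> ('x, 'e, real) form1)
        (p :: 'x set \<Rightarrow> 'x \<Rightarrow> real^'n) (ph :: 'x set \<Rightarrow> 'x \<Rightarrow> real^'n)
        (q :: 'x set \<Rightarrow> 'x set \<Rightarrow> real^'n) (qh :: 'x set \<Rightarrow> 'x set \<Rightarrow> real^'n)
        (e :: 'x set \<Rightarrow> 'x set \<Rightarrow> 'x \<Rightarrow> circle).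
        (\<forall>i\<in>\<U>. is_form1 M i (\<phi> i) \<and> smooth_fun M i (p i) \<and> smooth_fun M i (ph i)) \<and>
        (\<forall>i\<in>\<U>. \<forall>j\<in>\<U>. q i j \<in> lattice \<and> qh i j \<in> lattice \<and> smooth_circle M (i \<inter> j) (e i j)) \<and>
        (\<forall>i\<in>\<U>. \<forall>j\<in>\<U>. \<forall>x \<in> i \<inter> j.
           ta z' i j x + p i x = q i j + p j x + ta z i j x \<and>
           tah z' i j x + ph i x = qh i j + ph j x + tah z i j x) \<and>
        (\<forall>i\<in>\<U>. \<forall>j\<in>\<U>. \<forall>k\<in>\<U>. \<forall>x \<in> i \<inter> j \<inter> k.
           tt z' i j k x + e i j x - circle_of (tah z' j k x \<bullet> q i j) + e j k x =
           e i k x + tt z i j k x - circle_of (ph k x \<bullet> tm z i j k)) \<and>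
        (\<forall>i\<in>\<U>. \<forall>(c, x) \<in> coords M i. \<forall>v.
           tA z' i c x v = tA z i c x v - d0 (p i) c x v \<and>
           tAh z' i c x v = tAh z i c x v - d0 (ph i) c x v) \<and>
        (\<forall>i\<in>\<U>. \<forall>j\<in>\<U>. \<forall>(c, x) \<in> coords M (i \<inter> j). \<forall>v.
           tphi z' i j c x v + \<phi> i c x v - q i j \<bullet> tAh z' j c x v =
           \<phi> j c x v + tphi z i j c x v - mc M (e i j) c x v) \<and>
        (\<forall>i\<in>\<U>. \<forall>(c, x) \<in> coords M i. \<forall>v w.
           tR z' i c x v w + d1 (\<phi> i) c x v w =
           tR z i c x v w + p i x \<bullet> d1 (tAh z i) c x v w))"

definition td_pull :: "('x set \<Rightarrow> 'x set) \<Rightarrow> ('x, 'e, 'n::finite) td \<Rightarrow> ('x, 'e, 'n) td" where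
  "td_pull r z =
     \<lparr>tA = \<lambda>i. tA z (r i), tAh = \<lambda>i. tAh z (r i), tR = \<lambda>i. tR z (r i),
      tphi = \<lambda>i j. tphi z (r i) (r j), ta = \<lambda>i j. ta z (r i) (r j), tah = \<lambda>i j. tah z (r i) (r j),
      tm = \<lambda>i j k. tm z (r i) (r j) (r k), tmh = \<lambda>i j k. tmh z (r i) (r j) (r k),
      tt = \<lambda>i j k. tt z (r i) (r j) (r k)\<rparr>"

definition td_cocycles ::
  "('x::topological_space, 'e::real_normed_vector) atlas \<Rightarrow>
   ('x set set \<times> ('x, 'e, 'n::finite) td) set" where
  "td_cocycles M = {(\<U>, z). open_cover M \<U> \<and> td_cocycle M \<U> z}"

definition td_rel ::
  "('x::topological_space, 'e::real_normed_vector) atlas \<Rightarrow>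
   (('x set set \<times> ('x, 'e, 'n::finite) td) \<times> ('x set set \<times> ('x, 'e, 'n) td)) set" where
  "td_rel M =
     {((\<U>, z), (\<U>', z')). (\<U>, z) \<in> td_cocycles M \<and> (\<U>', z') \<in> td_cocycles M \<and>
        (\<exists>\<V> r r'. open_cover M \<V> \<and> refinement \<V> \<U> r \<and> refinement \<V> \<U>' r' \<and>
           td_equiv M \<V> (td_pull r z) (td_pull r' z'))}"

definition H1TD ::
  "('x::topological_space, 'e::real_normed_vector) atlas \<Rightarrow>
   ('x set set \<times> ('x, 'e, 'n::finite) td) set set" where
  "H1TD M = td_cocycles M // td_rel M"


section \<open>The action of differential cohomology\<close>

definition td_shift :: "('x, 'e) deligne \<Rightarrow> ('x, 'e, 'n::finite) td \<Rightarrow> ('x, 'e, 'n) td" where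
  "td_shift g z = z
     \<lparr>tR := \<lambda>i c x v w. tR z i c x v w + DB g i c x v w,
      tphi := \<lambda>i j c x v. tphi z i j c x v + DA g i j c x v,
      tt := \<lambda>i j k x. tt z i j k x + Dc g i j k x\<rparr>"

definition td_act ::
  "('x::topological_space, 'e::real_normed_vector) atlas \<Rightarrow>
   ('x set set \<times> ('x, 'e) deligne) set \<Rightarrow>
   ('x set set \<times> ('x, 'e, 'n::finite) td) set \<Rightarrow> ('x set set \<times> ('x, 'e, 'n) td) set" where
  "td_act M K = (\<lambda>L\<in>H1TD M.
     td_rel M `` {(\<U>, td_shift g z) | \<U> g z. (\<U>, g) \<in> K \<and> (\<U>, z) \<in> L})"


section \<open>Principal torus bundles with connection\<close>

record ('x, 'p, 'e, 'n) torus_bundle =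
  total :: "('p, 'e \<times> real^'n) atlas"
  proj :: "'p \<Rightarrow> 'x"
  rmul :: "'p \<Rightarrow> circle^'n \<Rightarrow> 'p"
  conn :: "('p, 'e \<times> real^'n, real^'n) form1"

definition local_section ::
  "('x::topological_space, 'e::real_normed_vector) atlas \<Rightarrow>
   ('x, 'p::topological_space, 'e, 'n::finite) torus_bundle \<Rightarrow> 'x set \<Rightarrow> ('x \<Rightarrow> 'p) \<Rightarrow> bool" where
  "local_section M P U s \<longleftrightarrow>
     open U \<and> U \<subseteq> points M \<and> smooth_map M (total P) U s \<and> (\<forall>x\<in>U. proj P (s x) = x)"

text \<open>The last clause below says that \<open>(x, u) \<mapsto> s x \<cdot> u\<close> is a diffeomorphism from \<open>V \<times> T\<^sup>n\<close> onto the part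
  of the bundle over \<open>V\<close>, with inverse \<open>p \<mapsto> (\<pi> p, h p)\<close>; smoothness of the former is tested on
  \<open>V \<times> \<real>\<^sup>n\<close>.\<close>

definition principal_torus_bundle ::
  "('x::{t2_space,second_countable_topology}, 'e::{real_normed_vector,heine_borel}) atlas \<Rightarrow>
   ('x, 'p::{t2_space,second_countable_topology}, 'e, 'n::finite) torus_bundle \<Rightarrow> bool" where
  "principal_torus_bundle M P \<longleftrightarrow>
     smooth_manifold (total P) \<and>
     smooth_map (total P) M (points (total P)) (proj P) \<and>
     (\<forall>p \<in> points (total P). rmul P p 0 = p \<and>
        (\<forall>u. rmul P p u \<in> points (total P) \<and> proj P (rmul P p u) = proj P p \<and>
          (\<forall>w. rmul P (rmul P p u) w = rmul P p (u + w)))) \<and>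
     (\<forall>x \<in> points M. \<exists>V s h. x \<in> V \<and> local_section M P V s \<and>
        smooth_map (times_euclidean M) (total P) (V \<times> UNIV) (\<lambda>(y, v). rmul P (s y) (torus_of v)) \<and>
        smooth_torus (total P) {p \<in> points (total P). proj P p \<in> V} h \<and>
        (\<forall>p \<in> points (total P). proj P p \<in> V \<longrightarrow> rmul P (s (proj P p)) (h p) = p) \<and>
        (\<forall>y\<in>V. \<forall>u. h (rmul P (s y) u) = u))"

text \<open>A connection is an invariant one-form that reproduces the generators of the action.\<close>

definition torus_bundle_with_connection ::
  "('x::{t2_space,second_countable_topology}, 'e::{real_normed_vector,heine_borel}) atlas \<Rightarrow>
   ('x, 'p::{t2_space,second_countable_topology}, 'e, 'n::finite) torus_bundle \<Rightarrow> bool" where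
  "torus_bundle_with_connection M P \<longleftrightarrow>
     principal_torus_bundle M P \<and>
     is_form1 (total P) (points (total P)) (conn P) \<and>
     (\<forall>u. \<forall>(c, p) \<in> coords (total P) (points (total P)). \<forall>v.
        pullback1 (total P) (\<lambda>p. rmul P p u) (conn P) c p v = conn P c p v) \<and>
     (\<forall>(c, p) \<in> coords (total P) (points (total P)). \<forall>\<xi>.
        conn P c p (vector_derivative (\<lambda>t. cmap c (rmul P p (torus_of (t *\<^sub>R \<xi>)))) (at 0)) = \<xi>)"

text \<open>
  \<open>(A\<^sub>i, a\<^sub>i\<^sub>j)\<close> are local data of \<open>P\<close> if there are sections \<open>s\<^sub>i\<close> with \<open>A\<^sub>i = s\<^sub>i\<^sup>*\<omega>\<close> and \<open>s\<^sub>i = s\<^sub>j \<cdot> a\<^sub>i\<^sub>j\<close>, the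
  convention for which \<open>A\<^sub>j = A\<^sub>i - a\<^sub>i\<^sub>j\<^sup>*\<theta>\<close>.
\<close>

definition local_data ::
  "('x::topological_space, 'e::real_normed_vector) atlas \<Rightarrow> 'x set set \<Rightarrow>
   ('x, 'p::topological_space, 'e, 'n::finite) torus_bundle \<Rightarrow>
   ('x set \<Rightarrow> ('x, 'e, real^'n) form1) \<Rightarrow> ('x set \<Rightarrow> 'x set \<Rightarrow> 'x \<Rightarrow> real^'n) \<Rightarrow> bool" where
  "local_data M \<U> P A a \<longleftrightarrow>
     (\<exists>s. (\<forall>i\<in>\<U>. local_section M P i (s i) \<and>
             (\<forall>(c, x) \<in> coords M i. \<forall>v. A i c x v = pullback1 (total P) (s i) (conn P) c x v)) \<and>
          (\<forall>i\<in>\<U>. \<forall>j\<in>\<U>. \<forall>x \<in> i \<inter> j. s i x = rmul P (s j x) (torus_of (a i j x))))"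

definition is_curvature ::
  "('x::topological_space, 'e::real_normed_vector) atlas \<Rightarrow>
   ('x, 'p::topological_space, 'e, 'n::finite) torus_bundle \<Rightarrow> ('x, 'e, real^'n) form2 \<Rightarrow> bool" where
  "is_curvature M P F \<longleftrightarrow>
     is_form2 M (points M) F \<and>
     (\<forall>U s. local_section M P U s \<longrightarrow>
        (\<forall>(c, x) \<in> coords M U. \<forall>v w.
           F c x v w = d1 (pullback1 (total P) s (conn P)) c x v w))"

text \<open>The fibre over the pair of isomorphism classes of \<open>P\<close> and \<open>Q\<close>: a bundle with connection is
  isomorphic to the one glued from \<open>(A\<^sub>i, a\<^sub>i\<^sub>j)\<close> iff it has \<open>(A\<^sub>i, a\<^sub>i\<^sub>j)\<close> as local data itself.\<close>

definition td_fibre ::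
  "('x::topological_space, 'e::real_normed_vector) atlas \<Rightarrow>
   ('x, 'p::topological_space, 'e, 'n::finite) torus_bundle \<Rightarrow>
   ('x, 'q::topological_space, 'e, 'n) torus_bundle \<Rightarrow>
   ('x set set \<times> ('x, 'e, 'n) td) set set" where
  "td_fibre M P Q =
     {L \<in> H1TD M. \<exists>(\<U>, z) \<in> L.
        local_data M \<U> P (tA z) (ta z) \<and> local_data M \<U> Q (tAh z) (tah z)}"

definition flux_subgroup ::
  "('x::topological_space, 'e::real_normed_vector) atlas \<Rightarrow>
   ('x, 'e, real^'n) form2 \<Rightarrow> ('x, 'e, real^'n) form2 \<Rightarrow>
   ('x set set \<times> ('x, 'e) deligne) set set" where
  "flux_subgroup M F Fh =
     {trivial_gerbe M (\<lambda>c x v w. y \<bullet> Fh c x v w + yh \<bullet> F c x v w) | y yh. True}"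

text \<open>The map on cosets induced by an action of a group on \<open>E\<close>.\<close>

definition coset_act :: "('g \<Rightarrow> 'a \<Rightarrow> 'a) \<Rightarrow> 'a set \<Rightarrow> 'g set \<Rightarrow> 'a \<Rightarrow> 'a" where
  "coset_act \<phi> E S = (\<lambda>L\<in>E. the_elem ((\<lambda>g. \<phi> g L) ` S))"

end

theory Submission
  imports Defs
begin

text \<open>
  Write \<open>(A, Ah, R, \<phi>, a, ah, m, mh, t)\<close> for an adjusted cocycle and \<open>(B, C, c)\<close> for a Deligne cocycle.  The
  conditions on \<open>(A, a, m)\<close> and \<open>(Ah, ah, mh)\<close> say that these are local data of two torus bundles
  with connection.  With these fixed, the conditions on \<open>(R, \<phi>, t)\<close> are affine, and the
  associated linear conditions are those of the Deligne complex.  This is why gerbes act on the cocycles over a fixed pair of bundles, and why the action is transitive there.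

  Transitivity.  Two cocycles in one fibre come from two families of local sections of the same bundles.
  On a fine cover the sections differ by smooth functions \<open>p\<^sub>i\<close>, \<open>ph\<^sub>i\<close> with values in \<open>\<real>\<^sup>n\<close>
  (\<open>local_data_differ\<close>).  The functions \<open>a'\<^sub>i\<^sub>j + p\<^sub>i - p\<^sub>j - a\<^sub>i\<^sub>j\<close> take values in the lattice, so they
  are locally constant; an equivalence of cocycles needs them to be constant on every overlap.  As overlaps may be
  disconnected, this requires a special refinement (\<open>connected_refinement\<close>).  Solving the remaining equations
  of an equivalence for the gerbe gives a Deligne cocycle (\<open>difference_gerbe\<close>).  Geometrically everything rests on
  the formula for the pullback of a connection form along a translated section
  (\<open>pullback_translated_section\<close>).

  Stabilizer.  If \<open>g\<close> fixes the class of a cocycle, then the functions \<open>p\<^sub>i\<close>, \<open>ph\<^sub>i\<close> of the equivalence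
  have zero differential and agree on overlaps up to integers.  On a connected space they are therefore constants
  \<open>y\<close>, \<open>yh\<close> up to integers, and the equations for the gerbe say that \<open>g\<close> is equivalent to
  \<open>(-y Fh - yh F, 0, 0)\<close> (\<open>stabilizing_gerbe_is_trivial\<close>).  The same formulas read backwards show that these
  gerbes act trivially (\<open>flux_gerbe_acts_trivially\<close>).

  Classes.  That equivalence over refinements is an equivalence relation needs two facts: gauge transformations
  compose (\<open>td_gauge_trans\<close>), and restrictions of one cocycle along two refinement maps are gauge
  equivalent (\<open>td_pull_gauge\<close>).  The Deligne relation is the special case of trivial bundles
  (\<open>deligne_equiv_iff\<close>), so nothing has to be done twice.  Adding the action and the group
  structure is then formal, and the statement on the quotient holds for every transitive action all of whose stabilizers
  are one and the same normal subgroup (\<open>quotient_by_common_stabilizer\<close>).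

  The analysis needed is that smoothness, defined by iterated directional derivatives on a locally compact normed space,
  is stable under composition, and that second derivatives are symmetric.  The first holds because such a space has
  a finite basis; the second gives that the exterior derivative of a one-form is a two-form and vanishes on
  differentials.
\<close>

section \<open>Finite-dimensional model spaces\<close>

text \<open>If \<open>a\<close> has distance \<open>d > 0\<close> from \<open>Y\<close>, then \<open>\<bar>t\<bar> d \<le> norm (y + t a)\<close>.  So along a convergent sequence
  in the span the coefficients of \<open>a\<close> form a Cauchy sequence.\<close>

lemma closed_span_insert:
  fixes Y :: "'a::real_normed_vector set"
  assumes Y: "subspace Y" "closed Y"
  shows "closed (span (insert a Y))"
proof (cases "a \<in> Y")
  case True
  then have "span (insert a Y) = Y"
    using Y by (simp add: insert_absorb span_eq_iff)
  then show ?thesis using Y by simp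
next
  case False
  define d where "d = infdist a Y"
  have ne: "Y \<noteq> {}" using Y subspace_0 by blast
  have d: "d > 0"
    unfolding d_def using in_closed_iff_infdist_zero[OF Y(2) ne, of a] False infdist_nonneg[of a Y]
    by simp
  have bound: "\<bar>t\<bar> * d \<le> norm (y + t *\<^sub>R a)" if "y \<in> Y" for y t
  proof (cases "t = 0")
    case False
    have "(- (1 / t)) *\<^sub>R y \<in> Y" using that Y subspace_scale by blast
    then have "d \<le> dist a ((- (1 / t)) *\<^sub>R y)"
      unfolding d_def by (rule infdist_le)
    also have "\<dots> = norm ((1 / t) *\<^sub>R (y + t *\<^sub>R a))"
      using False by (simp add: dist_norm algebra_simps)
    finally have "d \<le> norm (y + t *\<^sub>R a) / \<bar>t\<bar>"
      by simp
    then show ?thesis using False by (simp add: field_simps)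
  qed simp
  have sp: "span (insert a Y) = {x. \<exists>k. x - k *\<^sub>R a \<in> Y}"
    using Y by (simp add: span_insert span_eq_iff[THEN iffD2])
  show ?thesis
    unfolding closed_sequential_limits
  proof (intro allI impI, elim conjE)
    fix x l assume x: "\<forall>n. x n \<in> span (insert a Y)" and l: "x \<longlonglongrightarrow> l"
    then have "\<forall>n. \<exists>k. x n - k *\<^sub>R a \<in> Y" unfolding sp by blast
    then obtain t where t: "\<And>n. x n - t n *\<^sub>R a \<in> Y" by metis
    have "Cauchy t"
    proof (rule metric_CauchyI)
      fix e :: real assume "e > 0"
      with d have "e * d > 0" by simp
      from metric_CauchyD[OF LIMSEQ_imp_Cauchy[OF l] this]
      obtain N where N: "\<And>m n. m \<ge> N \<Longrightarrow> n \<ge> N \<Longrightarrow> dist (x m) (x n) < e * d" by blast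
      have "dist (t m) (t n) < e" if "m \<ge> N" "n \<ge> N" for m n
      proof -
        have "(x m - t m *\<^sub>R a) - (x n - t n *\<^sub>R a) \<in> Y"
          using t Y subspace_diff by blast
        from bound[OF this, of "t m - t n"]
        have "\<bar>t m - t n\<bar> * d \<le> norm (x m - x n)" by (simp add: algebra_simps)
        also have "\<dots> < e * d" using N[OF that] by (simp add: dist_norm)
        finally show ?thesis using d by (simp add: dist_real_def)
      qed
      then show "\<exists>N. \<forall>m\<ge>N. \<forall>n\<ge>N. dist (t m) (t n) < e" by blast
    qed
    then obtain s where "t \<longlonglongrightarrow> s" using Cauchy_convergent_iff convergent_def by blast
    then have "(\<lambda>n. x n - t n *\<^sub>R a) \<longlonglongrightarrow> l - s *\<^sub>R a"
      using l by (intro tendsto_intros)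
    with t Y(2) have "l - s *\<^sub>R a \<in> Y"
      using closed_sequentially[of Y "\<lambda>n. x n - t n *\<^sub>R a" "l - s *\<^sub>R a"] by simp
    then show "l \<in> span (insert a Y)" unfolding sp by blast
  qed
qed

lemma closed_span_of_finite:
  fixes B :: "'a::real_normed_vector set"
  assumes "finite B" shows "closed (span B)"
  using assms
proof (induction B)
  case (insert a B)
  have "span (insert a (span B)) = span (insert a B)"
    by (simp add: span_insert span_eq_iff[THEN iffD2, OF subspace_span])
  then show ?case
    using closed_span_insert[OF subspace_span insert.IH, of a] by simp
qed simp

text \<open>Riesz: the unit ball is covered by finitely many balls of radius one half; a vector outside the
  (closed) span of their centres would have a nearly best approximation whose error can be halved.\<close>

lemma heine_borel_finite_basis:
  "\<exists>B::'e::{real_normed_vector,heine_borel} set. finite B \<and> independent B \<and> span B = UNIV"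
proof -
  have "compact (cball (0::'e) 1)" by (simp add: compact_eq_bounded_closed)
  moreover have "cball (0::'e) 1 \<subseteq> (\<Union>f\<in>cball 0 1. ball f (1/2))"
    by (force simp: dist_norm)
  ultimately obtain F where F: "F \<subseteq> cball (0::'e) 1" "finite F"
      "cball 0 1 \<subseteq> (\<Union>f\<in>F. ball f (1/2))"
    using compactE_image[of "cball (0::'e) 1" "cball 0 1" "\<lambda>f. ball f (1/2)"] by auto
  define Y where "Y = span F"
  have Y: "subspace Y" "closed Y" "0 \<in> Y"
    unfolding Y_def using closed_span_of_finite[OF F(2)] by (auto simp: span_zero)
  have "x \<in> Y" for x
  proof (rule ccontr)
    assume x: "x \<notin> Y"
    define d where "d = infdist x Y"
    have ne: "Y \<noteq> {}" using Y by blast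
    have d: "d > 0"
      unfolding d_def
      using in_closed_iff_infdist_zero[OF Y(2) ne, of x] x infdist_nonneg[of x Y] by simp
    have "\<exists>y\<in>Y. dist x y < 2 * d"
    proof (rule ccontr)
      assume "\<not> ?thesis"
      then have "2 * d \<le> infdist x Y"
        unfolding infdist_notempty[OF ne] using ne by (intro cINF_greatest) (auto simp: not_less)
      then show False using d unfolding d_def by simp
    qed
    then obtain y where y: "y \<in> Y" "norm (x - y) < 2 * d" by (auto simp: dist_norm)
    define r where "r = norm (x - y)"
    have r: "r > 0" unfolding r_def using x y by auto
    have "(1 / r) *\<^sub>R (x - y) \<in> cball 0 1" using r unfolding r_def by simp
    then obtain f where "f \<in> F" "(1 / r) *\<^sub>R (x - y) \<in> ball f (1/2)"
      using F(3) by blast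
    then have f: "f \<in> F" "norm (f - (1 / r) *\<^sub>R (x - y)) < 1/2" by (simp_all add: dist_norm)
    have "y + r *\<^sub>R f \<in> Y"
      using Y y f unfolding Y_def by (simp add: span_add span_base span_scale)
    then have "d \<le> norm (x - (y + r *\<^sub>R f))"
      unfolding d_def dist_norm[symmetric] by (rule infdist_le)
    also have "x - (y + r *\<^sub>R f) = (- r) *\<^sub>R (f - (1 / r) *\<^sub>R (x - y))"
      using r by (simp add: algebra_simps)
    also have "norm \<dots> = r * norm (f - (1 / r) *\<^sub>R (x - y))" using r by simp
    also have "\<dots> < r * (1/2)" using r f by (intro mult_strict_left_mono)
    finally show False using y r_def by simp
  qed
  then have "span F = UNIV" unfolding Y_def by blast
  then obtain B where "B \<subseteq> F" "independent B" "F \<subseteq> span B"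
    using maximal_independent_subset[of F] by blast
  moreover have "span B = UNIV"
    using \<open>span F = UNIV\<close> \<open>F \<subseteq> span B\<close> by (metis span_minimal subspace_span top.extremum_uniqueI)
  ultimately show ?thesis using F(2) finite_subset by blast
qed

text \<open>A coordinate is bounded because its basis vector has positive distance from the span of the
  others.\<close>

lemma finite_coordinates:
  "\<exists>(B::'e::{real_normed_vector,heine_borel} set) rep. finite B \<and>
     (\<forall>b. bounded_linear (rep b)) \<and> (\<forall>x. (\<Sum>b\<in>B. rep b x *\<^sub>R b) = x)"
proof -
  obtain B :: "'e set" where B: "finite B" "independent B" "span B = UNIV"
    using heine_borel_finite_basis by blast
  define rep where "rep = (\<lambda>b x. representation B x b)"
  have sum: "(\<Sum>b\<in>B. rep b x *\<^sub>R b) = x" for x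
    unfolding rep_def using B by (intro sum_representation_eq) auto
  have "bounded_linear (rep b)" for b
  proof (cases "b \<in> B")
    case False
    then have "rep b = (\<lambda>x. 0)"
      unfolding rep_def using representation_ne_zero[of B _ b] by blast
    then show ?thesis by simp
  next
    case True
    define Y where "Y = span (B - {b})"
    have "closed Y" unfolding Y_def using B by (intro closed_span_of_finite) auto
    have "Y \<noteq> {}" unfolding Y_def using span_zero by blast
    have "b \<notin> Y" unfolding Y_def using B True by (auto simp: dependent_def)
    define d where "d = infdist b Y"
    have d: "d > 0"
      unfolding d_def using in_closed_iff_infdist_zero[OF \<open>closed Y\<close> \<open>Y \<noteq> {}\<close>, of b] \<open>b \<notin> Y\<close>
        infdist_nonneg[of b Y] by simp
    show ?thesis
    proof (rule bounded_linear_intro[where K = "1 / d"])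
      show "rep b (x + y) = rep b x + rep b y" for x y
        unfolding rep_def using B by (simp add: representation_add)
      show "rep b (r *\<^sub>R x) = r *\<^sub>R rep b x" for r x
        unfolding rep_def using B by (simp add: representation_scale)
      show "norm (rep b x) \<le> norm x * (1 / d)" for x
      proof (cases "rep b x = 0")
        case False
        let ?r = "rep b x" and ?s = "\<Sum>c\<in>B - {b}. rep c x *\<^sub>R c"
        have x: "x = ?r *\<^sub>R b + ?s"
          using sum[of x] B True by (simp add: sum.remove[of B b])
        have "?s \<in> Y" unfolding Y_def by (intro span_sum span_scale span_base)
        then have "(- (1 / ?r)) *\<^sub>R ?s \<in> Y" unfolding Y_def by (rule span_scale)
        then have "d \<le> norm (b - (- (1 / ?r)) *\<^sub>R ?s)"
          unfolding d_def dist_norm[symmetric] by (rule infdist_le)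
        also have "b - (- (1 / ?r)) *\<^sub>R ?s = (1 / ?r) *\<^sub>R (?r *\<^sub>R b + ?s)"
          using False by (simp add: algebra_simps)
        also have "\<dots> = (1 / ?r) *\<^sub>R x" using x by simp
        finally have "d \<le> norm x / \<bar>?r\<bar>" by simp
        then show ?thesis using False d by (simp add: field_simps)
      qed (use d in simp)
    qed
  qed
  with B sum show ?thesis by blast
qed

lemma linear_eq_sum_coordinates:
  assumes "linear f" "(\<Sum>b\<in>B. rep b x *\<^sub>R b) = x"
  shows "f x = (\<Sum>b\<in>B. rep b x *\<^sub>R f b)"
proof -
  have "f x = f (\<Sum>b\<in>B. rep b x *\<^sub>R b)" by (simp only: assms(2))
  also have "\<dots> = (\<Sum>b\<in>B. rep b x *\<^sub>R f b)"
    by (simp add: linear_sum[OF assms(1)] linear_scale[OF assms(1)])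
  finally show ?thesis .
qed

section \<open>Smooth functions on open sets\<close>

lemma frechet_derivative_eqI:
  "(f has_derivative D) (at x) \<Longrightarrow> frechet_derivative f (at x) = D"
  by (metis frechet_derivative_at)

lemma has_frechet_derivative:
  "f differentiable (at x) \<Longrightarrow> (f has_derivative frechet_derivative f (at x)) (at x)"
  by (simp add: frechet_derivative_works)

lemma has_derivative_cong_open:
  assumes "open S" "x \<in> S" "\<And>y. y \<in> S \<Longrightarrow> f y = g y"
  shows "(f has_derivative D) (at x) \<longleftrightarrow> (g has_derivative D) (at x)"
proof
  assume "(f has_derivative D) (at x)"
  then show "(g has_derivative D) (at x)"
    by (rule has_derivative_transform_within_open[OF _ assms(1,2)]) (use assms(3) in simp)
next
  assume "(g has_derivative D) (at x)"
  then show "(f has_derivative D) (at x)"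
    by (rule has_derivative_transform_within_open[OF _ assms(1,2)]) (use assms(3) in simp)
qed

lemma frechet_derivative_cong_open:
  assumes "open S" "x \<in> S" "\<And>y. y \<in> S \<Longrightarrow> f y = g y"
  shows "frechet_derivative f (at x) = frechet_derivative g (at x)"
  using has_derivative_cong_open[OF assms] unfolding frechet_derivative_def by simp

lemma times_diff_on_subset: "times_diff_on k S f \<Longrightarrow> T \<subseteq> S \<Longrightarrow> times_diff_on k T f"
  by (induction k arbitrary: f) (auto intro: continuous_on_subset)

lemma times_diff_on_cong:
  assumes "open S" "\<And>x. x \<in> S \<Longrightarrow> f x = g x"
  shows "times_diff_on k S f \<longleftrightarrow> times_diff_on k S g"
  using assms(2)
proof (induction k arbitrary: f g)
  case 0
  then show ?case by (simp cong: continuous_on_cong)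
next
  case (Suc k)
  have "f differentiable (at x) \<longleftrightarrow> g differentiable (at x)" if "x \<in> S" for x
    unfolding differentiable_def
    using has_derivative_cong_open[OF assms(1) that Suc.prems] by simp
  moreover have "times_diff_on k S (\<lambda>x. frechet_derivative f (at x) v) \<longleftrightarrow>
      times_diff_on k S (\<lambda>x. frechet_derivative g (at x) v)" for v
  proof (rule Suc.IH)
    show "frechet_derivative f (at x) v = frechet_derivative g (at x) v" if "x \<in> S" for x
      by (rule fun_cong[OF frechet_derivative_cong_open[OF assms(1) that Suc.prems]])
  qed
  ultimately show ?case by simp
qed

lemma times_diff_on_continuous: "times_diff_on k S f \<Longrightarrow> continuous_on S f"
  by (cases k) (auto intro!: continuous_at_imp_continuous_on differentiable_imp_continuous_within)

lemma times_diff_on_SucD: "times_diff_on (Suc k) S f \<Longrightarrow> times_diff_on k S f"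
proof (induction k arbitrary: f)
  case 0
  show ?case using times_diff_on_continuous[OF 0] by simp
next
  case (Suc k)
  then show ?case unfolding times_diff_on.simps(2)[of "Suc k"] times_diff_on.simps(2)[of k]
    by blast
qed

lemma times_diff_on_local:
  assumes "\<And>x. x \<in> S \<Longrightarrow> \<exists>T. open T \<and> x \<in> T \<and> times_diff_on k T f"
  shows "times_diff_on k S f"
  using assms
proof (induction k arbitrary: f)
  case 0
  then have "isCont f x" if "x \<in> S" for x
    using that by (metis continuous_on_eq_continuous_at times_diff_on.simps(1))
  then show ?case by (simp add: continuous_at_imp_continuous_on)
next
  case (Suc k)
  have "f differentiable (at x)" if "x \<in> S" for x
    using Suc.prems[OF that] by auto
  moreover have "times_diff_on k S (\<lambda>x. frechet_derivative f (at x) v)" for v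
    using Suc.prems by (intro Suc.IH) fastforce
  ultimately show ?case by simp
qed

lemma times_diff_on_SucI:
  assumes "open S" "\<And>x. x \<in> S \<Longrightarrow> (f has_derivative f' x) (at x)"
    and "\<And>v. times_diff_on k S (\<lambda>x. f' x v)"
  shows "times_diff_on (Suc k) S f"
proof -
  have "times_diff_on k S (\<lambda>x. frechet_derivative f (at x) v)" for v
    using assms(3)[of v] frechet_derivative_eqI[OF assms(2)]
    by (subst times_diff_on_cong[OF assms(1), where g = "\<lambda>x. f' x v"]) auto
  then show ?thesis using assms(2) by (auto simp: differentiable_def)
qed

lemma times_diff_on_SucE:
  assumes "times_diff_on (Suc k) S f" "x \<in> S"
  shows "(f has_derivative frechet_derivative f (at x)) (at x)"
  using assms has_frechet_derivative by auto

lemma times_diff_on_const: "open S \<Longrightarrow> times_diff_on k S (\<lambda>x. c)"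
proof (induction k arbitrary: c)
  case (Suc k)
  then show ?case by (intro times_diff_on_SucI[where f' = "\<lambda>x v. 0"]) auto
qed simp

lemma times_diff_on_add:
  assumes "open S" "times_diff_on k S f" "times_diff_on k S g"
  shows "times_diff_on k S (\<lambda>x. f x + g x)"
  using assms(2,3)
proof (induction k arbitrary: f g)
  case 0
  then show ?case by (simp add: continuous_on_add)
next
  case (Suc k)
  show ?case
  proof (rule times_diff_on_SucI[OF assms(1)])
    show "((\<lambda>x. f x + g x) has_derivative
        (\<lambda>v. frechet_derivative f (at x) v + frechet_derivative g (at x) v)) (at x)"
      if "x \<in> S" for x
      using Suc.prems that by (intro has_derivative_add times_diff_on_SucE)
    show "times_diff_on k S (\<lambda>x. frechet_derivative f (at x) v + frechet_derivative g (at x) v)"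
      for v
      using Suc.prems by (intro Suc.IH) auto
  qed
qed

lemma times_diff_on_sum:
  assumes "open S" "\<And>b. b \<in> B \<Longrightarrow> times_diff_on k S (f b)"
  shows "times_diff_on k S (\<lambda>x. \<Sum>b\<in>B. f b x)"
  using assms(2)
  by (induction B rule: infinite_finite_induct)
     (auto intro!: times_diff_on_add times_diff_on_const assms(1))

lemma times_diff_on_bounded_linear:
  assumes "open S" "bounded_linear L" "times_diff_on k S f"
  shows "times_diff_on k S (\<lambda>x. L (f x))"
  using assms(3)
proof (induction k arbitrary: f)
  case 0
  then show ?case using assms(2) by (simp add: bounded_linear.continuous_on)
next
  case (Suc k)
  show ?case
  proof (rule times_diff_on_SucI[OF assms(1)])
    show "((\<lambda>x. L (f x)) has_derivative (\<lambda>v. L (frechet_derivative f (at x) v))) (at x)"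
      if "x \<in> S" for x
      by (rule bounded_linear.has_derivative[OF assms(2) times_diff_on_SucE[OF Suc.prems that]])
    show "times_diff_on k S (\<lambda>x. L (frechet_derivative f (at x) v))" for v
      by (rule Suc.IH) (use Suc.prems in simp)
  qed
qed

lemma times_diff_on_bilinear:
  assumes "open S" "bounded_bilinear mul" "times_diff_on k S f" "times_diff_on k S g"
  shows "times_diff_on k S (\<lambda>x. mul (f x) (g x))"
  using assms(3,4)
proof (induction k arbitrary: f g)
  case 0
  then show ?case using assms(2) by (simp add: bounded_bilinear.continuous_on)
next
  case (Suc k)
  show ?case
  proof (rule times_diff_on_SucI[OF assms(1)])
    show "((\<lambda>x. mul (f x) (g x)) has_derivative
        (\<lambda>v. mul (f x) (frechet_derivative g (at x) v) + mul (frechet_derivative f (at x) v) (g x)))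
        (at x)" if "x \<in> S" for x
      by (rule bounded_bilinear.FDERIV[OF assms(2) times_diff_on_SucE[OF Suc.prems(1) that]
            times_diff_on_SucE[OF Suc.prems(2) that]])
    show "times_diff_on k S (\<lambda>x. mul (f x) (frechet_derivative g (at x) v) +
        mul (frechet_derivative f (at x) v) (g x))" for v
    proof (rule times_diff_on_add[OF assms(1)])
      show "times_diff_on k S (\<lambda>x. mul (f x) (frechet_derivative g (at x) v))"
        by (rule Suc.IH[OF times_diff_on_SucD[OF Suc.prems(1)]]) (use Suc.prems(2) in simp)
      show "times_diff_on k S (\<lambda>x. mul (frechet_derivative f (at x) v) (g x))"
        by (rule Suc.IH[OF _ times_diff_on_SucD[OF Suc.prems(2)]]) (use Suc.prems(1) in simp)
    qed
  qed
qed

text \<open>The derivative of a composite is \<open>f'(g x)(g'(x) v)\<close>.  Expanding the inner vector in a basis of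
  the finite-dimensional middle space turns it into a sum of products of functions to which the
  induction hypothesis applies.\<close>

lemma times_diff_on_compose:
  fixes g :: "'a::real_normed_vector \<Rightarrow> 'e::{real_normed_vector,heine_borel}"
  assumes "open S" "open T" "g ` S \<subseteq> T" "times_diff_on k T f" "times_diff_on k S g"
  shows "times_diff_on k S (\<lambda>x. f (g x))"
  using assms(4,5)
proof (induction k arbitrary: f)
  case 0
  then have "continuous_on T f" "continuous_on S g" by auto
  then show ?case using continuous_on_compose2[OF _ _ assms(3)] by simp
next
  case (Suc k)
  obtain B :: "'e set" and rep where B: "finite B" "\<And>b. bounded_linear (rep b)"
      "\<And>x. (\<Sum>b\<in>B. rep b x *\<^sub>R b) = x"
    using finite_coordinates by blast
  let ?f' = "\<lambda>y. frechet_derivative f (at y)" and ?g' = "\<lambda>x. frechet_derivative g (at x)"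
  have f': "(f has_derivative ?f' y) (at y)" if "y \<in> T" for y
    using Suc.prems(1) that by (rule times_diff_on_SucE)
  show ?case
  proof (rule times_diff_on_SucI[OF assms(1)])
    fix x assume x: "x \<in> S"
    have g': "(g has_derivative ?g' x) (at x)" using Suc.prems(2) x by (rule times_diff_on_SucE)
    have fg: "(f has_derivative ?f' (g x)) (at (g x))" using x assms(3) by (intro f') auto
    have "(\<lambda>v. ?f' (g x) (?g' x v)) = (\<lambda>v. \<Sum>b\<in>B. rep b (?g' x v) *\<^sub>R ?f' (g x) b)"
      by (rule ext linear_eq_sum_coordinates[OF has_derivative_linear[OF fg] B(3)])+
    with diff_chain_at[OF g' fg]
    show "((\<lambda>x. f (g x)) has_derivative
        (\<lambda>v. \<Sum>b\<in>B. rep b (?g' x v) *\<^sub>R ?f' (g x) b)) (at x)"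
      by (simp only: o_def)
  next
    fix v
    have "times_diff_on k S (\<lambda>x. rep b (?g' x v))" for b
      by (rule times_diff_on_bounded_linear[OF assms(1) B(2)]) (use Suc.prems(2) in simp)
    moreover have "times_diff_on k S (\<lambda>x. ?f' (g x) b)" for b
      by (rule Suc.IH[OF _ times_diff_on_SucD[OF Suc.prems(2)]]) (use Suc.prems(1) in simp)
    ultimately show "times_diff_on k S (\<lambda>x. \<Sum>b\<in>B. rep b (?g' x v) *\<^sub>R ?f' (g x) b)"
      by (intro times_diff_on_sum[OF assms(1)]
          times_diff_on_bilinear[OF assms(1) bounded_bilinear_scaleR])
  qed
qed

lemma smooth_on_subset: "smooth_on S f \<Longrightarrow> T \<subseteq> S \<Longrightarrow> smooth_on T f"
  unfolding smooth_on_def using times_diff_on_subset by blast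

lemma smooth_on_cong: "open S \<Longrightarrow> (\<And>x. x \<in> S \<Longrightarrow> f x = g x) \<Longrightarrow> smooth_on S f \<longleftrightarrow> smooth_on S g"
  unfolding smooth_on_def using times_diff_on_cong by blast

lemma smooth_on_local:
  "(\<And>x. x \<in> S \<Longrightarrow> \<exists>T. open T \<and> x \<in> T \<and> smooth_on T f) \<Longrightarrow> smooth_on S f"
  unfolding smooth_on_def by (meson times_diff_on_local)

lemma smooth_on_continuous: "smooth_on S f \<Longrightarrow> continuous_on S f"
  unfolding smooth_on_def using times_diff_on_continuous by blast

lemma smooth_on_has_derivative:
  "smooth_on S f \<Longrightarrow> x \<in> S \<Longrightarrow> (f has_derivative frechet_derivative f (at x)) (at x)"
  unfolding smooth_on_def using times_diff_on_SucE by blast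

lemma smooth_on_derivative: "smooth_on S f \<Longrightarrow> smooth_on S (\<lambda>x. frechet_derivative f (at x) v)"
  unfolding smooth_on_def by (metis times_diff_on.simps(2))

lemma smooth_on_const: "open S \<Longrightarrow> smooth_on S (\<lambda>x. c)"
  unfolding smooth_on_def by (blast intro: times_diff_on_const)

lemma smooth_on_add:
  "open S \<Longrightarrow> smooth_on S f \<Longrightarrow> smooth_on S g \<Longrightarrow> smooth_on S (\<lambda>x. f x + g x)"
  unfolding smooth_on_def by (blast intro: times_diff_on_add)

lemma smooth_on_bounded_linear:
  "open S \<Longrightarrow> bounded_linear L \<Longrightarrow> smooth_on S f \<Longrightarrow> smooth_on S (\<lambda>x. L (f x))"
  unfolding smooth_on_def by (blast intro: times_diff_on_bounded_linear)

lemma smooth_on_bilinear: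
  "open S \<Longrightarrow> bounded_bilinear mul \<Longrightarrow> smooth_on S f \<Longrightarrow> smooth_on S g \<Longrightarrow>
    smooth_on S (\<lambda>x. mul (f x) (g x))"
  unfolding smooth_on_def by (blast intro: times_diff_on_bilinear)

lemma smooth_on_minus: "open S \<Longrightarrow> smooth_on S f \<Longrightarrow> smooth_on S (\<lambda>x. - f x)"
  by (rule smooth_on_bounded_linear[OF _ bounded_linear_minus[OF bounded_linear_ident]])

lemma smooth_on_diff:
  "open S \<Longrightarrow> smooth_on S f \<Longrightarrow> smooth_on S g \<Longrightarrow> smooth_on S (\<lambda>x. f x - g x)"
  using smooth_on_add[of S f "\<lambda>x. - g x"] smooth_on_minus by auto

lemma smooth_on_compose:
  fixes g :: "'a::real_normed_vector \<Rightarrow> 'e::{real_normed_vector,heine_borel}"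
  assumes "open S" "open T" "g ` S \<subseteq> T" "smooth_on T f" "smooth_on S g"
  shows "smooth_on S (\<lambda>x. f (g x))"
  using assms unfolding smooth_on_def by (blast intro: times_diff_on_compose)

lemma increment_bound:
  fixes k :: "real \<Rightarrow> 'b::real_normed_vector"
  assumes "0 \<le> t" "\<And>r. r \<in> {0..t} \<Longrightarrow> (k has_vector_derivative k' r) (at r)"
    and "\<And>r. r \<in> {0..t} \<Longrightarrow> norm (k' r - c) \<le> e"
  shows "norm (k t - k 0 - t *\<^sub>R c) \<le> e * t"
proof -
  have "norm ((k t - t *\<^sub>R c) - (k 0 - 0 *\<^sub>R c)) \<le> e * norm (t - 0)"
  proof (rule differentiable_bound[where S = "{0..t}" and f' = "\<lambda>r h. h *\<^sub>R (k' r - c)"])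
    fix r assume r: "r \<in> {0..t}"
    have "(k has_derivative (\<lambda>h. h *\<^sub>R k' r)) (at r within {0..t})"
      using assms(2)[OF r] unfolding has_vector_derivative_def by (rule has_derivative_at_withinI)
    then have "((\<lambda>r. k r - r *\<^sub>R c) has_derivative (\<lambda>h. h *\<^sub>R k' r - h *\<^sub>R c)) (at r within {0..t})"
      by (intro has_derivative_diff has_derivative_scaleR_left has_derivative_ident)
    then show "((\<lambda>r. k r - r *\<^sub>R c) has_derivative (\<lambda>h. h *\<^sub>R (k' r - c))) (at r within {0..t})"
      by (simp add: scaleR_diff_right)
    show "onorm (\<lambda>h. h *\<^sub>R (k' r - c)) \<le> e"
    proof (rule onorm_le)
      show "norm (h *\<^sub>R (k' r - c)) \<le> e * norm h" for h
        using mult_right_mono[OF assms(3)[OF r], of "\<bar>h\<bar>"] by (simp add: mult.commute)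
    qed
  qed (use assms(1) in auto)
  then show ?thesis using assms(1) by (simp add: algebra_simps)
qed

text \<open>Both mixed derivatives are the limit of the second difference quotient
  \<open>(f(x + tv + tw) - f(x + tv) - f(x + tw) + f(x)) / t\<^sup>2\<close>, which is symmetric in \<open>v\<close> and \<open>w\<close>.\<close>

lemma second_difference_estimate:
  assumes S: "open S" "x \<in> S" and f: "smooth_on S f" and e: "e > 0"
  shows "\<exists>\<delta>>0. \<forall>t. 0 < t \<and> t < \<delta> \<longrightarrow>
    norm (f (x + t *\<^sub>R v + t *\<^sub>R w) - f (x + t *\<^sub>R v) - f (x + t *\<^sub>R w) + f x -
      (t * t) *\<^sub>R frechet_derivative (\<lambda>y. frechet_derivative f (at y) v) (at x) w) \<le> e * (t * t)"
proof -
  define D where "D = (\<lambda>y. frechet_derivative f (at y) v)"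
  define E where "E = (\<lambda>y. frechet_derivative D (at y) w)"
  have D: "smooth_on S D" unfolding D_def using f by (rule smooth_on_derivative)
  have E: "smooth_on S E" unfolding E_def using D by (rule smooth_on_derivative)
  have cont: "isCont E x"
    using smooth_on_continuous[OF E] S continuous_on_eq_continuous_at by blast
  obtain d1 where d1: "d1 > 0" "\<And>y. dist y x < d1 \<Longrightarrow> dist (E y) (E x) < e"
    using cont e unfolding continuous_at by (metis continuous_at_eps_delta cont)
  obtain d2 where d2: "d2 > 0" "ball x d2 \<subseteq> S" using S open_contains_ball by blast
  define d where "d = min d1 d2"
  have d: "d > 0" unfolding d_def using d1 d2 by simp
  have near: "y \<in> S \<and> norm (E y - E x) \<le> e" if "norm (y - x) < d" for y
  proof -
    have "dist y x < d1" "dist x y < d2" using that unfolding d_def by (simp_all add: dist_norm norm_minus_commute)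
    then show ?thesis using d1(2)[of y] d2 by (auto simp: dist_norm)
  qed
  define \<delta> where "\<delta> = d / (norm v + norm w + 1)"
  have pos: "norm v + norm w + 1 > 0" by (simp add: add_nonneg_pos)
  have \<delta>: "\<delta> > 0" unfolding \<delta>_def using d pos by simp
  have "norm (f (x + t *\<^sub>R v + t *\<^sub>R w) - f (x + t *\<^sub>R v) - f (x + t *\<^sub>R w) + f x - (t * t) *\<^sub>R E x)
      \<le> e * (t * t)" if t: "0 < t" "t < \<delta>" for t
  proof -
    have small: "norm ((x + u *\<^sub>R v + r *\<^sub>R w) - x) < d" if "u \<in> {0..t}" "r \<in> {0..t}" for u r
    proof -
      have "norm (u *\<^sub>R v + r *\<^sub>R w) \<le> u * norm v + r * norm w"
        using norm_triangle_ineq[of "u *\<^sub>R v" "r *\<^sub>R w"] that by simp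
      also have "\<dots> \<le> t * norm v + t * norm w"
        using that by (intro add_mono mult_right_mono) auto
      also have "\<dots> \<le> t * (norm v + norm w + 1)" using t by (simp add: algebra_simps)
      also have "\<dots> < d" using t pos unfolding \<delta>_def by (simp add: pos_less_divide_eq)
      finally show ?thesis by (simp add: algebra_simps)
    qed
    have inS: "x + u *\<^sub>R v + r *\<^sub>R w \<in> S" if "u \<in> {0..t}" "r \<in> {0..t}" for u r
      using near[OF small[OF that]] by simp
    have inner: "norm (D (x + u *\<^sub>R v + t *\<^sub>R w) - D (x + u *\<^sub>R v) - t *\<^sub>R E x) \<le> e * t"
      if u: "u \<in> {0..t}" for u
    proof -
      have "norm (D (x + u *\<^sub>R v + t *\<^sub>R w) - D (x + u *\<^sub>R v + 0 *\<^sub>R w) - t *\<^sub>R E x) \<le> e * t"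
      proof (rule increment_bound[where k' = "\<lambda>r. E (x + u *\<^sub>R v + r *\<^sub>R w)"])
        fix r assume r: "r \<in> {0..t}"
        have D': "(D has_derivative frechet_derivative D (at (x + u *\<^sub>R v + r *\<^sub>R w)))
            (at (x + u *\<^sub>R v + r *\<^sub>R w))"
          using smooth_on_has_derivative[OF D inS[OF u r]] .
        have "((\<lambda>r. x + u *\<^sub>R v + r *\<^sub>R w) has_derivative (\<lambda>h. h *\<^sub>R w)) (at r)"
          by (auto intro!: derivative_eq_intros)
        from diff_chain_at[OF this D']
        show "((\<lambda>r. D (x + u *\<^sub>R v + r *\<^sub>R w)) has_vector_derivative E (x + u *\<^sub>R v + r *\<^sub>R w)) (at r)"
          unfolding has_vector_derivative_def E_def o_def
          by (simp add: linear_scale[OF has_derivative_linear[OF D']])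
        show "norm (E (x + u *\<^sub>R v + r *\<^sub>R w) - E x) \<le> e"
          using near[OF small[OF u r]] by simp
      qed (use t in simp)
      then show ?thesis by simp
    qed
    have "norm ((f (x + t *\<^sub>R v + t *\<^sub>R w) - f (x + t *\<^sub>R v)) -
        (f (x + 0 *\<^sub>R v + t *\<^sub>R w) - f (x + 0 *\<^sub>R v)) - t *\<^sub>R (t *\<^sub>R E x)) \<le> (e * t) * t"
    proof (rule increment_bound[where k' = "\<lambda>u. D (x + u *\<^sub>R v + t *\<^sub>R w) - D (x + u *\<^sub>R v)"])
      fix u assume u: "u \<in> {0..t}"
      have *: "((\<lambda>u. f (x + u *\<^sub>R v + r *\<^sub>R w)) has_vector_derivative D (x + u *\<^sub>R v + r *\<^sub>R w)) (at u)"
        if r: "r \<in> {0..t}" for r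
      proof -
        have f': "(f has_derivative frechet_derivative f (at (x + u *\<^sub>R v + r *\<^sub>R w)))
            (at (x + u *\<^sub>R v + r *\<^sub>R w))"
          using smooth_on_has_derivative[OF f inS[OF u r]] .
        have "((\<lambda>u. x + u *\<^sub>R v + r *\<^sub>R w) has_derivative (\<lambda>h. h *\<^sub>R v)) (at u)"
          by (auto intro!: derivative_eq_intros)
        from diff_chain_at[OF this f'] show ?thesis
          unfolding has_vector_derivative_def D_def o_def
          by (simp add: linear_scale[OF has_derivative_linear[OF f']])
      qed
      show "((\<lambda>u. f (x + u *\<^sub>R v + t *\<^sub>R w) - f (x + u *\<^sub>R v)) has_vector_derivative
          D (x + u *\<^sub>R v + t *\<^sub>R w) - D (x + u *\<^sub>R v)) (at u)"
        using has_vector_derivative_diff[OF *[of t] *[of 0]] t by simp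
      show "norm (D (x + u *\<^sub>R v + t *\<^sub>R w) - D (x + u *\<^sub>R v) - t *\<^sub>R E x) \<le> e * t"
        by (rule inner[OF u])
    qed (use t in simp)
    then show ?thesis by (simp add: algebra_simps)
  qed
  then show ?thesis using \<delta> unfolding E_def D_def by blast
qed

lemma mixed_derivatives_commute:
  assumes S: "open S" "x \<in> S" and f: "smooth_on S f"
  shows "frechet_derivative (\<lambda>y. frechet_derivative f (at y) v) (at x) w =
    frechet_derivative (\<lambda>y. frechet_derivative f (at y) w) (at x) v" (is "?a = ?b")
proof (rule ccontr)
  assume "?a \<noteq> ?b"
  define e where "e = norm (?a - ?b) / 3"
  have e: "e > 0" unfolding e_def using \<open>?a \<noteq> ?b\<close> by simp
  obtain \<delta> where \<delta>: "\<delta> > 0" "\<And>t. 0 < t \<Longrightarrow> t < \<delta> \<Longrightarrow>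
    norm (f (x + t *\<^sub>R v + t *\<^sub>R w) - f (x + t *\<^sub>R v) - f (x + t *\<^sub>R w) + f x - (t * t) *\<^sub>R ?a) \<le> e * (t * t)"
    using second_difference_estimate[OF S f e, of v w] by blast
  obtain \<delta>' where \<delta>': "\<delta>' > 0" "\<And>t. 0 < t \<Longrightarrow> t < \<delta>' \<Longrightarrow>
    norm (f (x + t *\<^sub>R w + t *\<^sub>R v) - f (x + t *\<^sub>R w) - f (x + t *\<^sub>R v) + f x - (t * t) *\<^sub>R ?b) \<le> e * (t * t)"
    using second_difference_estimate[OF S f e, of w v] by blast
  define t where "t = min \<delta> \<delta>' / 2"
  have t: "0 < t" "t < \<delta>" "t < \<delta>'" unfolding t_def using \<delta>(1) \<delta>'(1) by auto
  define A where "A = f (x + t *\<^sub>R v + t *\<^sub>R w) - f (x + t *\<^sub>R v) - f (x + t *\<^sub>R w) + f x"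
  have A: "norm (A - (t * t) *\<^sub>R ?a) \<le> e * (t * t)"
    unfolding A_def using \<delta>(2) t by blast
  have "f (x + t *\<^sub>R w + t *\<^sub>R v) - f (x + t *\<^sub>R w) - f (x + t *\<^sub>R v) + f x = A"
    unfolding A_def by (simp add: algebra_simps)
  with \<delta>'(2)[OF t(1,3)] have B: "norm (A - (t * t) *\<^sub>R ?b) \<le> e * (t * t)" by simp
  have "(t * t) *\<^sub>R (?a - ?b) = (A - (t * t) *\<^sub>R ?b) - (A - (t * t) *\<^sub>R ?a)"
    by (simp add: algebra_simps)
  then have "norm ((t * t) *\<^sub>R (?a - ?b)) \<le> norm (A - (t * t) *\<^sub>R ?b) + norm (A - (t * t) *\<^sub>R ?a)"
    by (metis norm_triangle_ineq4)
  moreover have "norm ((t * t) *\<^sub>R (?a - ?b)) = (t * t) * norm (?a - ?b)" using t by simp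
  moreover have "(t * t) * (2 * e) = e * (t * t) + e * (t * t)" by (simp add: algebra_simps)
  ultimately have "(t * t) * norm (?a - ?b) \<le> (t * t) * (2 * e)" using A B by linarith
  then have "norm (?a - ?b) \<le> 2 * e" by (rule mult_left_le_imp_le) (use t in simp)
  then show False using e unfolding e_def by simp
qed

section \<open>Calculus on a manifold\<close>

lemma ball_coords: "(\<forall>(c, x)\<in>coords M U. Q c x) \<longleftrightarrow> (\<forall>c x. c \<in> M \<longrightarrow> x \<in> U \<longrightarrow> x \<in> cdom c \<longrightarrow> Q c x)"
  by (auto simp: coords_def)

locale manifold =
  fixes M :: "('x::{t2_space,second_countable_topology}, 'e::{real_normed_vector,heine_borel}) atlas"
  assumes smooth_manifold: "smooth_manifold M"
begin

lemma chart_homeomorphism: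
  "c \<in> M \<Longrightarrow> homeomorphism (cdom c) (cmap c ` cdom c) (cmap c) (cinv c)"
  using smooth_manifold unfolding smooth_manifold_def by blast

lemma chart_open: "c \<in> M \<Longrightarrow> open (cdom c)"
  using smooth_manifold unfolding smooth_manifold_def by blast

lemma open_points: "open (points M)"
  unfolding points_def using chart_open by blast

lemma cdom_subset_points: "c \<in> M \<Longrightarrow> cdom c \<subseteq> points M"
  unfolding points_def by blast

lemma cinv_cmap [simp]: "c \<in> M \<Longrightarrow> x \<in> cdom c \<Longrightarrow> cinv c (cmap c x) = x"
  using chart_homeomorphism homeomorphism_apply1 by blast

lemma chart_image_open:
  assumes "c \<in> M" "open U" shows "open (cmap c ` (U \<inter> cdom c))"
proof -
  have "openin (top_of_set (cmap c ` cdom c)) (cmap c ` (U \<inter> cdom c))"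
    using homeomorphism_imp_open_map[OF chart_homeomorphism[OF assms(1)]] chart_open[OF assms(1)] assms(2)
    by (simp add: openin_open_eq open_Int inf_le2 Int_absorb1)
  moreover have "open (cmap c ` cdom c)"
    using smooth_manifold assms(1) unfolding smooth_manifold_def by blast
  ultimately show ?thesis by (simp add: openin_open_eq)
qed

lemma continuous_cmap: "c \<in> M \<Longrightarrow> continuous_on (cdom c) (cmap c)"
  using chart_homeomorphism unfolding homeomorphism_def by blast

lemma continuous_cinv: "c \<in> M \<Longrightarrow> continuous_on (cmap c ` cdom c) (cinv c)"
  using chart_homeomorphism unfolding homeomorphism_def by blast

lemma transition_smooth:
  "c \<in> M \<Longrightarrow> c' \<in> M \<Longrightarrow> smooth_on (cmap c ` (cdom c \<inter> cdom c')) (cmap c' \<circ> cinv c)"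
  using smooth_manifold unfolding smooth_manifold_def by blast

subsection \<open>Functions\<close>

lemma smooth_fun_subset: "smooth_fun M U f \<Longrightarrow> V \<subseteq> U \<Longrightarrow> smooth_fun M V f"
  unfolding smooth_fun_def by (meson Int_mono image_mono order_refl smooth_on_subset)

lemma smooth_fun_bounded_linear:
  assumes "open U" "bounded_linear L" "smooth_fun M U f"
  shows "smooth_fun M U (\<lambda>x. L (f x))"
  using assms(3) smooth_on_bounded_linear[OF chart_image_open[OF _ assms(1)] assms(2)]
  unfolding smooth_fun_def o_def by blast

lemma smooth_fun_add:
  assumes "open U" "smooth_fun M U f" "smooth_fun M U g"
  shows "smooth_fun M U (\<lambda>x. f x + g x)"
  using assms(2,3) smooth_on_add[OF chart_image_open[OF _ assms(1)]]
  unfolding smooth_fun_def o_def by blast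

lemma smooth_fun_minus: "open U \<Longrightarrow> smooth_fun M U f \<Longrightarrow> smooth_fun M U (\<lambda>x. - f x)"
  using smooth_fun_bounded_linear[OF _ bounded_linear_minus[OF bounded_linear_ident]] .

lemma smooth_fun_diff:
  "open U \<Longrightarrow> smooth_fun M U f \<Longrightarrow> smooth_fun M U g \<Longrightarrow> smooth_fun M U (\<lambda>x. f x - g x)"
  using smooth_fun_add[of U f "\<lambda>x. - g x"] smooth_fun_minus by auto

lemma smooth_fun_const: "open U \<Longrightarrow> smooth_fun M U (\<lambda>x. c)"
  unfolding smooth_fun_def o_def using smooth_on_const[OF chart_image_open] by blast

lemma smooth_fun_inner_const: "open U \<Longrightarrow> smooth_fun M U f \<Longrightarrow> smooth_fun M U (\<lambda>x. y \<bullet> f x)"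
  by (rule smooth_fun_bounded_linear[OF _ bounded_linear_inner_right])

lemma smooth_fun_continuous:
  assumes "U \<subseteq> points M" "open U" "smooth_fun M U f"
  shows "continuous_on U f"
proof (rule continuous_at_imp_continuous_on, rule ballI)
  fix x assume x: "x \<in> U"
  then obtain c where c: "c \<in> M" "x \<in> cdom c" using assms(1) unfolding points_def by blast
  have "continuous_on (cmap c ` (U \<inter> cdom c)) (f \<circ> cinv c)"
    using assms(3) c smooth_on_continuous unfolding smooth_fun_def by blast
  moreover have "continuous_on (U \<inter> cdom c) (cmap c)"
    using continuous_cmap[OF c(1)] continuous_on_subset by blast
  ultimately have "continuous_on (U \<inter> cdom c) (\<lambda>x. (f \<circ> cinv c) (cmap c x))"
    by (rule continuous_on_compose2) auto
  then have "continuous_on (U \<inter> cdom c) f"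
    by (rule continuous_on_eq) (use c in simp)
  moreover have "open (U \<inter> cdom c)" "x \<in> U \<inter> cdom c"
    using assms(2) chart_open[OF c(1)] x c by auto
  ultimately show "isCont f x" by (simp add: continuous_on_eq_continuous_at)
qed

lemma d0_has_derivative:
  "smooth_fun M U f \<Longrightarrow> c \<in> M \<Longrightarrow> x \<in> U \<Longrightarrow> x \<in> cdom c \<Longrightarrow>
    (f \<circ> cinv c has_derivative d0 f c x) (at (cmap c x))"
  unfolding smooth_fun_def d0_def using smooth_on_has_derivative by blast

lemma d0_eqI:
  "(f \<circ> cinv c has_derivative D) (at (cmap c x)) \<Longrightarrow> d0 f c x v = D v"
  unfolding d0_def using frechet_derivative_eqI by metis

lemma d0_bounded_linear:
  assumes "bounded_linear L" "smooth_fun M U f" "c \<in> M" "x \<in> U" "x \<in> cdom c"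
  shows "d0 (\<lambda>x. L (f x)) c x v = L (d0 f c x v)"
  using bounded_linear.has_derivative[OF assms(1) d0_has_derivative[OF assms(2-5)]]
  by (intro d0_eqI) (simp add: o_def)

lemma d0_add:
  assumes "smooth_fun M U f" "smooth_fun M U g" "c \<in> M" "x \<in> U" "x \<in> cdom c"
  shows "d0 (\<lambda>x. f x + g x) c x v = d0 f c x v + d0 g c x v"
  using has_derivative_add[OF d0_has_derivative[OF assms(1,3-5)] d0_has_derivative[OF assms(2-5)]]
  by (intro d0_eqI) (simp add: o_def)

lemma d0_minus:
  assumes "smooth_fun M U f" "c \<in> M" "x \<in> U" "x \<in> cdom c"
  shows "d0 (\<lambda>x. - f x) c x v = - d0 f c x v"
  by (rule d0_bounded_linear[OF bounded_linear_minus[OF bounded_linear_ident] assms])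

lemma d0_diff:
  assumes "smooth_fun M U f" "smooth_fun M U g" "c \<in> M" "x \<in> U" "x \<in> cdom c"
  shows "d0 (\<lambda>x. f x - g x) c x v = d0 f c x v - d0 g c x v"
  using has_derivative_diff[OF d0_has_derivative[OF assms(1,3-5)] d0_has_derivative[OF assms(2-5)]]
  by (intro d0_eqI) (simp add: o_def)

lemma d0_inner_const:
  assumes "smooth_fun M U f" "c \<in> M" "x \<in> U" "x \<in> cdom c"
  shows "d0 (\<lambda>x. y \<bullet> f x) c x v = y \<bullet> d0 f c x v"
  by (rule d0_bounded_linear[OF bounded_linear_inner_right assms])

lemma d0_const [simp]: "d0 (\<lambda>x. k) c x v = 0"
  by (rule d0_eqI) (simp add: o_def)

lemma d0_cong:
  assumes "open U" "\<And>x. x \<in> U \<Longrightarrow> f x = g x" "c \<in> M" "x \<in> U" "x \<in> cdom c"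
  shows "d0 f c x v = d0 g c x v"
proof -
  have "frechet_derivative (f \<circ> cinv c) (at (cmap c x)) = frechet_derivative (g \<circ> cinv c) (at (cmap c x))"
    by (rule frechet_derivative_cong_open[OF chart_image_open[OF assms(3,1)]])
       (use assms in auto)
  then show ?thesis by (simp add: d0_def)
qed

end

context manifold begin

text \<open>In a ball of a chart the derivative is zero; the level sets are therefore open.\<close>

lemma constant_if_d0_zero:
  fixes f :: "'x \<Rightarrow> 'b::euclidean_space"
  assumes "open U" "U \<subseteq> points M" "smooth_fun M U f" "connected U" "x \<in> U" "y \<in> U"
    and "\<And>c x v. c \<in> M \<Longrightarrow> x \<in> U \<Longrightarrow> x \<in> cdom c \<Longrightarrow> d0 f c x v = 0"
  shows "f x = f y"
proof -
  have loc: "\<exists>W. open W \<and> z \<in> W \<and> W \<subseteq> U \<and> (\<forall>y\<in>W. f y = f z)" if z: "z \<in> U" for z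
  proof -
    obtain c where c: "c \<in> M" "z \<in> cdom c" using z assms(2) unfolding points_def by blast
    have "open (cmap c ` (U \<inter> cdom c))" by (rule chart_image_open[OF c(1) assms(1)])
    moreover have "cmap c z \<in> cmap c ` (U \<inter> cdom c)" using z c by blast
    ultimately obtain r where r: "r > 0" "ball (cmap c z) r \<subseteq> cmap c ` (U \<inter> cdom c)"
      by (rule openE)
    define W where "W = U \<inter> cdom c \<inter> cmap c -` ball (cmap c z) r"
    have "continuous_on (U \<inter> cdom c) (cmap c)"
      using continuous_cmap[OF c(1)] by (rule continuous_on_subset) simp
    then have "open W"
      unfolding W_def using open_Int[OF assms(1) chart_open[OF c(1)]] open_ball
      by (rule continuous_open_preimage)
    moreover have "z \<in> W" unfolding W_def using z c r by simp
    moreover have "f y = f z" if y: "y \<in> W" for y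
    proof -
      have "((f \<circ> cinv c) has_derivative (\<lambda>h. 0)) (at u within ball (cmap c z) r)"
        if u: "u \<in> ball (cmap c z) r" for u
      proof -
        have "u \<in> cmap c ` (U \<inter> cdom c)" using u r(2) by blast
        then obtain p where p: "p \<in> U" "p \<in> cdom c" "u = cmap c p" by blast
        have "d0 f c p = (\<lambda>h. 0)" using assms(7)[OF c(1) p(1,2)] by (rule ext)
        then have "((f \<circ> cinv c) has_derivative (\<lambda>h. 0)) (at u)"
          using d0_has_derivative[OF assms(3) c(1) p(1,2)] p(3) by simp
        then show ?thesis by (rule has_derivative_at_withinI)
      qed
      from has_derivative_zero_constant[OF convex_ball this]
      obtain k where k: "\<And>u. u \<in> ball (cmap c z) r \<Longrightarrow> (f \<circ> cinv c) u = k" by blast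
      have "(f \<circ> cinv c) (cmap c y) = (f \<circ> cinv c) (cmap c z)"
        using k[of "cmap c y"] k[of "cmap c z"] y r(1) unfolding W_def by simp
      then show ?thesis using y c unfolding W_def by simp
    qed
    moreover have "W \<subseteq> U" unfolding W_def by blast
    ultimately show ?thesis by (intro exI[of _ W] conjI ballI)
  qed
  have op: "open {z \<in> U. Q (f z)}" for Q
  proof (rule open_subopen[THEN iffD2], rule ballI)
    fix z assume z: "z \<in> {z \<in> U. Q (f z)}"
    then have "z \<in> U" by simp
    from loc[OF this] obtain W where "open W" "z \<in> W" "W \<subseteq> U" "\<forall>y\<in>W. f y = f z"
      by (elim exE conjE)
    moreover have "W \<subseteq> {z \<in> U. Q (f z)}"
    proof (rule subsetI, rule CollectI, rule conjI)
      fix y assume "y \<in> W"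
      then show "y \<in> U" using \<open>W \<subseteq> U\<close> by blast
      have "f y = f z" using \<open>y \<in> W\<close> \<open>\<forall>y\<in>W. f y = f z\<close> by blast
      then show "Q (f y)" using z by (simp only: mem_Collect_eq)
    qed
    ultimately show "\<exists>T. open T \<and> z \<in> T \<and> T \<subseteq> {z \<in> U. Q (f z)}"
      by (intro exI[of _ W] conjI)
  qed
  let ?A = "{z \<in> U. f z = f x}" and ?B = "{z \<in> U. f z \<noteq> f x}"
  have "?A \<inter> ?B \<inter> U = {}" "U \<subseteq> ?A \<union> ?B" by auto
  from connectedD[OF assms(4) op[of "\<lambda>u. u = f x"] op[of "\<lambda>u. u \<noteq> f x"] this]
  have "?A \<inter> U = {} \<or> ?B \<inter> U = {}" .
  moreover have "x \<in> ?A \<inter> U" using assms(5) by simp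
  ultimately have "?B \<inter> U = {}" by blast
  then show ?thesis using assms(6) by force
qed


subsection \<open>Forms\<close>

lemma is_form1I:
  assumes "\<And>c x. c \<in> M \<Longrightarrow> x \<in> U \<Longrightarrow> x \<in> cdom c \<Longrightarrow> linear (\<omega> c x)"
    and "\<And>c v. c \<in> M \<Longrightarrow> smooth_on (cmap c ` (U \<inter> cdom c)) (\<lambda>y. \<omega> c (cinv c y) v)"
    and "\<And>c c' x v. c \<in> M \<Longrightarrow> c' \<in> M \<Longrightarrow> x \<in> U \<Longrightarrow> x \<in> cdom c \<Longrightarrow> x \<in> cdom c' \<Longrightarrow>
      \<omega> c x v = \<omega> c' x (transition c c' x v)"
  shows "is_form1 M U \<omega>"
  unfolding is_form1_def ball_coords using assms by blast

lemma is_form1D: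
  assumes "is_form1 M U \<omega>"
  shows "c \<in> M \<Longrightarrow> x \<in> U \<Longrightarrow> x \<in> cdom c \<Longrightarrow> linear (\<omega> c x)"
    and "c \<in> M \<Longrightarrow> smooth_on (cmap c ` (U \<inter> cdom c)) (\<lambda>y. \<omega> c (cinv c y) v)"
    and "c \<in> M \<Longrightarrow> c' \<in> M \<Longrightarrow> x \<in> U \<Longrightarrow> x \<in> cdom c \<Longrightarrow> x \<in> cdom c' \<Longrightarrow>
      \<omega> c x v = \<omega> c' x (transition c c' x v)"
  using assms unfolding is_form1_def ball_coords by blast+

lemma is_form2I:
  assumes "\<And>c x v. c \<in> M \<Longrightarrow> x \<in> U \<Longrightarrow> x \<in> cdom c \<Longrightarrow> linear (\<omega> c x v)"
    and "\<And>c x w. c \<in> M \<Longrightarrow> x \<in> U \<Longrightarrow> x \<in> cdom c \<Longrightarrow> linear (\<lambda>v. \<omega> c x v w)"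
    and "\<And>c x v. c \<in> M \<Longrightarrow> x \<in> U \<Longrightarrow> x \<in> cdom c \<Longrightarrow> \<omega> c x v v = 0"
    and "\<And>c v w. c \<in> M \<Longrightarrow> smooth_on (cmap c ` (U \<inter> cdom c)) (\<lambda>y. \<omega> c (cinv c y) v w)"
    and "\<And>c c' x v w. c \<in> M \<Longrightarrow> c' \<in> M \<Longrightarrow> x \<in> U \<Longrightarrow> x \<in> cdom c \<Longrightarrow> x \<in> cdom c' \<Longrightarrow>
      \<omega> c x v w = \<omega> c' x (transition c c' x v) (transition c c' x w)"
  shows "is_form2 M U \<omega>"
  unfolding is_form2_def ball_coords using assms by blast

lemma is_form2D:
  assumes "is_form2 M U \<omega>"
  shows "c \<in> M \<Longrightarrow> x \<in> U \<Longrightarrow> x \<in> cdom c \<Longrightarrow> linear (\<omega> c x v)"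
    and "c \<in> M \<Longrightarrow> x \<in> U \<Longrightarrow> x \<in> cdom c \<Longrightarrow> linear (\<lambda>v. \<omega> c x v w)"
    and "c \<in> M \<Longrightarrow> x \<in> U \<Longrightarrow> x \<in> cdom c \<Longrightarrow> \<omega> c x v v = 0"
    and "c \<in> M \<Longrightarrow> smooth_on (cmap c ` (U \<inter> cdom c)) (\<lambda>y. \<omega> c (cinv c y) v w)"
    and "c \<in> M \<Longrightarrow> c' \<in> M \<Longrightarrow> x \<in> U \<Longrightarrow> x \<in> cdom c \<Longrightarrow> x \<in> cdom c' \<Longrightarrow>
      \<omega> c x v w = \<omega> c' x (transition c c' x v) (transition c c' x w)"
  using assms unfolding is_form2_def ball_coords by blast+

lemma is_form1_subset:
  assumes "is_form1 M U \<omega>" "V \<subseteq> U" shows "is_form1 M V \<omega>"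
proof (rule is_form1I)
  show "smooth_on (cmap c ` (V \<inter> cdom c)) (\<lambda>y. \<omega> c (cinv c y) v)" if "c \<in> M" for c v
    using is_form1D(2)[OF assms(1) that] by (rule smooth_on_subset) (use assms(2) in auto)
qed (use is_form1D[OF assms(1)] assms(2) in blast)+

lemma is_form2_subset:
  assumes "is_form2 M U \<omega>" "V \<subseteq> U" shows "is_form2 M V \<omega>"
proof (rule is_form2I)
  show "smooth_on (cmap c ` (V \<inter> cdom c)) (\<lambda>y. \<omega> c (cinv c y) v w)" if "c \<in> M" for c v w
    using is_form2D(4)[OF assms(1) that] by (rule smooth_on_subset) (use assms(2) in auto)
qed (use is_form2D[OF assms(1)] assms(2) in blast)+

lemma is_form1_bounded_linear:
  assumes "open U" "bounded_linear L" "is_form1 M U \<omega>"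
  shows "is_form1 M U (\<lambda>c x v. L (\<omega> c x v))"
proof (rule is_form1I)
  show "linear (\<lambda>v. L (\<omega> c x v))" if "c \<in> M" "x \<in> U" "x \<in> cdom c" for c x
    using linear_compose[OF is_form1D(1)[OF assms(3) that] bounded_linear.linear[OF assms(2)]]
    by (simp add: o_def)
  show "smooth_on (cmap c ` (U \<inter> cdom c)) (\<lambda>y. L (\<omega> c (cinv c y) v))" if "c \<in> M" for c v
    by (rule smooth_on_bounded_linear[OF chart_image_open[OF that assms(1)] assms(2)
          is_form1D(2)[OF assms(3) that]])
  show "L (\<omega> c x v) = L (\<omega> c' x (transition c c' x v))"
    if "c \<in> M" "c' \<in> M" "x \<in> U" "x \<in> cdom c" "x \<in> cdom c'" for c c' x v
    using is_form1D(3)[OF assms(3) that] by simp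
qed

lemma is_form1_minus: "open U \<Longrightarrow> is_form1 M U \<omega> \<Longrightarrow> is_form1 M U (\<lambda>c x v. - \<omega> c x v)"
  using is_form1_bounded_linear[OF _ bounded_linear_minus[OF bounded_linear_ident]] .

lemma is_form1_inner_const: "open U \<Longrightarrow> is_form1 M U \<omega> \<Longrightarrow> is_form1 M U (\<lambda>c x v. y \<bullet> \<omega> c x v)"
  using is_form1_bounded_linear[OF _ bounded_linear_inner_right] .

lemma is_form1_add:
  assumes "open U" "is_form1 M U \<omega>" "is_form1 M U \<eta>"
  shows "is_form1 M U (\<lambda>c x v. \<omega> c x v + \<eta> c x v)"
proof (rule is_form1I)
  show "linear (\<lambda>v. \<omega> c x v + \<eta> c x v)" if "c \<in> M" "x \<in> U" "x \<in> cdom c" for c x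
    by (rule linear_compose_add[OF is_form1D(1)[OF assms(2) that] is_form1D(1)[OF assms(3) that]])
  show "smooth_on (cmap c ` (U \<inter> cdom c)) (\<lambda>y. \<omega> c (cinv c y) v + \<eta> c (cinv c y) v)"
    if "c \<in> M" for c v
    by (rule smooth_on_add[OF chart_image_open[OF that assms(1)]
          is_form1D(2)[OF assms(2) that] is_form1D(2)[OF assms(3) that]])
  show "\<omega> c x v + \<eta> c x v = \<omega> c' x (transition c c' x v) + \<eta> c' x (transition c c' x v)"
    if "c \<in> M" "c' \<in> M" "x \<in> U" "x \<in> cdom c" "x \<in> cdom c'" for c c' x v
    using is_form1D(3)[OF assms(2) that] is_form1D(3)[OF assms(3) that] by simp
qed

lemma is_form1_diff:
  "open U \<Longrightarrow> is_form1 M U \<omega> \<Longrightarrow> is_form1 M U \<eta> \<Longrightarrow> is_form1 M U (\<lambda>c x v. \<omega> c x v - \<eta> c x v)"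
  using is_form1_add[of U \<omega> "\<lambda>c x v. - \<eta> c x v"] is_form1_minus by auto

lemma is_form1_zero: "open U \<Longrightarrow> is_form1 M U (\<lambda>c x v. 0)"
  by (rule is_form1I) (auto intro: smooth_on_const chart_image_open simp: linear_zero)

lemma is_form2_add:
  assumes "open U" "is_form2 M U \<omega>" "is_form2 M U \<eta>"
  shows "is_form2 M U (\<lambda>c x v w. \<omega> c x v w + \<eta> c x v w)"
proof (rule is_form2I)
  show "linear (\<lambda>w. \<omega> c x v w + \<eta> c x v w)" if "c \<in> M" "x \<in> U" "x \<in> cdom c" for c x v
    by (rule linear_compose_add[OF is_form2D(1)[OF assms(2) that] is_form2D(1)[OF assms(3) that]])
  show "linear (\<lambda>v. \<omega> c x v w + \<eta> c x v w)" if "c \<in> M" "x \<in> U" "x \<in> cdom c" for c x w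
    by (rule linear_compose_add[OF is_form2D(2)[OF assms(2) that] is_form2D(2)[OF assms(3) that]])
  show "\<omega> c x v v + \<eta> c x v v = 0" if "c \<in> M" "x \<in> U" "x \<in> cdom c" for c x v
    using is_form2D(3)[OF assms(2) that] is_form2D(3)[OF assms(3) that] by simp
  show "smooth_on (cmap c ` (U \<inter> cdom c)) (\<lambda>y. \<omega> c (cinv c y) v w + \<eta> c (cinv c y) v w)"
    if "c \<in> M" for c v w
    by (rule smooth_on_add[OF chart_image_open[OF that assms(1)]
          is_form2D(4)[OF assms(2) that] is_form2D(4)[OF assms(3) that]])
  show "\<omega> c x v w + \<eta> c x v w = \<omega> c' x (transition c c' x v) (transition c c' x w) +
      \<eta> c' x (transition c c' x v) (transition c c' x w)"
    if "c \<in> M" "c' \<in> M" "x \<in> U" "x \<in> cdom c" "x \<in> cdom c'" for c c' x v w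
    using is_form2D(5)[OF assms(2) that] is_form2D(5)[OF assms(3) that] by simp
qed

lemma is_form2_zero: "open U \<Longrightarrow> is_form2 M U (\<lambda>c x v w. 0)"
  by (rule is_form2I) (auto intro: smooth_on_const chart_image_open simp: linear_zero)

lemma is_form2_inner_fun:
  fixes \<omega> :: "('x, 'e, 'b::real_inner) form2"
  assumes "open U" "smooth_fun M U f" "is_form2 M U \<omega>"
  shows "is_form2 M U (\<lambda>c x v w. f x \<bullet> \<omega> c x v w)"
proof (rule is_form2I)
  have L: "linear ((\<bullet>) (f x))" for x by (rule bounded_linear.linear[OF bounded_linear_inner_right])
  show "linear (\<lambda>w. f x \<bullet> \<omega> c x v w)" if "c \<in> M" "x \<in> U" "x \<in> cdom c" for c x v
    using linear_compose[OF is_form2D(1)[OF assms(3) that] L] by (simp add: o_def)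
  show "linear (\<lambda>v. f x \<bullet> \<omega> c x v w)" if "c \<in> M" "x \<in> U" "x \<in> cdom c" for c x w
    using linear_compose[OF is_form2D(2)[OF assms(3) that] L] by (simp add: o_def)
  show "f x \<bullet> \<omega> c x v v = 0" if "c \<in> M" "x \<in> U" "x \<in> cdom c" for c x v
    using is_form2D(3)[OF assms(3) that] by simp
  show "smooth_on (cmap c ` (U \<inter> cdom c)) (\<lambda>y. f (cinv c y) \<bullet> \<omega> c (cinv c y) v w)"
    if "c \<in> M" for c v w
    using smooth_on_bilinear[OF chart_image_open[OF that assms(1)] bounded_bilinear_inner
      _ is_form2D(4)[OF assms(3) that], of "f \<circ> cinv c"] assms(2) that
    unfolding smooth_fun_def by simp
  show "f x \<bullet> \<omega> c x v w = f x \<bullet> \<omega> c' x (transition c c' x v) (transition c c' x w)"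
    if "c \<in> M" "c' \<in> M" "x \<in> U" "x \<in> cdom c" "x \<in> cdom c'" for c c' x v w
    using is_form2D(5)[OF assms(3) that] by simp
qed

lemma is_form2_minus:
  assumes "open U" "is_form2 M U (\<omega> :: ('x, 'e, real) form2)"
  shows "is_form2 M U (\<lambda>c x v w. - \<omega> c x v w)"
  using is_form2_inner_fun[OF assms(1) smooth_fun_const[OF assms(1), of "-1"] assms(2)] by simp

lemma is_form2_diff:
  assumes "open U" "is_form2 M U (\<omega> :: ('x, 'e, real) form2)" "is_form2 M U \<eta>"
  shows "is_form2 M U (\<lambda>c x v w. \<omega> c x v w - \<eta> c x v w)"
  using is_form2_add[OF assms(1,2) is_form2_minus[OF assms(1,3)]] by simp

lemma form_has_derivative:
  assumes "is_form1 M U \<omega>" "c \<in> M" "x \<in> U" "x \<in> cdom c"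
  shows "((\<lambda>y. \<omega> c (cinv c y) w) has_derivative
    frechet_derivative (\<lambda>y. \<omega> c (cinv c y) w) (at (cmap c x))) (at (cmap c x))"
  using smooth_on_has_derivative[OF is_form1D(2)[OF assms(1,2)]] assms(3,4) by blast

lemma d1_add:
  assumes "is_form1 M U \<omega>" "is_form1 M U \<eta>" "c \<in> M" "x \<in> U" "x \<in> cdom c"
  shows "d1 (\<lambda>c x v. \<omega> c x v + \<eta> c x v) c x v w = d1 \<omega> c x v w + d1 \<eta> c x v w"
proof -
  have "frechet_derivative (\<lambda>y. \<omega> c (cinv c y) u + \<eta> c (cinv c y) u) (at (cmap c x)) =
      (\<lambda>z. frechet_derivative (\<lambda>y. \<omega> c (cinv c y) u) (at (cmap c x)) z +
        frechet_derivative (\<lambda>y. \<eta> c (cinv c y) u) (at (cmap c x)) z)" for u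
    by (rule frechet_derivative_eqI[OF has_derivative_add
          [OF form_has_derivative[OF assms(1,3-5)] form_has_derivative[OF assms(2-5)]]])
  then show ?thesis unfolding d1_def by simp
qed

lemma d1_diff:
  assumes "is_form1 M U \<omega>" "is_form1 M U \<eta>" "c \<in> M" "x \<in> U" "x \<in> cdom c"
  shows "d1 (\<lambda>c x v. \<omega> c x v - \<eta> c x v) c x v w = d1 \<omega> c x v w - d1 \<eta> c x v w"
proof -
  have "frechet_derivative (\<lambda>y. \<omega> c (cinv c y) u - \<eta> c (cinv c y) u) (at (cmap c x)) =
      (\<lambda>z. frechet_derivative (\<lambda>y. \<omega> c (cinv c y) u) (at (cmap c x)) z -
        frechet_derivative (\<lambda>y. \<eta> c (cinv c y) u) (at (cmap c x)) z)" for u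
    by (rule frechet_derivative_eqI[OF has_derivative_diff
          [OF form_has_derivative[OF assms(1,3-5)] form_has_derivative[OF assms(2-5)]]])
  then show ?thesis unfolding d1_def by simp
qed

lemma d1_bounded_linear:
  assumes "bounded_linear L" "is_form1 M U \<omega>" "c \<in> M" "x \<in> U" "x \<in> cdom c"
  shows "d1 (\<lambda>c x v. L (\<omega> c x v)) c x v w = L (d1 \<omega> c x v w)"
proof -
  have "frechet_derivative (\<lambda>y. L (\<omega> c (cinv c y) u)) (at (cmap c x)) =
      (\<lambda>z. L (frechet_derivative (\<lambda>y. \<omega> c (cinv c y) u) (at (cmap c x)) z))" for u
    by (rule frechet_derivative_eqI[OF bounded_linear.has_derivative
          [OF assms(1) form_has_derivative[OF assms(2-5)]]])
  then show ?thesis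
    unfolding d1_def by (simp add: linear_diff[OF bounded_linear.linear[OF assms(1)]])
qed

lemma d1_minus:
  assumes "is_form1 M U \<omega>" "c \<in> M" "x \<in> U" "x \<in> cdom c"
  shows "d1 (\<lambda>c x v. - \<omega> c x v) c x v w = - d1 \<omega> c x v w"
  using d1_bounded_linear[OF bounded_linear_minus[OF bounded_linear_ident] assms] .

lemma d1_inner_const:
  assumes "is_form1 M U \<omega>" "c \<in> M" "x \<in> U" "x \<in> cdom c"
  shows "d1 (\<lambda>c x v. y \<bullet> \<omega> c x v) c x v w = y \<bullet> d1 \<omega> c x v w"
  by (rule d1_bounded_linear[OF bounded_linear_inner_right assms])

lemma d1_zero [simp]: "d1 (\<lambda>c x v. 0) c x v w = 0"
  by (simp add: d1_def frechet_derivative_eqI[OF has_derivative_const])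

lemma d1_cong:
  assumes "open U" "\<And>y v. y \<in> U \<Longrightarrow> y \<in> cdom c \<Longrightarrow> \<omega> c y v = \<eta> c y v" "c \<in> M" "x \<in> U" "x \<in> cdom c"
  shows "d1 \<omega> c x v w = d1 \<eta> c x v w"
proof -
  have "frechet_derivative (\<lambda>y. \<omega> c (cinv c y) u) (at (cmap c x)) =
      frechet_derivative (\<lambda>y. \<eta> c (cinv c y) u) (at (cmap c x))" for u
    by (rule frechet_derivative_cong_open[OF chart_image_open[OF assms(3,1)]])
       (use assms in auto)
  then show ?thesis by (simp add: d1_def)
qed

text \<open>Subtracting an exact form does not change the exterior derivative, by symmetry of second
  derivatives.\<close>

lemma d1_diff_exact:
  assumes U: "open U" and \<omega>: "is_form1 M U \<omega>" and f: "smooth_fun M U f"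
    and c: "c \<in> M" "x \<in> U" "x \<in> cdom c"
    and eq: "\<And>y v. y \<in> U \<Longrightarrow> y \<in> cdom c \<Longrightarrow> \<eta> c y v = \<omega> c y v - d0 f c y v"
  shows "d1 \<eta> c x v w = d1 \<omega> c x v w"
proof -
  let ?N = "cmap c ` (U \<inter> cdom c)" and ?g = "f \<circ> cinv c"
  have N: "open ?N" "cmap c x \<in> ?N" using chart_image_open[OF c(1) U] c by auto
  have g: "smooth_on ?N ?g" using f c unfolding smooth_fun_def by blast
  let ?h = "\<lambda>u y. frechet_derivative ?g (at y) u"
  have "frechet_derivative (\<lambda>y. \<eta> c (cinv c y) u) (at (cmap c x)) =
      frechet_derivative (\<lambda>y. \<omega> c (cinv c y) u - ?h u y) (at (cmap c x))" for u
    by (rule frechet_derivative_cong_open[OF N]) (use eq c in \<open>auto simp: d0_def\<close>)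
  also have "frechet_derivative (\<lambda>y. \<omega> c (cinv c y) u - ?h u y) (at (cmap c x)) =
      (\<lambda>z. frechet_derivative (\<lambda>y. \<omega> c (cinv c y) u) (at (cmap c x)) z -
        frechet_derivative (?h u) (at (cmap c x)) z)" for u
    by (rule frechet_derivative_eqI
        [OF has_derivative_diff[OF form_has_derivative[OF \<omega> c]
            smooth_on_has_derivative[OF smooth_on_derivative[OF g] N(2)]]])
  finally show ?thesis
    unfolding d1_def using mixed_derivatives_commute[OF N g, of v w] by simp
qed

text \<open>In coordinates \<open>\<tau>\<close> the form is \<open>\<omega>(\<tau> y)(D\<tau> w)\<close>.  Its derivative along \<open>v\<close> has the tensorial term
  and the term \<open>\<omega>(\<tau> y)(D\<^sup>2\<tau> v w)\<close>, which is symmetric and cancels in the exterior derivative.\<close>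

lemma is_form2_d1:
  assumes U: "open U" and \<omega>: "is_form1 M U \<omega>"
  shows "is_form2 M U (d1 \<omega>)"
proof (rule is_form2I)
  fix c x assume c: "c \<in> M" "x \<in> U" "x \<in> cdom c"
  let ?D = "\<lambda>w. frechet_derivative (\<lambda>y. \<omega> c (cinv c y) w) (at (cmap c x))"
  have D: "((\<lambda>y. \<omega> c (cinv c y) w) has_derivative ?D w) (at (cmap c x))" for w
    by (rule form_has_derivative[OF \<omega> c])
  have D1: "linear (?D w)" for w using has_derivative_linear[OF D] .
  let ?N = "cmap c ` (U \<inter> cdom c)"
  have N: "open ?N" "cmap c x \<in> ?N" using chart_image_open[OF c(1) U] c by auto
  have lin: "linear (\<omega> c (cinv c y))" if "y \<in> ?N" for y
    using is_form1D(1)[OF \<omega> c(1)] that c by auto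
  have D2: "linear (\<lambda>w. ?D w v)" for v
  proof (rule linearI)
    fix a b :: 'e and r :: real
    have "?D (a + b) = frechet_derivative (\<lambda>y. \<omega> c (cinv c y) a + \<omega> c (cinv c y) b) (at (cmap c x))"
      by (rule frechet_derivative_cong_open[OF N]) (use lin linear_add in blast)
    also have "\<dots> = (\<lambda>v. ?D a v + ?D b v)"
      by (rule frechet_derivative_eqI[OF has_derivative_add[OF D D]])
    finally show "?D (a + b) v = ?D a v + ?D b v" by simp
    have "?D (r *\<^sub>R a) = frechet_derivative (\<lambda>y. r *\<^sub>R \<omega> c (cinv c y) a) (at (cmap c x))"
      by (rule frechet_derivative_cong_open[OF N]) (use lin linear_scale in blast)
    also have "\<dots> = (\<lambda>v. r *\<^sub>R ?D a v)"
      by (rule frechet_derivative_eqI[OF has_derivative_scaleR_right[OF D]])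
    finally show "?D (r *\<^sub>R a) v = r *\<^sub>R ?D a v" by simp
  qed
  show "linear (d1 \<omega> c x v)" for v
    unfolding d1_def using linear_compose_sub[OF D2[of v] D1[of v]] by simp
  show "linear (\<lambda>v. d1 \<omega> c x v w)" for w
    unfolding d1_def using linear_compose_sub[OF D1[of w] D2[of w]] by simp
  show "d1 \<omega> c x v v = 0" for v by (simp add: d1_def)
next
  fix c v w assume c: "c \<in> M"
  let ?N = "cmap c ` (U \<inter> cdom c)"
  have N: "open ?N" by (rule chart_image_open[OF c U])
  have "smooth_on ?N (\<lambda>y. frechet_derivative (\<lambda>y. \<omega> c (cinv c y) w) (at y) v -
      frechet_derivative (\<lambda>y. \<omega> c (cinv c y) v) (at y) w)"
    by (intro smooth_on_diff N smooth_on_derivative is_form1D(2)[OF \<omega> c])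
  then show "smooth_on ?N (\<lambda>y. d1 \<omega> c (cinv c y) v w)"
    by (rule smooth_on_cong[OF N, THEN iffD1, rotated]) (use c in \<open>auto simp: d1_def\<close>)
next
  fix c c' x v w assume c: "c \<in> M" "c' \<in> M" "x \<in> U" "x \<in> cdom c" "x \<in> cdom c'"
  obtain B :: "'e set" and rep where B: "finite B" "\<And>b. bounded_linear (rep b)"
      "\<And>x. (\<Sum>b\<in>B. rep b x *\<^sub>R b) = x"
    using finite_coordinates by blast
  define \<tau> where "\<tau> = cmap c' \<circ> cinv c"
  define T where "T = (\<lambda>y. frechet_derivative \<tau> (at y))"
  define N where "N = cmap c ` (U \<inter> cdom c' \<inter> cdom c)"
  define x0 where "x0 = cmap c x"
  have N: "open N" "x0 \<in> N"
    unfolding N_def x0_def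
    using chart_image_open[OF c(1) open_Int[OF U chart_open[OF c(2)]]] c by auto
  have \<tau>: "smooth_on N \<tau>"
    unfolding N_def \<tau>_def using transition_smooth[OF c(1,2)] by (rule smooth_on_subset) auto
  have \<tau>x: "\<tau> x0 = cmap c' x" unfolding \<tau>_def x0_def using c by simp
  have T: "transition c c' x = T x0" unfolding transition_def T_def \<tau>_def x0_def ..
  define W where "W = (\<lambda>b z. \<omega> c' (cinv c' z) b)"
  define W' where "W' = (\<lambda>b. frechet_derivative (W b) (at (\<tau> x0)))"
  have W: "(W b has_derivative W' b) (at (\<tau> x0))" for b
    unfolding W_def W'_def \<tau>x by (rule form_has_derivative[OF \<omega> c(2,3,5)])
  have DT: "((\<lambda>y. T y u) has_derivative frechet_derivative (\<lambda>y. T y u) (at x0)) (at x0)" for u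
    unfolding T_def by (rule smooth_on_has_derivative[OF smooth_on_derivative[OF \<tau>] N(2)])
  have D\<tau>: "(\<tau> has_derivative T x0) (at x0)"
    unfolding T_def by (rule smooth_on_has_derivative[OF \<tau> N(2)])
  define H where "H = (\<lambda>v w. \<Sum>b\<in>B. rep b (frechet_derivative (\<lambda>y. T y w) (at x0) v) *\<^sub>R W b (\<tau> x0))"
  have H: "H v w = H w v" for v w
    unfolding H_def T_def using mixed_derivatives_commute[OF N \<tau>, of w v] by simp
  \<comment> \<open>The coefficients \<open>rep b (T y w)\<close> expand \<open>D\<tau> w\<close> in a basis, so that only forms with constant
    arguments have to be differentiated.\<close>
  have deriv: "frechet_derivative (\<lambda>y. \<omega> c (cinv c y) w) (at x0) v =
      H v w + (\<Sum>b\<in>B. rep b (T x0 w) *\<^sub>R W' b (T x0 v))" for v w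
  proof -
    have "frechet_derivative (\<lambda>y. \<omega> c (cinv c y) w) (at x0) =
        frechet_derivative (\<lambda>y. \<Sum>b\<in>B. rep b (T y w) *\<^sub>R W b (\<tau> y)) (at x0)"
    proof (rule frechet_derivative_cong_open[OF N])
      fix y assume "y \<in> N"
      then obtain z where z: "z \<in> U" "z \<in> cdom c" "z \<in> cdom c'" "y = cmap c z"
        unfolding N_def by auto
      have "\<omega> c (cinv c y) w = \<omega> c' z (T y w)"
        using is_form1D(3)[OF \<omega> c(1,2) z(1-3), of w] z c by (simp add: T_def \<tau>_def transition_def)
      also have "\<dots> = (\<Sum>b\<in>B. rep b (T y w) *\<^sub>R \<omega> c' z b)"
        by (rule linear_eq_sum_coordinates[OF is_form1D(1)[OF \<omega> c(2) z(1,3)] B(3)])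
      also have "\<dots> = (\<Sum>b\<in>B. rep b (T y w) *\<^sub>R W b (\<tau> y))"
        using z c by (simp add: W_def \<tau>_def)
      finally show "\<omega> c (cinv c y) w = (\<Sum>b\<in>B. rep b (T y w) *\<^sub>R W b (\<tau> y))" .
    qed
    also have "\<dots> = (\<lambda>v. \<Sum>b\<in>B. rep b (T x0 w) *\<^sub>R W' b (T x0 v) +
        rep b (frechet_derivative (\<lambda>y. T y w) (at x0) v) *\<^sub>R W b (\<tau> x0))"
    proof (rule frechet_derivative_eqI, rule has_derivative_sum)
      fix b
      have 1: "((\<lambda>y. rep b (T y w)) has_derivative
          (\<lambda>v. rep b (frechet_derivative (\<lambda>y. T y w) (at x0) v))) (at x0)"
        by (rule bounded_linear.has_derivative[OF B(2) DT])
      have 2: "((\<lambda>y. W b (\<tau> y)) has_derivative (\<lambda>v. W' b (T x0 v))) (at x0)"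
        using diff_chain_at[OF D\<tau> W[of b]] by (simp add: o_def)
      show "((\<lambda>y. rep b (T y w) *\<^sub>R W b (\<tau> y)) has_derivative
          (\<lambda>v. rep b (T x0 w) *\<^sub>R W' b (T x0 v) +
            rep b (frechet_derivative (\<lambda>y. T y w) (at x0) v) *\<^sub>R W b (\<tau> x0))) (at x0)"
        by (rule has_derivative_scaleR[OF 1 2])
    qed
    finally show ?thesis by (simp add: H_def sum.distrib)
  qed
  have W'lin: "(\<Sum>b\<in>B. rep b u *\<^sub>R W' b z) = W' u z" for u z
  proof -
    let ?N' = "cmap c' ` (U \<inter> cdom c')"
    have N': "open ?N'" "\<tau> x0 \<in> ?N'" using chart_image_open[OF c(2) U] c \<tau>x by auto
    have "W' u = frechet_derivative (\<lambda>y. \<Sum>b\<in>B. rep b u *\<^sub>R W b y) (at (\<tau> x0))"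
      unfolding W'_def
    proof (rule frechet_derivative_cong_open[OF N'])
      fix y assume "y \<in> ?N'"
      then have "linear (\<omega> c' (cinv c' y))" using is_form1D(1)[OF \<omega> c(2)] c by auto
      then show "W u y = (\<Sum>b\<in>B. rep b u *\<^sub>R W b y)"
        unfolding W_def by (rule linear_eq_sum_coordinates[OF _ B(3)])
    qed
    also have "\<dots> = (\<lambda>z. \<Sum>b\<in>B. rep b u *\<^sub>R W' b z)"
      by (intro frechet_derivative_eqI has_derivative_sum has_derivative_scaleR_right W)
    finally show ?thesis by simp
  qed
  have "d1 \<omega> c x v w = W' (T x0 w) (T x0 v) - W' (T x0 v) (T x0 w)"
    unfolding d1_def x0_def[symmetric] deriv W'lin using H[of v w] by simp
  then show "d1 \<omega> c x v w = d1 \<omega> c' x (transition c c' x v) (transition c c' x w)"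
    unfolding d1_def T W'_def W_def \<tau>x .
qed

end

subsection \<open>Maps to the circle\<close>

lemma circle_of_add: "circle_of (a + b) = circle_of a + circle_of b"
  by transfer simp

lemma circle_of_minus: "circle_of (- a) = - circle_of a"
  by transfer simp

lemma circle_of_diff: "circle_of (a - b) = circle_of a - circle_of b"
  by transfer simp

lemma circle_of_eq_iff: "circle_of a = circle_of b \<longleftrightarrow> a - b \<in> \<int>"
  by transfer simp

lemma circle_of_0 [simp]: "circle_of 0 = 0"
  by transfer simp

lemma integer_valued_locally_constant:
  fixes f :: "'x::topological_space \<Rightarrow> real"
  assumes "open V" "continuous_on V f" "\<And>y. y \<in> V \<Longrightarrow> f y \<in> \<int>" "x \<in> V"
  shows "\<exists>W. open W \<and> x \<in> W \<and> W \<subseteq> V \<and> (\<forall>y\<in>W. f y = f x)"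
proof -
  define W where "W = V \<inter> f -` {f x - 1<..<f x + 1}"
  have "open W" unfolding W_def
    by (rule continuous_open_preimage[OF assms(2,1)]) simp
  moreover have "f y = f x" if y: "y \<in> W" for y
  proof -
    have "f y \<in> \<int>" "f x \<in> \<int>" using assms(3,4) y unfolding W_def by blast+
    then have "f y - f x \<in> \<int>" by simp
    moreover have "\<bar>f y - f x\<bar> < 1" using y unfolding W_def by (simp add: abs_less_iff)
    ultimately have "f y - f x = 0" by (rule Ints_nonzero_abs_less1)
    then show ?thesis by simp
  qed
  moreover have "x \<in> W" "W \<subseteq> V" using assms(4) unfolding W_def by auto
  ultimately show ?thesis by (intro exI[of _ W] conjI ballI)
qed

context manifold begin

lemma circle_lift_subset:
  "circle_lift M f V g \<Longrightarrow> open W \<Longrightarrow> W \<subseteq> V \<Longrightarrow> circle_lift M f W g"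
  unfolding circle_lift_def using smooth_fun_subset by blast

text \<open>Two lifts of a map to the circle differ by an integer-valued, hence locally constant, function, so the
  choice made in the definition of the pullback of the Maurer-Cartan form does not matter.\<close>

lemma mc_eq_d0:
  assumes f: "circle_lift M f V g" and x: "c \<in> M" "x \<in> V" "x \<in> cdom c"
  shows "mc M f c x v = d0 g c x v"
proof -
  define g' where "g' = (SOME g. \<exists>V. x \<in> V \<and> circle_lift M f V g)"
  have "\<exists>V. x \<in> V \<and> circle_lift M f V g'"
    unfolding g'_def by (rule someI[of _ g]) (use f x in blast)
  then obtain V' where V': "x \<in> V'" "circle_lift M f V' g'" by blast
  define W where "W = V \<inter> V'"
  have W: "open W" "x \<in> W" "W \<subseteq> points M"
    using f V' x unfolding W_def circle_lift_def by auto
  have g: "smooth_fun M W g" "smooth_fun M W g'"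
    using f V' smooth_fun_subset unfolding W_def circle_lift_def by blast+
  have d: "smooth_fun M W (\<lambda>y. g' y - g y)" using smooth_fun_diff[OF W(1) g(2,1)] .
  have "g' y - g y \<in> \<int>" if "y \<in> W" for y
    using f V' that circle_of_eq_iff[of "g' y" "g y"] unfolding W_def circle_lift_def by auto
  from integer_valued_locally_constant[OF W(1) smooth_fun_continuous[OF W(3,1) d] this W(2)]
  obtain W' where W': "open W'" "x \<in> W'" "W' \<subseteq> W" "\<And>y. y \<in> W' \<Longrightarrow> g' y - g y = g' x - g x" by blast
  have "d0 (\<lambda>y. g' y - g y) c x v = d0 (\<lambda>y. g' x - g x) c x v"
    using W'(4) by (rule d0_cong[OF W'(1) _ x(1) W'(2) x(3)])
  then have "d0 g' c x v = d0 g c x v" using d0_diff[OF g(2,1) x(1) W(2) x(3)] by simp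
  then show ?thesis unfolding mc_def g'_def .
qed

lemma smooth_circle_liftE:
  assumes "smooth_circle M U f" "x \<in> U"
  obtains V g where "x \<in> V" "V \<subseteq> U" "circle_lift M f V g"
  using assms unfolding smooth_circle_def by blast

lemma smooth_circle_subset:
  assumes "smooth_circle M U f" "W \<subseteq> U" "open W"
  shows "smooth_circle M W f"
  unfolding smooth_circle_def
proof
  fix x assume x: "x \<in> W"
  then have "x \<in> U" using assms(2) by blast
  from assms(1) this obtain V g where V: "x \<in> V" "V \<subseteq> U" "circle_lift M f V g"
    by (rule smooth_circle_liftE)
  have "open V" using V(3) unfolding circle_lift_def by simp
  then have o: "open (V \<inter> W)" using assms(3) by (rule open_Int)
  have "circle_lift M f (V \<inter> W) g" by (rule circle_lift_subset[OF V(3) o]) simp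
  then show "\<exists>V g. x \<in> V \<and> V \<subseteq> W \<and> circle_lift M f V g"
    using x V(1) by (intro exI[of _ "V \<inter> W"] exI[of _ g] conjI) simp_all
qed

lemma common_lift:
  assumes "smooth_circle M U f" "smooth_circle M U g" "x \<in> U"
  obtains V a b where "x \<in> V" "V \<subseteq> U" "open V" "V \<subseteq> points M" "smooth_fun M V a" "smooth_fun M V b"
    "circle_lift M f V a" "circle_lift M g V b"
proof -
  obtain V a where V: "x \<in> V" "V \<subseteq> U" "circle_lift M f V a"
    by (rule smooth_circle_liftE[OF assms(1,3)])
  obtain W b where W: "x \<in> W" "W \<subseteq> U" "circle_lift M g W b"
    by (rule smooth_circle_liftE[OF assms(2,3)])
  have VW: "open V" "open W" "V \<subseteq> points M" using V(3) W(3) unfolding circle_lift_def by simp_all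
  then have o: "open (V \<inter> W)" by blast
  have l: "circle_lift M f (V \<inter> W) a" "circle_lift M g (V \<inter> W) b"
    by (rule circle_lift_subset[OF V(3) o], simp) (rule circle_lift_subset[OF W(3) o], simp)
  show ?thesis
  proof (rule that[of "V \<inter> W" a b])
    show "smooth_fun M (V \<inter> W) a" "smooth_fun M (V \<inter> W) b"
      using l unfolding circle_lift_def by simp_all
  qed (use V W VW o l in auto)
qed

lemma circle_lift_add:
  assumes "circle_lift M f V a" "circle_lift M g V b"
  shows "circle_lift M (\<lambda>x. f x + g x) V (\<lambda>x. a x + b x)"
  using assms smooth_fun_add[of V a b] unfolding circle_lift_def by (simp add: circle_of_add)

lemma circle_lift_minus:
  assumes "circle_lift M f V a"
  shows "circle_lift M (\<lambda>x. - f x) V (\<lambda>x. - a x)"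
  using assms smooth_fun_minus[of V a] unfolding circle_lift_def by (simp add: circle_of_minus)

lemma smooth_circle_add:
  assumes "smooth_circle M U f" "smooth_circle M U g"
  shows "smooth_circle M U (\<lambda>x. f x + g x)"
  unfolding smooth_circle_def
proof
  fix x assume "x \<in> U"
  from common_lift[OF assms this]
  obtain V a b where V: "x \<in> V" "V \<subseteq> U" "circle_lift M f V a" "circle_lift M g V b" .
  from V(1,2) circle_lift_add[OF V(3,4)]
  show "\<exists>V k. x \<in> V \<and> V \<subseteq> U \<and> circle_lift M (\<lambda>x. f x + g x) V k"
    by (intro exI conjI)
qed

lemma smooth_circle_minus:
  assumes "smooth_circle M U f" shows "smooth_circle M U (\<lambda>x. - f x)"
  unfolding smooth_circle_def
proof
  fix x assume "x \<in> U"
  from smooth_circle_liftE[OF assms this]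
  obtain V a where V: "x \<in> V" "V \<subseteq> U" "circle_lift M f V a" .
  from V(1,2) circle_lift_minus[OF V(3)]
  show "\<exists>V k. x \<in> V \<and> V \<subseteq> U \<and> circle_lift M (\<lambda>x. - f x) V k"
    by (intro exI conjI)
qed

lemma smooth_circle_diff:
  assumes "smooth_circle M U f" "smooth_circle M U g"
  shows "smooth_circle M U (\<lambda>x. f x - g x)"
  using smooth_circle_add[OF assms(1) smooth_circle_minus[OF assms(2)]] by simp

lemma circle_lift_circle_of:
  "open U \<Longrightarrow> U \<subseteq> points M \<Longrightarrow> smooth_fun M U f \<Longrightarrow> circle_lift M (\<lambda>x. circle_of (f x)) U f"
  unfolding circle_lift_def by simp

lemma smooth_circle_circle_of:
  "open U \<Longrightarrow> U \<subseteq> points M \<Longrightarrow> smooth_fun M U f \<Longrightarrow> smooth_circle M U (\<lambda>x. circle_of (f x))"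
  unfolding smooth_circle_def using circle_lift_circle_of[of U f] by (intro ballI exI conjI) auto

lemma smooth_circle_zero: "open U \<Longrightarrow> U \<subseteq> points M \<Longrightarrow> smooth_circle M U (\<lambda>x. 0)"
  using smooth_circle_circle_of[OF _ _ smooth_fun_const, of U 0] by simp

lemma mc_circle_of:
  assumes "open U" "U \<subseteq> points M" "smooth_fun M U f" "c \<in> M" "x \<in> U" "x \<in> cdom c"
  shows "mc M (\<lambda>x. circle_of (f x)) c x v = d0 f c x v"
  by (rule mc_eq_d0[OF circle_lift_circle_of[OF assms(1-3)] assms(4-6)])

lemma mc_zero: "c \<in> M \<Longrightarrow> x \<in> cdom c \<Longrightarrow> mc M (\<lambda>x. 0) c x v = 0"
  using mc_circle_of[OF chart_open cdom_subset_points smooth_fun_const[OF chart_open, of c 0]] by simp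

lemma mc_add:
  assumes "smooth_circle M U f" "smooth_circle M U g" "c \<in> M" "x \<in> U" "x \<in> cdom c"
  shows "mc M (\<lambda>x. f x + g x) c x v = mc M f c x v + mc M g c x v"
proof -
  from common_lift[OF assms(1,2,4)]
  obtain V a b where V: "x \<in> V" "smooth_fun M V a" "smooth_fun M V b"
      "circle_lift M f V a" "circle_lift M g V b" .
  have "mc M (\<lambda>x. f x + g x) c x v = d0 (\<lambda>x. a x + b x) c x v"
    by (rule mc_eq_d0[OF circle_lift_add[OF V(4,5)] assms(3) V(1) assms(5)])
  also have "\<dots> = d0 a c x v + d0 b c x v"
    by (rule d0_add[OF V(2,3) assms(3) V(1) assms(5)])
  finally show ?thesis
    using mc_eq_d0[OF V(4) assms(3) V(1) assms(5)] mc_eq_d0[OF V(5) assms(3) V(1) assms(5)] by simp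
qed

lemma mc_minus:
  assumes "smooth_circle M U f" "c \<in> M" "x \<in> U" "x \<in> cdom c"
  shows "mc M (\<lambda>x. - f x) c x v = - mc M f c x v"
proof -
  from smooth_circle_liftE[OF assms(1,3)]
  obtain V a where V: "x \<in> V" "circle_lift M f V a" .
  then have a: "smooth_fun M V a" unfolding circle_lift_def by blast
  have "mc M (\<lambda>x. - f x) c x v = d0 (\<lambda>x. - a x) c x v"
    by (rule mc_eq_d0[OF circle_lift_minus[OF V(2)] assms(2) V(1) assms(4)])
  also have "\<dots> = - d0 a c x v" by (rule d0_minus[OF a assms(2) V(1) assms(4)])
  finally show ?thesis using mc_eq_d0[OF V(2) assms(2) V(1) assms(4)] by simp
qed

lemma mc_diff:
  assumes "smooth_circle M U f" "smooth_circle M U g" "c \<in> M" "x \<in> U" "x \<in> cdom c"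
  shows "mc M (\<lambda>x. f x - g x) c x v = mc M f c x v - mc M g c x v"
  using mc_add[OF assms(1) smooth_circle_minus[OF assms(2)] assms(3-5)] mc_minus[OF assms(2-5)] by simp

end

section \<open>Gauge transformations of cocycles\<close>

lemma lattice_zero [simp]: "0 \<in> lattice"
  by (simp add: lattice_def)

lemma lattice_add: "a \<in> lattice \<Longrightarrow> b \<in> lattice \<Longrightarrow> a + b \<in> lattice"
  by (simp add: lattice_def)

lemma lattice_minus: "a \<in> lattice \<Longrightarrow> - a \<in> lattice"
  by (simp add: lattice_def)

lemma lattice_diff: "a \<in> lattice \<Longrightarrow> b \<in> lattice \<Longrightarrow> a - b \<in> lattice"
  by (simp add: lattice_def)

lemma lattice_inner: "a \<in> lattice \<Longrightarrow> b \<in> lattice \<Longrightarrow> a \<bullet> b \<in> \<int>"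
  unfolding lattice_def inner_vec_def by (auto intro!: Ints_sum Ints_mult)

lemma open_coverD:
  assumes "open_cover M \<U>" "i \<in> \<U>"
  shows "open i" "i \<subseteq> points M"
  using assms unfolding open_cover_def by auto

lemmas td_cocycle_conjuncts = td_cocycle_def[unfolded ball_coords, THEN iffD1]

lemma td_cocycleD:
  assumes "td_cocycle M \<U> z"
  shows "i \<in> \<U> \<Longrightarrow> is_form1 M i (tA z i)"
    and "i \<in> \<U> \<Longrightarrow> is_form1 M i (tAh z i)"
    and "i \<in> \<U> \<Longrightarrow> is_form2 M i (tR z i)"
    and "i \<in> \<U> \<Longrightarrow> j \<in> \<U> \<Longrightarrow> is_form1 M (i \<inter> j) (tphi z i j)"
    and "i \<in> \<U> \<Longrightarrow> j \<in> \<U> \<Longrightarrow> smooth_fun M (i \<inter> j) (ta z i j)"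
    and "i \<in> \<U> \<Longrightarrow> j \<in> \<U> \<Longrightarrow> smooth_fun M (i \<inter> j) (tah z i j)"
    and "i \<in> \<U> \<Longrightarrow> j \<in> \<U> \<Longrightarrow> k \<in> \<U> \<Longrightarrow> tm z i j k \<in> lattice"
    and "i \<in> \<U> \<Longrightarrow> j \<in> \<U> \<Longrightarrow> k \<in> \<U> \<Longrightarrow> tmh z i j k \<in> lattice"
    and "i \<in> \<U> \<Longrightarrow> j \<in> \<U> \<Longrightarrow> k \<in> \<U> \<Longrightarrow> smooth_circle M (i \<inter> j \<inter> k) (tt z i j k)"
    and "i \<in> \<U> \<Longrightarrow> j \<in> \<U> \<Longrightarrow> k \<in> \<U> \<Longrightarrow> x \<in> i \<Longrightarrow> x \<in> j \<Longrightarrow> x \<in> k \<Longrightarrow>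
      ta z i k x = tm z i j k + ta z i j x + ta z j k x"
    and "i \<in> \<U> \<Longrightarrow> j \<in> \<U> \<Longrightarrow> k \<in> \<U> \<Longrightarrow> x \<in> i \<Longrightarrow> x \<in> j \<Longrightarrow> x \<in> k \<Longrightarrow>
      tah z i k x = tmh z i j k + tah z i j x + tah z j k x"
    and "i \<in> \<U> \<Longrightarrow> j \<in> \<U> \<Longrightarrow> k \<in> \<U> \<Longrightarrow> l \<in> \<U> \<Longrightarrow> x \<in> i \<Longrightarrow> x \<in> j \<Longrightarrow> x \<in> k \<Longrightarrow> x \<in> l \<Longrightarrow>
      tt z i k l x + tt z i j k x - circle_of (tm z i j k \<bullet> tah z k l x) = tt z i j l x + tt z j k l x"
    and "i \<in> \<U> \<Longrightarrow> j \<in> \<U> \<Longrightarrow> c \<in> M \<Longrightarrow> x \<in> i \<Longrightarrow> x \<in> j \<Longrightarrow> x \<in> cdom c \<Longrightarrow>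
      tA z j c x v = tA z i c x v - d0 (ta z i j) c x v"
    and "i \<in> \<U> \<Longrightarrow> j \<in> \<U> \<Longrightarrow> c \<in> M \<Longrightarrow> x \<in> i \<Longrightarrow> x \<in> j \<Longrightarrow> x \<in> cdom c \<Longrightarrow>
      tAh z j c x v = tAh z i c x v - d0 (tah z i j) c x v"
    and "i \<in> \<U> \<Longrightarrow> j \<in> \<U> \<Longrightarrow> k \<in> \<U> \<Longrightarrow> c \<in> M \<Longrightarrow> x \<in> i \<Longrightarrow> x \<in> j \<Longrightarrow> x \<in> k \<Longrightarrow> x \<in> cdom c \<Longrightarrow>
      tphi z i k c x v - tAh z k c x v \<bullet> tm z i j k =
      tphi z j k c x v + tphi z i j c x v - mc M (tt z i j k) c x v"
    and "i \<in> \<U> \<Longrightarrow> j \<in> \<U> \<Longrightarrow> c \<in> M \<Longrightarrow> x \<in> i \<Longrightarrow> x \<in> j \<Longrightarrow> x \<in> cdom c \<Longrightarrow>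
      tR z j c x v w + d1 (tphi z i j) c x v w = tR z i c x v w + ta z i j x \<bullet> d1 (tAh z i) c x v w"
  by (((use td_cocycle_conjuncts[OF assms, THEN conjunct1] in blast)+)[3],
      ((use td_cocycle_conjuncts[OF assms, THEN conjunct2, THEN conjunct1] in blast)+)[3],
      ((use td_cocycle_conjuncts[OF assms, THEN conjunct2, THEN conjunct2, THEN conjunct1] in blast)+)[3],
      ((use td_cocycle_conjuncts[OF assms, THEN conjunct2, THEN conjunct2, THEN conjunct2, THEN conjunct1] in blast)+)[2],
      ((use td_cocycle_conjuncts[OF assms, THEN conjunct2, THEN conjunct2, THEN conjunct2, THEN conjunct2, THEN conjunct1] in blast)+)[1],
      ((use td_cocycle_conjuncts[OF assms, THEN conjunct2, THEN conjunct2, THEN conjunct2, THEN conjunct2, THEN conjunct2, THEN conjunct1] in blast)+)[2],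
      ((use td_cocycle_conjuncts[OF assms, THEN conjunct2, THEN conjunct2, THEN conjunct2, THEN conjunct2, THEN conjunct2, THEN conjunct2, THEN conjunct1] in blast)+)[1],
      ((use td_cocycle_conjuncts[OF assms, THEN conjunct2, THEN conjunct2, THEN conjunct2, THEN conjunct2, THEN conjunct2, THEN conjunct2, THEN conjunct2] in blast)+)[1])

lemma td_cocycleI:
  assumes "\<And>i. i \<in> \<U> \<Longrightarrow> is_form1 M i (tA z i)"
    and "\<And>i. i \<in> \<U> \<Longrightarrow> is_form1 M i (tAh z i)"
    and "\<And>i. i \<in> \<U> \<Longrightarrow> is_form2 M i (tR z i)"
    and "\<And>i j. i \<in> \<U> \<Longrightarrow> j \<in> \<U> \<Longrightarrow> is_form1 M (i \<inter> j) (tphi z i j)"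
    and "\<And>i j. i \<in> \<U> \<Longrightarrow> j \<in> \<U> \<Longrightarrow> smooth_fun M (i \<inter> j) (ta z i j)"
    and "\<And>i j. i \<in> \<U> \<Longrightarrow> j \<in> \<U> \<Longrightarrow> smooth_fun M (i \<inter> j) (tah z i j)"
    and "\<And>i j k. i \<in> \<U> \<Longrightarrow> j \<in> \<U> \<Longrightarrow> k \<in> \<U> \<Longrightarrow> tm z i j k \<in> lattice"
    and "\<And>i j k. i \<in> \<U> \<Longrightarrow> j \<in> \<U> \<Longrightarrow> k \<in> \<U> \<Longrightarrow> tmh z i j k \<in> lattice"
    and "\<And>i j k. i \<in> \<U> \<Longrightarrow> j \<in> \<U> \<Longrightarrow> k \<in> \<U> \<Longrightarrow> smooth_circle M (i \<inter> j \<inter> k) (tt z i j k)"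
    and "\<And>i j k x. i \<in> \<U> \<Longrightarrow> j \<in> \<U> \<Longrightarrow> k \<in> \<U> \<Longrightarrow> x \<in> i \<Longrightarrow> x \<in> j \<Longrightarrow> x \<in> k \<Longrightarrow>
      ta z i k x = tm z i j k + ta z i j x + ta z j k x"
    and "\<And>i j k x. i \<in> \<U> \<Longrightarrow> j \<in> \<U> \<Longrightarrow> k \<in> \<U> \<Longrightarrow> x \<in> i \<Longrightarrow> x \<in> j \<Longrightarrow> x \<in> k \<Longrightarrow>
      tah z i k x = tmh z i j k + tah z i j x + tah z j k x"
    and "\<And>i j k l x. i \<in> \<U> \<Longrightarrow> j \<in> \<U> \<Longrightarrow> k \<in> \<U> \<Longrightarrow> l \<in> \<U> \<Longrightarrow> x \<in> i \<Longrightarrow> x \<in> j \<Longrightarrow> x \<in> k \<Longrightarrow> x \<in> l \<Longrightarrow>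
      tt z i k l x + tt z i j k x - circle_of (tm z i j k \<bullet> tah z k l x) = tt z i j l x + tt z j k l x"
    and "\<And>i j c x v. i \<in> \<U> \<Longrightarrow> j \<in> \<U> \<Longrightarrow> c \<in> M \<Longrightarrow> x \<in> i \<Longrightarrow> x \<in> j \<Longrightarrow> x \<in> cdom c \<Longrightarrow>
      tA z j c x v = tA z i c x v - d0 (ta z i j) c x v"
    and "\<And>i j c x v. i \<in> \<U> \<Longrightarrow> j \<in> \<U> \<Longrightarrow> c \<in> M \<Longrightarrow> x \<in> i \<Longrightarrow> x \<in> j \<Longrightarrow> x \<in> cdom c \<Longrightarrow>
      tAh z j c x v = tAh z i c x v - d0 (tah z i j) c x v"
    and "\<And>i j k c x v. i \<in> \<U> \<Longrightarrow> j \<in> \<U> \<Longrightarrow> k \<in> \<U> \<Longrightarrow> c \<in> M \<Longrightarrow> x \<in> i \<Longrightarrow> x \<in> j \<Longrightarrow> x \<in> k \<Longrightarrow> x \<in> cdom c \<Longrightarrow>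
      tphi z i k c x v - tAh z k c x v \<bullet> tm z i j k =
      tphi z j k c x v + tphi z i j c x v - mc M (tt z i j k) c x v"
    and "\<And>i j c x v w. i \<in> \<U> \<Longrightarrow> j \<in> \<U> \<Longrightarrow> c \<in> M \<Longrightarrow> x \<in> i \<Longrightarrow> x \<in> j \<Longrightarrow> x \<in> cdom c \<Longrightarrow>
      tR z j c x v w + d1 (tphi z i j) c x v w = tR z i c x v w + ta z i j x \<bullet> d1 (tAh z i) c x v w"
  shows "td_cocycle M \<U> z"
  unfolding td_cocycle_def ball_coords
  by (intro conjI ballI allI impI; (elim IntE)?; rule assms; assumption)

text \<open>The witnesses of the equivalence relation are made explicit here because the inverse and the composite
  of gauge transformations are given by formulas in them.\<close>

definition td_gauge ::
  "('x::topological_space, 'e::real_normed_vector) atlas \<Rightarrow> 'x set set \<Rightarrow>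
   ('x set \<Rightarrow> ('x, 'e, real) form1) \<Rightarrow> ('x set \<Rightarrow> 'x \<Rightarrow> real^'n) \<Rightarrow> ('x set \<Rightarrow> 'x \<Rightarrow> real^'n) \<Rightarrow>
   ('x set \<Rightarrow> 'x set \<Rightarrow> real^'n) \<Rightarrow> ('x set \<Rightarrow> 'x set \<Rightarrow> real^'n) \<Rightarrow>
   ('x set \<Rightarrow> 'x set \<Rightarrow> 'x \<Rightarrow> circle) \<Rightarrow> ('x, 'e, 'n::finite) td \<Rightarrow> ('x, 'e, 'n) td \<Rightarrow> bool" where
  "td_gauge M \<U> \<phi> p ph q qh e z z' \<longleftrightarrow>
        (\<forall>i\<in>\<U>. is_form1 M i (\<phi> i) \<and> smooth_fun M i (p i) \<and> smooth_fun M i (ph i)) \<and>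
        (\<forall>i\<in>\<U>. \<forall>j\<in>\<U>. q i j \<in> lattice \<and> qh i j \<in> lattice \<and> smooth_circle M (i \<inter> j) (e i j)) \<and>
        (\<forall>i\<in>\<U>. \<forall>j\<in>\<U>. \<forall>x \<in> i \<inter> j.
           ta z' i j x + p i x = q i j + p j x + ta z i j x \<and>
           tah z' i j x + ph i x = qh i j + ph j x + tah z i j x) \<and>
        (\<forall>i\<in>\<U>. \<forall>j\<in>\<U>. \<forall>k\<in>\<U>. \<forall>x \<in> i \<inter> j \<inter> k.
           tt z' i j k x + e i j x - circle_of (tah z' j k x \<bullet> q i j) + e j k x =
           e i k x + tt z i j k x - circle_of (ph k x \<bullet> tm z i j k)) \<and>
        (\<forall>i\<in>\<U>. \<forall>(c, x) \<in> coords M i. \<forall>v.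
           tA z' i c x v = tA z i c x v - d0 (p i) c x v \<and>
           tAh z' i c x v = tAh z i c x v - d0 (ph i) c x v) \<and>
        (\<forall>i\<in>\<U>. \<forall>j\<in>\<U>. \<forall>(c, x) \<in> coords M (i \<inter> j). \<forall>v.
           tphi z' i j c x v + \<phi> i c x v - q i j \<bullet> tAh z' j c x v =
           \<phi> j c x v + tphi z i j c x v - mc M (e i j) c x v) \<and>
        (\<forall>i\<in>\<U>. \<forall>(c, x) \<in> coords M i. \<forall>v w.
           tR z' i c x v w + d1 (\<phi> i) c x v w =
           tR z i c x v w + p i x \<bullet> d1 (tAh z i) c x v w)"

lemma td_equiv_iff_gauge:
  "td_equiv M \<U> z z' \<longleftrightarrow> (\<exists>\<phi> p ph q qh e. td_gauge M \<U> \<phi> p ph q qh e z z')"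
  unfolding td_equiv_def td_gauge_def ..

lemmas td_gauge_conjuncts = td_gauge_def[unfolded ball_coords, THEN iffD1]

lemma td_gaugeD:
  assumes "td_gauge M \<U> \<phi> p ph q qh e z z'"
  shows "i \<in> \<U> \<Longrightarrow> is_form1 M i (\<phi> i)"
    and "i \<in> \<U> \<Longrightarrow> smooth_fun M i (p i)"
    and "i \<in> \<U> \<Longrightarrow> smooth_fun M i (ph i)"
    and "i \<in> \<U> \<Longrightarrow> j \<in> \<U> \<Longrightarrow> q i j \<in> lattice"
    and "i \<in> \<U> \<Longrightarrow> j \<in> \<U> \<Longrightarrow> qh i j \<in> lattice"
    and "i \<in> \<U> \<Longrightarrow> j \<in> \<U> \<Longrightarrow> smooth_circle M (i \<inter> j) (e i j)"
    and "i \<in> \<U> \<Longrightarrow> j \<in> \<U> \<Longrightarrow> x \<in> i \<Longrightarrow> x \<in> j \<Longrightarrow> ta z' i j x + p i x = q i j + p j x + ta z i j x"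
    and "i \<in> \<U> \<Longrightarrow> j \<in> \<U> \<Longrightarrow> x \<in> i \<Longrightarrow> x \<in> j \<Longrightarrow> tah z' i j x + ph i x = qh i j + ph j x + tah z i j x"
    and "i \<in> \<U> \<Longrightarrow> j \<in> \<U> \<Longrightarrow> k \<in> \<U> \<Longrightarrow> x \<in> i \<Longrightarrow> x \<in> j \<Longrightarrow> x \<in> k \<Longrightarrow>
      tt z' i j k x + e i j x - circle_of (tah z' j k x \<bullet> q i j) + e j k x =
      e i k x + tt z i j k x - circle_of (ph k x \<bullet> tm z i j k)"
    and "i \<in> \<U> \<Longrightarrow> c \<in> M \<Longrightarrow> x \<in> i \<Longrightarrow> x \<in> cdom c \<Longrightarrow> tA z' i c x v = tA z i c x v - d0 (p i) c x v"
    and "i \<in> \<U> \<Longrightarrow> c \<in> M \<Longrightarrow> x \<in> i \<Longrightarrow> x \<in> cdom c \<Longrightarrow> tAh z' i c x v = tAh z i c x v - d0 (ph i) c x v"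
    and "i \<in> \<U> \<Longrightarrow> j \<in> \<U> \<Longrightarrow> c \<in> M \<Longrightarrow> x \<in> i \<Longrightarrow> x \<in> j \<Longrightarrow> x \<in> cdom c \<Longrightarrow>
      tphi z' i j c x v + \<phi> i c x v - q i j \<bullet> tAh z' j c x v =
      \<phi> j c x v + tphi z i j c x v - mc M (e i j) c x v"
    and "i \<in> \<U> \<Longrightarrow> c \<in> M \<Longrightarrow> x \<in> i \<Longrightarrow> x \<in> cdom c \<Longrightarrow>
      tR z' i c x v w + d1 (\<phi> i) c x v w = tR z i c x v w + p i x \<bullet> d1 (tAh z i) c x v w"
  by (((use td_gauge_conjuncts[OF assms, THEN conjunct1] in blast)+)[3],
      ((use td_gauge_conjuncts[OF assms, THEN conjunct2, THEN conjunct1] in blast)+)[3],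
      ((use td_gauge_conjuncts[OF assms, THEN conjunct2, THEN conjunct2, THEN conjunct1] in blast)+)[2],
      ((use td_gauge_conjuncts[OF assms, THEN conjunct2, THEN conjunct2, THEN conjunct2, THEN conjunct1] in blast)+)[1],
      ((use td_gauge_conjuncts[OF assms, THEN conjunct2, THEN conjunct2, THEN conjunct2, THEN conjunct2, THEN conjunct1] in blast)+)[2],
      ((use td_gauge_conjuncts[OF assms, THEN conjunct2, THEN conjunct2, THEN conjunct2, THEN conjunct2, THEN conjunct2, THEN conjunct1] in blast)+)[1],
      ((use td_gauge_conjuncts[OF assms, THEN conjunct2, THEN conjunct2, THEN conjunct2, THEN conjunct2, THEN conjunct2, THEN conjunct2] in blast)+)[1])

lemma td_gaugeI:
  assumes "\<And>i. i \<in> \<U> \<Longrightarrow> is_form1 M i (\<phi> i)"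
    and "\<And>i. i \<in> \<U> \<Longrightarrow> smooth_fun M i (p i)"
    and "\<And>i. i \<in> \<U> \<Longrightarrow> smooth_fun M i (ph i)"
    and "\<And>i j. i \<in> \<U> \<Longrightarrow> j \<in> \<U> \<Longrightarrow> q i j \<in> lattice"
    and "\<And>i j. i \<in> \<U> \<Longrightarrow> j \<in> \<U> \<Longrightarrow> qh i j \<in> lattice"
    and "\<And>i j. i \<in> \<U> \<Longrightarrow> j \<in> \<U> \<Longrightarrow> smooth_circle M (i \<inter> j) (e i j)"
    and "\<And>i j x. i \<in> \<U> \<Longrightarrow> j \<in> \<U> \<Longrightarrow> x \<in> i \<Longrightarrow> x \<in> j \<Longrightarrow> ta z' i j x + p i x = q i j + p j x + ta z i j x"
    and "\<And>i j x. i \<in> \<U> \<Longrightarrow> j \<in> \<U> \<Longrightarrow> x \<in> i \<Longrightarrow> x \<in> j \<Longrightarrow> tah z' i j x + ph i x = qh i j + ph j x + tah z i j x"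
    and "\<And>i j k x. i \<in> \<U> \<Longrightarrow> j \<in> \<U> \<Longrightarrow> k \<in> \<U> \<Longrightarrow> x \<in> i \<Longrightarrow> x \<in> j \<Longrightarrow> x \<in> k \<Longrightarrow>
      tt z' i j k x + e i j x - circle_of (tah z' j k x \<bullet> q i j) + e j k x =
      e i k x + tt z i j k x - circle_of (ph k x \<bullet> tm z i j k)"
    and "\<And>i c x v. i \<in> \<U> \<Longrightarrow> c \<in> M \<Longrightarrow> x \<in> i \<Longrightarrow> x \<in> cdom c \<Longrightarrow> tA z' i c x v = tA z i c x v - d0 (p i) c x v"
    and "\<And>i c x v. i \<in> \<U> \<Longrightarrow> c \<in> M \<Longrightarrow> x \<in> i \<Longrightarrow> x \<in> cdom c \<Longrightarrow> tAh z' i c x v = tAh z i c x v - d0 (ph i) c x v"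
    and "\<And>i j c x v. i \<in> \<U> \<Longrightarrow> j \<in> \<U> \<Longrightarrow> c \<in> M \<Longrightarrow> x \<in> i \<Longrightarrow> x \<in> j \<Longrightarrow> x \<in> cdom c \<Longrightarrow>
      tphi z' i j c x v + \<phi> i c x v - q i j \<bullet> tAh z' j c x v =
      \<phi> j c x v + tphi z i j c x v - mc M (e i j) c x v"
    and "\<And>i c x v w. i \<in> \<U> \<Longrightarrow> c \<in> M \<Longrightarrow> x \<in> i \<Longrightarrow> x \<in> cdom c \<Longrightarrow>
      tR z' i c x v w + d1 (\<phi> i) c x v w = tR z i c x v w + p i x \<bullet> d1 (tAh z i) c x v w"
  shows "td_gauge M \<U> \<phi> p ph q qh e z z'"
  unfolding td_gauge_def ball_coords
  by (intro conjI ballI allI impI; (elim IntE)?; rule assms; assumption)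

lemma refinementD:
  assumes "refinement \<V> \<U> r" "i \<in> \<V>"
  shows "r i \<in> \<U>" "x \<in> i \<Longrightarrow> x \<in> r i" "i \<subseteq> r i"
  using assms unfolding refinement_def by auto

context manifold begin

text \<open>The connection forms differ by the differential of \<open>ph\<close>.\<close>

lemma gauge_curvature_eq:
  assumes "open_cover M \<U>" "td_cocycle M \<U> z" "td_gauge M \<U> \<phi> p ph q qh e z z'"
    and "i \<in> \<U>" "c \<in> M" "x \<in> i" "x \<in> cdom c"
  shows "d1 (tAh z' i) c x v w = d1 (tAh z i) c x v w"
  by (rule d1_diff_exact[OF open_coverD(1)[OF assms(1,4)] td_cocycleD(2)[OF assms(2,4)]
        td_gaugeD(3)[OF assms(3,4)] assms(5-7)])
     (rule td_gaugeD(11)[OF assms(3,4,5)])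

lemma gauge_winding_eq:
  assumes "td_cocycle M \<U> z" "td_cocycle M \<U> z'" "td_gauge M \<U> \<phi> p ph q qh e z z'"
    and ijk: "i \<in> \<U>" "j \<in> \<U>" "k \<in> \<U>" "x \<in> i" "x \<in> j" "x \<in> k"
  shows "tm z' i j k = tm z i j k + q i k - q i j - q j k"
proof -
  have a: "ta z' i j x = q i j + p j x + ta z i j x - p i x" if "i \<in> \<U>" "j \<in> \<U>" "x \<in> i" "x \<in> j" for i j
    using td_gaugeD(7)[OF assms(3) that] by (simp add: algebra_simps)
  have m: "tm z' i j k = ta z' i k x - ta z' i j x - ta z' j k x"
      "tm z i j k = ta z i k x - ta z i j x - ta z j k x"
    using td_cocycleD(10)[OF assms(1) ijk] td_cocycleD(10)[OF assms(2) ijk] by simp_all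
  show ?thesis
    unfolding m a[OF ijk(1,2,4,5)] a[OF ijk(2,3,5,6)] a[OF ijk(1,3,4,6)] by simp
qed

lemma td_gauge_refl:
  assumes "open_cover M \<U>"
  shows "td_gauge M \<U> (\<lambda>i c x v. 0) (\<lambda>i x. 0) (\<lambda>i x. 0) (\<lambda>i j. 0) (\<lambda>i j. 0) (\<lambda>i j x. 0) z z"
proof (rule td_gaugeI)
  show "smooth_circle M (i \<inter> j) (\<lambda>x. 0)" if "i \<in> \<U>" "j \<in> \<U>" for i j
    using open_coverD[OF assms that(1)] open_coverD[OF assms that(2)]
    by (intro smooth_circle_zero) auto
qed (use open_coverD[OF assms] in \<open>auto intro!: is_form1_zero smooth_fun_const simp: mc_zero\<close>)

text \<open>The last component is not just \<open>- e\<close>: the condition on \<open>\<phi>\<close> refers to the connection form of the target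
  cocycle, and exchanging the roles of the two cocycles replaces it by one that differs by the differential of
  \<open>ph j\<close>.  The product \<open>q i j \<bullet> ph j\<close> compensates for this.  In the condition on \<open>t\<close> the terms then match up to
  \<open>q i j \<bullet> qh j k\<close>, which is an integer.\<close>

lemma td_gauge_sym:
  assumes U: "open_cover M \<U>" and z: "td_cocycle M \<U> z" and z': "td_cocycle M \<U> z'"
    and g: "td_gauge M \<U> \<phi> p ph q qh e z z'"
  shows "td_gauge M \<U> (\<lambda>i c x v. - \<phi> i c x v) (\<lambda>i x. - p i x) (\<lambda>i x. - ph i x)
    (\<lambda>i j. - q i j) (\<lambda>i j. - qh i j) (\<lambda>i j x. - e i j x - circle_of (q i j \<bullet> ph j x)) z' z"
proof (rule td_gaugeI)
  note op = open_coverD(1)[OF U] and pt = open_coverD(2)[OF U]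
  fix i assume i: "i \<in> \<U>"
  show "is_form1 M i (\<lambda>c x v. - \<phi> i c x v)" by (rule is_form1_minus[OF op[OF i] td_gaugeD(1)[OF g i]])
  show "smooth_fun M i (\<lambda>x. - p i x)" by (rule smooth_fun_minus[OF op[OF i] td_gaugeD(2)[OF g i]])
  show "smooth_fun M i (\<lambda>x. - ph i x)" by (rule smooth_fun_minus[OF op[OF i] td_gaugeD(3)[OF g i]])
  {
    fix c x v w assume c: "c \<in> M" "x \<in> i" "x \<in> cdom c"
    show "tA z i c x v = tA z' i c x v - d0 (\<lambda>x. - p i x) c x v"
      using td_gaugeD(10)[OF g i c] d0_minus[OF td_gaugeD(2)[OF g i] c] by simp
    show "tAh z i c x v = tAh z' i c x v - d0 (\<lambda>x. - ph i x) c x v"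
      using td_gaugeD(11)[OF g i c] d0_minus[OF td_gaugeD(3)[OF g i] c] by simp
    show "tR z i c x v w + d1 (\<lambda>c x v. - \<phi> i c x v) c x v w =
        tR z' i c x v w + - p i x \<bullet> d1 (tAh z' i) c x v w"
      using td_gaugeD(13)[OF g i c, of v w] d1_minus[OF td_gaugeD(1)[OF g i] c, of v w]
        gauge_curvature_eq[OF U z g i c, of v w] by simp
  }
  fix j assume j: "j \<in> \<U>"
  have ij: "open (i \<inter> j)" "i \<inter> j \<subseteq> points M" using op pt i j by auto
  show "- q i j \<in> lattice" "- qh i j \<in> lattice"
    using td_gaugeD(4,5)[OF g i j] by (simp_all add: lattice_minus)
  have s: "smooth_fun M (i \<inter> j) (\<lambda>x. q i j \<bullet> ph j x)"
    by (rule smooth_fun_inner_const[OF ij(1)])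
       (rule smooth_fun_subset[OF td_gaugeD(3)[OF g j]], simp)
  note sc = smooth_circle_minus[OF td_gaugeD(6)[OF g i j]] smooth_circle_circle_of[OF ij s]
  show "smooth_circle M (i \<inter> j) (\<lambda>x. - e i j x - circle_of (q i j \<bullet> ph j x))"
    by (rule smooth_circle_diff[OF sc])
  show "tphi z i j c x v + - \<phi> i c x v - - q i j \<bullet> tAh z j c x v =
      - \<phi> j c x v + tphi z' i j c x v - mc M (\<lambda>x. - e i j x - circle_of (q i j \<bullet> ph j x)) c x v"
    if c: "c \<in> M" "x \<in> i" "x \<in> j" "x \<in> cdom c" for c x v
  proof -
    have x: "x \<in> i \<inter> j" using c by simp
    have "mc M (\<lambda>x. - e i j x - circle_of (q i j \<bullet> ph j x)) c x v =
        - mc M (e i j) c x v - q i j \<bullet> d0 (ph j) c x v"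
      using mc_diff[OF sc c(1) x c(4), of v] mc_minus[OF td_gaugeD(6)[OF g i j] c(1) x c(4), of v]
        mc_circle_of[OF ij s c(1) x c(4), of v]
        d0_inner_const[OF td_gaugeD(3)[OF g j] c(1,3,4), of "q i j" v] by simp
    then show ?thesis
      using td_gaugeD(12)[OF g i j c, of v] td_gaugeD(11)[OF g j c(1,3,4), of v]
      by (simp add: inner_diff_right)
  qed
  {
    fix x assume x: "x \<in> i" "x \<in> j"
    show "ta z i j x + - p i x = - q i j + - p j x + ta z' i j x"
      using td_gaugeD(7)[OF g i j x] by (simp add: algebra_simps)
    show "tah z i j x + - ph i x = - qh i j + - ph j x + tah z' i j x"
      using td_gaugeD(8)[OF g i j x] by (simp add: algebra_simps)
  }
  fix k x assume k: "k \<in> \<U>" and x: "x \<in> i" "x \<in> j" "x \<in> k"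
  have m: "tm z' i j k = tm z i j k + q i k - q i j - q j k"
    by (rule gauge_winding_eq[OF z z' g i j k x])
  have ah: "tah z' j k x = qh j k + ph k x + tah z j k x - ph j x"
    using td_gaugeD(8)[OF g j k x(2,3)] by (simp add: algebra_simps)
  have "circle_of (- (q i j \<bullet> ph j x) + tah z j k x \<bullet> q i j - q j k \<bullet> ph k x) =
      circle_of (tah z' j k x \<bullet> q i j - q i k \<bullet> ph k x + ph k x \<bullet> tm z' i j k - ph k x \<bullet> tm z i j k)"
    unfolding circle_of_eq_iff m ah
    using Ints_minus[OF lattice_inner[OF td_gaugeD(5)[OF g j k] td_gaugeD(4)[OF g i j]]]
    by (simp add: algebra_simps inner_commute)
  then have key: "- circle_of (q i j \<bullet> ph j x) + circle_of (tah z j k x \<bullet> q i j) - circle_of (q j k \<bullet> ph k x) =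
      circle_of (tah z' j k x \<bullet> q i j) - circle_of (q i k \<bullet> ph k x) + circle_of (ph k x \<bullet> tm z' i j k)
      - circle_of (ph k x \<bullet> tm z i j k)"
    by (simp only: circle_of_add circle_of_diff circle_of_minus)
  have 1: "tt z i j k x = tt z' i j k x + e i j x - circle_of (tah z' j k x \<bullet> q i j) + e j k x - e i k x
      + circle_of (ph k x \<bullet> tm z i j k)"
    using td_gaugeD(9)[OF g i j k x] by (simp add: algebra_simps)
  have 2: "circle_of (tah z j k x \<bullet> q i j) = circle_of (q i j \<bullet> ph j x) + circle_of (q j k \<bullet> ph k x)
      + circle_of (tah z' j k x \<bullet> q i j) - circle_of (q i k \<bullet> ph k x) + circle_of (ph k x \<bullet> tm z' i j k)
      - circle_of (ph k x \<bullet> tm z i j k)"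
    using key by (simp add: algebra_simps)
  show "tt z i j k x + (- e i j x - circle_of (q i j \<bullet> ph j x)) - circle_of (tah z j k x \<bullet> - q i j)
      + (- e j k x - circle_of (q j k \<bullet> ph k x)) =
      - e i k x - circle_of (q i k \<bullet> ph k x) + tt z' i j k x - circle_of (- ph k x \<bullet> tm z' i j k)"
    unfolding inner_minus_left inner_minus_right circle_of_minus 1 2 by (simp add: algebra_simps)
qed

text \<open>As for the inverse, the two conditions on \<open>\<phi>\<close> refer to different target cocycles; bringing them to the
  last one costs \<open>q i j\<close> times the differential of \<open>ph' j\<close>.\<close>

lemma td_gauge_trans:
  assumes U: "open_cover M \<U>" and z: "td_cocycle M \<U> z" and z': "td_cocycle M \<U> z'"
    and g: "td_gauge M \<U> \<phi> p ph q qh e z z'" and g': "td_gauge M \<U> \<phi>' p' ph' q' qh' e' z' z''"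
  shows "td_gauge M \<U> (\<lambda>i c x v. \<phi> i c x v + \<phi>' i c x v) (\<lambda>i x. p i x + p' i x) (\<lambda>i x. ph i x + ph' i x)
    (\<lambda>i j. q i j + q' i j) (\<lambda>i j. qh i j + qh' i j)
    (\<lambda>i j x. e i j x + e' i j x - circle_of (q i j \<bullet> ph' j x)) z z''"
proof (rule td_gaugeI)
  note op = open_coverD(1)[OF U] and pt = open_coverD(2)[OF U]
  fix i assume i: "i \<in> \<U>"
  show "is_form1 M i (\<lambda>c x v. \<phi> i c x v + \<phi>' i c x v)"
    by (rule is_form1_add[OF op[OF i] td_gaugeD(1)[OF g i] td_gaugeD(1)[OF g' i]])
  show "smooth_fun M i (\<lambda>x. p i x + p' i x)"
    by (rule smooth_fun_add[OF op[OF i] td_gaugeD(2)[OF g i] td_gaugeD(2)[OF g' i]])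
  show "smooth_fun M i (\<lambda>x. ph i x + ph' i x)"
    by (rule smooth_fun_add[OF op[OF i] td_gaugeD(3)[OF g i] td_gaugeD(3)[OF g' i]])
  {
    fix c x v w assume c: "c \<in> M" "x \<in> i" "x \<in> cdom c"
    show "tA z'' i c x v = tA z i c x v - d0 (\<lambda>x. p i x + p' i x) c x v"
      using td_gaugeD(10)[OF g i c] td_gaugeD(10)[OF g' i c]
        d0_add[OF td_gaugeD(2)[OF g i] td_gaugeD(2)[OF g' i] c] by simp
    show "tAh z'' i c x v = tAh z i c x v - d0 (\<lambda>x. ph i x + ph' i x) c x v"
      using td_gaugeD(11)[OF g i c] td_gaugeD(11)[OF g' i c]
        d0_add[OF td_gaugeD(3)[OF g i] td_gaugeD(3)[OF g' i] c] by simp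
    show "tR z'' i c x v w + d1 (\<lambda>c x v. \<phi> i c x v + \<phi>' i c x v) c x v w =
        tR z i c x v w + (p i x + p' i x) \<bullet> d1 (tAh z i) c x v w"
      using td_gaugeD(13)[OF g i c, of v w] td_gaugeD(13)[OF g' i c, of v w]
        d1_add[OF td_gaugeD(1)[OF g i] td_gaugeD(1)[OF g' i] c, of v w]
        gauge_curvature_eq[OF U z g i c, of v w] by (simp add: inner_add_left)
  }
  fix j assume j: "j \<in> \<U>"
  have ij: "open (i \<inter> j)" "i \<inter> j \<subseteq> points M" using op pt i j by auto
  show "q i j + q' i j \<in> lattice" "qh i j + qh' i j \<in> lattice"
    using td_gaugeD(4,5)[OF g i j] td_gaugeD(4,5)[OF g' i j] by (simp_all add: lattice_add)
  have s: "smooth_fun M (i \<inter> j) (\<lambda>x. q i j \<bullet> ph' j x)"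
    by (rule smooth_fun_inner_const[OF ij(1)])
       (rule smooth_fun_subset[OF td_gaugeD(3)[OF g' j]], simp)
  note ee = td_gaugeD(6)[OF g i j] td_gaugeD(6)[OF g' i j]
  note sc = smooth_circle_add[OF ee] smooth_circle_circle_of[OF ij s]
  show "smooth_circle M (i \<inter> j) (\<lambda>x. e i j x + e' i j x - circle_of (q i j \<bullet> ph' j x))"
    by (rule smooth_circle_diff[OF sc])
  show "tphi z'' i j c x v + (\<phi> i c x v + \<phi>' i c x v) - (q i j + q' i j) \<bullet> tAh z'' j c x v =
      \<phi> j c x v + \<phi>' j c x v + tphi z i j c x v -
      mc M (\<lambda>x. e i j x + e' i j x - circle_of (q i j \<bullet> ph' j x)) c x v"
    if c: "c \<in> M" "x \<in> i" "x \<in> j" "x \<in> cdom c" for c x v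
  proof -
    have x: "x \<in> i \<inter> j" using c by simp
    have "mc M (\<lambda>x. e i j x + e' i j x - circle_of (q i j \<bullet> ph' j x)) c x v =
        mc M (e i j) c x v + mc M (e' i j) c x v - q i j \<bullet> d0 (ph' j) c x v"
      using mc_diff[OF sc c(1) x c(4), of v] mc_add[OF ee c(1) x c(4), of v]
        mc_circle_of[OF ij s c(1) x c(4), of v]
        d0_inner_const[OF td_gaugeD(3)[OF g' j] c(1,3,4), of "q i j" v] by simp
    then show ?thesis
      using td_gaugeD(12)[OF g i j c, of v] td_gaugeD(12)[OF g' i j c, of v]
        td_gaugeD(11)[OF g' j c(1,3,4), of v]
      by (simp add: inner_diff_right inner_add_left)
  qed
  {
    fix x assume x: "x \<in> i" "x \<in> j"
    show "ta z'' i j x + (p i x + p' i x) = q i j + q' i j + (p j x + p' j x) + ta z i j x"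
      using td_gaugeD(7)[OF g i j x] td_gaugeD(7)[OF g' i j x] by (simp add: algebra_simps)
    show "tah z'' i j x + (ph i x + ph' i x) = qh i j + qh' i j + (ph j x + ph' j x) + tah z i j x"
      using td_gaugeD(8)[OF g i j x] td_gaugeD(8)[OF g' i j x] by (simp add: algebra_simps)
  }
  fix k x assume k: "k \<in> \<U>" and x: "x \<in> i" "x \<in> j" "x \<in> k"
  have m: "tm z' i j k = tm z i j k + q i k - q i j - q j k"
    by (rule gauge_winding_eq[OF z z' g i j k x])
  have ah: "tah z' j k x = tah z'' j k x + ph' j x - qh' j k - ph' k x"
    using td_gaugeD(8)[OF g' j k x(2,3)] by (simp add: algebra_simps)
  \<comment> \<open>The two sides differ by the integer \<open>q i j \<bullet> qh' j k\<close>.\<close>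
  have "circle_of (q i j \<bullet> ph' j x + tah z'' j k x \<bullet> q i j + q j k \<bullet> ph' k x) =
      circle_of (tah z' j k x \<bullet> q i j + q i k \<bullet> ph' k x - ph' k x \<bullet> tm z' i j k + ph' k x \<bullet> tm z i j k)"
    unfolding circle_of_eq_iff m ah
    using lattice_inner[OF td_gaugeD(5)[OF g' j k] td_gaugeD(4)[OF g i j]]
    by (simp add: algebra_simps inner_commute)
  then have key: "circle_of (q i j \<bullet> ph' j x) + circle_of (tah z'' j k x \<bullet> q i j) + circle_of (q j k \<bullet> ph' k x) =
      circle_of (tah z' j k x \<bullet> q i j) + circle_of (q i k \<bullet> ph' k x) - circle_of (ph' k x \<bullet> tm z' i j k)
      + circle_of (ph' k x \<bullet> tm z i j k)"
    by (simp only: circle_of_add circle_of_diff)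
  have 1: "tt z i j k x = tt z' i j k x + e i j x - circle_of (tah z' j k x \<bullet> q i j) + e j k x - e i k x
      + circle_of (ph k x \<bullet> tm z i j k)"
    using td_gaugeD(9)[OF g i j k x] by (simp add: algebra_simps)
  have 2: "tt z' i j k x = tt z'' i j k x + e' i j x - circle_of (tah z'' j k x \<bullet> q' i j) + e' j k x - e' i k x
      + circle_of (ph' k x \<bullet> tm z' i j k)"
    using td_gaugeD(9)[OF g' i j k x] by (simp add: algebra_simps)
  have 3: "circle_of (tah z' j k x \<bullet> q i j) = circle_of (q i j \<bullet> ph' j x) + circle_of (tah z'' j k x \<bullet> q i j)
      + circle_of (q j k \<bullet> ph' k x) - circle_of (q i k \<bullet> ph' k x) + circle_of (ph' k x \<bullet> tm z' i j k)
      - circle_of (ph' k x \<bullet> tm z i j k)"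
    using key by (simp add: algebra_simps)
  show "tt z'' i j k x + (e i j x + e' i j x - circle_of (q i j \<bullet> ph' j x))
      - circle_of (tah z'' j k x \<bullet> (q i j + q' i j)) + (e j k x + e' j k x - circle_of (q j k \<bullet> ph' k x)) =
      e i k x + e' i k x - circle_of (q i k \<bullet> ph' k x) + tt z i j k x
      - circle_of ((ph k x + ph' k x) \<bullet> tm z i j k)"
    unfolding 1 2 3 by (simp add: circle_of_add inner_add_left inner_add_right algebra_simps)
qed

lemma td_cocycle_pull:
  assumes U: "open_cover M \<U>" and V: "open_cover M \<V>" and r: "refinement \<V> \<U> r"
    and z: "td_cocycle M \<U> z"
  shows "td_cocycle M \<V> (td_pull r z)"
proof (rule td_cocycleI; unfold td_pull_def td.simps)
  note R = refinementD(1)[OF r] and S = refinementD(2)[OF r] and T = refinementD(3)[OF r]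
  fix i assume i: "i \<in> \<V>"
  show "is_form1 M i (tA z (r i))" by (rule is_form1_subset[OF td_cocycleD(1)[OF z R[OF i]] T[OF i]])
  show "is_form1 M i (tAh z (r i))" by (rule is_form1_subset[OF td_cocycleD(2)[OF z R[OF i]] T[OF i]])
  show "is_form2 M i (tR z (r i))" by (rule is_form2_subset[OF td_cocycleD(3)[OF z R[OF i]] T[OF i]])
  fix j assume j: "j \<in> \<V>"
  have ij: "i \<inter> j \<subseteq> r i \<inter> r j" using T i j by blast
  show "is_form1 M (i \<inter> j) (tphi z (r i) (r j))"
    by (rule is_form1_subset[OF td_cocycleD(4)[OF z R[OF i] R[OF j]] ij])
  show "smooth_fun M (i \<inter> j) (ta z (r i) (r j))"
    by (rule smooth_fun_subset[OF td_cocycleD(5)[OF z R[OF i] R[OF j]] ij])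
  show "smooth_fun M (i \<inter> j) (tah z (r i) (r j))"
    by (rule smooth_fun_subset[OF td_cocycleD(6)[OF z R[OF i] R[OF j]] ij])
  {
    fix c x v w assume c: "c \<in> M" "x \<in> i" "x \<in> j" "x \<in> cdom c"
    note c' = c(1) S[OF i c(2)] S[OF j c(3)] c(4)
    show "tA z (r j) c x v = tA z (r i) c x v - d0 (ta z (r i) (r j)) c x v"
      by (rule td_cocycleD(13)[OF z R[OF i] R[OF j] c'])
    show "tAh z (r j) c x v = tAh z (r i) c x v - d0 (tah z (r i) (r j)) c x v"
      by (rule td_cocycleD(14)[OF z R[OF i] R[OF j] c'])
    show "tR z (r j) c x v w + d1 (tphi z (r i) (r j)) c x v w =
        tR z (r i) c x v w + ta z (r i) (r j) x \<bullet> d1 (tAh z (r i)) c x v w"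
      by (rule td_cocycleD(16)[OF z R[OF i] R[OF j] c'])
  }
  fix k assume k: "k \<in> \<V>"
  have ijk: "i \<inter> j \<inter> k \<subseteq> r i \<inter> r j \<inter> r k" using T i j k by blast
  have op: "open (i \<inter> j \<inter> k)" using open_coverD(1)[OF V] i j k by blast
  show "tm z (r i) (r j) (r k) \<in> lattice" by (rule td_cocycleD(7)[OF z R[OF i] R[OF j] R[OF k]])
  show "tmh z (r i) (r j) (r k) \<in> lattice" by (rule td_cocycleD(8)[OF z R[OF i] R[OF j] R[OF k]])
  show "smooth_circle M (i \<inter> j \<inter> k) (tt z (r i) (r j) (r k))"
    by (rule smooth_circle_subset[OF td_cocycleD(9)[OF z R[OF i] R[OF j] R[OF k]] ijk op])
  show "tphi z (r i) (r k) c x v - tAh z (r k) c x v \<bullet> tm z (r i) (r j) (r k) =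
      tphi z (r j) (r k) c x v + tphi z (r i) (r j) c x v - mc M (tt z (r i) (r j) (r k)) c x v"
    if c: "c \<in> M" "x \<in> i" "x \<in> j" "x \<in> k" "x \<in> cdom c" for c x v
    by (rule td_cocycleD(15)[OF z R[OF i] R[OF j] R[OF k] c(1) S[OF i c(2)] S[OF j c(3)] S[OF k c(4)] c(5)])
  {
    fix x assume x: "x \<in> i" "x \<in> j" "x \<in> k"
    note x' = S[OF i x(1)] S[OF j x(2)] S[OF k x(3)]
    show "ta z (r i) (r k) x = tm z (r i) (r j) (r k) + ta z (r i) (r j) x + ta z (r j) (r k) x"
      by (rule td_cocycleD(10)[OF z R[OF i] R[OF j] R[OF k] x'])
    show "tah z (r i) (r k) x = tmh z (r i) (r j) (r k) + tah z (r i) (r j) x + tah z (r j) (r k) x"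
      by (rule td_cocycleD(11)[OF z R[OF i] R[OF j] R[OF k] x'])
    show "tt z (r i) (r k) (r l) x + tt z (r i) (r j) (r k) x -
        circle_of (tm z (r i) (r j) (r k) \<bullet> tah z (r k) (r l) x) =
        tt z (r i) (r j) (r l) x + tt z (r j) (r k) (r l) x" if l: "l \<in> \<V>" "x \<in> l" for l
      by (rule td_cocycleD(12)[OF z R[OF i] R[OF j] R[OF k] R[OF l(1)] x' S[OF l]])
  }
qed

lemma td_gauge_pull:
  assumes V: "open_cover M \<V>" and r: "refinement \<V> \<U> r"
    and g: "td_gauge M \<U> \<phi> p ph q qh e z z'"
  shows "td_gauge M \<V> (\<lambda>i. \<phi> (r i)) (\<lambda>i. p (r i)) (\<lambda>i. ph (r i)) (\<lambda>i j. q (r i) (r j))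
    (\<lambda>i j. qh (r i) (r j)) (\<lambda>i j. e (r i) (r j)) (td_pull r z) (td_pull r z')"
proof (rule td_gaugeI; (unfold td_pull_def td.simps)?)
  note R = refinementD(1)[OF r] and S = refinementD(2)[OF r] and T = refinementD(3)[OF r]
  fix i assume i: "i \<in> \<V>"
  show "is_form1 M i (\<phi> (r i))" by (rule is_form1_subset[OF td_gaugeD(1)[OF g R[OF i]] T[OF i]])
  show "smooth_fun M i (p (r i))" by (rule smooth_fun_subset[OF td_gaugeD(2)[OF g R[OF i]] T[OF i]])
  show "smooth_fun M i (ph (r i))" by (rule smooth_fun_subset[OF td_gaugeD(3)[OF g R[OF i]] T[OF i]])
  {
    fix c x v w assume c: "c \<in> M" "x \<in> i" "x \<in> cdom c"
    note c' = c(1) S[OF i c(2)] c(3)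
    show "tA z' (r i) c x v = tA z (r i) c x v - d0 (p (r i)) c x v"
      by (rule td_gaugeD(10)[OF g R[OF i] c'])
    show "tAh z' (r i) c x v = tAh z (r i) c x v - d0 (ph (r i)) c x v"
      by (rule td_gaugeD(11)[OF g R[OF i] c'])
    show "tR z' (r i) c x v w + d1 (\<phi> (r i)) c x v w =
        tR z (r i) c x v w + p (r i) x \<bullet> d1 (tAh z (r i)) c x v w"
      by (rule td_gaugeD(13)[OF g R[OF i] c'])
  }
  fix j assume j: "j \<in> \<V>"
  have ij: "i \<inter> j \<subseteq> r i \<inter> r j" using T i j by blast
  have op: "open (i \<inter> j)" using open_coverD(1)[OF V] i j by blast
  show "q (r i) (r j) \<in> lattice" by (rule td_gaugeD(4)[OF g R[OF i] R[OF j]])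
  show "qh (r i) (r j) \<in> lattice" by (rule td_gaugeD(5)[OF g R[OF i] R[OF j]])
  show "smooth_circle M (i \<inter> j) (e (r i) (r j))"
    by (rule smooth_circle_subset[OF td_gaugeD(6)[OF g R[OF i] R[OF j]] ij op])
  show "tphi z' (r i) (r j) c x v + \<phi> (r i) c x v - q (r i) (r j) \<bullet> tAh z' (r j) c x v =
      \<phi> (r j) c x v + tphi z (r i) (r j) c x v - mc M (e (r i) (r j)) c x v"
    if c: "c \<in> M" "x \<in> i" "x \<in> j" "x \<in> cdom c" for c x v
    by (rule td_gaugeD(12)[OF g R[OF i] R[OF j] c(1) S[OF i c(2)] S[OF j c(3)] c(4)])
  {
    fix x assume x: "x \<in> i" "x \<in> j"
    note x' = S[OF i x(1)] S[OF j x(2)]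
    show "ta z' (r i) (r j) x + p (r i) x = q (r i) (r j) + p (r j) x + ta z (r i) (r j) x"
      by (rule td_gaugeD(7)[OF g R[OF i] R[OF j] x'])
    show "tah z' (r i) (r j) x + ph (r i) x = qh (r i) (r j) + ph (r j) x + tah z (r i) (r j) x"
      by (rule td_gaugeD(8)[OF g R[OF i] R[OF j] x'])
    show "tt z' (r i) (r j) (r k) x + e (r i) (r j) x - circle_of (tah z' (r j) (r k) x \<bullet> q (r i) (r j)) +
        e (r j) (r k) x =
        e (r i) (r k) x + tt z (r i) (r j) (r k) x - circle_of (ph (r k) x \<bullet> tm z (r i) (r j) (r k))"
      if k: "k \<in> \<V>" "x \<in> k" for k
      by (rule td_gaugeD(9)[OF g R[OF i] R[OF j] R[OF k(1)] x' S[OF k]])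
  }
qed

text \<open>The class of a restriction does not depend on the refinement map: the components of the cocycle
  with one index for each of the two maps form a gauge transformation.\<close>

lemma td_pull_gauge:
  assumes U: "open_cover M \<U>" and V: "open_cover M \<V>"
    and r: "refinement \<V> \<U> r" and r': "refinement \<V> \<U> r'" and z: "td_cocycle M \<U> z"
  shows "td_gauge M \<V> (\<lambda>i. tphi z (r i) (r' i)) (\<lambda>i. ta z (r i) (r' i)) (\<lambda>i. tah z (r i) (r' i))
    (\<lambda>i j. tm z (r i) (r j) (r' j) - tm z (r i) (r' i) (r' j))
    (\<lambda>i j. tmh z (r i) (r j) (r' j) - tmh z (r i) (r' i) (r' j))
    (\<lambda>i j x. tt z (r i) (r j) (r' j) x - tt z (r i) (r' i) (r' j) x) (td_pull r z) (td_pull r' z)"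
proof (rule td_gaugeI; (unfold td_pull_def td.simps)?)
  note R = refinementD(1)[OF r] and S = refinementD(2)[OF r] and T = refinementD(3)[OF r]
  note R' = refinementD(1)[OF r'] and S' = refinementD(2)[OF r'] and T' = refinementD(3)[OF r']
  fix i assume i: "i \<in> \<V>"
  have ii: "i \<subseteq> r i \<inter> r' i" using T T' i by blast
  show "is_form1 M i (tphi z (r i) (r' i))"
    by (rule is_form1_subset[OF td_cocycleD(4)[OF z R[OF i] R'[OF i]] ii])
  show "smooth_fun M i (ta z (r i) (r' i))"
    by (rule smooth_fun_subset[OF td_cocycleD(5)[OF z R[OF i] R'[OF i]] ii])
  show "smooth_fun M i (tah z (r i) (r' i))"
    by (rule smooth_fun_subset[OF td_cocycleD(6)[OF z R[OF i] R'[OF i]] ii])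
  {
    fix c x v w assume c: "c \<in> M" "x \<in> i" "x \<in> cdom c"
    note c' = c(1) S[OF i c(2)] S'[OF i c(2)] c(3)
    show "tA z (r' i) c x v = tA z (r i) c x v - d0 (ta z (r i) (r' i)) c x v"
      by (rule td_cocycleD(13)[OF z R[OF i] R'[OF i] c'])
    show "tAh z (r' i) c x v = tAh z (r i) c x v - d0 (tah z (r i) (r' i)) c x v"
      by (rule td_cocycleD(14)[OF z R[OF i] R'[OF i] c'])
    show "tR z (r' i) c x v w + d1 (tphi z (r i) (r' i)) c x v w =
        tR z (r i) c x v w + ta z (r i) (r' i) x \<bullet> d1 (tAh z (r i)) c x v w"
      by (rule td_cocycleD(16)[OF z R[OF i] R'[OF i] c'])
  }
  fix j assume j: "j \<in> \<V>"
  have op: "open (i \<inter> j)" using open_coverD(1)[OF V] i j by blast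
  note ijj = R[OF i] R[OF j] R'[OF j] and iij = R[OF i] R'[OF i] R'[OF j]
  show "tm z (r i) (r j) (r' j) - tm z (r i) (r' i) (r' j) \<in> lattice"
    by (rule lattice_diff[OF td_cocycleD(7)[OF z ijj] td_cocycleD(7)[OF z iij]])
  show "tmh z (r i) (r j) (r' j) - tmh z (r i) (r' i) (r' j) \<in> lattice"
    by (rule lattice_diff[OF td_cocycleD(8)[OF z ijj] td_cocycleD(8)[OF z iij]])
  have s1: "smooth_circle M (i \<inter> j) (tt z (r i) (r j) (r' j))"
    by (rule smooth_circle_subset[OF td_cocycleD(9)[OF z ijj] _ op]) (use T T' i j in blast)
  have s2: "smooth_circle M (i \<inter> j) (tt z (r i) (r' i) (r' j))"
    by (rule smooth_circle_subset[OF td_cocycleD(9)[OF z iij] _ op]) (use T T' i j in blast)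
  show "smooth_circle M (i \<inter> j) (\<lambda>x. tt z (r i) (r j) (r' j) x - tt z (r i) (r' i) (r' j) x)"
    by (rule smooth_circle_diff[OF s1 s2])
  show "tphi z (r' i) (r' j) c x v + tphi z (r i) (r' i) c x v -
      (tm z (r i) (r j) (r' j) - tm z (r i) (r' i) (r' j)) \<bullet> tAh z (r' j) c x v =
      tphi z (r j) (r' j) c x v + tphi z (r i) (r j) c x v -
      mc M (\<lambda>x. tt z (r i) (r j) (r' j) x - tt z (r i) (r' i) (r' j) x) c x v"
    if c: "c \<in> M" "x \<in> i" "x \<in> j" "x \<in> cdom c" for c x v
  proof -
    have x: "x \<in> i \<inter> j" using c by simp
    show ?thesis
      using mc_diff[OF s1 s2 c(1) x c(4), of v]
        td_cocycleD(15)[OF z ijj c(1) S[OF i c(2)] S[OF j c(3)] S'[OF j c(3)] c(4), of v]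
        td_cocycleD(15)[OF z iij c(1) S[OF i c(2)] S'[OF i c(2)] S'[OF j c(3)] c(4), of v]
      by (simp add: inner_diff_left inner_diff_right inner_commute)
  qed
  {
    fix x assume x: "x \<in> i" "x \<in> j"
    note ijjx = S[OF i x(1)] S[OF j x(2)] S'[OF j x(2)]
    note iijx = S[OF i x(1)] S'[OF i x(1)] S'[OF j x(2)]
    show "ta z (r' i) (r' j) x + ta z (r i) (r' i) x =
        tm z (r i) (r j) (r' j) - tm z (r i) (r' i) (r' j) + ta z (r j) (r' j) x + ta z (r i) (r j) x"
      using td_cocycleD(10)[OF z ijj ijjx] td_cocycleD(10)[OF z iij iijx] by (simp add: algebra_simps)
    show "tah z (r' i) (r' j) x + tah z (r i) (r' i) x =
        tmh z (r i) (r j) (r' j) - tmh z (r i) (r' i) (r' j) + tah z (r j) (r' j) x + tah z (r i) (r j) x"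
      using td_cocycleD(11)[OF z ijj ijjx] td_cocycleD(11)[OF z iij iijx] by (simp add: algebra_simps)
    fix k assume k: "k \<in> \<V>" "x \<in> k"
    have 1: "tt z (r i) (r k) (r' k) x = tt z (r i) (r j) (r' k) x + tt z (r j) (r k) (r' k) x
        - tt z (r i) (r j) (r k) x + circle_of (tm z (r i) (r j) (r k) \<bullet> tah z (r k) (r' k) x)"
      using td_cocycleD(12)[OF z R[OF i] R[OF j] R[OF k(1)] R'[OF k(1)]
          S[OF i x(1)] S[OF j x(2)] S[OF k] S'[OF k]] by (simp add: algebra_simps)
    have 2: "tt z (r i) (r j) (r' j) x = tt z (r i) (r j) (r' k) x + tt z (r j) (r' j) (r' k) x
        - tt z (r i) (r' j) (r' k) x + circle_of (tm z (r i) (r j) (r' j) \<bullet> tah z (r' j) (r' k) x)"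
      using td_cocycleD(12)[OF z ijj R'[OF k(1)] ijjx S'[OF k]] by (simp add: algebra_simps)
    have 3: "tt z (r i) (r' i) (r' j) x = tt z (r i) (r' i) (r' k) x + tt z (r' i) (r' j) (r' k) x
        - tt z (r i) (r' j) (r' k) x + circle_of (tm z (r i) (r' i) (r' j) \<bullet> tah z (r' j) (r' k) x)"
      using td_cocycleD(12)[OF z iij R'[OF k(1)] iijx S'[OF k]] by (simp add: algebra_simps)
    show "tt z (r' i) (r' j) (r' k) x + (tt z (r i) (r j) (r' j) x - tt z (r i) (r' i) (r' j) x) -
        circle_of (tah z (r' j) (r' k) x \<bullet> (tm z (r i) (r j) (r' j) - tm z (r i) (r' i) (r' j))) +
        (tt z (r j) (r k) (r' k) x - tt z (r j) (r' j) (r' k) x) =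
        tt z (r i) (r k) (r' k) x - tt z (r i) (r' i) (r' k) x + tt z (r i) (r j) (r k) x -
        circle_of (tah z (r k) (r' k) x \<bullet> tm z (r i) (r j) (r k))"
      unfolding 1 2 3
      by (simp add: inner_diff_right circle_of_diff inner_commute algebra_simps)
  }
qed

end

section \<open>Differential cohomology inside adjusted differential cohomology\<close>

lemmas deligne_cocycle_conjuncts = deligne_cocycle_def[unfolded ball_coords, THEN iffD1]

lemma deligne_cocycleD:
  assumes "deligne_cocycle M \<U> g"
  shows "i \<in> \<U> \<Longrightarrow> is_form2 M i (DB g i)"
    and "i \<in> \<U> \<Longrightarrow> j \<in> \<U> \<Longrightarrow> is_form1 M (i \<inter> j) (DA g i j)"
    and "i \<in> \<U> \<Longrightarrow> j \<in> \<U> \<Longrightarrow> k \<in> \<U> \<Longrightarrow> smooth_circle M (i \<inter> j \<inter> k) (Dc g i j k)"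
    and "i \<in> \<U> \<Longrightarrow> j \<in> \<U> \<Longrightarrow> c \<in> M \<Longrightarrow> x \<in> i \<Longrightarrow> x \<in> j \<Longrightarrow> x \<in> cdom c \<Longrightarrow>
      DB g j c x v w + d1 (DA g i j) c x v w = DB g i c x v w"
    and "i \<in> \<U> \<Longrightarrow> j \<in> \<U> \<Longrightarrow> k \<in> \<U> \<Longrightarrow> c \<in> M \<Longrightarrow> x \<in> i \<Longrightarrow> x \<in> j \<Longrightarrow> x \<in> k \<Longrightarrow> x \<in> cdom c \<Longrightarrow>
      DA g i k c x v = DA g i j c x v + DA g j k c x v - mc M (Dc g i j k) c x v"
    and "i \<in> \<U> \<Longrightarrow> j \<in> \<U> \<Longrightarrow> k \<in> \<U> \<Longrightarrow> l \<in> \<U> \<Longrightarrow> x \<in> i \<Longrightarrow> x \<in> j \<Longrightarrow> x \<in> k \<Longrightarrow> x \<in> l \<Longrightarrow>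
      Dc g j k l x + Dc g i j l x = Dc g i j k x + Dc g i k l x"
  by ((use deligne_cocycle_conjuncts[OF assms, THEN conjunct1] in blast)[1],
      (use deligne_cocycle_conjuncts[OF assms, THEN conjunct2, THEN conjunct1] in blast)[1],
      (use deligne_cocycle_conjuncts[OF assms, THEN conjunct2, THEN conjunct2, THEN conjunct1] in blast)[1],
      (use deligne_cocycle_conjuncts[OF assms, THEN conjunct2, THEN conjunct2, THEN conjunct2, THEN conjunct1] in blast)[1],
      (use deligne_cocycle_conjuncts[OF assms, THEN conjunct2, THEN conjunct2, THEN conjunct2, THEN conjunct2, THEN conjunct1] in blast)[1],
      (use deligne_cocycle_conjuncts[OF assms, THEN conjunct2, THEN conjunct2, THEN conjunct2, THEN conjunct2, THEN conjunct2] in blast)[1])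

lemma deligne_cocycleI:
  assumes "\<And>i. i \<in> \<U> \<Longrightarrow> is_form2 M i (DB g i)"
    and "\<And>i j. i \<in> \<U> \<Longrightarrow> j \<in> \<U> \<Longrightarrow> is_form1 M (i \<inter> j) (DA g i j)"
    and "\<And>i j k. i \<in> \<U> \<Longrightarrow> j \<in> \<U> \<Longrightarrow> k \<in> \<U> \<Longrightarrow> smooth_circle M (i \<inter> j \<inter> k) (Dc g i j k)"
    and "\<And>i j c x v w. i \<in> \<U> \<Longrightarrow> j \<in> \<U> \<Longrightarrow> c \<in> M \<Longrightarrow> x \<in> i \<Longrightarrow> x \<in> j \<Longrightarrow> x \<in> cdom c \<Longrightarrow>
      DB g j c x v w + d1 (DA g i j) c x v w = DB g i c x v w"
    and "\<And>i j k c x v. i \<in> \<U> \<Longrightarrow> j \<in> \<U> \<Longrightarrow> k \<in> \<U> \<Longrightarrow> c \<in> M \<Longrightarrow> x \<in> i \<Longrightarrow> x \<in> j \<Longrightarrow> x \<in> k \<Longrightarrow> x \<in> cdom c \<Longrightarrow>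
      DA g i k c x v = DA g i j c x v + DA g j k c x v - mc M (Dc g i j k) c x v"
    and "\<And>i j k l x. i \<in> \<U> \<Longrightarrow> j \<in> \<U> \<Longrightarrow> k \<in> \<U> \<Longrightarrow> l \<in> \<U> \<Longrightarrow> x \<in> i \<Longrightarrow> x \<in> j \<Longrightarrow> x \<in> k \<Longrightarrow> x \<in> l \<Longrightarrow>
      Dc g j k l x + Dc g i j l x = Dc g i j k x + Dc g i k l x"
  shows "deligne_cocycle M \<U> g"
  unfolding deligne_cocycle_def ball_coords
  by (intro conjI ballI allI impI; (elim IntE)?; rule assms; assumption)

definition deligne_gauge ::
  "('x::topological_space, 'e::real_normed_vector) atlas \<Rightarrow> 'x set set \<Rightarrow>
   ('x set \<Rightarrow> ('x, 'e, real) form1) \<Rightarrow> ('x set \<Rightarrow> 'x set \<Rightarrow> 'x \<Rightarrow> circle) \<Rightarrow>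
   ('x, 'e) deligne \<Rightarrow> ('x, 'e) deligne \<Rightarrow> bool" where
  "deligne_gauge M \<U> C e g g' \<longleftrightarrow>
        (\<forall>i\<in>\<U>. is_form1 M i (C i)) \<and>
        (\<forall>i\<in>\<U>. \<forall>j\<in>\<U>. smooth_circle M (i \<inter> j) (e i j)) \<and>
        (\<forall>i\<in>\<U>. \<forall>(c, x) \<in> coords M i. \<forall>v w.
           DB g' i c x v w = DB g i c x v w + d1 (C i) c x v w) \<and>
        (\<forall>i\<in>\<U>. \<forall>j\<in>\<U>. \<forall>(c, x) \<in> coords M (i \<inter> j). \<forall>v.
           DA g' i j c x v = DA g i j c x v + C i c x v - C j c x v - mc M (e i j) c x v) \<and>
        (\<forall>i\<in>\<U>. \<forall>j\<in>\<U>. \<forall>k\<in>\<U>. \<forall>x \<in> i \<inter> j \<inter> k.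
           Dc g' i j k x = Dc g i j k x + e i k x - e i j x - e j k x)"

lemma deligne_equiv_iff_gauge:
  "deligne_equiv M \<U> g g' \<longleftrightarrow> (\<exists>C e. deligne_gauge M \<U> C e g g')"
  unfolding deligne_equiv_def deligne_gauge_def ..

lemmas deligne_gauge_conjuncts = deligne_gauge_def[unfolded ball_coords, THEN iffD1]

lemma deligne_gaugeD:
  assumes "deligne_gauge M \<U> C e g g'"
  shows "i \<in> \<U> \<Longrightarrow> is_form1 M i (C i)"
    and "i \<in> \<U> \<Longrightarrow> j \<in> \<U> \<Longrightarrow> smooth_circle M (i \<inter> j) (e i j)"
    and "i \<in> \<U> \<Longrightarrow> c \<in> M \<Longrightarrow> x \<in> i \<Longrightarrow> x \<in> cdom c \<Longrightarrow> DB g' i c x v w = DB g i c x v w + d1 (C i) c x v w"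
    and "i \<in> \<U> \<Longrightarrow> j \<in> \<U> \<Longrightarrow> c \<in> M \<Longrightarrow> x \<in> i \<Longrightarrow> x \<in> j \<Longrightarrow> x \<in> cdom c \<Longrightarrow>
      DA g' i j c x v = DA g i j c x v + C i c x v - C j c x v - mc M (e i j) c x v"
    and "i \<in> \<U> \<Longrightarrow> j \<in> \<U> \<Longrightarrow> k \<in> \<U> \<Longrightarrow> x \<in> i \<Longrightarrow> x \<in> j \<Longrightarrow> x \<in> k \<Longrightarrow>
      Dc g' i j k x = Dc g i j k x + e i k x - e i j x - e j k x"
  by ((use deligne_gauge_conjuncts[OF assms, THEN conjunct1] in blast)[1],
      (use deligne_gauge_conjuncts[OF assms, THEN conjunct2, THEN conjunct1] in blast)[1],
      (use deligne_gauge_conjuncts[OF assms, THEN conjunct2, THEN conjunct2, THEN conjunct1] in blast)[1],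
      (use deligne_gauge_conjuncts[OF assms, THEN conjunct2, THEN conjunct2, THEN conjunct2, THEN conjunct1] in blast)[1],
      (use deligne_gauge_conjuncts[OF assms, THEN conjunct2, THEN conjunct2, THEN conjunct2, THEN conjunct2] in blast)[1])

lemma deligne_gaugeI:
  assumes "\<And>i. i \<in> \<U> \<Longrightarrow> is_form1 M i (C i)"
    and "\<And>i j. i \<in> \<U> \<Longrightarrow> j \<in> \<U> \<Longrightarrow> smooth_circle M (i \<inter> j) (e i j)"
    and "\<And>i c x v w. i \<in> \<U> \<Longrightarrow> c \<in> M \<Longrightarrow> x \<in> i \<Longrightarrow> x \<in> cdom c \<Longrightarrow>
      DB g' i c x v w = DB g i c x v w + d1 (C i) c x v w"
    and "\<And>i j c x v. i \<in> \<U> \<Longrightarrow> j \<in> \<U> \<Longrightarrow> c \<in> M \<Longrightarrow> x \<in> i \<Longrightarrow> x \<in> j \<Longrightarrow> x \<in> cdom c \<Longrightarrow>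
      DA g' i j c x v = DA g i j c x v + C i c x v - C j c x v - mc M (e i j) c x v"
    and "\<And>i j k x. i \<in> \<U> \<Longrightarrow> j \<in> \<U> \<Longrightarrow> k \<in> \<U> \<Longrightarrow> x \<in> i \<Longrightarrow> x \<in> j \<Longrightarrow> x \<in> k \<Longrightarrow>
      Dc g' i j k x = Dc g i j k x + e i k x - e i j x - e j k x"
  shows "deligne_gauge M \<U> C e g g'"
  unfolding deligne_gauge_def ball_coords
  by (intro conjI ballI allI impI; (elim IntE)?; rule assms; assumption)

definition td_zero :: "('x, 'e, 'n::finite) td" where
  "td_zero = \<lparr>tA = \<lambda>i c x v. 0, tAh = \<lambda>i c x v. 0, tR = \<lambda>i c x v w. 0, tphi = \<lambda>i j c x v. 0,
     ta = \<lambda>i j x. 0, tah = \<lambda>i j x. 0, tm = \<lambda>i j k. 0, tmh = \<lambda>i j k. 0, tt = \<lambda>i j k x. 0\<rparr>"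

lemma td_zero_simps [simp]:
  "tA td_zero i c x v = 0" "tAh td_zero i c x v = 0" "tR td_zero i c x v w = 0"
  "tphi td_zero i j c x v = 0" "ta td_zero i j x = 0" "tah td_zero i j x = 0"
  "tm td_zero i j k = 0" "tmh td_zero i j k = 0" "tt td_zero i j k x = 0"
  by (simp_all add: td_zero_def)

lemma td_shift_simps [simp]:
  "tA (td_shift g z) = tA z" "tAh (td_shift g z) = tAh z" "ta (td_shift g z) = ta z"
  "tah (td_shift g z) = tah z" "tm (td_shift g z) = tm z" "tmh (td_shift g z) = tmh z"
  "tR (td_shift g z) i = (\<lambda>c x v w. tR z i c x v w + DB g i c x v w)"
  "tphi (td_shift g z) i j = (\<lambda>c x v. tphi z i j c x v + DA g i j c x v)"
  "tt (td_shift g z) i j k = (\<lambda>x. tt z i j k x + Dc g i j k x)"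
  by (simp_all add: td_shift_def)

lemma deligne_add_simps [simp]:
  "DB (deligne_add g h) i = (\<lambda>c x v w. DB g i c x v w + DB h i c x v w)"
  "DA (deligne_add g h) i j = (\<lambda>c x v. DA g i j c x v + DA h i j c x v)"
  "Dc (deligne_add g h) i j k = (\<lambda>x. Dc g i j k x + Dc h i j k x)"
  by (simp_all add: deligne_add_def)

lemma td_shift_add: "td_shift (deligne_add g h) z = td_shift g (td_shift h z)"
  by (rule td.equality) (simp_all add: fun_eq_iff algebra_simps td_shift_def deligne_add_def)

lemma td_pull_shift: "td_pull r (td_shift g z) = td_shift (deligne_pull r g) (td_pull r z)"
  by (simp add: td_pull_def td_shift_def deligne_pull_def)

lemma td_pull_zero [simp]: "td_pull r td_zero = td_zero"
  by (simp add: td_pull_def td_zero_def)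

lemma td_pull_pull: "td_pull s (td_pull r z) = td_pull (r \<circ> s) z"
  by (simp add: td_pull_def)

context manifold begin

lemma td_cocycle_shift:
  assumes U: "open_cover M \<U>" and z: "td_cocycle M \<U> z" and g: "deligne_cocycle M \<U> g"
  shows "td_cocycle M \<U> (td_shift g z)"
proof (rule td_cocycleI; (unfold td_shift_simps)?)
  note op = open_coverD(1)[OF U]
  fix i assume i: "i \<in> \<U>"
  show "is_form1 M i (tA z i)" "is_form1 M i (tAh z i)" using td_cocycleD(1,2)[OF z i] .
  show "is_form2 M i (\<lambda>c x v w. tR z i c x v w + DB g i c x v w)"
    by (rule is_form2_add[OF op[OF i] td_cocycleD(3)[OF z i] deligne_cocycleD(1)[OF g i]])
  fix j assume j: "j \<in> \<U>"
  have ij: "open (i \<inter> j)" using op i j by blast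
  note f = td_cocycleD(4)[OF z i j] deligne_cocycleD(2)[OF g i j]
  show "is_form1 M (i \<inter> j) (\<lambda>c x v. tphi z i j c x v + DA g i j c x v)"
    by (rule is_form1_add[OF ij f])
  show "smooth_fun M (i \<inter> j) (ta z i j)" "smooth_fun M (i \<inter> j) (tah z i j)"
    using td_cocycleD(5,6)[OF z i j] .
  {
    fix c x v w assume c: "c \<in> M" "x \<in> i" "x \<in> j" "x \<in> cdom c"
    then have x: "x \<in> i \<inter> j" by simp
    show "tA z j c x v = tA z i c x v - d0 (ta z i j) c x v" by (rule td_cocycleD(13)[OF z i j c])
    show "tAh z j c x v = tAh z i c x v - d0 (tah z i j) c x v" by (rule td_cocycleD(14)[OF z i j c])
    show "tR z j c x v w + DB g j c x v w + d1 (\<lambda>c x v. tphi z i j c x v + DA g i j c x v) c x v w =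
        tR z i c x v w + DB g i c x v w + ta z i j x \<bullet> d1 (tAh z i) c x v w"
      using td_cocycleD(16)[OF z i j c, of v w] deligne_cocycleD(4)[OF g i j c, of v w]
        d1_add[OF f c(1) x c(4), of v w] by simp
  }
  fix k assume k: "k \<in> \<U>"
  show "tm z i j k \<in> lattice" "tmh z i j k \<in> lattice" using td_cocycleD(7,8)[OF z i j k] .
  note s = td_cocycleD(9)[OF z i j k] deligne_cocycleD(3)[OF g i j k]
  show "smooth_circle M (i \<inter> j \<inter> k) (\<lambda>x. tt z i j k x + Dc g i j k x)"
    by (rule smooth_circle_add[OF s])
  show "tphi z i k c x v + DA g i k c x v - tAh z k c x v \<bullet> tm z i j k =
      tphi z j k c x v + DA g j k c x v + (tphi z i j c x v + DA g i j c x v) -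
      mc M (\<lambda>x. tt z i j k x + Dc g i j k x) c x v"
    if c: "c \<in> M" "x \<in> i" "x \<in> j" "x \<in> k" "x \<in> cdom c" for c x v
  proof -
    have x: "x \<in> i \<inter> j \<inter> k" using c by simp
    show ?thesis
      using td_cocycleD(15)[OF z i j k c, of v] deligne_cocycleD(5)[OF g i j k c, of v]
        mc_add[OF s c(1) x c(5), of v] by simp
  qed
  {
    fix x assume x: "x \<in> i" "x \<in> j" "x \<in> k"
    show "ta z i k x = tm z i j k + ta z i j x + ta z j k x" by (rule td_cocycleD(10)[OF z i j k x])
    show "tah z i k x = tmh z i j k + tah z i j x + tah z j k x" by (rule td_cocycleD(11)[OF z i j k x])
    show "tt z i k l x + Dc g i k l x + (tt z i j k x + Dc g i j k x) - circle_of (tm z i j k \<bullet> tah z k l x) =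
        tt z i j l x + Dc g i j l x + (tt z j k l x + Dc g j k l x)" if l: "l \<in> \<U>" "x \<in> l" for l
    proof -
      have 1: "tt z i k l x = tt z i j l x + tt z j k l x - tt z i j k x + circle_of (tm z i j k \<bullet> tah z k l x)"
        using td_cocycleD(12)[OF z i j k l(1) x l(2)] by (simp add: algebra_simps)
      have 2: "Dc g i k l x = Dc g j k l x + Dc g i j l x - Dc g i j k x"
        using deligne_cocycleD(6)[OF g i j k l(1) x l(2)] by (simp add: algebra_simps)
      show ?thesis unfolding 1 2 by (simp add: algebra_simps)
    qed
  }
qed

lemma td_gauge_shift:
  assumes U: "open_cover M \<U>" and g: "deligne_gauge M \<U> C f g g'"
    and z: "td_gauge M \<U> \<phi> p ph q qh e z z'"
  shows "td_gauge M \<U> (\<lambda>i c x v. \<phi> i c x v - C i c x v) p ph q qh (\<lambda>i j x. e i j x + f i j x)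
    (td_shift g z) (td_shift g' z')"
proof (rule td_gaugeI; (unfold td_shift_simps)?)
  note op = open_coverD(1)[OF U]
  fix i assume i: "i \<in> \<U>"
  note fo = td_gaugeD(1)[OF z i] deligne_gaugeD(1)[OF g i]
  show "is_form1 M i (\<lambda>c x v. \<phi> i c x v - C i c x v)" by (rule is_form1_diff[OF op[OF i] fo])
  show "smooth_fun M i (p i)" "smooth_fun M i (ph i)" using td_gaugeD(2,3)[OF z i] .
  {
    fix c x v w assume c: "c \<in> M" "x \<in> i" "x \<in> cdom c"
    show "tA z' i c x v = tA z i c x v - d0 (p i) c x v" by (rule td_gaugeD(10)[OF z i c])
    show "tAh z' i c x v = tAh z i c x v - d0 (ph i) c x v" by (rule td_gaugeD(11)[OF z i c])
    show "tR z' i c x v w + DB g' i c x v w + d1 (\<lambda>c x v. \<phi> i c x v - C i c x v) c x v w =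
        tR z i c x v w + DB g i c x v w + p i x \<bullet> d1 (tAh z i) c x v w"
      using td_gaugeD(13)[OF z i c, of v w] deligne_gaugeD(3)[OF g i c, of v w]
        d1_diff[OF fo c, of v w] by simp
  }
  fix j assume j: "j \<in> \<U>"
  show "q i j \<in> lattice" "qh i j \<in> lattice" using td_gaugeD(4,5)[OF z i j] .
  note s = td_gaugeD(6)[OF z i j] deligne_gaugeD(2)[OF g i j]
  show "smooth_circle M (i \<inter> j) (\<lambda>x. e i j x + f i j x)" by (rule smooth_circle_add[OF s])
  show "tphi z' i j c x v + DA g' i j c x v + (\<phi> i c x v - C i c x v) - q i j \<bullet> tAh z' j c x v =
      \<phi> j c x v - C j c x v + (tphi z i j c x v + DA g i j c x v) - mc M (\<lambda>x. e i j x + f i j x) c x v"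
    if c: "c \<in> M" "x \<in> i" "x \<in> j" "x \<in> cdom c" for c x v
  proof -
    have x: "x \<in> i \<inter> j" using c by simp
    show ?thesis
      using td_gaugeD(12)[OF z i j c, of v] deligne_gaugeD(4)[OF g i j c, of v]
        mc_add[OF s c(1) x c(4), of v] by simp
  qed
  {
    fix x assume x: "x \<in> i" "x \<in> j"
    show "ta z' i j x + p i x = q i j + p j x + ta z i j x" by (rule td_gaugeD(7)[OF z i j x])
    show "tah z' i j x + ph i x = qh i j + ph j x + tah z i j x" by (rule td_gaugeD(8)[OF z i j x])
    fix k assume k: "k \<in> \<U>" "x \<in> k"
    have 1: "tt z' i j k x = e i k x + tt z i j k x - circle_of (ph k x \<bullet> tm z i j k) - e i j x
        + circle_of (tah z' j k x \<bullet> q i j) - e j k x"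
      using td_gaugeD(9)[OF z i j k(1) x k(2)] by (simp add: algebra_simps)
    show "tt z' i j k x + Dc g' i j k x + (e i j x + f i j x) - circle_of (tah z' j k x \<bullet> q i j) +
        (e j k x + f j k x) =
        e i k x + f i k x + (tt z i j k x + Dc g i j k x) - circle_of (ph k x \<bullet> tm z i j k)"
      unfolding 1 deligne_gaugeD(5)[OF g i j k(1) x k(2)] by (simp add: algebra_simps)
  }
qed

lemma td_cocycle_zero:
  assumes U: "open_cover M \<U>" shows "td_cocycle M \<U> td_zero"
proof -
  have 1: "is_form1 M i (\<lambda>c x v. 0::'b::real_normed_vector)" "is_form2 M i (\<lambda>c x v w. 0::'b)"
    "smooth_fun M i (\<lambda>x. 0::'b)" if "open i" for i
    using that by (auto intro: is_form1_zero is_form2_zero smooth_fun_const)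
  note op = open_coverD(1)[OF U] and pt = open_coverD(2)[OF U]
  show ?thesis
  proof (rule td_cocycleI; (unfold td_zero_def td.simps)?)
    show "smooth_circle M (i \<inter> j \<inter> k) (\<lambda>x. 0)" if "i \<in> \<U>" "j \<in> \<U>" "k \<in> \<U>" for i j k
      using op pt that by (intro smooth_circle_zero) blast+
  qed (use open_Int[OF op op] in \<open>auto intro: 1 op simp: mc_zero\<close>)
qed

text \<open>With trivial bundles the gauge transformations of the adjusted theory are those of the Deligne
  complex, since the conditions on \<open>p\<close>, \<open>ph\<close>, \<open>q\<close>, \<open>qh\<close> decouple from those on \<open>\<phi>\<close> and \<open>e\<close>.  All properties
  of the Deligne relation therefore follow from the adjusted case, taken for bundles of rank one.\<close>

lemma deligne_cocycle_iff:
  assumes U: "open_cover M \<U>"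
  shows "deligne_cocycle M \<U> g \<longleftrightarrow> td_cocycle M \<U> (td_shift g td_zero :: ('x, 'e, 1) td)"
proof
  assume "deligne_cocycle M \<U> g"
  then show "td_cocycle M \<U> (td_shift g td_zero :: ('x, 'e, 1) td)"
    by (rule td_cocycle_shift[OF U td_cocycle_zero[OF U]])
next
  assume z: "td_cocycle M \<U> (td_shift g td_zero :: ('x, 'e, 1) td)"
  show "deligne_cocycle M \<U> g"
  proof (rule deligne_cocycleI)
    fix i assume i: "i \<in> \<U>"
    show "is_form2 M i (DB g i)" using td_cocycleD(3)[OF z i] by simp
    fix j assume j: "j \<in> \<U>"
    show "is_form1 M (i \<inter> j) (DA g i j)" using td_cocycleD(4)[OF z i j] by simp
    show "DB g j c x v w + d1 (DA g i j) c x v w = DB g i c x v w"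
      if "c \<in> M" "x \<in> i" "x \<in> j" "x \<in> cdom c" for c x v w
      using td_cocycleD(16)[OF z i j that, of v w] by simp
    fix k assume k: "k \<in> \<U>"
    show "smooth_circle M (i \<inter> j \<inter> k) (Dc g i j k)" using td_cocycleD(9)[OF z i j k] by simp
    show "DA g i k c x v = DA g i j c x v + DA g j k c x v - mc M (Dc g i j k) c x v"
      if "c \<in> M" "x \<in> i" "x \<in> j" "x \<in> k" "x \<in> cdom c" for c x v
      using td_cocycleD(15)[OF z i j k that, of v] by simp
    show "Dc g j k l x + Dc g i j l x = Dc g i j k x + Dc g i k l x"
      if "l \<in> \<U>" "x \<in> i" "x \<in> j" "x \<in> k" "x \<in> l" for l x
      using td_cocycleD(12)[OF z i j k that] by (simp add: add.commute)
  qed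
qed

lemma deligne_equiv_iff:
  assumes U: "open_cover M \<U>"
  shows "deligne_equiv M \<U> g g' \<longleftrightarrow>
    td_equiv M \<U> (td_shift g td_zero :: ('x, 'e, 1) td) (td_shift g' td_zero)"
proof
  assume "deligne_equiv M \<U> g g'"
  then obtain C e where "deligne_gauge M \<U> C e g g'" unfolding deligne_equiv_iff_gauge by blast
  from td_gauge_shift[OF U this td_gauge_refl[OF U]]
  show "td_equiv M \<U> (td_shift g td_zero :: ('x, 'e, 1) td) (td_shift g' td_zero)"
    unfolding td_equiv_iff_gauge by blast
next
  assume "td_equiv M \<U> (td_shift g td_zero :: ('x, 'e, 1) td) (td_shift g' td_zero)"
  then obtain \<phi> p ph q qh e where
    z: "td_gauge M \<U> \<phi> p ph q qh e (td_shift g td_zero :: ('x, 'e, 1) td) (td_shift g' td_zero)"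
    unfolding td_equiv_iff_gauge by blast
  have d: "d1 (tAh (td_zero :: ('x, 'e, 1) td) i) c x v w = 0" for i c x v w
    by (simp add: td_zero_def)
  have "deligne_gauge M \<U> (\<lambda>i c x v. - \<phi> i c x v) e g g'"
  proof (rule deligne_gaugeI)
    fix i assume i: "i \<in> \<U>"
    show "is_form1 M i (\<lambda>c x v. - \<phi> i c x v)"
      by (rule is_form1_minus[OF open_coverD(1)[OF U i] td_gaugeD(1)[OF z i]])
    show "DB g' i c x v w = DB g i c x v w + d1 (\<lambda>c x v. - \<phi> i c x v) c x v w"
      if c: "c \<in> M" "x \<in> i" "x \<in> cdom c" for c x v w
      using td_gaugeD(13)[OF z i c, of v w] d1_minus[OF td_gaugeD(1)[OF z i] c, of v w]
      by (simp add: d)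
    fix j assume j: "j \<in> \<U>"
    show "smooth_circle M (i \<inter> j) (e i j)" by (rule td_gaugeD(6)[OF z i j])
    show "DA g' i j c x v = DA g i j c x v + - \<phi> i c x v - - \<phi> j c x v - mc M (e i j) c x v"
      if c: "c \<in> M" "x \<in> i" "x \<in> j" "x \<in> cdom c" for c x v
      using td_gaugeD(12)[OF z i j c, of v] by simp
    show "Dc g' i j k x = Dc g i j k x + e i k x - e i j x - e j k x"
      if "k \<in> \<U>" "x \<in> i" "x \<in> j" "x \<in> k" for k x
      using td_gaugeD(9)[OF z i j that] by (simp add: algebra_simps)
  qed
  then show "deligne_equiv M \<U> g g'" unfolding deligne_equiv_iff_gauge by blast
qed

section \<open>Classes over refinements of covers\<close>

lemma td_equiv_refl: "open_cover M \<U> \<Longrightarrow> td_equiv M \<U> z z"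
  unfolding td_equiv_iff_gauge using td_gauge_refl by blast

lemma td_equiv_sym:
  assumes "open_cover M \<U>" "td_cocycle M \<U> z" "td_cocycle M \<U> z'" "td_equiv M \<U> z z'"
  shows "td_equiv M \<U> z' z"
proof -
  from assms(4) obtain \<phi> p ph q qh e where "td_gauge M \<U> \<phi> p ph q qh e z z'"
    unfolding td_equiv_iff_gauge by blast
  from td_gauge_sym[OF assms(1-3) this] show ?thesis unfolding td_equiv_iff_gauge by blast
qed

lemma td_equiv_trans:
  assumes "open_cover M \<U>" "td_cocycle M \<U> z" "td_cocycle M \<U> z'"
    "td_equiv M \<U> z z'" "td_equiv M \<U> z' z''"
  shows "td_equiv M \<U> z z''"
proof -
  from assms(4) obtain \<phi> p ph q qh e where 1: "td_gauge M \<U> \<phi> p ph q qh e z z'"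
    unfolding td_equiv_iff_gauge by blast
  from assms(5) obtain \<phi>' p' ph' q' qh' e' where 2: "td_gauge M \<U> \<phi>' p' ph' q' qh' e' z' z''"
    unfolding td_equiv_iff_gauge by blast
  from td_gauge_trans[OF assms(1-3) 1 2] show ?thesis unfolding td_equiv_iff_gauge by blast
qed

lemma td_equiv_pull:
  assumes "open_cover M \<V>" "refinement \<V> \<U> r" "td_equiv M \<U> z z'"
  shows "td_equiv M \<V> (td_pull r z) (td_pull r z')"
proof -
  from assms(3) obtain \<phi> p ph q qh e where "td_gauge M \<U> \<phi> p ph q qh e z z'"
    unfolding td_equiv_iff_gauge by blast
  from td_gauge_pull[OF assms(1,2) this] show ?thesis unfolding td_equiv_iff_gauge by blast
qed

lemma td_equiv_pulls:
  assumes "open_cover M \<U>" "open_cover M \<V>" "refinement \<V> \<U> r" "refinement \<V> \<U> r'" "td_cocycle M \<U> z"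
  shows "td_equiv M \<V> (td_pull r z) (td_pull r' z)"
  using td_pull_gauge[OF assms] unfolding td_equiv_iff_gauge by blast

lemma td_equiv_shift:
  assumes "open_cover M \<U>" "deligne_equiv M \<U> g g'" "td_equiv M \<U> z z'"
  shows "td_equiv M \<U> (td_shift g z) (td_shift g' z')"
proof -
  from assms(3) obtain \<phi> p ph q qh e where 1: "td_gauge M \<U> \<phi> p ph q qh e z z'"
    unfolding td_equiv_iff_gauge by blast
  from assms(2) obtain C f where 2: "deligne_gauge M \<U> C f g g'"
    unfolding deligne_equiv_iff_gauge by blast
  from td_gauge_shift[OF assms(1) 2 1] show ?thesis unfolding td_equiv_iff_gauge by blast
qed

end

lemma refinement_id: "refinement \<U> \<U> id"
  by (simp add: refinement_def)

lemma refinement_comp: "refinement \<W> \<V> s \<Longrightarrow> refinement \<V> \<U> r \<Longrightarrow> refinement \<W> \<U> (r \<circ> s)"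
  unfolding refinement_def by (metis comp_apply order_trans)

lemma common_refinement:
  assumes "open_cover M \<U>" "open_cover M \<U>'"
  obtains \<V> r r' where "open_cover M \<V>" "refinement \<V> \<U> r" "refinement \<V> \<U>' r'"
proof -
  define \<V> where "\<V> = {i \<inter> j |i j. i \<in> \<U> \<and> j \<in> \<U>'}"
  have "\<forall>V\<in>\<V>. \<exists>i j. i \<in> \<U> \<and> j \<in> \<U>' \<and> V \<subseteq> i \<and> V \<subseteq> j" unfolding \<V>_def by blast
  then obtain r r' where "\<forall>V\<in>\<V>. r V \<in> \<U> \<and> r' V \<in> \<U>' \<and> V \<subseteq> r V \<and> V \<subseteq> r' V" by metis
  then have "refinement \<V> \<U> r" "refinement \<V> \<U>' r'" unfolding refinement_def by auto
  moreover have "open_cover M \<V>"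
    unfolding open_cover_def
  proof
    show "\<forall>U\<in>\<V>. open U" using assms unfolding \<V>_def open_cover_def by blast
    have "\<Union>\<V> = \<Union>\<U> \<inter> \<Union>\<U>'" unfolding \<V>_def by blast
    then show "\<Union>\<V> = points M" using assms unfolding open_cover_def by simp
  qed
  ultimately show ?thesis using that by blast
qed

lemma td_rel_iff:
  "((\<U>, z), (\<U>', z')) \<in> td_rel M \<longleftrightarrow> (\<U>, z) \<in> td_cocycles M \<and> (\<U>', z') \<in> td_cocycles M \<and>
        (\<exists>\<V> r r'. open_cover M \<V> \<and> refinement \<V> \<U> r \<and> refinement \<V> \<U>' r' \<and>
           td_equiv M \<V> (td_pull r z) (td_pull r' z'))"
  unfolding td_rel_def by simp

lemma deligne_rel_iff:
  "((\<U>, z), (\<U>', z')) \<in> deligne_rel M \<longleftrightarrow> (\<U>, z) \<in> deligne_cocycles M \<and> (\<U>', z') \<in> deligne_cocycles M \<and>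
        (\<exists>\<V> r r'. open_cover M \<V> \<and> refinement \<V> \<U> r \<and> refinement \<V> \<U>' r' \<and>
           deligne_equiv M \<V> (deligne_pull r z) (deligne_pull r' z'))"
  unfolding deligne_rel_def by simp

lemma td_cocycles_iff: "(\<U>, z) \<in> td_cocycles M \<longleftrightarrow> open_cover M \<U> \<and> td_cocycle M \<U> z"
  unfolding td_cocycles_def by simp

lemma deligne_cocycles_iff: "(\<U>, z) \<in> deligne_cocycles M \<longleftrightarrow> open_cover M \<U> \<and> deligne_cocycle M \<U> z"
  unfolding deligne_cocycles_def by simp

context manifold begin

lemma td_cocycles_pull:
  assumes "(\<U>, z) \<in> td_cocycles M" "open_cover M \<V>" "refinement \<V> \<U> r"
  shows "(\<V>, td_pull r z) \<in> td_cocycles M"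
  using assms td_cocycle_pull unfolding td_cocycles_iff by blast

text \<open>An equivalence over one refinement holds over all finer covers and for all choices of refinement maps,
  because restrictions along different maps are equivalent.  This makes it possible to combine several equivalences
  on a common refinement, with the same maps in all of them.\<close>

lemma td_rel_on_refinements:
  assumes "((\<U>, z), (\<U>', z')) \<in> td_rel M"
  shows "\<exists>\<V> r r'. open_cover M \<V> \<and> refinement \<V> \<U> r \<and> refinement \<V> \<U>' r' \<and>
    (\<forall>\<W> s t t'. open_cover M \<W> \<longrightarrow> refinement \<W> \<V> s \<longrightarrow> refinement \<W> \<U> t \<longrightarrow> refinement \<W> \<U>' t' \<longrightarrow>
      td_equiv M \<W> (td_pull t z) (td_pull t' z'))"
proof -
  from assms obtain \<V> r r' where V: "open_cover M \<V>" "refinement \<V> \<U> r" "refinement \<V> \<U>' r'"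
    and eq: "td_equiv M \<V> (td_pull r z) (td_pull r' z')"
    and c: "open_cover M \<U>" "open_cover M \<U>'" "td_cocycle M \<U> z" "td_cocycle M \<U>' z'"
    unfolding td_rel_iff td_cocycles_iff by blast
  have "td_equiv M \<W> (td_pull t z) (td_pull t' z')"
    if W: "open_cover M \<W>" "refinement \<W> \<V> s" "refinement \<W> \<U> t" "refinement \<W> \<U>' t'" for \<W> s t t'
  proof -
    note rs = refinement_comp[OF W(2) V(2)] and rs' = refinement_comp[OF W(2) V(3)]
    note co = td_cocycle_pull[OF c(1) W(1) W(3) c(3)] td_cocycle_pull[OF c(1) W(1) rs c(3)]
      td_cocycle_pull[OF c(2) W(1) rs' c(4)]
    have 1: "td_equiv M \<W> (td_pull t z) (td_pull (r \<circ> s) z)"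
      by (rule td_equiv_pulls[OF c(1) W(1) W(3) rs c(3)])
    have 2: "td_equiv M \<W> (td_pull (r \<circ> s) z) (td_pull (r' \<circ> s) z')"
      using td_equiv_pull[OF W(1,2) eq] unfolding td_pull_pull .
    have 3: "td_equiv M \<W> (td_pull (r' \<circ> s) z') (td_pull t' z')"
      by (rule td_equiv_pulls[OF c(2) W(1) rs' W(4) c(4)])
    show ?thesis
      by (rule td_equiv_trans[OF W(1) co(1,2) 1 td_equiv_trans[OF W(1) co(2,3) 2 3]])
  qed
  with V show ?thesis by blast
qed

lemma td_rel_refl: "(\<U>, z) \<in> td_cocycles M \<Longrightarrow> ((\<U>, z), (\<U>, z)) \<in> td_rel M"
  unfolding td_rel_iff using td_equiv_refl refinement_id td_cocycles_iff by blast

lemma td_rel_sym: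
  assumes "((\<U>, z), (\<U>', z')) \<in> td_rel M" shows "((\<U>', z'), (\<U>, z)) \<in> td_rel M"
proof -
  from assms obtain \<V> r r' where V: "open_cover M \<V>" "refinement \<V> \<U> r" "refinement \<V> \<U>' r'"
    and eq: "td_equiv M \<V> (td_pull r z) (td_pull r' z')"
    and c: "(\<U>, z) \<in> td_cocycles M" "(\<U>', z') \<in> td_cocycles M"
    unfolding td_rel_iff by blast
  have "td_equiv M \<V> (td_pull r' z') (td_pull r z)"
    using td_equiv_sym[OF V(1) _ _ eq] td_cocycles_pull[OF c(1) V(1,2)] td_cocycles_pull[OF c(2) V(1,3)]
    unfolding td_cocycles_iff by blast
  then show ?thesis unfolding td_rel_iff using V c by blast
qed

lemma td_rel_trans:
  assumes 1: "((\<U>, z), (\<U>', z')) \<in> td_rel M" and 2: "((\<U>', z'), (\<U>'', z'')) \<in> td_rel M"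
  shows "((\<U>, z), (\<U>'', z'')) \<in> td_rel M"
proof -
  obtain \<V> r r' where V: "open_cover M \<V>" "refinement \<V> \<U> r" "refinement \<V> \<U>' r'"
    "\<forall>\<W> s t t'. open_cover M \<W> \<longrightarrow> refinement \<W> \<V> s \<longrightarrow> refinement \<W> \<U> t \<longrightarrow> refinement \<W> \<U>' t' \<longrightarrow>
      td_equiv M \<W> (td_pull t z) (td_pull t' z')"
    using td_rel_on_refinements[OF 1] by (elim exE conjE)
  obtain \<V>' q q' where V': "open_cover M \<V>'" "refinement \<V>' \<U>' q" "refinement \<V>' \<U>'' q'"
    "\<forall>\<W> s t t'. open_cover M \<W> \<longrightarrow> refinement \<W> \<V>' s \<longrightarrow> refinement \<W> \<U>' t \<longrightarrow> refinement \<W> \<U>'' t' \<longrightarrow>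
      td_equiv M \<W> (td_pull t z') (td_pull t' z'')"
    using td_rel_on_refinements[OF 2] by (elim exE conjE)
  obtain \<W> s s' where W: "open_cover M \<W>" "refinement \<W> \<V> s" "refinement \<W> \<V>' s'"
    by (rule common_refinement[OF V(1) V'(1)])
  have c: "(\<U>, z) \<in> td_cocycles M" "(\<U>', z') \<in> td_cocycles M" "(\<U>'', z'') \<in> td_cocycles M"
    using 1 2 unfolding td_rel_iff by auto
  note a = refinement_comp[OF W(2) V(2)] and b = refinement_comp[OF W(2) V(3)]
    and d = refinement_comp[OF W(3) V'(3)]
  have "td_equiv M \<W> (td_pull (r \<circ> s) z) (td_pull (q' \<circ> s') z'')"
    using td_equiv_trans[OF W(1) _ _ V(4)[rule_format, OF W(1,2) a b] V'(4)[rule_format, OF W(1,3) b d]]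
      td_cocycles_pull[OF c(1) W(1) a] td_cocycles_pull[OF c(2) W(1) b]
    unfolding td_cocycles_iff by blast
  then show ?thesis unfolding td_rel_iff using c W(1) a d by blast
qed

lemma equiv_td_rel: "equiv (td_cocycles M) (td_rel M)"
proof (rule equivI)
  show "td_rel M \<subseteq> td_cocycles M \<times> td_cocycles M" unfolding td_rel_def by auto
  show "refl_on (td_cocycles M) (td_rel M)" by (rule refl_onI) (auto intro: td_rel_refl)
  show "sym (td_rel M)" by (rule symI) (auto intro: td_rel_sym)
  show "trans (td_rel M)" by (rule transI) (auto intro: td_rel_trans)
qed

lemma td_rel_pull:
  assumes "(\<U>, z) \<in> td_cocycles M" "open_cover M \<V>" "refinement \<V> \<U> r"
  shows "((\<U>, z), (\<V>, td_pull r z)) \<in> td_rel M"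
proof -
  have "td_pull id (td_pull r z) = td_pull r z" by (simp add: td_pull_pull)
  then have "td_equiv M \<V> (td_pull r z) (td_pull id (td_pull r z))"
    using td_equiv_refl[OF assms(2)] by simp
  then show ?thesis
    unfolding td_rel_iff using assms td_cocycles_pull[OF assms] refinement_id by blast
qed

lemma deligne_cocycles_iff_td:
  "(\<U>, g) \<in> deligne_cocycles M \<longleftrightarrow> (\<U>, td_shift g td_zero :: ('x, 'e, 1) td) \<in> td_cocycles M"
  unfolding deligne_cocycles_iff td_cocycles_iff
  by (rule conj_cong[OF refl]) (rule deligne_cocycle_iff)

lemma deligne_rel_iff_td:
  "((\<U>, g), (\<U>', g')) \<in> deligne_rel M \<longleftrightarrow>
    ((\<U>, td_shift g td_zero :: ('x, 'e, 1) td), (\<U>', td_shift g' td_zero)) \<in> td_rel M"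
  unfolding deligne_rel_iff td_rel_iff td_pull_shift td_pull_zero deligne_cocycles_iff_td
  by (intro conj_cong refl ex_cong1) (simp add: deligne_equiv_iff cong: conj_cong)

lemma equiv_deligne_rel: "equiv (deligne_cocycles M) (deligne_rel M)"
proof (rule equivI)
  show "deligne_rel M \<subseteq> deligne_cocycles M \<times> deligne_cocycles M" unfolding deligne_rel_def by auto
  show "refl_on (deligne_cocycles M) (deligne_rel M)"
    by (rule refl_onI) (auto intro: td_rel_refl simp: deligne_rel_iff_td deligne_cocycles_iff_td)
  show "sym (deligne_rel M)" by (rule symI) (auto intro: td_rel_sym simp: deligne_rel_iff_td)
  show "trans (deligne_rel M)" by (rule transI) (auto intro: td_rel_trans simp: deligne_rel_iff_td)
qed

lemma deligne_cocycles_pull: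
  assumes "(\<U>, g) \<in> deligne_cocycles M" "open_cover M \<V>" "refinement \<V> \<U> r"
  shows "(\<V>, deligne_pull r g) \<in> deligne_cocycles M"
  using td_cocycles_pull[OF assms(1)[unfolded deligne_cocycles_iff_td] assms(2,3)]
  unfolding deligne_cocycles_iff_td td_pull_shift td_pull_zero .

lemma deligne_rel_pull:
  assumes "(\<U>, g) \<in> deligne_cocycles M" "open_cover M \<V>" "refinement \<V> \<U> r"
  shows "((\<U>, g), (\<V>, deligne_pull r g)) \<in> deligne_rel M"
  using td_rel_pull[OF assms(1)[unfolded deligne_cocycles_iff_td] assms(2,3)]
  unfolding deligne_rel_iff_td td_pull_shift td_pull_zero .

lemma td_shift_rel:
  assumes 1: "((\<U>, g), (\<U>', g')) \<in> deligne_rel M" and 2: "((\<U>, z), (\<U>', z')) \<in> td_rel M"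
  shows "((\<U>, td_shift g z), (\<U>', td_shift g' z')) \<in> td_rel M"
proof -
  have c: "(\<U>, g) \<in> deligne_cocycles M" "(\<U>', g') \<in> deligne_cocycles M"
    "(\<U>, z) \<in> td_cocycles M" "(\<U>', z') \<in> td_cocycles M"
    using 1 2 unfolding td_rel_iff deligne_rel_iff by auto
  obtain \<V> r r' where V: "open_cover M \<V>" "refinement \<V> \<U> r" "refinement \<V> \<U>' r'"
    "\<forall>\<W> s t t'. open_cover M \<W> \<longrightarrow> refinement \<W> \<V> s \<longrightarrow> refinement \<W> \<U> t \<longrightarrow> refinement \<W> \<U>' t' \<longrightarrow>
      td_equiv M \<W> (td_pull t (td_shift g td_zero :: ('x, 'e, 1) td)) (td_pull t' (td_shift g' td_zero))"
    using td_rel_on_refinements[OF 1[unfolded deligne_rel_iff_td]] by (elim exE conjE)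
  obtain \<V>' q q' where V': "open_cover M \<V>'" "refinement \<V>' \<U> q" "refinement \<V>' \<U>' q'"
    "\<forall>\<W> s t t'. open_cover M \<W> \<longrightarrow> refinement \<W> \<V>' s \<longrightarrow> refinement \<W> \<U> t \<longrightarrow> refinement \<W> \<U>' t' \<longrightarrow>
      td_equiv M \<W> (td_pull t z) (td_pull t' z')"
    using td_rel_on_refinements[OF 2] by (elim exE conjE)
  obtain \<W> s s' where W: "open_cover M \<W>" "refinement \<W> \<V> s" "refinement \<W> \<V>' s'"
    by (rule common_refinement[OF V(1) V'(1)])
  note a = refinement_comp[OF W(2) V(2)] and b = refinement_comp[OF W(2) V(3)]
  have "deligne_equiv M \<W> (deligne_pull (r \<circ> s) g) (deligne_pull (r' \<circ> s) g')"
    using V(4)[rule_format, OF W(1,2) a b] unfolding td_pull_shift td_pull_zero deligne_equiv_iff[OF W(1)] .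
  from td_equiv_shift[OF W(1) this V'(4)[rule_format, OF W(1,3) a b]]
  have "td_equiv M \<W> (td_pull (r \<circ> s) (td_shift g z)) (td_pull (r' \<circ> s) (td_shift g' z'))"
    unfolding td_pull_shift .
  moreover have "(\<U>, td_shift g z) \<in> td_cocycles M" "(\<U>', td_shift g' z') \<in> td_cocycles M"
    using c td_cocycle_shift unfolding td_cocycles_iff deligne_cocycles_iff by blast+
  ultimately show ?thesis unfolding td_rel_iff using W(1) a b by blast
qed

lemma deligne_add_rel:
  assumes "((\<U>, g), (\<U>', g')) \<in> deligne_rel M" "((\<U>, h), (\<U>', h')) \<in> deligne_rel M"
  shows "((\<U>, deligne_add g h), (\<U>', deligne_add g' h')) \<in> deligne_rel M"
  using td_shift_rel[OF assms(1) assms(2)[unfolded deligne_rel_iff_td]]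
  unfolding deligne_rel_iff_td td_shift_add .

end

section \<open>Group actions and quotients by a common stabilizer\<close>

lemma group_actionI:
  assumes G: "group G"
    and ext: "\<And>g. g \<in> carrier G \<Longrightarrow> \<phi> g \<in> extensional E"
    and mem: "\<And>g x. g \<in> carrier G \<Longrightarrow> x \<in> E \<Longrightarrow> \<phi> g x \<in> E"
    and one: "\<And>x. x \<in> E \<Longrightarrow> \<phi> \<one>\<^bsub>G\<^esub> x = x"
    and mult: "\<And>g h x. g \<in> carrier G \<Longrightarrow> h \<in> carrier G \<Longrightarrow> x \<in> E \<Longrightarrow> \<phi> (g \<otimes>\<^bsub>G\<^esub> h) x = \<phi> g (\<phi> h x)"
  shows "group_action G E \<phi>"
proof -
  interpret group G by (rule G)
  have bij: "\<phi> g \<in> Bij E" if g: "g \<in> carrier G" for g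
  proof -
    have "\<phi> (inv\<^bsub>G\<^esub> g) (\<phi> g x) = x" "\<phi> g (\<phi> (inv\<^bsub>G\<^esub> g) x) = x" if "x \<in> E" for x
      using mult[of "inv\<^bsub>G\<^esub> g" g x] mult[of g "inv\<^bsub>G\<^esub> g" x] one[OF that] that g by simp_all
    then have "bij_betw (\<phi> g) E E"
      by (intro bij_betw_byWitness[where f' = "\<phi> (inv\<^bsub>G\<^esub> g)"]) (use mem g inv_closed in auto)
    then show ?thesis using ext[OF g] by (simp add: Bij_def)
  qed
  have "\<phi> (g \<otimes>\<^bsub>G\<^esub> h) = compose E (\<phi> g) (\<phi> h)" if "g \<in> carrier G" "h \<in> carrier G" for g h
    by (rule extensionalityI[OF ext compose_extensional]) (use that mult in \<open>auto simp: compose_def\<close>)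
  then have "\<phi> \<in> hom G (BijGroup E)"
    by (intro homI) (auto simp: BijGroup_def bij)
  then show ?thesis
    by (simp add: group_action_def group_hom_def group_hom_axioms_def G group_BijGroup)
qed

text \<open>All elements of a coset \<open>N g\<close> move \<open>x\<close> to \<open>g x\<close>, because \<open>N\<close> fixes \<open>g x\<close> as well.\<close>

lemma quotient_by_common_stabilizer:
  assumes N: "N \<lhd> G"
    and mem: "\<And>g x. g \<in> carrier G \<Longrightarrow> x \<in> E \<Longrightarrow> \<phi> g x \<in> E"
    and one: "\<And>x. x \<in> E \<Longrightarrow> \<phi> \<one>\<^bsub>G\<^esub> x = x"
    and mult: "\<And>g h x. g \<in> carrier G \<Longrightarrow> h \<in> carrier G \<Longrightarrow> x \<in> E \<Longrightarrow> \<phi> (g \<otimes>\<^bsub>G\<^esub> h) x = \<phi> g (\<phi> h x)"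
    and trans: "\<And>x y. x \<in> E \<Longrightarrow> y \<in> E \<Longrightarrow> \<exists>g\<in>carrier G. \<phi> g x = y"
    and stab: "\<And>x. x \<in> E \<Longrightarrow> stabilizer G \<phi> x = N"
  shows "transitive_action (G Mod N) E (coset_act \<phi> E)"
    and "x \<in> E \<Longrightarrow> stabilizer (G Mod N) (coset_act \<phi> E) x = {\<one>\<^bsub>G Mod N\<^esub>}"
proof -
  interpret normal N G by (rule N)
  have NE: "\<phi> n x = x" if "n \<in> N" "x \<in> E" for n x
    using stab[OF that(2)] that(1) unfolding stabilizer_def by blast
  have act: "coset_act \<phi> E (N #>\<^bsub>G\<^esub> g) x = \<phi> g x" if g: "g \<in> carrier G" "x \<in> E" for g x
  proof -
    have "\<phi> h x = \<phi> g x" if h: "h \<in> N #>\<^bsub>G\<^esub> g" for h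
    proof -
      obtain n where n: "n \<in> N" "h = n \<otimes>\<^bsub>G\<^esub> g" using h unfolding r_coset_def by blast
      then show ?thesis using mult[of n g x] NE[OF n(1) mem[OF g]] g mem_carrier[OF n(1)] by simp
    qed
    moreover have "g \<in> N #>\<^bsub>G\<^esub> g" by (rule rcos_self[OF g(1) subgroup_axioms])
    ultimately have "(\<lambda>h. \<phi> h x) ` (N #>\<^bsub>G\<^esub> g) = {\<phi> g x}" by blast
    then show ?thesis using g(2) by (simp add: coset_act_def)
  qed
  have coset: "\<exists>g\<in>carrier G. S = N #>\<^bsub>G\<^esub> g" if "S \<in> carrier (G Mod N)" for S
    using that unfolding FactGroup_def RCOSETS_def by auto
  have carr: "N #>\<^bsub>G\<^esub> g \<in> carrier (G Mod N)" if "g \<in> carrier G" for g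
    using that unfolding FactGroup_def RCOSETS_def by auto
  have oneN: "\<one>\<^bsub>G Mod N\<^esub> = N #>\<^bsub>G\<^esub> \<one>\<^bsub>G\<^esub>"
    by (simp add: FactGroup_def coset_mult_one subset)
  have "group_action (G Mod N) E (coset_act \<phi> E)"
  proof (rule group_actionI[OF factorgroup_is_group])
    show "coset_act \<phi> E S \<in> extensional E" for S by (simp add: coset_act_def)
    show "coset_act \<phi> E S x \<in> E" if "S \<in> carrier (G Mod N)" "x \<in> E" for S x
      using coset[OF that(1)] act mem that(2) by auto
    show "coset_act \<phi> E \<one>\<^bsub>G Mod N\<^esub> x = x" if "x \<in> E" for x
      using act[OF one_closed that] one[OF that] unfolding oneN by simp
    show "coset_act \<phi> E (S \<otimes>\<^bsub>G Mod N\<^esub> T) x = coset_act \<phi> E S (coset_act \<phi> E T x)"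
      if ST: "S \<in> carrier (G Mod N)" "T \<in> carrier (G Mod N)" and x: "x \<in> E" for S T x
    proof -
      obtain g h where g: "g \<in> carrier G" "S = N #>\<^bsub>G\<^esub> g" and h: "h \<in> carrier G" "T = N #>\<^bsub>G\<^esub> h"
        using coset ST by blast
      have "S \<otimes>\<^bsub>G Mod N\<^esub> T = N #>\<^bsub>G\<^esub> (g \<otimes>\<^bsub>G\<^esub> h)"
        unfolding g h by (simp add: FactGroup_def rcos_sum g h)
      then show ?thesis
        using act[of "g \<otimes>\<^bsub>G\<^esub> h" x] act[OF h(1) x] act[OF g(1) mem[OF h(1) x]] mult[OF g(1) h(1) x] g h x
        by simp
    qed
  qed
  moreover have "\<exists>S\<in>carrier (G Mod N). coset_act \<phi> E S x = y" if "x \<in> E" "y \<in> E" for x y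
    using trans[OF that] act[OF _ that(1)] carr by metis
  ultimately show "transitive_action (G Mod N) E (coset_act \<phi> E)"
    by (simp add: transitive_action_def transitive_action_axioms_def)
  show "stabilizer (G Mod N) (coset_act \<phi> E) x = {\<one>\<^bsub>G Mod N\<^esub>}" if x: "x \<in> E"
  proof
    show "{\<one>\<^bsub>G Mod N\<^esub>} \<subseteq> stabilizer (G Mod N) (coset_act \<phi> E) x"
      unfolding stabilizer_def oneN using carr[OF one_closed] act[OF one_closed x] one[OF x] by simp
    show "stabilizer (G Mod N) (coset_act \<phi> E) x \<subseteq> {\<one>\<^bsub>G Mod N\<^esub>}"
    proof
      fix S assume "S \<in> stabilizer (G Mod N) (coset_act \<phi> E) x"
      then have S: "S \<in> carrier (G Mod N)" "coset_act \<phi> E S x = x" unfolding stabilizer_def by auto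
      obtain g where g: "g \<in> carrier G" "S = N #>\<^bsub>G\<^esub> g" using coset[OF S(1)] by blast
      then have "\<phi> g x = x" using act[OF g(1) x] S(2) by simp
      then have "g \<in> N" using g(1) stab[OF x] unfolding stabilizer_def by blast
      then have "S = N" using g rcos_const by simp
      then show "S \<in> {\<one>\<^bsub>G Mod N\<^esub>}" by (simp add: FactGroup_def)
    qed
  qed
qed

text \<open>Product and action are defined as images of sets of sums of representatives; this identifies such an image
  with a single class.\<close>

lemma Image_class:
  assumes "equiv A R" "x \<in> S" "\<And>y. y \<in> S \<Longrightarrow> (x, y) \<in> R"
  shows "R `` S = R `` {x}"
proof
  show "R `` {x} \<subseteq> R `` S" using assms(2) by blast
  show "R `` S \<subseteq> R `` {x}"
    using assms(3) equivE[OF assms(1)] by (blast dest: transD)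
qed

section \<open>The group of gerbes and its action\<close>

context manifold begin

lemma deligne_class_eq_iff:
  assumes "(\<U>, g) \<in> deligne_cocycles M" "(\<V>, h) \<in> deligne_cocycles M"
  shows "deligne_rel M `` {(\<U>, g)} = deligne_rel M `` {(\<V>, h)} \<longleftrightarrow> ((\<U>, g), (\<V>, h)) \<in> deligne_rel M"
  using eq_equiv_class_iff[OF equiv_deligne_rel assms] .

lemma td_class_eq_iff:
  assumes "(\<U>, g) \<in> td_cocycles M" "(\<V>, h) \<in> td_cocycles M"
  shows "td_rel M `` {(\<U>, g)} = td_rel M `` {(\<V>, h)} \<longleftrightarrow> ((\<U>, g), (\<V>, h)) \<in> td_rel M"
  using eq_equiv_class_iff[OF equiv_td_rel assms] .

lemma deligne_class_pull:
  assumes "(\<U>, g) \<in> deligne_cocycles M" "open_cover M \<V>" "refinement \<V> \<U> r"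
  shows "deligne_rel M `` {(\<U>, g)} = deligne_rel M `` {(\<V>, deligne_pull r g)}"
  using deligne_class_eq_iff[OF assms(1) deligne_cocycles_pull[OF assms]] deligne_rel_pull[OF assms] by simp

lemma td_class_pull:
  assumes "(\<U>, z) \<in> td_cocycles M" "open_cover M \<V>" "refinement \<V> \<U> r"
  shows "td_rel M `` {(\<U>, z)} = td_rel M `` {(\<V>, td_pull r z)}"
  using td_class_eq_iff[OF assms(1) td_cocycles_pull[OF assms]] td_rel_pull[OF assms] by simp

lemma H3_carrierI: "(\<U>, g) \<in> deligne_cocycles M \<Longrightarrow> deligne_rel M `` {(\<U>, g)} \<in> carrier (H3 M)"
  unfolding H3_def by (simp add: quotientI)

lemma H1TD_I: "(\<U>, z) \<in> td_cocycles M \<Longrightarrow> td_rel M `` {(\<U>, z)} \<in> H1TD M"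
  unfolding H1TD_def by (rule quotientI)

lemma H3_carrierE:
  assumes "K \<in> carrier (H3 M)"
  obtains \<U> g where "open_cover M \<U>" "(\<U>, g) \<in> deligne_cocycles M" "K = deligne_rel M `` {(\<U>, g)}"
proof -
  from assms have "K \<in> deligne_cocycles M // deligne_rel M" unfolding H3_def by simp
  then obtain y where y: "y \<in> deligne_cocycles M" "K = deligne_rel M `` {y}" by (rule quotientE)
  obtain \<U> g where "y = (\<U>, g)" by (cases y)
  with y show ?thesis using that deligne_cocycles_iff by blast
qed

lemma H1TD_E:
  assumes "L \<in> H1TD M"
  obtains \<U> z where "open_cover M \<U>" "(\<U>, z) \<in> td_cocycles M" "L = td_rel M `` {(\<U>, z)}"
proof -
  from assms obtain y where y: "y \<in> td_cocycles M" "L = td_rel M `` {y}"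
    unfolding H1TD_def by (rule quotientE)
  obtain \<U> z where "y = (\<U>, z)" by (cases y)
  with y show ?thesis using that td_cocycles_iff by blast
qed

text \<open>Representatives of several classes on one cover are obtained by restricting to a common
  refinement.\<close>

lemma H3_H3_common:
  assumes "K \<in> carrier (H3 M)" "L \<in> carrier (H3 M)"
  obtains \<U> g h where "open_cover M \<U>" "(\<U>, g) \<in> deligne_cocycles M" "(\<U>, h) \<in> deligne_cocycles M"
    "K = deligne_rel M `` {(\<U>, g)}" "L = deligne_rel M `` {(\<U>, h)}"
proof -
  obtain \<U> g where g: "open_cover M \<U>" "(\<U>, g) \<in> deligne_cocycles M" "K = deligne_rel M `` {(\<U>, g)}"
    by (rule H3_carrierE[OF assms(1)])
  obtain \<V> h where h: "open_cover M \<V>" "(\<V>, h) \<in> deligne_cocycles M" "L = deligne_rel M `` {(\<V>, h)}"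
    by (rule H3_carrierE[OF assms(2)])
  obtain \<W> r s where W: "open_cover M \<W>" "refinement \<W> \<U> r" "refinement \<W> \<V> s"
    by (rule common_refinement[OF g(1) h(1)])
  show ?thesis
    by (rule that[OF W(1) deligne_cocycles_pull[OF g(2) W(1,2)] deligne_cocycles_pull[OF h(2) W(1,3)]])
       (simp_all add: g h deligne_class_pull[OF g(2) W(1,2)] deligne_class_pull[OF h(2) W(1,3)])
qed

lemma H3_H1TD_common:
  assumes "K \<in> carrier (H3 M)" "L \<in> H1TD M"
  obtains \<U> g z where "open_cover M \<U>" "(\<U>, g) \<in> deligne_cocycles M" "(\<U>, z) \<in> td_cocycles M"
    "K = deligne_rel M `` {(\<U>, g)}" "L = td_rel M `` {(\<U>, z)}"
proof -
  obtain \<U> g where g: "open_cover M \<U>" "(\<U>, g) \<in> deligne_cocycles M" "K = deligne_rel M `` {(\<U>, g)}"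
    by (rule H3_carrierE[OF assms(1)])
  obtain \<V> z where z: "open_cover M \<V>" "(\<V>, z) \<in> td_cocycles M" "L = td_rel M `` {(\<V>, z)}"
    by (rule H1TD_E[OF assms(2)])
  obtain \<W> r s where W: "open_cover M \<W>" "refinement \<W> \<U> r" "refinement \<W> \<V> s"
    by (rule common_refinement[OF g(1) z(1)])
  show ?thesis
    by (rule that[OF W(1) deligne_cocycles_pull[OF g(2) W(1,2)] td_cocycles_pull[OF z(2) W(1,3)]])
       (simp_all add: g z deligne_class_pull[OF g(2) W(1,2)] td_class_pull[OF z(2) W(1,3)])
qed

lemma deligne_cocycles_add:
  assumes "(\<U>, g) \<in> deligne_cocycles M" "(\<U>, h) \<in> deligne_cocycles M"
  shows "(\<U>, deligne_add g h) \<in> deligne_cocycles M"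
proof -
  have U: "open_cover M \<U>" "deligne_cocycle M \<U> g" using assms unfolding deligne_cocycles_iff by auto
  have "td_cocycle M \<U> (td_shift h td_zero :: ('x, 'e, 1) td)"
    using assms(2) unfolding deligne_cocycles_iff_td td_cocycles_iff by blast
  from td_cocycle_shift[OF U(1) this U(2)] show ?thesis
    unfolding deligne_cocycles_iff_td td_cocycles_iff td_shift_add using U(1) by blast
qed

lemma td_cocycles_shift:
  assumes "(\<U>, g) \<in> deligne_cocycles M" "(\<U>, z) \<in> td_cocycles M"
  shows "(\<U>, td_shift g z) \<in> td_cocycles M"
  using assms td_cocycle_shift unfolding deligne_cocycles_iff td_cocycles_iff by blast

lemma H3_mult_class:
  assumes g: "(\<U>, g) \<in> deligne_cocycles M" and h: "(\<U>, h) \<in> deligne_cocycles M"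
  shows "deligne_rel M `` {(\<U>, g)} \<otimes>\<^bsub>H3 M\<^esub> deligne_rel M `` {(\<U>, h)} =
    deligne_rel M `` {(\<U>, deligne_add g h)}"
proof -
  let ?S = "{(\<V>, deligne_add g' h') |\<V> g' h'. (\<V>, g') \<in> deligne_rel M `` {(\<U>, g)} \<and>
    (\<V>, h') \<in> deligne_rel M `` {(\<U>, h)}}"
  have "deligne_rel M `` ?S = deligne_rel M `` {(\<U>, deligne_add g h)}"
  proof (rule Image_class[OF equiv_deligne_rel])
    have "(\<U>, g) \<in> deligne_rel M `` {(\<U>, g)}" "(\<U>, h) \<in> deligne_rel M `` {(\<U>, h)}"
      using equiv_class_self[OF equiv_deligne_rel] g h by blast+
    then show "(\<U>, deligne_add g h) \<in> ?S" by blast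
    show "((\<U>, deligne_add g h), y) \<in> deligne_rel M" if "y \<in> ?S" for y
      using that deligne_add_rel by blast
  qed
  then show ?thesis unfolding H3_def by simp
qed

lemma td_act_class:
  assumes g: "(\<U>, g) \<in> deligne_cocycles M" and z: "(\<U>, z) \<in> td_cocycles M"
  shows "td_act M (deligne_rel M `` {(\<U>, g)}) (td_rel M `` {(\<U>, z)}) = td_rel M `` {(\<U>, td_shift g z)}"
proof -
  let ?S = "{(\<V>, td_shift g' z') |\<V> g' z'. (\<V>, g') \<in> deligne_rel M `` {(\<U>, g)} \<and>
    (\<V>, z') \<in> td_rel M `` {(\<U>, z)}}"
  have "td_rel M `` ?S = td_rel M `` {(\<U>, td_shift g z)}"
  proof (rule Image_class[OF equiv_td_rel])
    have "(\<U>, g) \<in> deligne_rel M `` {(\<U>, g)}" "(\<U>, z) \<in> td_rel M `` {(\<U>, z)}"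
      using equiv_class_self[OF equiv_deligne_rel g] equiv_class_self[OF equiv_td_rel z] by blast+
    then show "(\<U>, td_shift g z) \<in> ?S" by blast
    show "((\<U>, td_shift g z), y) \<in> td_rel M" if "y \<in> ?S" for y
      using that td_shift_rel by blast
  qed
  then show ?thesis using H1TD_I[OF z] unfolding td_act_def by simp
qed

definition trivial_deligne :: "('x, 'e, real) form2 \<Rightarrow> ('x, 'e) deligne" where
  "trivial_deligne \<beta> = \<lparr>DB = \<lambda>i. \<beta>, DA = \<lambda>i j c x v. 0, Dc = \<lambda>i j k x. 0\<rparr>"

lemma trivial_deligne_cocycles:
  assumes U: "open_cover M \<U>" and \<beta>: "is_form2 M (points M) \<beta>"
  shows "(\<U>, trivial_deligne \<beta>) \<in> deligne_cocycles M"
proof -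
  note op = open_coverD(1)[OF U] and pt = open_coverD(2)[OF U]
  have "deligne_cocycle M \<U> (trivial_deligne \<beta>)"
  proof (rule deligne_cocycleI; (unfold trivial_deligne_def deligne.simps)?)
    show "is_form2 M i \<beta>" if "i \<in> \<U>" for i by (rule is_form2_subset[OF \<beta> pt[OF that]])
    show "is_form1 M (i \<inter> j) (\<lambda>c x v. 0)" if "i \<in> \<U>" "j \<in> \<U>" for i j
      using op that by (intro is_form1_zero) blast
    show "smooth_circle M (i \<inter> j \<inter> k) (\<lambda>x. 0)" if "i \<in> \<U>" "j \<in> \<U>" "k \<in> \<U>" for i j k
      using op pt that by (intro smooth_circle_zero) blast+
  qed (simp_all add: mc_zero)
  with U show ?thesis unfolding deligne_cocycles_iff by blast
qed

lemma open_cover_points: "open_cover M {points M}"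
  unfolding open_cover_def using open_points by simp

text \<open>The cocycle of a trivial gerbe does not depend on the indices, so it is its own restriction to every cover.\<close>

lemma trivial_gerbe_eq:
  assumes U: "open_cover M \<U>" and \<beta>: "is_form2 M (points M) \<beta>"
  shows "trivial_gerbe M \<beta> = deligne_rel M `` {(\<U>, trivial_deligne \<beta>)}"
proof -
  have "refinement \<U> {points M} (\<lambda>_. points M)"
    using open_coverD(2)[OF U] unfolding refinement_def by simp
  from deligne_class_pull[OF trivial_deligne_cocycles[OF open_cover_points \<beta>] U this]
  show ?thesis unfolding trivial_gerbe_def by (simp add: trivial_deligne_def deligne_pull_def)
qed

lemma trivial_gerbe_carrier:
  "is_form2 M (points M) \<beta> \<Longrightarrow> trivial_gerbe M \<beta> \<in> carrier (H3 M)"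
  using H3_carrierI[OF trivial_deligne_cocycles[OF open_cover_points]] trivial_gerbe_eq[OF open_cover_points]
  by simp

lemma H3_one: "open_cover M \<U> \<Longrightarrow> \<one>\<^bsub>H3 M\<^esub> = deligne_rel M `` {(\<U>, trivial_deligne (\<lambda>c x v w. 0))}"
  using trivial_gerbe_eq[OF _ is_form2_zero[OF open_points]] unfolding H3_def by simp

lemma trivial_gerbe_mult:
  assumes "is_form2 M (points M) \<beta>" "is_form2 M (points M) \<gamma>"
  shows "trivial_gerbe M \<beta> \<otimes>\<^bsub>H3 M\<^esub> trivial_gerbe M \<gamma> = trivial_gerbe M (\<lambda>c x v w. \<beta> c x v w + \<gamma> c x v w)"
proof -
  have "deligne_add (trivial_deligne \<beta>) (trivial_deligne \<gamma>) =
      trivial_deligne (\<lambda>c x v w. \<beta> c x v w + \<gamma> c x v w)"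
    by (simp add: deligne_add_def trivial_deligne_def)
  then show ?thesis
    using H3_mult_class[OF trivial_deligne_cocycles[OF open_cover_points assms(1)]
        trivial_deligne_cocycles[OF open_cover_points assms(2)]]
    by (simp add: trivial_gerbe_eq[OF open_cover_points] assms is_form2_add[OF open_points])
qed

definition deligne_minus :: "('x, 'e) deligne \<Rightarrow> ('x, 'e) deligne" where
  "deligne_minus g = \<lparr>DB = \<lambda>i c x v w. - DB g i c x v w, DA = \<lambda>i j c x v. - DA g i j c x v,
     Dc = \<lambda>i j k x. - Dc g i j k x\<rparr>"

lemma deligne_cocycles_minus:
  assumes "(\<U>, g) \<in> deligne_cocycles M" shows "(\<U>, deligne_minus g) \<in> deligne_cocycles M"
proof -
  have U: "open_cover M \<U>" and g: "deligne_cocycle M \<U> g" using assms unfolding deligne_cocycles_iff by auto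
  note op = open_coverD(1)[OF U]
  have "deligne_cocycle M \<U> (deligne_minus g)"
  proof (rule deligne_cocycleI; (unfold deligne_minus_def deligne.simps)?)
    fix i assume i: "i \<in> \<U>"
    show "is_form2 M i (\<lambda>c x v w. - DB g i c x v w)"
      by (rule is_form2_minus[OF op[OF i] deligne_cocycleD(1)[OF g i]])
    fix j assume j: "j \<in> \<U>"
    show "is_form1 M (i \<inter> j) (\<lambda>c x v. - DA g i j c x v)"
      by (rule is_form1_minus[OF open_Int[OF op[OF i] op[OF j]] deligne_cocycleD(2)[OF g i j]])
    show "- DB g j c x v w + d1 (\<lambda>c x v. - DA g i j c x v) c x v w = - DB g i c x v w"
      if c: "c \<in> M" "x \<in> i" "x \<in> j" "x \<in> cdom c" for c x v w
    proof -
      have x: "x \<in> i \<inter> j" using c by simp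
      show ?thesis using deligne_cocycleD(4)[OF g i j c, of v w]
        d1_minus[OF deligne_cocycleD(2)[OF g i j] c(1) x c(4), of v w] by simp
    qed
    fix k assume k: "k \<in> \<U>"
    note s = deligne_cocycleD(3)[OF g i j k]
    show "smooth_circle M (i \<inter> j \<inter> k) (\<lambda>x. - Dc g i j k x)" by (rule smooth_circle_minus[OF s])
    show "- DA g i k c x v = - DA g i j c x v + - DA g j k c x v - mc M (\<lambda>x. - Dc g i j k x) c x v"
      if c: "c \<in> M" "x \<in> i" "x \<in> j" "x \<in> k" "x \<in> cdom c" for c x v
    proof -
      have x: "x \<in> i \<inter> j \<inter> k" using c by simp
      show ?thesis using deligne_cocycleD(5)[OF g i j k c, of v] mc_minus[OF s c(1) x c(5), of v] by simp
    qed
    show "- Dc g j k l x + - Dc g i j l x = - Dc g i j k x + - Dc g i k l x"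
      if "l \<in> \<U>" "x \<in> i" "x \<in> j" "x \<in> k" "x \<in> l" for l x
      using arg_cong[OF deligne_cocycleD(6)[OF g i j k that], of uminus] by (simp add: algebra_simps)
  qed
  with U show ?thesis unfolding deligne_cocycles_iff by blast
qed

lemma H3_comm_group: "comm_group (H3 M)"
proof (rule comm_groupI)
  fix K L assume K: "K \<in> carrier (H3 M)" and L: "L \<in> carrier (H3 M)"
  obtain \<U> g h where U: "open_cover M \<U>" "(\<U>, g) \<in> deligne_cocycles M" "(\<U>, h) \<in> deligne_cocycles M"
    "K = deligne_rel M `` {(\<U>, g)}" "L = deligne_rel M `` {(\<U>, h)}"
    by (rule H3_H3_common[OF K L])
  show "K \<otimes>\<^bsub>H3 M\<^esub> L \<in> carrier (H3 M)"
    unfolding U(4,5) H3_mult_class[OF U(2,3)] by (rule H3_carrierI[OF deligne_cocycles_add[OF U(2,3)]])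
  have "deligne_add g h = deligne_add h g"
    by (simp add: deligne_add_def fun_eq_iff add.commute)
  then show "K \<otimes>\<^bsub>H3 M\<^esub> L = L \<otimes>\<^bsub>H3 M\<^esub> K"
    unfolding U(4,5) H3_mult_class[OF U(2,3)] H3_mult_class[OF U(3,2)] by simp
  fix N assume "N \<in> carrier (H3 M)"
  then obtain \<V> k where V: "open_cover M \<V>" "(\<V>, k) \<in> deligne_cocycles M" "N = deligne_rel M `` {(\<V>, k)}"
    by (rule H3_carrierE)
  obtain \<W> r s where W: "open_cover M \<W>" "refinement \<W> \<U> r" "refinement \<W> \<V> s"
    by (rule common_refinement[OF U(1) V(1)])
  note co = deligne_cocycles_pull[OF U(2) W(1,2)] deligne_cocycles_pull[OF U(3) W(1,2)]
    deligne_cocycles_pull[OF V(2) W(1,3)]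
  note cl = U(4)[unfolded deligne_class_pull[OF U(2) W(1,2)]] U(5)[unfolded deligne_class_pull[OF U(3) W(1,2)]]
    V(3)[unfolded deligne_class_pull[OF V(2) W(1,3)]]
  show "K \<otimes>\<^bsub>H3 M\<^esub> L \<otimes>\<^bsub>H3 M\<^esub> N = K \<otimes>\<^bsub>H3 M\<^esub> (L \<otimes>\<^bsub>H3 M\<^esub> N)"
    unfolding cl H3_mult_class[OF co(1,2)] H3_mult_class[OF co(2,3)]
      H3_mult_class[OF deligne_cocycles_add[OF co(1,2)] co(3)]
      H3_mult_class[OF co(1) deligne_cocycles_add[OF co(2,3)]]
    by (simp add: deligne_add_def add.assoc)
next
  show "\<one>\<^bsub>H3 M\<^esub> \<in> carrier (H3 M)"
    using trivial_gerbe_carrier[OF is_form2_zero[OF open_points]] unfolding H3_def by simp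
next
  fix K assume K: "K \<in> carrier (H3 M)"
  obtain \<U> g where U: "open_cover M \<U>" "(\<U>, g) \<in> deligne_cocycles M" "K = deligne_rel M `` {(\<U>, g)}"
    by (rule H3_carrierE[OF K])
  note z = trivial_deligne_cocycles[OF U(1) is_form2_zero[OF open_points]]
  have "deligne_add (trivial_deligne (\<lambda>c x v w. 0)) g = g"
    by (rule deligne.equality) (simp_all add: deligne_add_def trivial_deligne_def)
  then show "\<one>\<^bsub>H3 M\<^esub> \<otimes>\<^bsub>H3 M\<^esub> K = K"
    unfolding H3_one[OF U(1)] U(3) H3_mult_class[OF z U(2)] by simp
  have "deligne_add (deligne_minus g) g = trivial_deligne (\<lambda>c x v w. 0)"
    by (simp add: deligne_add_def trivial_deligne_def deligne_minus_def)
  then show "\<exists>L\<in>carrier (H3 M). L \<otimes>\<^bsub>H3 M\<^esub> K = \<one>\<^bsub>H3 M\<^esub>"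
    unfolding H3_one[OF U(1)] U(3)
    using H3_mult_class[OF deligne_cocycles_minus[OF U(2)] U(2)]
      H3_carrierI[OF deligne_cocycles_minus[OF U(2)]] by (intro bexI) simp_all
qed

lemma td_act_closed:
  assumes "K \<in> carrier (H3 M)" "L \<in> H1TD M" shows "td_act M K L \<in> H1TD M"
proof -
  obtain \<U> g z where U: "(\<U>, g) \<in> deligne_cocycles M" "(\<U>, z) \<in> td_cocycles M"
    "K = deligne_rel M `` {(\<U>, g)}" "L = td_rel M `` {(\<U>, z)}"
    by (rule H3_H1TD_common[OF assms])
  show ?thesis unfolding U(3,4) td_act_class[OF U(1,2)] by (rule H1TD_I[OF td_cocycles_shift[OF U(1,2)]])
qed

lemma td_act_one:
  assumes "L \<in> H1TD M" shows "td_act M \<one>\<^bsub>H3 M\<^esub> L = L"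
proof -
  obtain \<U> z where U: "open_cover M \<U>" "(\<U>, z) \<in> td_cocycles M" "L = td_rel M `` {(\<U>, z)}"
    by (rule H1TD_E[OF assms])
  have "td_shift (trivial_deligne (\<lambda>c x v w. 0)) z = z"
    by (simp add: td_shift_def trivial_deligne_def)
  then show ?thesis
    unfolding U(3) H3_one[OF U(1)]
      td_act_class[OF trivial_deligne_cocycles[OF U(1) is_form2_zero[OF open_points]] U(2)] by simp
qed

lemma td_act_mult:
  assumes "K \<in> carrier (H3 M)" "K' \<in> carrier (H3 M)" "L \<in> H1TD M"
  shows "td_act M (K \<otimes>\<^bsub>H3 M\<^esub> K') L = td_act M K (td_act M K' L)"
proof -
  obtain \<U> g h where U: "open_cover M \<U>" "(\<U>, g) \<in> deligne_cocycles M" "(\<U>, h) \<in> deligne_cocycles M"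
    "K = deligne_rel M `` {(\<U>, g)}" "K' = deligne_rel M `` {(\<U>, h)}"
    by (rule H3_H3_common[OF assms(1,2)])
  obtain \<V> z where V: "open_cover M \<V>" "(\<V>, z) \<in> td_cocycles M" "L = td_rel M `` {(\<V>, z)}"
    by (rule H1TD_E[OF assms(3)])
  obtain \<W> r s where W: "open_cover M \<W>" "refinement \<W> \<U> r" "refinement \<W> \<V> s"
    by (rule common_refinement[OF U(1) V(1)])
  note co = deligne_cocycles_pull[OF U(2) W(1,2)] deligne_cocycles_pull[OF U(3) W(1,2)]
    td_cocycles_pull[OF V(2) W(1,3)]
  note cl = U(4)[unfolded deligne_class_pull[OF U(2) W(1,2)]] U(5)[unfolded deligne_class_pull[OF U(3) W(1,2)]]
    V(3)[unfolded td_class_pull[OF V(2) W(1,3)]]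
  show ?thesis
    unfolding cl H3_mult_class[OF co(1,2)] td_act_class[OF co(2,3)]
      td_act_class[OF deligne_cocycles_add[OF co(1,2)] co(3)]
      td_act_class[OF co(1) td_cocycles_shift[OF co(2,3)]] td_shift_add ..
qed

lemma td_act_group_action:
  "group_action (H3 M) (H1TD M :: ('x set set \<times> ('x, 'e, 'n::finite) td) set set) (td_act M)"
proof (rule group_actionI)
  show "group (H3 M)" using H3_comm_group comm_group_def by blast
  show "td_act M K \<in> extensional (H1TD M)" for K unfolding td_act_def by simp
qed (simp_all add: td_act_closed td_act_one td_act_mult)

end

section \<open>Refinements with connected members\<close>

context manifold begin

text \<open>The image of a compact ball is closed in the whole Hausdorff space, not only in the chart.\<close>

lemma chart_ball:
  assumes U: "open U" "U \<subseteq> points M" and x: "x \<in> U"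
  shows "\<exists>H C. open H \<and> connected H \<and> x \<in> H \<and> H \<subseteq> C \<and> closed C \<and> C \<subseteq> U"
proof -
  obtain c where c: "c \<in> M" "x \<in> cdom c" using x U(2) unfolding points_def by blast
  have "open (cmap c ` (U \<inter> cdom c))" by (rule chart_image_open[OF c(1) U(1)])
  moreover have "cmap c x \<in> cmap c ` (U \<inter> cdom c)" using x c by blast
  ultimately obtain r where r: "r > 0" "cball (cmap c x) r \<subseteq> cmap c ` (U \<inter> cdom c)"
    unfolding open_contains_cball by blast
  define H where "H = cinv c ` ball (cmap c x) r"
  define C where "C = cinv c ` cball (cmap c x) r"
  have cont: "continuous_on (cball (cmap c x) r) (cinv c)"
    using continuous_cinv[OF c(1)] by (rule continuous_on_subset) (use r(2) in blast)
  have bb: "ball (cmap c x) r \<subseteq> cball (cmap c x) r" by (rule ball_subset_cball)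
  have "H = (U \<inter> cdom c) \<inter> cmap c -` ball (cmap c x) r"
  proof
    show "H \<subseteq> (U \<inter> cdom c) \<inter> cmap c -` ball (cmap c x) r"
    proof
      fix y assume "y \<in> H"
      then obtain b where b: "b \<in> ball (cmap c x) r" "y = cinv c b" unfolding H_def by blast
      then have "b \<in> cmap c ` (U \<inter> cdom c)" using bb r(2) by blast
      then obtain p where "p \<in> U" "p \<in> cdom c" "b = cmap c p" by blast
      then show "y \<in> (U \<inter> cdom c) \<inter> cmap c -` ball (cmap c x) r" using b c by simp
    qed
    show "(U \<inter> cdom c) \<inter> cmap c -` ball (cmap c x) r \<subseteq> H"
    proof
      fix y assume y: "y \<in> (U \<inter> cdom c) \<inter> cmap c -` ball (cmap c x) r"
      then have "y = cinv c (cmap c y)" using c by simp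
      with y show "y \<in> H" unfolding H_def by blast
    qed
  qed
  moreover have "open ((U \<inter> cdom c) \<inter> cmap c -` ball (cmap c x) r)"
    by (rule continuous_open_preimage[OF continuous_on_subset[OF continuous_cmap[OF c(1)]]
          open_Int[OF U(1) chart_open[OF c(1)]] open_ball]) simp
  ultimately have "open H" by simp
  moreover have "connected H"
    unfolding H_def by (rule connected_continuous_image[OF continuous_on_subset[OF cont bb] connected_ball])
  moreover have "x \<in> H"
    unfolding H_def using r(1) cinv_cmap[OF c] by (metis centre_in_ball image_eqI)
  moreover have "H \<subseteq> C" unfolding H_def C_def using bb by (rule image_mono)
  moreover have "closed C"
    unfolding C_def by (intro compact_imp_closed compact_continuous_image[OF cont])
      (simp add: compact_eq_bounded_closed)
  moreover have "C \<subseteq> U"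
  proof
    fix y assume "y \<in> C"
    then obtain b where b: "b \<in> cball (cmap c x) r" "y = cinv c b" unfolding C_def by blast
    then have "b \<in> cmap c ` (U \<inter> cdom c)" using r(2) by blast
    then obtain p where "p \<in> U" "p \<in> cdom c" "b = cmap c p" by blast
    then show "y \<in> U" using b c by simp
  qed
  ultimately show ?thesis by (intro exI[of _ H] exI[of _ C] conjI)
qed

lemma countable_shrinking:
  assumes "open_cover M \<U>" "points M \<noteq> {}"
  shows "\<exists>H C u. (\<forall>n::nat. open (H n) \<and> H n \<subseteq> C n \<and> closed (C n) \<and> C n \<subseteq> u n \<and> u n \<in> \<U>) \<and>
    (\<Union>n. H n) = points M"
proof -
  define F where "F = {H. open H \<and> (\<exists>C. \<exists>u\<in>\<U>. H \<subseteq> C \<and> closed C \<and> C \<subseteq> u)}"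
  have "\<exists>H\<in>F. x \<in> H" if x: "x \<in> points M" for x
  proof -
    obtain u where u: "u \<in> \<U>" "x \<in> u" using x assms(1) unfolding open_cover_def by blast
    obtain H C where "open H" "x \<in> H" "H \<subseteq> C" "closed C" "C \<subseteq> u"
      using chart_ball[OF open_coverD[OF assms(1) u(1)] u(2)] by (elim exE conjE)
    then show ?thesis unfolding F_def using u(1) by blast
  qed
  moreover have "H \<subseteq> points M" if "H \<in> F" for H
    using that open_coverD(2)[OF assms(1)] unfolding F_def by blast
  ultimately have F: "\<Union>F = points M" by blast
  have "open S" if "S \<in> F" for S using that unfolding F_def by blast
  then obtain F' where F': "F' \<subseteq> F" "countable F'" "\<Union>F' = \<Union>F" by (rule Lindelof)
  then have "F' \<noteq> {}" using F assms(2) by auto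
  define H where "H = from_nat_into F'"
  have H: "H n \<in> F" for n unfolding H_def using from_nat_into[OF \<open>F' \<noteq> {}\<close>] F'(1) by blast
  then have "\<forall>n. \<exists>C u. u \<in> \<U> \<and> H n \<subseteq> C \<and> closed C \<and> C \<subseteq> u" unfolding F_def by blast
  then obtain C u where Cu: "\<And>n. u n \<in> \<U> \<and> H n \<subseteq> C n \<and> closed (C n) \<and> C n \<subseteq> u n" by metis
  have "range H = F'" unfolding H_def by (rule range_from_nat_into[OF \<open>F' \<noteq> {}\<close> F'(2)])
  then have "(\<Union>n. H n) = points M" using F F'(3) by simp
  moreover have "open (H n)" for n using H[of n] unfolding F_def by blast
  ultimately show ?thesis using Cu by (intro exI[of _ H] exI[of _ C] exI[of _ u]) simp
qed

text \<open>Locally constant functions on overlaps have to become constant after a refinement, although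
  overlaps of connected sets need not be connected.  It suffices that of any two members that meet,
  one is contained in the set assigned to the other: the overlap then lies in a connected set on
  which the function is still defined.  To achieve this, let \<open>H\<^sub>n \<subseteq> C\<^sub>n \<subseteq> u\<^sub>n\<close> be a countable shrinking
  with \<open>C\<^sub>n\<close> closed, let \<open>n(x)\<close> be the first index with \<open>x \<in> H\<^sub>n\<close>, and choose the neighbourhood of
  \<open>x\<close> inside \<open>u\<^sub>m\<close> or outside \<open>C\<^sub>m\<close>, according to whether \<open>x \<in> C\<^sub>m\<close>, for all \<open>m \<le> n(x)\<close>.\<close>

lemma connected_refinement:
  assumes U: "open_cover M \<U>"
  shows "\<exists>\<V> r. open_cover M \<V> \<and> refinement \<V> \<U> r \<and> (\<forall>i\<in>\<V>. connected i) \<and>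
    (\<forall>i\<in>\<V>. \<forall>j\<in>\<V>. i \<inter> j \<noteq> {} \<longrightarrow> i \<subseteq> r j \<or> j \<subseteq> r i)"
proof (cases "points M = {}")
  case True
  then have "open_cover M {}" unfolding open_cover_def by simp
  then show ?thesis by (intro exI[of _ "{}"] exI[of _ id]) (simp add: refinement_def)
next
  case False
  obtain H C u where HCu: "\<forall>n::nat. open (H n) \<and> H n \<subseteq> C n \<and> closed (C n) \<and> C n \<subseteq> u n \<and> u n \<in> \<U>"
    and cover: "(\<Union>n. H n) = points M"
    using countable_shrinking[OF U False] by (elim exE conjE)
  have H: "open (H n)" "H n \<subseteq> C n" "closed (C n)" "C n \<subseteq> u n" "u n \<in> \<U>" for n
    using HCu by blast+
  note H = H cover
  define n where "n = (\<lambda>x. LEAST n. x \<in> H n)"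
  have n: "x \<in> H (n x)" if "x \<in> points M" for x
  proof -
    have "x \<in> (\<Union>n. H n)" using that unfolding H(6) .
    then obtain k where "x \<in> H k" by blast
    then show ?thesis unfolding n_def by (rule LeastI[of "\<lambda>n. x \<in> H n"])
  qed
  define B where "B = (\<lambda>x. H (n x) \<inter> (\<Inter>m\<in>{..n x}. if x \<in> C m then u m else - C m))"
  have B: "open (B x)" "x \<in> B x" "B x \<subseteq> points M" if x: "x \<in> points M" for x
  proof -
    have o: "open (if x \<in> C m then u m else - C m)" for m
      using open_Compl[OF H(3)[of m]] open_coverD(1)[OF U H(5)[of m]] by simp
    show "open (B x)"
      unfolding B_def by (rule open_Int[OF H(1) open_INT[OF finite_atMost]]) (rule ballI, rule o)
    have "x \<in> (if x \<in> C m then u m else - C m)" for m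
      using H(4)[of m] by (cases "x \<in> C m") auto
    then show "x \<in> B x" unfolding B_def using n[OF x] by (intro IntI INT_I)
    have "H (n x) \<subseteq> (\<Union>n. H n)" by blast
    then have "H (n x) \<subseteq> points M" unfolding H(6) .
    then show "B x \<subseteq> points M" unfolding B_def by blast
  qed
  have "\<exists>V. open V \<and> connected V \<and> x \<in> V \<and> V \<subseteq> B x" if x: "x \<in> points M" for x
  proof -
    obtain V W where "open V" "connected V" "x \<in> V" "V \<subseteq> W" "W \<subseteq> B x"
      using chart_ball[OF B(1,3)[OF x] B(2)[OF x]] by (elim exE conjE)
    then show ?thesis by (intro exI[of _ V] conjI) auto
  qed
  then obtain V where V: "\<And>x. x \<in> points M \<Longrightarrow> open (V x) \<and> connected (V x) \<and> x \<in> V x \<and> V x \<subseteq> B x"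
    by metis
  define \<V> where "\<V> = V ` points M"
  define s where "s = inv_into (points M) V"
  define r where "r = (\<lambda>i. u (n (s i)))"
  have s: "s i \<in> points M" "V (s i) = i" if "i \<in> \<V>" for i
    using that unfolding \<V>_def s_def by (rule inv_into_into, rule f_inv_into_f)
  have VH: "V x \<subseteq> H (n x)" if "x \<in> points M" for x
    using V[OF that] unfolding B_def by blast
  have "open_cover M \<V>"
    unfolding open_cover_def
  proof
    show "\<forall>i\<in>\<V>. open i"
    proof
      fix i assume i: "i \<in> \<V>"
      show "open i" using V[OF s(1)[OF i]] unfolding s(2)[OF i] by blast
    qed
    show "\<Union>\<V> = points M"
    proof
      show "\<Union>\<V> \<subseteq> points M"
      proof
        fix y assume "y \<in> \<Union>\<V>"
        then obtain x where "x \<in> points M" "y \<in> V x" unfolding \<V>_def by blast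
        then show "y \<in> points M" using V B(3) by blast
      qed
      show "points M \<subseteq> \<Union>\<V>" unfolding \<V>_def using V by blast
    qed
  qed
  moreover have "refinement \<V> \<U> r"
    unfolding refinement_def
  proof (intro ballI conjI)
    fix i assume i: "i \<in> \<V>"
    show "r i \<in> \<U>" unfolding r_def by (rule H(5))
    have "i \<subseteq> H (n (s i))" using VH[OF s(1)[OF i]] unfolding s(2)[OF i] .
    also have "\<dots> \<subseteq> C (n (s i))" by (rule H(2))
    also have "\<dots> \<subseteq> u (n (s i))" by (rule H(4))
    finally show "i \<subseteq> r i" unfolding r_def .
  qed
  moreover have "connected i" if i: "i \<in> \<V>" for i
    using V[OF s(1)[OF i]] unfolding s(2)[OF i] by blast
  moreover have meet: "j \<subseteq> r i"
    if i: "i \<in> \<V>" and j: "j \<in> \<V>" and ij: "i \<inter> j \<noteq> {}" and le: "n (s i) \<le> n (s j)" for i j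
  proof -
    let ?k = "n (s i)"
    obtain y where y: "y \<in> i" "y \<in> j" using ij by blast
    have "i \<subseteq> H ?k" using VH[OF s(1)[OF i]] unfolding s(2)[OF i] .
    also have "\<dots> \<subseteq> C ?k" by (rule H(2))
    finally have yC: "y \<in> C ?k" using y(1) by blast
    have "j \<subseteq> B (s j)" using V[OF s(1)[OF j]] unfolding s(2)[OF j] by blast
    also have "\<dots> \<subseteq> (if s j \<in> C ?k then u ?k else - C ?k)"
      unfolding B_def using le by (intro INF_lower le_infI2) simp
    finally have "j \<subseteq> (if s j \<in> C ?k then u ?k else - C ?k)" .
    then show "j \<subseteq> r i" unfolding r_def using y(2) yC by (cases "s j \<in> C ?k") auto
  qed
  have "i \<subseteq> r j \<or> j \<subseteq> r i" if "i \<in> \<V>" "j \<in> \<V>" "i \<inter> j \<noteq> {}" for i j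
    using meet[OF that] meet[OF that(2,1)] that(3) nat_le_linear[of "n (s i)" "n (s j)"] by blast
  ultimately show ?thesis by (intro exI[of _ \<V>] exI[of _ r] conjI ballI impI)
qed

end

lemma lattice_valued_constant:
  fixes f :: "'x::topological_space \<Rightarrow> real^'n"
  assumes "connected S" "continuous_on S f" "\<And>x. x \<in> S \<Longrightarrow> f x \<in> lattice" "x \<in> S" "y \<in> S"
  shows "f x = f y"
proof -
  have "f x $ i = f y $ i" for i
  proof -
    have "(\<lambda>x. f x $ i) constant_on S"
    proof (rule continuous_discrete_range_constant[OF assms(1)])
      show "continuous_on S (\<lambda>x. f x $ i)" using assms(2) by (rule continuous_on_component)
      fix x assume x: "x \<in> S"
      have "1 \<le> norm (f y $ i - f x $ i)" if "y \<in> S" "f y $ i \<noteq> f x $ i" for y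
      proof -
        have "f y $ i - f x $ i \<in> \<int>"
          using assms(3)[OF x] assms(3)[OF that(1)] unfolding lattice_def by simp
        then show ?thesis using that(2) Ints_nonzero_abs_ge1[of "f y $ i - f x $ i"] by simp
      qed
      then show "\<exists>e>0. \<forall>y. y \<in> S \<and> f y $ i \<noteq> f x $ i \<longrightarrow> e \<le> norm (f y $ i - f x $ i)"
        by (intro exI[of _ 1]) simp
    qed
    then show ?thesis using assms(4,5) unfolding constant_on_def by metis
  qed
  then show ?thesis by (simp add: vec_eq_iff)
qed

section \<open>Local sections of torus bundles\<close>

lemma torus_of_add: "torus_of (a + b) = torus_of a + torus_of b"
  by (simp add: torus_of_def vec_eq_iff circle_of_add)

lemma torus_of_eq_iff: "torus_of a = torus_of b \<longleftrightarrow> a - b \<in> lattice"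
  by (simp add: torus_of_def vec_eq_iff circle_of_eq_iff lattice_def)

context manifold begin

lemma smooth_fun_sum:
  assumes "open U" "\<And>b. b \<in> B \<Longrightarrow> smooth_fun M U (f b)"
  shows "smooth_fun M U (\<lambda>x. \<Sum>b\<in>B. f b x)"
  using assms(2)
proof (induction B rule: infinite_finite_induct)
  case (insert b B)
  have "smooth_fun M U (\<lambda>x. f b x + (\<Sum>b\<in>B. f b x))"
    by (rule smooth_fun_add[OF assms(1)]) (use insert in auto)
  then show ?case using insert.hyps by simp
qed (use smooth_fun_const[OF assms(1)] in auto)

lemma smooth_fun_vec:
  fixes g :: "'n::finite \<Rightarrow> 'x \<Rightarrow> real"
  assumes "open U" "\<And>i. smooth_fun M U (g i)"
  shows "smooth_fun M U (\<lambda>x. \<chi> i. g i x)"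
proof -
  have "(\<lambda>x. \<chi> i. g i x) = (\<lambda>x. \<Sum>i\<in>UNIV. g i x *\<^sub>R axis i (1::real))"
    by (rule ext) (simp add: vec_eq_iff axis_def if_distrib cong: if_cong)
  moreover have "smooth_fun M U (\<lambda>x. \<Sum>i\<in>UNIV. g i x *\<^sub>R axis i (1::real))"
    by (intro smooth_fun_sum[OF assms(1)]
        smooth_fun_bounded_linear[OF assms(1) bounded_linear_scaleR_left assms(2)])
  ultimately show ?thesis by simp
qed

lemma smooth_torus_lift:
  fixes h :: "'x \<Rightarrow> circle^'n"
  assumes "smooth_torus M W h" "x \<in> W"
  shows "\<exists>V g. open V \<and> x \<in> V \<and> V \<subseteq> W \<and> V \<subseteq> points M \<and> smooth_fun M V g \<and> (\<forall>y\<in>V. h y = torus_of (g y))"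
proof -
  have "\<forall>i. \<exists>V g. x \<in> V \<and> V \<subseteq> W \<and> circle_lift M (\<lambda>x. h x $ i) V g"
    using assms unfolding smooth_torus_def smooth_circle_def by blast
  then obtain V g where V: "\<And>i. x \<in> V i \<and> V i \<subseteq> W \<and> circle_lift M (\<lambda>x. h x $ i) (V i) (g i)"
    by metis
  define V0 where "V0 = (\<Inter>i. V i)"
  have "open (V i)" "V i \<subseteq> points M" for i using V[of i] unfolding circle_lift_def by auto
  then have "open V0" unfolding V0_def by (intro open_INT) auto
  have l: "circle_lift M (\<lambda>x. h x $ i) V0 (g i)" for i
    by (rule circle_lift_subset[OF _ \<open>open V0\<close>, of _ "V i"]) (use V in \<open>auto simp: V0_def\<close>)
  show ?thesis
  proof (intro exI conjI ballI, rule \<open>open V0\<close>)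
    show "x \<in> V0" "V0 \<subseteq> W" "V0 \<subseteq> points M"
      unfolding V0_def using V \<open>\<And>i. V i \<subseteq> points M\<close> by blast+
    show "smooth_fun M V0 (\<lambda>x. \<chi> i. g i x)"
      by (rule smooth_fun_vec[OF \<open>open V0\<close>]) (use l in \<open>simp add: circle_lift_def\<close>)
    show "h y = torus_of (\<chi> i. g i y)" if "y \<in> V0" for y
      using l that unfolding circle_lift_def torus_of_def by (simp add: vec_eq_iff)
  qed
qed

end

lemma smooth_map_subset:
  assumes "smooth_map M N U f" "V \<subseteq> U" shows "smooth_map M N V f"
proof -
  have "smooth_on (cmap c ` (V \<inter> cdom c \<inter> f -` cdom c')) (cmap c' \<circ> f \<circ> cinv c)"
    if "c \<in> M" "c' \<in> N" for c c'
  proof (rule smooth_on_subset)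
    show "smooth_on (cmap c ` (U \<inter> cdom c \<inter> f -` cdom c')) (cmap c' \<circ> f \<circ> cinv c)"
      using assms(1) that unfolding smooth_map_def by blast
  qed (use assms(2) in blast)
  then show ?thesis
    using assms continuous_on_subset[of U f V] unfolding smooth_map_def by blast
qed

lemma smooth_fun_compose_smooth_map:
  fixes M :: "('x::{t2_space,second_countable_topology}, 'e::{real_normed_vector,heine_borel}) atlas"
    and N :: "('y::{t2_space,second_countable_topology}, 'f::{real_normed_vector,heine_borel}) atlas"
  assumes M: "manifold M" and N: "manifold N"
    and s: "smooth_map M N U s" and g: "smooth_fun N W g"
    and U: "open U" and W: "open W" and sub: "s ` U \<subseteq> W"
  shows "smooth_fun M U (\<lambda>x. g (s x))"
proof -
  interpret M: manifold M by (rule M)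
  interpret N: manifold N by (rule N)
  show ?thesis
    unfolding smooth_fun_def
  proof
    fix c assume c: "c \<in> M"
    show "smooth_on (cmap c ` (U \<inter> cdom c)) ((\<lambda>x. g (s x)) \<circ> cinv c)"
    proof (rule smooth_on_local)
      fix a assume "a \<in> cmap c ` (U \<inter> cdom c)"
      then obtain x where x: "x \<in> U" "x \<in> cdom c" "a = cmap c x" by blast
      have "s x \<in> points N" using s x(1) unfolding smooth_map_def by blast
      then obtain c' where c': "c' \<in> N" "s x \<in> cdom c'" unfolding points_def by blast
      have "continuous_on U s" using s unfolding smooth_map_def by blast
      then have "open (U \<inter> s -` cdom c')"
        using U N.chart_open[OF c'(1)] by (rule continuous_open_preimage)
      then have T: "open (cmap c ` ((U \<inter> s -` cdom c') \<inter> cdom c))"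
        by (rule M.chart_image_open[OF c])
      have eq: "(U \<inter> s -` cdom c') \<inter> cdom c = U \<inter> cdom c \<inter> s -` cdom c'" by blast
      let ?T = "cmap c ` (U \<inter> cdom c \<inter> s -` cdom c')"
      have "smooth_on ?T (\<lambda>a. (g \<circ> cinv c') ((cmap c' \<circ> s \<circ> cinv c) a))"
      proof (rule smooth_on_compose)
        show "open ?T" using T unfolding eq .
        show "open (cmap c' ` (W \<inter> cdom c'))" by (rule N.chart_image_open[OF c'(1) W])
        show "(cmap c' \<circ> s \<circ> cinv c) ` ?T \<subseteq> cmap c' ` (W \<inter> cdom c')"
          using sub c by auto
        show "smooth_on (cmap c' ` (W \<inter> cdom c')) (g \<circ> cinv c')"
          using g c'(1) unfolding smooth_fun_def by blast
        show "smooth_on ?T (cmap c' \<circ> s \<circ> cinv c)"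
          using s c c'(1) unfolding smooth_map_def by blast
      qed
      then have "smooth_on ?T ((\<lambda>x. g (s x)) \<circ> cinv c)"
        by (rule smooth_on_cong[THEN iffD1, rotated 2]) (use T eq c c' in auto)
      moreover have "a \<in> ?T" using x c' by blast
      ultimately show "\<exists>T. open T \<and> a \<in> T \<and> smooth_on T ((\<lambda>x. g (s x)) \<circ> cinv c)"
        using T unfolding eq by blast
    qed
  qed
qed

locale torus_bundle_connection = manifold M
  for M :: "('x::{t2_space,second_countable_topology}, 'e::{real_normed_vector,heine_borel}) atlas" +
  fixes P :: "('x, 'p::{t2_space,second_countable_topology}, 'e, 'n::finite) torus_bundle"
  assumes is_bundle: "torus_bundle_with_connection M P"
begin

lemma principal: "principal_torus_bundle M P"
  using is_bundle unfolding torus_bundle_with_connection_def by blast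

lemma total_manifold: "manifold (total P)"
  using principal unfolding principal_torus_bundle_def manifold_def by blast

sublocale T: manifold "total P"
  by (rule total_manifold)

lemma proj_smooth: "smooth_map (total P) M (points (total P)) (proj P)"
  using principal unfolding principal_torus_bundle_def by blast

lemma rmul_props:
  assumes "p \<in> points (total P)"
  shows "rmul P p 0 = p" "rmul P p u \<in> points (total P)" "proj P (rmul P p u) = proj P p"
    "rmul P (rmul P p u) w = rmul P p (u + w)"
  using principal assms unfolding principal_torus_bundle_def by blast+

lemma section_props:
  assumes "local_section M P U s"
  shows "open U" "U \<subseteq> points M" "smooth_map M (total P) U s" "x \<in> U \<Longrightarrow> proj P (s x) = x"
    "x \<in> U \<Longrightarrow> s x \<in> points (total P)"
  using assms unfolding local_section_def smooth_map_def by auto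

definition trivialization where
  "trivialization V \<sigma> h \<longleftrightarrow> local_section M P V \<sigma> \<and>
     smooth_map (times_euclidean M) (total P) (V \<times> UNIV) (\<lambda>(y, v). rmul P (\<sigma> y) (torus_of v)) \<and>
     smooth_torus (total P) {p \<in> points (total P). proj P p \<in> V} h \<and>
     (\<forall>p \<in> points (total P). proj P p \<in> V \<longrightarrow> rmul P (\<sigma> (proj P p)) (h p) = p) \<and>
     (\<forall>y\<in>V. \<forall>u. h (rmul P (\<sigma> y) u) = u)"

lemma trivialization_at:
  assumes "x \<in> points M" obtains V \<sigma> h where "x \<in> V" "trivialization V \<sigma> h"
proof -
  have "\<forall>x \<in> points M. \<exists>V s h. x \<in> V \<and> local_section M P V s \<and>
        smooth_map (times_euclidean M) (total P) (V \<times> UNIV) (\<lambda>(y, v). rmul P (s y) (torus_of v)) \<and>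
        smooth_torus (total P) {p \<in> points (total P). proj P p \<in> V} h \<and>
        (\<forall>p \<in> points (total P). proj P p \<in> V \<longrightarrow> rmul P (s (proj P p)) (h p) = p) \<and>
        (\<forall>y\<in>V. \<forall>u. h (rmul P (s y) u) = u)"
    using principal unfolding principal_torus_bundle_def by blast
  from bspec[OF this assms] show ?thesis
    using that unfolding trivialization_def by (elim exE conjE) blast
qed

lemma trivializationD:
  assumes "trivialization V \<sigma> h"
  shows "local_section M P V \<sigma>"
    and "smooth_map (times_euclidean M) (total P) (V \<times> UNIV) (\<lambda>(y, v). rmul P (\<sigma> y) (torus_of v))"
    and "smooth_torus (total P) {p \<in> points (total P). proj P p \<in> V} h"
    and "p \<in> points (total P) \<Longrightarrow> proj P p \<in> V \<Longrightarrow> rmul P (\<sigma> (proj P p)) (h p) = p"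
    and "y \<in> V \<Longrightarrow> h (rmul P (\<sigma> y) u) = u"
  using assms unfolding trivialization_def by blast+

lemma action_free:
  assumes p: "p \<in> points (total P)" and eq: "rmul P p u = rmul P p w"
  shows "u = w"
proof -
  have "proj P p \<in> points M" using proj_smooth p unfolding smooth_map_def by blast
  then obtain V \<sigma> h where V: "proj P p \<in> V" and tr: "trivialization V \<sigma> h" by (rule trivialization_at)
  let ?y = "proj P p"
  have \<sigma>: "\<sigma> ?y \<in> points (total P)" by (rule section_props(5)[OF trivializationD(1)[OF tr] V])
  have pp: "p = rmul P (\<sigma> ?y) (h p)" using trivializationD(4)[OF tr p V] by simp
  have "h (rmul P p v) = h p + v" for v
    by (subst pp) (simp add: rmul_props(4)[OF \<sigma>] trivializationD(5)[OF tr V])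
  then have "h p + u = h p + w" using eq by metis
  then show ?thesis by simp
qed

text \<open>Smoothness of \<open>(y, v) \<mapsto> \<sigma> y \<cdot> v\<close> is stated with charts of the product manifold; here it is brought to the
  form in which the inverse chart appears in the first argument only.\<close>

lemma trivialization_derivative:
  assumes tr: "trivialization V \<sigma> h" and c: "c \<in> M" "c' \<in> total P"
    and x: "x \<in> V" "x \<in> cdom c" "rmul P (\<sigma> x) (torus_of v) \<in> cdom c'"
  defines "\<psi> \<equiv> \<lambda>(a, v). cmap c' (rmul P (\<sigma> (cinv c a)) (torus_of v))"
  shows "\<exists>D. (\<psi> has_derivative D) (at (cmap c x, v))"
proof -
  let ?\<Psi> = "\<lambda>(y, v). rmul P (\<sigma> y) (torus_of v)"
  define C where "C = (cdom c \<times> (UNIV :: (real^'n) set), \<lambda>(x, v :: real^'n). (cmap c x, v))"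
  have C: "C \<in> times_euclidean M" unfolding times_euclidean_def C_def using c(1) by blast
  have inj: "inj_on (cmap C) (cdom C)"
  proof (rule inj_onI)
    fix p q assume "p \<in> cdom C" "q \<in> cdom C" "cmap C p = cmap C q"
    then show "p = q"
      unfolding C_def using cinv_cmap[OF c(1), of "fst p"] cinv_cmap[OF c(1), of "fst q"]
      by (auto simp: case_prod_unfold prod_eq_iff)
  qed
  have cC: "cinv C (cmap c y, w) = (y, w)" if "y \<in> cdom c" for y w
    using inv_into_f_f[OF inj, of "(y, w)"] that by (simp add: C_def)
  let ?S = "cmap C ` (V \<times> UNIV \<inter> cdom C \<inter> ?\<Psi> -` cdom c')"
  have sm: "smooth_on ?S (cmap c' \<circ> ?\<Psi> \<circ> cinv C)"
    using trivializationD(2)[OF tr] C c(2) unfolding smooth_map_def by blast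
  have "(x, v) \<in> V \<times> UNIV \<inter> cdom C \<inter> ?\<Psi> -` cdom c'"
    using x by (simp add: C_def)
  then have "cmap C (x, v) \<in> ?S" by (rule imageI)
  then have S: "(cmap c x, v) \<in> ?S" by (simp add: C_def)
  have V: "open V" by (rule section_props(1)[OF trivializationD(1)[OF tr]])
  define N where "N = cmap c ` (V \<inter> cdom c) \<times> (UNIV :: (real^'n) set)"
  have "open N" unfolding N_def by (intro open_Times chart_image_open[OF c(1) V] open_UNIV)
  moreover have "(cmap c x, v) \<in> N" unfolding N_def using x by blast
  moreover have "(cmap c' \<circ> ?\<Psi> \<circ> cinv C) y = \<psi> y" if "y \<in> N" for y
    using that cC c(1) unfolding N_def \<psi>_def by auto
  ultimately have "(\<psi> has_derivative frechet_derivative (cmap c' \<circ> ?\<Psi> \<circ> cinv C) (at (cmap c x, v)))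
      (at (cmap c x, v))"
    using has_derivative_cong_open smooth_on_has_derivative[OF sm S] by blast
  then show ?thesis by blast
qed

text \<open>Differentiability of a right translation comes from the trivialization: \<open>p \<cdot> u = \<sigma> (\<pi> p) \<cdot> (h p + u)\<close>, and
  all maps on the right are differentiable.\<close>

lemma right_translation_derivative:
  assumes tr: "trivialization V \<sigma> h" and x: "x \<in> V"
    and c: "c'' \<in> total P" "\<sigma> x \<in> cdom c''" "c' \<in> total P" "rmul P (\<sigma> x) (torus_of v) \<in> cdom c'"
  shows "\<exists>E. (cmap c' \<circ> (\<lambda>p. rmul P p (torus_of v)) \<circ> cinv c'' has_derivative E) (at (cmap c'' (\<sigma> x)))"
proof -
  note sec = section_props[OF trivializationD(1)[OF tr]]
  have x_pt: "x \<in> points M" using sec(2) x by blast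
  then obtain c0 where c0: "c0 \<in> M" "x \<in> cdom c0" unfolding points_def by blast
  have p0: "\<sigma> x \<in> points (total P)" "proj P (\<sigma> x) = x" using sec(4,5) x by auto
  have "\<sigma> x \<in> {p \<in> points (total P). proj P p \<in> V}" using p0 x by simp
  from T.smooth_torus_lift[OF trivializationD(3)[OF tr] this]
  obtain G g where G: "open G" "\<sigma> x \<in> G" "G \<subseteq> {p \<in> points (total P). proj P p \<in> V}"
      and "G \<subseteq> points (total P)" and g: "smooth_fun (total P) G g" "\<forall>p\<in>G. h p = torus_of (g p)"
    by (elim exE conjE)
  note g = g(1) bspec[OF g(2)]
  have "h (rmul P (\<sigma> x) 0) = 0" using trivializationD(5)[OF tr x] .
  then have h0: "torus_of (g (\<sigma> x)) = 0" using rmul_props(1)[OF p0(1)] g(2)[OF G(2)] by simp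
  have cont: "continuous_on (points (total P)) (proj P)" using proj_smooth unfolding smooth_map_def by blast
  define Y where "Y = G \<inter> proj P -` cdom c0"
  have Y: "open Y"
    unfolding Y_def
    by (rule continuous_open_preimage[OF continuous_on_subset[OF cont \<open>G \<subseteq> points (total P)\<close>] G(1)
          chart_open[OF c0(1)]])
  have xY: "\<sigma> x \<in> Y" unfolding Y_def using G(2) p0 c0 by simp
  define \<psi> where "\<psi> = (\<lambda>(a, v). cmap c' (rmul P (\<sigma> (cinv c0 a)) (torus_of v)))"
  have "rmul P (\<sigma> x) (torus_of (g (\<sigma> x) + v)) \<in> cdom c'"
    using c(4) h0 by (simp add: torus_of_add)
  then obtain D where D: "(\<psi> has_derivative D) (at (cmap c0 x, g (\<sigma> x) + v))"
    using trivialization_derivative[OF tr c0(1) c(3) x c0(2)] unfolding \<psi>_def by blast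
  have "smooth_on (cmap c'' ` (points (total P) \<inter> cdom c'' \<inter> proj P -` cdom c0)) (cmap c0 \<circ> proj P \<circ> cinv c'')"
    using proj_smooth c(1) c0(1) unfolding smooth_map_def by blast
  moreover have "cmap c'' (\<sigma> x) \<in> cmap c'' ` (points (total P) \<inter> cdom c'' \<inter> proj P -` cdom c0)"
    using p0 c(2) c0(2) by simp
  ultimately have pr: "(cmap c0 \<circ> proj P \<circ> cinv c'' has_derivative
      frechet_derivative (cmap c0 \<circ> proj P \<circ> cinv c'') (at (cmap c'' (\<sigma> x)))) (at (cmap c'' (\<sigma> x)))"
    by (rule smooth_on_has_derivative)
  have "(g \<circ> cinv c'' has_derivative d0 g c'' (\<sigma> x)) (at (cmap c'' (\<sigma> x)))"
    by (rule T.d0_has_derivative[OF g(1) c(1) G(2) c(2)])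
  then have "((\<lambda>b. (g \<circ> cinv c'') b + v) has_derivative (\<lambda>w. d0 g c'' (\<sigma> x) w + 0)) (at (cmap c'' (\<sigma> x)))"
    by (intro has_derivative_add has_derivative_const)
  from has_derivative_Pair[OF pr this]
  have inner: "((\<lambda>b. ((cmap c0 \<circ> proj P \<circ> cinv c'') b, (g \<circ> cinv c'') b + v)) has_derivative
      (\<lambda>w. (frechet_derivative (cmap c0 \<circ> proj P \<circ> cinv c'') (at (cmap c'' (\<sigma> x))) w,
        d0 g c'' (\<sigma> x) w + 0))) (at (cmap c'' (\<sigma> x)))" .
  have at: "((cmap c0 \<circ> proj P \<circ> cinv c'') (cmap c'' (\<sigma> x)), (g \<circ> cinv c'') (cmap c'' (\<sigma> x)) + v) =
      (cmap c0 x, g (\<sigma> x) + v)"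
    using c p0 by simp
  have "\<exists>E. ((\<lambda>b. \<psi> ((cmap c0 \<circ> proj P \<circ> cinv c'') b, (g \<circ> cinv c'') b + v)) has_derivative E)
      (at (cmap c'' (\<sigma> x)))"
    using diff_chain_at[OF inner D[folded at]] unfolding o_def by blast
  then obtain E where E: "((\<lambda>b. \<psi> ((cmap c0 \<circ> proj P \<circ> cinv c'') b, (g \<circ> cinv c'') b + v)) has_derivative E)
      (at (cmap c'' (\<sigma> x)))" by blast
  have "(cmap c' \<circ> (\<lambda>p. rmul P p (torus_of v)) \<circ> cinv c'') b =
      \<psi> ((cmap c0 \<circ> proj P \<circ> cinv c'') b, (g \<circ> cinv c'') b + v)"
    if b: "b \<in> cmap c'' ` (Y \<inter> cdom c'')" for b
  proof -
    obtain p where p: "p \<in> Y" "p \<in> cdom c''" "b = cmap c'' p" using b by blast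
    have pG: "p \<in> G" "proj P p \<in> cdom c0" using p(1) unfolding Y_def by auto
    then have pp: "p \<in> points (total P)" "proj P p \<in> V" using G(3) by auto
    have "rmul P p (torus_of v) = rmul P (rmul P (\<sigma> (proj P p)) (torus_of (g p))) (torus_of v)"
      using trivializationD(4)[OF tr pp] g(2)[OF pG(1)] by simp
    also have "\<dots> = rmul P (\<sigma> (proj P p)) (torus_of (g p + v))"
      unfolding torus_of_add by (rule rmul_props(4)[OF sec(5)[OF pp(2)]])
    finally show ?thesis using p(2,3) c(1) c0(1) pG(2) by (simp add: \<psi>_def)
  qed
  moreover have "cmap c'' (\<sigma> x) \<in> cmap c'' ` (Y \<inter> cdom c'')" using xY c(2) by blast
  ultimately have "(cmap c' \<circ> (\<lambda>p. rmul P p (torus_of v)) \<circ> cinv c'' has_derivative E) (at (cmap c'' (\<sigma> x)))"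
    by (intro has_derivative_cong_open[OF T.chart_image_open[OF c(1) Y], THEN iffD2, rotated, rotated, OF E])
  then show ?thesis by blast
qed

lemma conn_form: "is_form1 (total P) (points (total P)) (conn P)"
  using is_bundle unfolding torus_bundle_with_connection_def by blast

lemma conn_invariant:
  assumes "c \<in> total P" "p \<in> cdom c"
  shows "pullback1 (total P) (\<lambda>p. rmul P p u) (conn P) c p v = conn P c p v"
  using is_bundle assms T.cdom_subset_points[OF assms(1)]
  unfolding torus_bundle_with_connection_def ball_coords by blast

lemma conn_vertical:
  assumes "c \<in> total P" "p \<in> cdom c"
  shows "conn P c p (vector_derivative (\<lambda>t. cmap c (rmul P p (torus_of (t *\<^sub>R \<xi>)))) (at 0)) = \<xi>"
  using is_bundle assms T.cdom_subset_points[OF assms(1)]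
  unfolding torus_bundle_with_connection_def ball_coords by blast

text \<open>The derivative of \<open>y \<mapsto> \<sigma> y \<cdot> q y\<close> splits into the derivative of \<open>\<sigma> y \<cdot> q x\<close>, on which the
  connection takes the same value as on the derivative of \<open>\<sigma>\<close> by invariance, and a vertical vector
  with generator \<open>dq\<close>, which the connection reproduces.\<close>

lemma pullback_translated_section:
  assumes tr: "trivialization V \<sigma> h" and W: "open W" "W \<subseteq> V" and q: "smooth_fun M W q"
    and s: "\<And>y. y \<in> W \<Longrightarrow> s y = rmul P (\<sigma> y) (torus_of (q y))"
    and c: "c \<in> M" "x \<in> W" "x \<in> cdom c"
  shows "pullback1 (total P) s (conn P) c x w = pullback1 (total P) \<sigma> (conn P) c x w + d0 q c x w"
proof -
  note sec = section_props[OF trivializationD(1)[OF tr]]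
  have xV: "x \<in> V" using W(2) c(2) by blast
  define p where "p = rmul P (\<sigma> x) (torus_of (q x))"
  have sx: "s x = p" unfolding p_def by (rule s[OF c(2)])
  have \<sigma>x: "\<sigma> x \<in> points (total P)" by (rule sec(5)[OF xV])
  then have p: "p \<in> points (total P)" unfolding p_def by (rule rmul_props(2))
  define c' where "c' = (SOME c'. c' \<in> total P \<and> p \<in> cdom c')"
  define c'' where "c'' = (SOME c''. c'' \<in> total P \<and> \<sigma> x \<in> cdom c'')"
  have "\<exists>c'. c' \<in> total P \<and> p \<in> cdom c'" "\<exists>c''. c'' \<in> total P \<and> \<sigma> x \<in> cdom c''"
    using p \<sigma>x unfolding points_def by blast+
  then have c': "c' \<in> total P" "p \<in> cdom c'" and c'': "c'' \<in> total P" "\<sigma> x \<in> cdom c''"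
    unfolding c'_def c''_def by (metis (mono_tags, lifting) someI_ex)+
  define \<psi> where "\<psi> = (\<lambda>(a, v). cmap c' (rmul P (\<sigma> (cinv c a)) (torus_of v)))"
  obtain D where D: "(\<psi> has_derivative D) (at (cmap c x, q x))"
    using trivialization_derivative[OF tr c(1) c'(1) xV c(3)] c'(2) unfolding \<psi>_def p_def by blast
  have Dlin: "linear D" using has_derivative_linear[OF D] .
  let ?a = "cmap c x"

  have dq: "(q \<circ> cinv c has_derivative d0 q c x) (at ?a)" by (rule d0_has_derivative[OF q c])
  have "((\<lambda>a. (a, (q \<circ> cinv c) a)) has_derivative (\<lambda>v. (v, d0 q c x v))) (at ?a)"
    by (rule has_derivative_Pair[OF has_derivative_ident dq])
  moreover have "(\<psi> has_derivative D) (at (?a, (q \<circ> cinv c) ?a))" using D c by simp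
  ultimately have "(\<psi> \<circ> (\<lambda>a. (a, (q \<circ> cinv c) a)) has_derivative D \<circ> (\<lambda>v. (v, d0 q c x v))) (at ?a)"
    by (rule diff_chain_at)
  then have d\<psi>: "(\<psi> \<circ> (\<lambda>a. (a, (q \<circ> cinv c) a)) has_derivative D \<circ> (\<lambda>v. (v, d0 q c x v))) (at ?a)" .
  have aW: "?a \<in> cmap c ` (W \<inter> cdom c)" using c by blast
  have s\<psi>: "(cmap c' \<circ> s \<circ> cinv c) a = (\<psi> \<circ> (\<lambda>a. (a, (q \<circ> cinv c) a))) a"
    if "a \<in> cmap c ` (W \<inter> cdom c)" for a
    using that s c(1) by (auto simp: \<psi>_def)
  have ds: "(cmap c' \<circ> s \<circ> cinv c has_derivative D \<circ> (\<lambda>v. (v, d0 q c x v))) (at ?a)"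
    by (rule has_derivative_cong_open[OF chart_image_open[OF c(1) W(1)] aW, THEN iffD2, rotated, OF d\<psi>])
       (rule s\<psi>)

  \<comment> \<open>The curve \<open>t \<mapsto> \<sigma> x \<cdot> (q x + t \<xi>)\<close> is an orbit of the action through \<open>p\<close>.\<close>
  have vert: "conn P c' p (D (0, \<xi>)) = \<xi>" for \<xi>
  proof -
    have "((\<lambda>t. (?a, q x + t *\<^sub>R \<xi>)) has_derivative (\<lambda>t. (0, t *\<^sub>R \<xi>))) (at 0)"
      by (auto intro!: derivative_eq_intros)
    moreover have "(\<psi> has_derivative D) (at (?a, q x + 0 *\<^sub>R \<xi>))" using D by simp
    ultimately have "(\<psi> \<circ> (\<lambda>t. (?a, q x + t *\<^sub>R \<xi>)) has_derivative D \<circ> (\<lambda>t. (0, t *\<^sub>R \<xi>))) (at 0)"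
      by (rule diff_chain_at)
    moreover have "(\<psi> \<circ> (\<lambda>t. (?a, q x + t *\<^sub>R \<xi>))) = (\<lambda>t. cmap c' (rmul P p (torus_of (t *\<^sub>R \<xi>))))"
      by (rule ext) (simp add: \<psi>_def p_def c torus_of_add rmul_props(4)[OF \<sigma>x])
    moreover have "(D \<circ> (\<lambda>t. (0, t *\<^sub>R \<xi>))) = (\<lambda>t. t *\<^sub>R D (0, \<xi>))"
      using linear_scale[OF Dlin, of _ "(0, \<xi>)"] by (simp add: o_def)
    ultimately have "((\<lambda>t. cmap c' (rmul P p (torus_of (t *\<^sub>R \<xi>)))) has_vector_derivative D (0, \<xi>)) (at 0)"
      unfolding has_vector_derivative_def by simp
    then have "vector_derivative (\<lambda>t. cmap c' (rmul P p (torus_of (t *\<^sub>R \<xi>)))) (at 0) = D (0, \<xi>)"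
      by (rule vector_derivative_at)
    then show ?thesis using conn_vertical[OF c', of \<xi>] by simp
  qed

  \<comment> \<open>Near \<open>x\<close> the map \<open>y \<mapsto> \<sigma> y \<cdot> q x\<close> is the right translation after \<open>\<sigma>\<close>; both expressions have a derivative
    at \<open>x\<close>, which is therefore the same.\<close>
  have horiz: "conn P c' p (D (v, 0)) = pullback1 (total P) \<sigma> (conn P) c x v" for v
  proof -
    let ?R = "\<lambda>p. rmul P p (torus_of (q x))"
    define K where "K = frechet_derivative (cmap c'' \<circ> \<sigma> \<circ> cinv c) (at ?a)"
    let ?S = "cmap c ` (V \<inter> cdom c \<inter> \<sigma> -` cdom c'')"
    have "smooth_on ?S (cmap c'' \<circ> \<sigma> \<circ> cinv c)"
      using sec(3) c(1) c''(1) unfolding smooth_map_def by blast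
    moreover have "?a \<in> ?S" using xV c(3) c''(2) by blast
    ultimately have K: "(cmap c'' \<circ> \<sigma> \<circ> cinv c has_derivative K) (at ?a)"
      unfolding K_def by (rule smooth_on_has_derivative)
    obtain E where E: "(cmap c' \<circ> ?R \<circ> cinv c'' has_derivative E) (at (cmap c'' (\<sigma> x)))"
      using right_translation_derivative[OF tr xV c'' c'(1)] c'(2) unfolding p_def by blast
    then have "(cmap c' \<circ> ?R \<circ> cinv c'' has_derivative E) (at ((cmap c'' \<circ> \<sigma> \<circ> cinv c) ?a))"
      using c by simp
    from diff_chain_at[OF K this]
    have EK: "((cmap c' \<circ> ?R \<circ> cinv c'') \<circ> (cmap c'' \<circ> \<sigma> \<circ> cinv c) has_derivative E \<circ> K) (at ?a)" .
    have "((\<lambda>a. (a, q x)) has_derivative (\<lambda>v. (v, 0))) (at ?a)"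
      by (auto intro!: derivative_eq_intros)
    from diff_chain_at[OF this D]
    have DD: "(\<psi> \<circ> (\<lambda>a. (a, q x)) has_derivative D \<circ> (\<lambda>v. (v, 0))) (at ?a)" .
    have "continuous_on V \<sigma>" using sec(3) unfolding smooth_map_def by blast
    then have "open (V \<inter> \<sigma> -` cdom c'')" using sec(1) T.chart_open[OF c''(1)] by (rule continuous_open_preimage)
    then have N: "open (cmap c ` ((V \<inter> \<sigma> -` cdom c'') \<inter> cdom c))" by (rule chart_image_open[OF c(1)])
    have aN: "?a \<in> cmap c ` ((V \<inter> \<sigma> -` cdom c'') \<inter> cdom c)" using xV c(3) c''(2) by blast
    have eq: "((cmap c' \<circ> ?R \<circ> cinv c'') \<circ> (cmap c'' \<circ> \<sigma> \<circ> cinv c)) a = (\<psi> \<circ> (\<lambda>a. (a, q x))) a"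
      if "a \<in> cmap c ` ((V \<inter> \<sigma> -` cdom c'') \<inter> cdom c)" for a
      using that c(1) c''(1) by (auto simp: \<psi>_def)
    have "((cmap c' \<circ> ?R \<circ> cinv c'') \<circ> (cmap c'' \<circ> \<sigma> \<circ> cinv c) has_derivative D \<circ> (\<lambda>v. (v, 0))) (at ?a)"
      by (rule has_derivative_cong_open[OF N aN, THEN iffD2, rotated, OF DD]) (rule eq)
    then have "E \<circ> K = D \<circ> (\<lambda>v. (v, 0))" using EK has_derivative_unique by blast
    then have "D (v, 0) = E (K v)" by (metis comp_apply)
    moreover have "conn P c' p (E z) = conn P c'' (\<sigma> x) z" for z
      using conn_invariant[OF c'', of "torus_of (q x)" z] frechet_derivative_eqI[OF E]
      unfolding pullback1_def Let_def p_def[symmetric] c'_def[symmetric] by simp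
    moreover have "pullback1 (total P) \<sigma> (conn P) c x v = conn P c'' (\<sigma> x) (K v)"
      unfolding pullback1_def Let_def K_def c''_def ..
    ultimately show ?thesis by simp
  qed

  have "pullback1 (total P) s (conn P) c x w = conn P c' p (D (w, d0 q c x w))"
    unfolding pullback1_def Let_def sx c'_def[symmetric] frechet_derivative_eqI[OF ds] by simp
  also have "(w, d0 q c x w) = (w, 0) + (0, d0 q c x w)" by simp
  also have "conn P c' p (D ((w, 0) + (0, d0 q c x w))) = conn P c' p (D (w, 0)) + conn P c' p (D (0, d0 q c x w))"
    by (simp only: linear_add[OF Dlin] linear_add[OF T.is_form1D(1)[OF conn_form c'(1) p c'(2)]])
  finally show ?thesis unfolding vert horiz .
qed

text \<open>The function \<open>q\<close> is a local lift of \<open>h \<circ> s\<close>.\<close>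

lemma section_fibre_coordinate:
  assumes tr: "trivialization V \<sigma> h" and s: "local_section M P U s" and x: "x \<in> U" "x \<in> V"
  shows "\<exists>W q. open W \<and> x \<in> W \<and> W \<subseteq> U \<and> W \<subseteq> V \<and> smooth_fun M W q \<and>
    (\<forall>y\<in>W. s y = rmul P (\<sigma> y) (torus_of (q y)))"
proof -
  note sec = section_props[OF s]
  have "s x \<in> {p \<in> points (total P). proj P p \<in> V}" using sec(4,5)[OF x(1)] x(2) by simp
  from T.smooth_torus_lift[OF trivializationD(3)[OF tr] this]
  obtain G g where G: "open G" "s x \<in> G" "G \<subseteq> {p \<in> points (total P). proj P p \<in> V}"
      and g: "smooth_fun (total P) G g" "\<forall>p\<in>G. h p = torus_of (g p)"
    by (elim exE conjE)
  note g = g(1) bspec[OF g(2)]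
  have cont: "continuous_on U s" using sec(3) unfolding smooth_map_def by blast
  define W where "W = U \<inter> s -` G"
  have W: "open W" unfolding W_def using cont sec(1) G(1) by (rule continuous_open_preimage)
  have WU: "W \<subseteq> U" unfolding W_def by blast
  have y: "s y \<in> points (total P)" "proj P (s y) = y" "y \<in> V" "s y \<in> G" if "y \<in> W" for y
    using that sec(4,5)[of y] G(3) unfolding W_def by auto
  show ?thesis
  proof (intro exI conjI ballI, rule W)
    show "W \<subseteq> U" by (rule WU)
    show "x \<in> W" unfolding W_def using x(1) G(2) by blast
    show "W \<subseteq> V" using y(3) by blast
    show "smooth_fun M W (\<lambda>y. g (s y))"
      by (rule smooth_fun_compose_smooth_map[OF manifold_axioms total_manifold
            smooth_map_subset[OF sec(3) WU] g(1) W G(1)]) (use y(4) in blast)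
    show "s y = rmul P (\<sigma> y) (torus_of (g (s y)))" if "y \<in> W" for y
      using trivializationD(4)[OF tr y(1)[OF that]] y[OF that] g(2) by simp
  qed
qed

text \<open>Both sections are compared with the section of one trivialization.\<close>

lemma sections_differ:
  assumes s: "local_section M P U s" and s': "local_section M P U' s'" and x: "x \<in> U" "x \<in> U'"
  shows "\<exists>W p. open W \<and> x \<in> W \<and> W \<subseteq> U \<and> W \<subseteq> U' \<and> smooth_fun M W p \<and>
    (\<forall>y\<in>W. s y = rmul P (s' y) (torus_of (p y))) \<and>
    (\<forall>c y v. c \<in> M \<longrightarrow> y \<in> W \<longrightarrow> y \<in> cdom c \<longrightarrow>
      pullback1 (total P) s' (conn P) c y v = pullback1 (total P) s (conn P) c y v - d0 p c y v)"
proof -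
  have "x \<in> points M" using section_props(2)[OF s] x(1) by blast
  then obtain V \<sigma> h where V: "x \<in> V" and tr: "trivialization V \<sigma> h" by (rule trivialization_at)
  obtain W1 q where W1: "open W1" "x \<in> W1" "W1 \<subseteq> U" "W1 \<subseteq> V" "smooth_fun M W1 q"
    "\<forall>y\<in>W1. s y = rmul P (\<sigma> y) (torus_of (q y))"
    using section_fibre_coordinate[OF tr s x(1) V] by (elim exE conjE)
  obtain W2 q' where W2: "open W2" "x \<in> W2" "W2 \<subseteq> U'" "W2 \<subseteq> V" "smooth_fun M W2 q'"
    "\<forall>y\<in>W2. s' y = rmul P (\<sigma> y) (torus_of (q' y))"
    using section_fibre_coordinate[OF tr s' x(2) V] by (elim exE conjE)
  define W where "W = W1 \<inter> W2"
  have W: "open W" "x \<in> W" "W \<subseteq> U" "W \<subseteq> U'" "W \<subseteq> V" unfolding W_def using W1(1-4) W2(1-4) by auto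
  have q: "smooth_fun M W q" "smooth_fun M W q'"
    unfolding W_def by (rule smooth_fun_subset[OF W1(5)], simp) (rule smooth_fun_subset[OF W2(5)], simp)
  have sy: "s y = rmul P (\<sigma> y) (torus_of (q y))" "s' y = rmul P (\<sigma> y) (torus_of (q' y))" if "y \<in> W" for y
    using that W1(6) W2(6) unfolding W_def by auto
  have "s y = rmul P (s' y) (torus_of (q y - q' y))" if "y \<in> W" for y
  proof -
    have "\<sigma> y \<in> points (total P)" using section_props(5)[OF trivializationD(1)[OF tr]] that W(5) by blast
    from rmul_props(4)[OF this]
    show ?thesis unfolding sy[OF that] by (simp add: torus_of_add[symmetric])
  qed
  moreover have "pullback1 (total P) s' (conn P) c y v = pullback1 (total P) s (conn P) c y v -
      d0 (\<lambda>y. q y - q' y) c y v" if "c \<in> M" "y \<in> W" "y \<in> cdom c" for c y v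
    using pullback_translated_section[OF tr W(1,5) q(1) sy(1) that, of v]
      pullback_translated_section[OF tr W(1,5) q(2) sy(2) that, of v] d0_diff[OF q that, of v] by simp
  moreover have "smooth_fun M W (\<lambda>y. q y - q' y)" by (rule smooth_fun_diff[OF W(1) q])
  ultimately show ?thesis using W(1-4) by (intro exI[of _ W] exI[of _ "\<lambda>y. q y - q' y"]) blast
qed

end

section \<open>Cocycles over the same pair of bundles\<close>

context manifold begin

lemma cocycle_curvature_eq:
  assumes U: "open_cover M \<U>" and z: "td_cocycle M \<U> z" and ij: "i \<in> \<U>" "j \<in> \<U>"
    and c: "c \<in> M" "x \<in> i" "x \<in> j" "x \<in> cdom c"
  shows "d1 (tAh z j) c x v w = d1 (tAh z i) c x v w"
proof (rule d1_diff_exact[OF _ _ td_cocycleD(6)[OF z ij] c(1) _ c(4)])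
  show "open (i \<inter> j)" using open_coverD(1)[OF U] ij by blast
  show "is_form1 M (i \<inter> j) (tAh z i)" by (rule is_form1_subset[OF td_cocycleD(2)[OF z ij(1)]]) simp
  show "x \<in> i \<inter> j" using c by simp
  show "tAh z j c y v = tAh z i c y v - d0 (tah z i j) c y v" if "y \<in> i \<inter> j" "y \<in> cdom c" for y v
    by (rule td_cocycleD(14)[OF z ij c(1)]) (use that in auto)
qed

text \<open>With \<open>\<phi>\<close> and \<open>e\<close> zero, the three conditions on a gauge transformation that do not concern the bundles
  become formulas for the components of a gerbe.  They satisfy the Deligne conditions because both cocycles have the
  same curvature forms and the integers \<open>m\<close> are determined by the functions \<open>a\<close>.\<close>

lemma difference_gerbe:
  assumes U: "open_cover M \<U>" and z: "td_cocycle M \<U> z" and z': "td_cocycle M \<U> z'"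
    and p: "\<And>i. i \<in> \<U> \<Longrightarrow> smooth_fun M i (p i)" and ph: "\<And>i. i \<in> \<U> \<Longrightarrow> smooth_fun M i (ph i)"
    and q: "\<And>i j. i \<in> \<U> \<Longrightarrow> j \<in> \<U> \<Longrightarrow> q i j \<in> lattice" and qh: "\<And>i j. i \<in> \<U> \<Longrightarrow> j \<in> \<U> \<Longrightarrow> qh i j \<in> lattice"
    and a: "\<And>i j x. i \<in> \<U> \<Longrightarrow> j \<in> \<U> \<Longrightarrow> x \<in> i \<Longrightarrow> x \<in> j \<Longrightarrow> ta z' i j x + p i x = q i j + p j x + ta z i j x"
    and ah: "\<And>i j x. i \<in> \<U> \<Longrightarrow> j \<in> \<U> \<Longrightarrow> x \<in> i \<Longrightarrow> x \<in> j \<Longrightarrow> tah z' i j x + ph i x = qh i j + ph j x + tah z i j x"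
    and A: "\<And>i c x v. i \<in> \<U> \<Longrightarrow> c \<in> M \<Longrightarrow> x \<in> i \<Longrightarrow> x \<in> cdom c \<Longrightarrow> tA z' i c x v = tA z i c x v - d0 (p i) c x v"
    and Ah: "\<And>i c x v. i \<in> \<U> \<Longrightarrow> c \<in> M \<Longrightarrow> x \<in> i \<Longrightarrow> x \<in> cdom c \<Longrightarrow> tAh z' i c x v = tAh z i c x v - d0 (ph i) c x v"
  shows "\<exists>g. deligne_cocycle M \<U> g \<and> td_equiv M \<U> (td_shift g z) z'"
proof -
  note op = open_coverD(1)[OF U] and pt = open_coverD(2)[OF U]
  define B where "B = (\<lambda>i c x v w. tR z' i c x v w - tR z i c x v w - p i x \<bullet> d1 (tAh z i) c x v w)"
  define C where "C = (\<lambda>i j c x v. tphi z' i j c x v - tphi z i j c x v - q i j \<bullet> tAh z' j c x v)"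
  define D where "D = (\<lambda>i j k x. tt z' i j k x - tt z i j k x -
    circle_of (q i j \<bullet> tah z' j k x - tm z i j k \<bullet> ph k x))"
  define g where "g = \<lparr>DB = B, DA = C, Dc = D\<rparr>"
  have m: "tm z' i j k = tm z i j k + q i k - q i j - q j k"
    if ijk: "i \<in> \<U>" "j \<in> \<U>" "k \<in> \<U>" "x \<in> i" "x \<in> j" "x \<in> k" for i j k x
  proof -
    have a': "ta z' i j x = q i j + p j x + ta z i j x - p i x" if "i \<in> \<U>" "j \<in> \<U>" "x \<in> i" "x \<in> j" for i j
      using a[OF that] by (simp add: algebra_simps)
    have m': "tm z' i j k = ta z' i k x - ta z' i j x - ta z' j k x"
        "tm z i j k = ta z i k x - ta z i j x - ta z j k x"
      using td_cocycleD(10)[OF z ijk] td_cocycleD(10)[OF z' ijk] by simp_all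
    show ?thesis
      unfolding m' a'[OF ijk(1,2,4,5)] a'[OF ijk(2,3,5,6)] a'[OF ijk(1,3,4,6)] by simp
  qed
  have curv: "d1 (tAh z' i) c x v w = d1 (tAh z i) c x v w"
    if i: "i \<in> \<U>" and c: "c \<in> M" "x \<in> i" "x \<in> cdom c" for i c x v w
    by (rule d1_diff_exact[OF op[OF i] td_cocycleD(2)[OF z i] ph[OF i] c]) (rule Ah[OF i c(1)])
  have g: "deligne_cocycle M \<U> g"
  proof (rule deligne_cocycleI; (unfold g_def deligne.simps)?)
    fix i assume i: "i \<in> \<U>"
    show "is_form2 M i (B i)"
      unfolding B_def
      by (intro is_form2_diff is_form2_inner_fun is_form2_d1 op[OF i] td_cocycleD(3)[OF z i]
          td_cocycleD(3)[OF z' i] td_cocycleD(2)[OF z i] p[OF i])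
    fix j assume j: "j \<in> \<U>"
    have ij: "open (i \<inter> j)" "i \<inter> j \<subseteq> points M" using op pt i j by auto
    have Aj: "is_form1 M (i \<inter> j) (tAh z' j)"
      by (rule is_form1_subset[OF td_cocycleD(2)[OF z' j]]) simp
    note fo = td_cocycleD(4)[OF z' i j] td_cocycleD(4)[OF z i j] is_form1_inner_const[OF ij(1) Aj, of "q i j"]
    show "is_form1 M (i \<inter> j) (C i j)"
      unfolding C_def by (intro is_form1_diff ij(1) fo)
    show "B j c x v w + d1 (C i j) c x v w = B i c x v w"
      if c: "c \<in> M" "x \<in> i" "x \<in> j" "x \<in> cdom c" for c x v w
    proof -
      have x: "x \<in> i \<inter> j" using c by simp
      have "d1 (C i j) c x v w = d1 (tphi z' i j) c x v w - d1 (tphi z i j) c x v w - q i j \<bullet> d1 (tAh z' j) c x v w"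
        unfolding C_def
        using d1_diff[OF is_form1_diff[OF ij(1) fo(1,2)] fo(3) c(1) x c(4), of v w]
          d1_diff[OF fo(1,2) c(1) x c(4), of v w] d1_inner_const[OF Aj c(1) x c(4), of "q i j" v w] by simp
      moreover have "ta z' i j x = q i j + p j x + ta z i j x - p i x"
        using a[OF i j c(2,3)] by (simp add: algebra_simps)
      ultimately show ?thesis
        using td_cocycleD(16)[OF z i j c, of v w] td_cocycleD(16)[OF z' i j c, of v w]
        unfolding B_def curv[OF i c(1,2,4)] curv[OF j c(1,3,4)] cocycle_curvature_eq[OF U z i j c]
        by (simp add: inner_diff_left inner_add_left)
    qed
    fix k assume k: "k \<in> \<U>"
    have ijk: "open (i \<inter> j \<inter> k)" "i \<inter> j \<inter> k \<subseteq> points M" using op pt i j k by auto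
    have s1: "smooth_fun M (i \<inter> j \<inter> k) (tah z' j k)"
      by (rule smooth_fun_subset[OF td_cocycleD(6)[OF z' j k]]) auto
    have s2: "smooth_fun M (i \<inter> j \<inter> k) (ph k)" by (rule smooth_fun_subset[OF ph[OF k]]) auto
    note s = smooth_fun_inner_const[OF ijk(1) s1, of "q i j"] smooth_fun_inner_const[OF ijk(1) s2, of "tm z i j k"]
    note s3 = smooth_fun_diff[OF ijk(1) s]
    note sc = td_cocycleD(9)[OF z' i j k] td_cocycleD(9)[OF z i j k] smooth_circle_circle_of[OF ijk s3]
    show "smooth_circle M (i \<inter> j \<inter> k) (D i j k)"
      unfolding D_def by (intro smooth_circle_diff sc)
    show "C i k c x v = C i j c x v + C j k c x v - mc M (D i j k) c x v"
      if c: "c \<in> M" "x \<in> i" "x \<in> j" "x \<in> k" "x \<in> cdom c" for c x v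
    proof -
      have x: "x \<in> i \<inter> j \<inter> k" using c by simp
      have mcD: "mc M (D i j k) c x v = mc M (tt z' i j k) c x v - mc M (tt z i j k) c x v
          - (q i j \<bullet> d0 (tah z' j k) c x v - tm z i j k \<bullet> d0 (ph k) c x v)"
        unfolding D_def
        using mc_diff[OF smooth_circle_diff[OF sc(1,2)] sc(3) c(1) x c(5), of v]
          mc_diff[OF sc(1,2) c(1) x c(5), of v] mc_circle_of[OF ijk s3 c(1) x c(5), of v]
          d0_diff[OF s c(1) x c(5), of v] d0_inner_const[OF s1 c(1) x c(5), of "q i j" v]
          d0_inner_const[OF s2 c(1) x c(5), of "tm z i j k" v] by simp
      have 1: "tphi z' i k c x v = tphi z' j k c x v + tphi z' i j c x v - mc M (tt z' i j k) c x v
          + tAh z' k c x v \<bullet> (tm z i j k + q i k - q i j - q j k)"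
        using td_cocycleD(15)[OF z' i j k c, of v] unfolding m[OF i j k c(2-4)] by simp
      have 2: "tphi z i k c x v = tphi z j k c x v + tphi z i j c x v - mc M (tt z i j k) c x v
          + (tAh z' k c x v + d0 (ph k) c x v) \<bullet> tm z i j k"
        using td_cocycleD(15)[OF z i j k c, of v] Ah[OF k c(1,4,5), of v] by simp
      have 3: "tAh z' j c x v = tAh z' k c x v + d0 (tah z' j k) c x v"
        using td_cocycleD(14)[OF z' j k c(1,3,4,5), of v] by simp
      show ?thesis
        unfolding C_def mcD 1 2 3
        by (simp add: inner_diff_left inner_diff_right inner_add_left inner_add_right inner_commute)
    qed
    show "D j k l x + D i j l x = D i j k x + D i k l x"
      if l: "l \<in> \<U>" and x: "x \<in> i" "x \<in> j" "x \<in> k" "x \<in> l" for l x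
    proof -
      have mm: "tm z j k l = tm z i j k + tm z i k l - tm z i j l"
      proof -
        have t: "tm z a b c = ta z a c x - ta z a b x - ta z b c x"
          if "a \<in> \<U>" "b \<in> \<U>" "c \<in> \<U>" "x \<in> a" "x \<in> b" "x \<in> c" for a b c
          using td_cocycleD(10)[OF z that] by simp
        show ?thesis
          unfolding t[OF j k l x(2-4)] t[OF i j k x(1-3)] t[OF i k l x(1,3,4)] t[OF i j l x(1,2,4)] by simp
      qed
      have ahl: "tah z' j l x = tmh z' j k l + tah z' j k x + tah z' k l x"
        by (rule td_cocycleD(11)[OF z' j k l x(2-4)])
      have ahk: "tah z' k l x = qh k l + ph l x + tah z k l x - ph k x"
        using ah[OF k l x(3,4)] by (simp add: algebra_simps)
      \<comment> \<open>The two sides differ by the integer \<open>q i j \<bullet> tmh z' j k l + tm z i j k \<bullet> qh k l\<close>.\<close>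
      have "circle_of ((q j k \<bullet> tah z' k l x - tm z j k l \<bullet> ph l x) + (q i j \<bullet> tah z' j l x - tm z i j l \<bullet> ph l x)
          - (q i j \<bullet> tah z' j k x - tm z i j k \<bullet> ph k x) - (q i k \<bullet> tah z' k l x - tm z i k l \<bullet> ph l x)) =
          circle_of (tm z i j k \<bullet> tah z k l x - tm z' i j k \<bullet> tah z' k l x)"
        unfolding circle_of_eq_iff mm ahl m[OF i j k x(1-3)]
      proof -
        have "(q j k \<bullet> tah z' k l x - (tm z i j k + tm z i k l - tm z i j l) \<bullet> ph l x +
            (q i j \<bullet> (tmh z' j k l + tah z' j k x + tah z' k l x) - tm z i j l \<bullet> ph l x) -
            (q i j \<bullet> tah z' j k x - tm z i j k \<bullet> ph k x) - (q i k \<bullet> tah z' k l x - tm z i k l \<bullet> ph l x)) -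
            (tm z i j k \<bullet> tah z k l x - (tm z i j k + q i k - q i j - q j k) \<bullet> tah z' k l x) =
            q i j \<bullet> tmh z' j k l + tm z i j k \<bullet> qh k l"
          unfolding ahk by (simp add: inner_diff_left inner_diff_right inner_add_left inner_add_right)
        also have "\<dots> \<in> \<int>"
          by (intro Ints_add lattice_inner q qh i j k l td_cocycleD(8)[OF z'] td_cocycleD(7)[OF z])
        finally show "q j k \<bullet> tah z' k l x - (tm z i j k + tm z i k l - tm z i j l) \<bullet> ph l x +
            (q i j \<bullet> (tmh z' j k l + tah z' j k x + tah z' k l x) - tm z i j l \<bullet> ph l x) -
            (q i j \<bullet> tah z' j k x - tm z i j k \<bullet> ph k x) - (q i k \<bullet> tah z' k l x - tm z i k l \<bullet> ph l x) -
            (tm z i j k \<bullet> tah z k l x - (tm z i j k + q i k - q i j - q j k) \<bullet> tah z' k l x) \<in> \<int>" .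
      qed
      then have 3: "circle_of (q j k \<bullet> tah z' k l x - tm z j k l \<bullet> ph l x) =
          circle_of (q i j \<bullet> tah z' j k x - tm z i j k \<bullet> ph k x) + circle_of (q i k \<bullet> tah z' k l x - tm z i k l \<bullet> ph l x)
          - circle_of (q i j \<bullet> tah z' j l x - tm z i j l \<bullet> ph l x) + circle_of (tm z i j k \<bullet> tah z k l x)
          - circle_of (tm z' i j k \<bullet> tah z' k l x)"
        unfolding circle_of_add circle_of_diff by (simp add: algebra_simps)
      have 1: "tt z j k l x = tt z i k l x + tt z i j k x - circle_of (tm z i j k \<bullet> tah z k l x) - tt z i j l x"
        using td_cocycleD(12)[OF z i j k l x] by (simp add: algebra_simps)
      have 2: "tt z' j k l x = tt z' i k l x + tt z' i j k x - circle_of (tm z' i j k \<bullet> tah z' k l x) - tt z' i j l x"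
        using td_cocycleD(12)[OF z' i j k l x] by (simp add: algebra_simps)
      show ?thesis unfolding D_def 1 2 3 by (simp add: algebra_simps)
    qed
  qed
  have "td_gauge M \<U> (\<lambda>i c x v. 0) p ph q qh (\<lambda>i j x. 0) (td_shift g z) z'"
  proof (rule td_gaugeI; (unfold td_shift_simps)?)
    fix i assume i: "i \<in> \<U>"
    show "is_form1 M i (\<lambda>c x v. 0)" by (rule is_form1_zero[OF op[OF i]])
    show "smooth_fun M i (p i)" "smooth_fun M i (ph i)" by (rule p[OF i], rule ph[OF i])
    show "tR z' i c x v w + d1 (\<lambda>c x v. 0) c x v w =
        tR z i c x v w + DB g i c x v w + p i x \<bullet> d1 (tAh z i) c x v w" for c x v w
      by (simp add: g_def B_def)
    fix j assume j: "j \<in> \<U>"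
    show "q i j \<in> lattice" "qh i j \<in> lattice" by (rule q[OF i j], rule qh[OF i j])
    show "smooth_circle M (i \<inter> j) (\<lambda>x. 0)" using op pt i j by (intro smooth_circle_zero) blast+
    show "tphi z' i j c x v + 0 - q i j \<bullet> tAh z' j c x v =
        0 + (tphi z i j c x v + DA g i j c x v) - mc M (\<lambda>x. 0) c x v"
      if "c \<in> M" "x \<in> i" "x \<in> j" "x \<in> cdom c" for c x v
      using mc_zero[OF that(1,4)] by (simp add: g_def C_def)
    show "tt z' i j k x + 0 - circle_of (tah z' j k x \<bullet> q i j) + 0 =
        0 + (tt z i j k x + Dc g i j k x) - circle_of (ph k x \<bullet> tm z i j k)" for k x
      by (simp add: g_def D_def circle_of_diff inner_commute algebra_simps)
  qed (rule a ah A Ah; assumption)+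
  then show ?thesis using g unfolding td_equiv_iff_gauge by blast
qed

text \<open>An automorphism of a cocycle up to the gerbe \<open>g\<close>: the functions \<open>p\<close>, \<open>ph\<close> are closed, hence constant on
  the connected members, and agree up to integers across the cover.  With \<open>p = y + n\<close>
  the integral part \<open>n\<close> is absorbed in the gauge transformation; that of \<open>ph\<close> drops out because \<open>ph\<close> only enters
  through products with integers modulo integers.\<close>

lemma stabilizing_gerbe_is_trivial:
  assumes U: "open_cover M \<U>" and conn: "\<And>i. i \<in> \<U> \<Longrightarrow> connected i" and M: "connected (points M)"
    and z: "td_cocycle M \<U> z" and eq: "td_equiv M \<U> (td_shift g z) z"
    and F: "\<And>i c x v w. i \<in> \<U> \<Longrightarrow> c \<in> M \<Longrightarrow> x \<in> i \<Longrightarrow> x \<in> cdom c \<Longrightarrow> F c x v w = d1 (tA z i) c x v w"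
    and Fh: "\<And>i c x v w. i \<in> \<U> \<Longrightarrow> c \<in> M \<Longrightarrow> x \<in> i \<Longrightarrow> x \<in> cdom c \<Longrightarrow> Fh c x v w = d1 (tAh z i) c x v w"
  shows "\<exists>y yh. deligne_equiv M \<U> (trivial_deligne (\<lambda>c x v w. y \<bullet> Fh c x v w + yh \<bullet> F c x v w)) g"
proof -
  note op = open_coverD(1)[OF U] and pt = open_coverD(2)[OF U]
  from eq obtain \<phi> p ph q qh e where G: "td_gauge M \<U> \<phi> p ph q qh e (td_shift g z) z"
    unfolding td_equiv_iff_gauge by blast
  have const: "f x = f x'"
    if i: "i \<in> \<U>" and f: "smooth_fun M i f" and d: "\<And>c x v. c \<in> M \<Longrightarrow> x \<in> i \<Longrightarrow> x \<in> cdom c \<Longrightarrow> d0 f c x v = 0"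
      and x: "x \<in> i" "x' \<in> i" for f :: "'x \<Rightarrow> real^'n" and i x x'
    by (rule constant_if_d0_zero[OF op[OF i] pt[OF i] f conn[OF i] x d])
  have zero: "d0 (p i) c x v = 0" "d0 (ph i) c x v = 0" if "i \<in> \<U>" "c \<in> M" "x \<in> i" "x \<in> cdom c" for i c x v
    using td_gaugeD(10)[OF G that, of v] td_gaugeD(11)[OF G that, of v] by simp_all
  have pq: "p i x - p j x = q i j" "ph i x - ph j x = qh i j" if "i \<in> \<U>" "j \<in> \<U>" "x \<in> i" "x \<in> j" for i j x
    using td_gaugeD(7)[OF G that] td_gaugeD(8)[OF G that] by (simp_all add: algebra_simps)
  \<comment> \<open>The members on which the constant is \<open>y\<close> modulo the lattice and those on which it is not have
    disjoint open unions.\<close>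
  have mod: "\<exists>y. \<forall>i\<in>\<U>. \<forall>x\<in>i. f i x - y \<in> lattice"
    if f: "\<And>i x x'. i \<in> \<U> \<Longrightarrow> x \<in> i \<Longrightarrow> x' \<in> i \<Longrightarrow> f i x = f i x'"
      and l: "\<And>i j x. i \<in> \<U> \<Longrightarrow> j \<in> \<U> \<Longrightarrow> x \<in> i \<Longrightarrow> x \<in> j \<Longrightarrow> f i x - f j x \<in> lattice"
    for f :: "'x set \<Rightarrow> 'x \<Rightarrow> real^'n"
  proof (cases "points M = {}")
    case True
    then show ?thesis using pt by blast
  next
    case False
    then obtain i0 x0 where 0: "i0 \<in> \<U>" "x0 \<in> i0" using U unfolding open_cover_def by blast
    define y where "y = f i0 x0"
    define S where "S = \<Union>{i \<in> \<U>. \<forall>x\<in>i. f i x - y \<in> lattice}"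
    define T where "T = \<Union>{i \<in> \<U>. \<exists>x\<in>i. f i x - y \<notin> lattice}"
    have "open S" "open T" unfolding S_def T_def using op by blast+
    moreover have "S \<inter> T \<inter> points M = {}"
    proof (rule ccontr)
      assume "S \<inter> T \<inter> points M \<noteq> {}"
      then obtain x i j x' where i: "i \<in> \<U>" "x \<in> i" "\<forall>x\<in>i. f i x - y \<in> lattice"
        and j: "j \<in> \<U>" "x \<in> j" "x' \<in> j" "f j x' - y \<notin> lattice" unfolding S_def T_def by blast
      have "f j x' = f j x" by (rule f[OF j(1,3,2)])
      moreover have "f j x - y \<in> lattice"
        using lattice_add[OF l[OF j(1) i(1) j(2) i(2)] bspec[OF i(3) i(2)]] by simp
      ultimately show False using j(4) by simp
    qed
    moreover have "points M \<subseteq> S \<union> T"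
    proof
      fix x assume "x \<in> points M"
      then obtain i where "i \<in> \<U>" "x \<in> i" using U unfolding open_cover_def by blast
      then show "x \<in> S \<union> T" unfolding S_def T_def by blast
    qed
    ultimately have "S \<inter> points M = {} \<or> T \<inter> points M = {}"
      by (intro connectedD[OF M])
    moreover have "x0 \<in> S \<inter> points M"
    proof -
      have "f i0 x - y \<in> lattice" if "x \<in> i0" for x unfolding y_def using f[OF 0(1) that 0(2)] by simp
      then show ?thesis unfolding S_def using 0 pt by blast
    qed
    ultimately have "T \<inter> points M = {}" by blast
    then have "f i x - y \<in> lattice" if "i \<in> \<U>" "x \<in> i" for i x
      unfolding T_def using pt that by blast
    then show ?thesis by blast
  qed
  have pc1: "p i x = p i x'" if "i \<in> \<U>" "x \<in> i" "x' \<in> i" for i x x'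
    by (rule const[OF that(1) td_gaugeD(2)[OF G that(1)] _ that(2,3)]) (rule zero(1)[OF that(1)])
  have pc2: "ph i x = ph i x'" if "i \<in> \<U>" "x \<in> i" "x' \<in> i" for i x x'
    by (rule const[OF that(1) td_gaugeD(3)[OF G that(1)] _ that(2,3)]) (rule zero(2)[OF that(1)])
  note pc = pc1 pc2
  have "p i x - p j x \<in> lattice" "ph i x - ph j x \<in> lattice"
    if "i \<in> \<U>" "j \<in> \<U>" "x \<in> i" "x \<in> j" for i j x
    unfolding pq[OF that] using td_gaugeD(4,5)[OF G that(1,2)] by blast+
  note mods = mod[of p, OF pc1 this(1)] mod[of ph, OF pc2 this(2)]
  obtain y where y: "\<And>i x. i \<in> \<U> \<Longrightarrow> x \<in> i \<Longrightarrow> p i x - y \<in> lattice"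
    using mods(1) by blast
  obtain yh where yh: "\<And>i x. i \<in> \<U> \<Longrightarrow> x \<in> i \<Longrightarrow> ph i x - yh \<in> lattice"
    using mods(2) by blast
  define n where "n = (\<lambda>i. if i = {} then 0 else p i (SOME x. x \<in> i) - y)"
  have n: "p i x = y + n i" if "i \<in> \<U>" "x \<in> i" for i x
  proof -
    have "(SOME x. x \<in> i) \<in> i" using that(2) by (rule someI)
    then show ?thesis unfolding n_def using pc(1)[OF that] that(2) by auto
  qed
  have nl: "n i \<in> lattice" if "i \<in> \<U>" for i
  proof (cases "i = {}")
    case False
    then have "(SOME x. x \<in> i) \<in> i" by (simp add: some_in_eq)
    then show ?thesis using y[OF that] False unfolding n_def by simp
  qed (simp add: n_def)
  have qn: "q i j = n i - n j" if "i \<in> \<U>" "j \<in> \<U>" "x \<in> i" "x \<in> j" for i j x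
    using pq(1)[OF that] n[OF that(1,3)] n[OF that(2,4)] by simp
  \<comment> \<open>\<open>C\<close> collects the terms of the equation for \<open>\<phi>\<close> with index \<open>i\<close> only, after \<open>q i j = n i - n j\<close> is
    inserted; \<open>D\<close> contains \<open>ta z i j\<close> and \<open>tah z i j\<close> because they relate the connection forms of \<open>i\<close> and \<open>j\<close>.\<close>
  define \<beta> where "\<beta> = (\<lambda>c x v w. (- y) \<bullet> Fh c x v w + (- yh) \<bullet> F c x v w)"
  define C where "C = (\<lambda>i c x v. \<phi> i c x v + (yh \<bullet> tA z i c x v - n i \<bullet> tAh z i c x v))"
  define D where "D = (\<lambda>i j x. circle_of (yh \<bullet> ta z i j x - n i \<bullet> tah z i j x) - e i j x)"
  have "deligne_gauge M \<U> C D (trivial_deligne \<beta>) g"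
  proof (rule deligne_gaugeI; (unfold trivial_deligne_def deligne.simps)?)
    fix i assume i: "i \<in> \<U>"
    note fo = is_form1_inner_const[OF op[OF i] td_cocycleD(1)[OF z i], of yh]
      is_form1_inner_const[OF op[OF i] td_cocycleD(2)[OF z i], of "n i"]
    note fd = is_form1_diff[OF op[OF i] fo]
    show "is_form1 M i (C i)" unfolding C_def by (rule is_form1_add[OF op[OF i] td_gaugeD(1)[OF G i] fd])
    show "DB g i c x v w = \<beta> c x v w + d1 (C i) c x v w"
      if c: "c \<in> M" "x \<in> i" "x \<in> cdom c" for c x v w
    proof -
      have "d1 (C i) c x v w = d1 (\<phi> i) c x v w + (yh \<bullet> F c x v w - n i \<bullet> Fh c x v w)"
        unfolding C_def
        using d1_add[OF td_gaugeD(1)[OF G i] fd c, of v w] d1_diff[OF fo c, of v w]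
          d1_inner_const[OF td_cocycleD(1)[OF z i] c, of yh v w] F[OF i c, of v w]
          d1_inner_const[OF td_cocycleD(2)[OF z i] c, of "n i" v w] Fh[OF i c, of v w] by simp
      moreover have "d1 (\<phi> i) c x v w = DB g i c x v w + (y + n i) \<bullet> Fh c x v w"
        using td_gaugeD(13)[OF G i c, of v w] n[OF i c(2)] Fh[OF i c, of v w] by simp
      ultimately show ?thesis unfolding \<beta>_def by (simp add: inner_add_left)
    qed
    fix j assume j: "j \<in> \<U>"
    have ij: "open (i \<inter> j)" "i \<inter> j \<subseteq> points M" using op pt i j by auto
    note s = smooth_fun_inner_const[OF ij(1) td_cocycleD(5)[OF z i j], of yh]
      smooth_fun_inner_const[OF ij(1) td_cocycleD(6)[OF z i j], of "n i"]
    note sd = smooth_fun_diff[OF ij(1) s]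
    note sc = smooth_circle_circle_of[OF ij sd] td_gaugeD(6)[OF G i j]
    show "smooth_circle M (i \<inter> j) (D i j)" unfolding D_def by (rule smooth_circle_diff[OF sc])
    show "DA g i j c x v = 0 + C i c x v - C j c x v - mc M (D i j) c x v"
      if c: "c \<in> M" "x \<in> i" "x \<in> j" "x \<in> cdom c" for c x v
    proof -
      have x: "x \<in> i \<inter> j" using c by simp
      have mcD: "mc M (D i j) c x v = yh \<bullet> d0 (ta z i j) c x v - n i \<bullet> d0 (tah z i j) c x v - mc M (e i j) c x v"
        unfolding D_def
        using mc_diff[OF sc c(1) x c(4), of v] mc_circle_of[OF ij sd c(1) x c(4), of v]
          d0_diff[OF s c(1) x c(4), of v] d0_inner_const[OF td_cocycleD(5)[OF z i j] c(1) x c(4), of yh v]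
          d0_inner_const[OF td_cocycleD(6)[OF z i j] c(1) x c(4), of "n i" v] by simp
      have DA: "DA g i j c x v = \<phi> i c x v - \<phi> j c x v - (n i - n j) \<bullet> tAh z j c x v + mc M (e i j) c x v"
        using td_gaugeD(12)[OF G i j c, of v] qn[OF i j c(2,3)] by simp
      have 1: "tA z i c x v = tA z j c x v + d0 (ta z i j) c x v"
        and 2: "tAh z i c x v = tAh z j c x v + d0 (tah z i j) c x v"
        using td_cocycleD(13)[OF z i j c, of v] td_cocycleD(14)[OF z i j c, of v] by simp_all
      show ?thesis unfolding C_def mcD DA 1 2 by (simp add: inner_add_right inner_diff_left)
    qed
    fix k x assume k: "k \<in> \<U>" and x: "x \<in> i" "x \<in> j" "x \<in> k"
    have Dc: "Dc g i j k x = e i j x - circle_of (tah z j k x \<bullet> (n i - n j)) + e j k x - e i k x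
        + circle_of (ph k x \<bullet> tm z i j k)"
      using td_gaugeD(9)[OF G i j k x] qn[OF i j x(1,2)] by (simp add: algebra_simps)
    have "ph k x = yh + (ph k x - yh)" by simp
    moreover have "(ph k x - yh) \<bullet> tm z i j k \<in> \<int>"
      by (rule lattice_inner[OF yh[OF k x(3)] td_cocycleD(7)[OF z i j k]])
    ultimately have phm: "circle_of (ph k x \<bullet> tm z i j k) = circle_of (yh \<bullet> tm z i j k)"
      unfolding circle_of_eq_iff by (simp add: inner_diff_left)
    have m: "tm z i j k = ta z i k x - ta z i j x - ta z j k x"
      using td_cocycleD(10)[OF z i j k x] by simp
    have "circle_of (n i \<bullet> tah z i k x) = circle_of (n i \<bullet> tah z i j x + n i \<bullet> tah z j k x)"
      unfolding circle_of_eq_iff td_cocycleD(11)[OF z i j k x]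
      using lattice_inner[OF nl[OF i] td_cocycleD(8)[OF z i j k]] by (simp add: inner_add_right)
    then have ik: "circle_of (n i \<bullet> tah z i k x) = circle_of (n i \<bullet> tah z i j x) + circle_of (n i \<bullet> tah z j k x)"
      by (simp only: circle_of_add)
    show "Dc g i j k x = 0 + D i k x - D i j x - D j k x"
      unfolding Dc phm
      unfolding D_def m circle_of_diff ik inner_diff_right
      by (simp add: inner_commute algebra_simps)
  qed
  then have "deligne_equiv M \<U> (trivial_deligne \<beta>) g" unfolding deligne_equiv_iff_gauge by blast
  then show ?thesis unfolding \<beta>_def by blast
qed

text \<open>Conversely the gauge transformation with constant functions \<open>p = -y\<close> and \<open>ph = -yh\<close> removes a
  gerbe with curving \<open>y Fh + yh F\<close>.\<close>

lemma flux_gerbe_acts_trivially: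
  assumes U: "open_cover M \<U>" and z: "td_cocycle M \<U> z"
    and F: "\<And>i c x v w. i \<in> \<U> \<Longrightarrow> c \<in> M \<Longrightarrow> x \<in> i \<Longrightarrow> x \<in> cdom c \<Longrightarrow> F c x v w = d1 (tA z i) c x v w"
    and Fh: "\<And>i c x v w. i \<in> \<U> \<Longrightarrow> c \<in> M \<Longrightarrow> x \<in> i \<Longrightarrow> x \<in> cdom c \<Longrightarrow> Fh c x v w = d1 (tAh z i) c x v w"
  shows "td_equiv M \<U> (td_shift (trivial_deligne (\<lambda>c x v w. y \<bullet> Fh c x v w + yh \<bullet> F c x v w)) z) z"
proof -
  note op = open_coverD(1)[OF U] and pt = open_coverD(2)[OF U]
  have "td_gauge M \<U> (\<lambda>i c x v. yh \<bullet> tA z i c x v) (\<lambda>i x. - y) (\<lambda>i x. - yh) (\<lambda>i j. 0) (\<lambda>i j. 0)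
    (\<lambda>i j x. circle_of ((- yh) \<bullet> ta z i j x))
    (td_shift (trivial_deligne (\<lambda>c x v w. y \<bullet> Fh c x v w + yh \<bullet> F c x v w)) z) z"
  proof (rule td_gaugeI; (unfold td_shift_simps trivial_deligne_def deligne.simps)?)
    fix i assume i: "i \<in> \<U>"
    show "is_form1 M i (\<lambda>c x v. yh \<bullet> tA z i c x v)"
      by (rule is_form1_inner_const[OF op[OF i] td_cocycleD(1)[OF z i]])
    show "smooth_fun M i (\<lambda>x. - y)" "smooth_fun M i (\<lambda>x. - yh)" by (rule smooth_fun_const[OF op[OF i]])+
    show "tR z i c x v w + d1 (\<lambda>c x v. yh \<bullet> tA z i c x v) c x v w =
        tR z i c x v w + (y \<bullet> Fh c x v w + yh \<bullet> F c x v w) + - y \<bullet> d1 (tAh z i) c x v w"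
      if c: "c \<in> M" "x \<in> i" "x \<in> cdom c" for c x v w
      using d1_inner_const[OF td_cocycleD(1)[OF z i] c, of yh v w] F[OF i c, of v w] Fh[OF i c, of v w] by simp
    fix j assume j: "j \<in> \<U>"
    have ij: "open (i \<inter> j)" "i \<inter> j \<subseteq> points M" using op pt i j by auto
    note s = smooth_fun_inner_const[OF ij(1) td_cocycleD(5)[OF z i j], of "- yh"]
    show "smooth_circle M (i \<inter> j) (\<lambda>x. circle_of ((- yh) \<bullet> ta z i j x))"
      by (rule smooth_circle_circle_of[OF ij s])
    show "tphi z i j c x v + yh \<bullet> tA z i c x v - 0 \<bullet> tAh z j c x v =
        yh \<bullet> tA z j c x v + (tphi z i j c x v + 0) - mc M (\<lambda>x. circle_of ((- yh) \<bullet> ta z i j x)) c x v"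
      if c: "c \<in> M" "x \<in> i" "x \<in> j" "x \<in> cdom c" for c x v
    proof -
      have x: "x \<in> i \<inter> j" using c by simp
      show ?thesis
        using mc_circle_of[OF ij s c(1) x c(4), of v] td_cocycleD(13)[OF z i j c, of v]
          d0_inner_const[OF td_cocycleD(5)[OF z i j] c(1) x c(4), of "- yh" v] by (simp add: inner_diff_right)
    qed
    fix k x assume k: "k \<in> \<U>" and x: "x \<in> i" "x \<in> j" "x \<in> k"
    have m: "tm z i j k = ta z i k x - ta z i j x - ta z j k x"
      using td_cocycleD(10)[OF z i j k x] by simp
    show "tt z i j k x + circle_of ((- yh) \<bullet> ta z i j x) - circle_of (tah z j k x \<bullet> 0) +
        circle_of ((- yh) \<bullet> ta z j k x) =
        circle_of ((- yh) \<bullet> ta z i k x) + (tt z i j k x + 0) - circle_of (- yh \<bullet> tm z i j k)"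
      unfolding m by (simp add: inner_diff_right circle_of_minus circle_of_diff circle_of_add algebra_simps)
  qed simp_all
  then show ?thesis unfolding td_equiv_iff_gauge by blast
qed

end

section \<open>The fibres of the projection to pairs of bundles\<close>

lemma local_section_subset:
  assumes s: "local_section M P U s" and V: "V \<subseteq> U" "open V"
  shows "local_section M P V s"
proof -
  have *: "smooth_map M (total P) U s" "U \<subseteq> points M" "\<forall>x\<in>U. proj P (s x) = x"
    using s unfolding local_section_def by simp_all
  from V * smooth_map_subset[OF *(1) V(1)] show ?thesis unfolding local_section_def by auto
qed

lemma local_data_pull:
  assumes V: "open_cover M \<V>" and r: "refinement \<V> \<U> r" and A: "local_data M \<U> P A a"
  shows "local_data M \<V> P (\<lambda>i. A (r i)) (\<lambda>i j. a (r i) (r j))"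
proof -
  note R = refinementD(1)[OF r] and S = refinementD(2)[OF r] and T = refinementD(3)[OF r]
  obtain s where s: "\<forall>i\<in>\<U>. local_section M P i (s i) \<and>
      (\<forall>(c, x) \<in> coords M i. \<forall>v. A i c x v = pullback1 (total P) (s i) (conn P) c x v)"
    and t: "\<forall>i\<in>\<U>. \<forall>j\<in>\<U>. \<forall>x \<in> i \<inter> j. s i x = rmul P (s j x) (torus_of (a i j x))"
    using A unfolding local_data_def by (elim exE conjE)
  have "local_section M P i (s (r i))" if i: "i \<in> \<V>" for i
    by (rule local_section_subset[OF conjunct1[OF bspec[OF s R[OF i]]] T[OF i] open_coverD(1)[OF V i]])
  moreover have "A (r i) c x v = pullback1 (total P) (s (r i)) (conn P) c x v"
    if i: "i \<in> \<V>" and c: "c \<in> M" "x \<in> i" "x \<in> cdom c" for i c x v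
    using conjunct2[OF bspec[OF s R[OF i]], unfolded ball_coords] S[OF i c(2)] c(1,3) by blast
  moreover have "s (r i) x = rmul P (s (r j) x) (torus_of (a (r i) (r j) x))"
    if "i \<in> \<V>" "j \<in> \<V>" "x \<in> i" "x \<in> j" for i j x
    by (rule bspec[OF bspec[OF bspec[OF t R[OF that(1)]] R[OF that(2)]] IntI[OF S[OF that(1,3)] S[OF that(2,4)]]])
  ultimately show ?thesis
    unfolding local_data_def ball_coords
    by (intro exI[of _ "\<lambda>i. s (r i)"] conjI ballI allI impI) (elim IntE, blast | blast)+
qed

context torus_bundle_connection begin

lemma curvature_local_data:
  assumes F: "is_curvature M P F" and A: "local_data M \<U> P A a" and U: "open_cover M \<U>"
    and i: "i \<in> \<U>" and c: "c \<in> M" "x \<in> i" "x \<in> cdom c"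
  shows "F c x v w = d1 (A i) c x v w"
proof -
  obtain s where s: "\<forall>i\<in>\<U>. local_section M P i (s i) \<and>
      (\<forall>(c, x) \<in> coords M i. \<forall>v. A i c x v = pullback1 (total P) (s i) (conn P) c x v)"
    using A unfolding local_data_def by (elim exE conjE)
  have sec: "local_section M P i (s i)" using bspec[OF s i] by (rule conjunct1)
  have As: "A i c y v = pullback1 (total P) (s i) (conn P) c y v" if "y \<in> i" "y \<in> cdom c" for y v
    using bspec[OF s i] that c(1) unfolding ball_coords by blast
  have "F c x v w = d1 (pullback1 (total P) (s i) (conn P)) c x v w"
    using F sec c unfolding is_curvature_def ball_coords by blast
  also have "\<dots> = d1 (A i) c x v w"
    by (rule d1_cong[OF open_coverD(1)[OF U i] _ c]) (simp add: As)
  finally show ?thesis .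
qed

text \<open>Local data of one bundle come from two families of sections, which differ locally by functions to \<open>\<real>\<^sup>n\<close>.
  The relation \<open>D i W p\<close> says that on \<open>W\<close> the sections with index \<open>i\<close> differ by \<open>p\<close>.  It hides the sections, but
  fixes them, so that the lattice condition makes sense for differences found on different sets.\<close>

lemma local_data_differ:
  assumes A: "local_data M \<U> P A a" and A': "local_data M \<U> P A' a'"
  shows "\<exists>D. (\<forall>i\<in>\<U>. \<forall>x\<in>i. \<exists>W p. open W \<and> x \<in> W \<and> W \<subseteq> i \<and> D i W p) \<and>
    (\<forall>i\<in>\<U>. \<forall>W p. D i W p \<longrightarrow> smooth_fun M W p \<and> (\<forall>V. V \<subseteq> W \<longrightarrow> D i V p) \<and>
      (\<forall>c x v. c \<in> M \<longrightarrow> x \<in> W \<longrightarrow> x \<in> i \<longrightarrow> x \<in> cdom c \<longrightarrow> A' i c x v = A i c x v - d0 p c x v)) \<and>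
    (\<forall>i\<in>\<U>. \<forall>j\<in>\<U>. \<forall>W W' p p'. D i W p \<longrightarrow> D j W' p' \<longrightarrow>
      (\<forall>x\<in>W \<inter> W' \<inter> i \<inter> j. a' i j x + p x - p' x - a i j x \<in> lattice))"
proof -
  obtain s where s: "\<forall>i\<in>\<U>. local_section M P i (s i) \<and>
      (\<forall>(c, x) \<in> coords M i. \<forall>v. A i c x v = pullback1 (total P) (s i) (conn P) c x v)"
    and t: "\<forall>i\<in>\<U>. \<forall>j\<in>\<U>. \<forall>x \<in> i \<inter> j. s i x = rmul P (s j x) (torus_of (a i j x))"
    using A unfolding local_data_def by (elim exE conjE)
  obtain s' where s': "\<forall>i\<in>\<U>. local_section M P i (s' i) \<and>
      (\<forall>(c, x) \<in> coords M i. \<forall>v. A' i c x v = pullback1 (total P) (s' i) (conn P) c x v)"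
    and t': "\<forall>i\<in>\<U>. \<forall>j\<in>\<U>. \<forall>x \<in> i \<inter> j. s' i x = rmul P (s' j x) (torus_of (a' i j x))"
    using A' unfolding local_data_def by (elim exE conjE)
  note sec = conjunct1[OF bspec[OF s]] and sec' = conjunct1[OF bspec[OF s']]
  have As: "A i c x v = pullback1 (total P) (s i) (conn P) c x v"
    and As': "A' i c x v = pullback1 (total P) (s' i) (conn P) c x v"
    if "i \<in> \<U>" "c \<in> M" "x \<in> i" "x \<in> cdom c" for i c x v
    using conjunct2[OF bspec[OF s that(1)], unfolded ball_coords]
      conjunct2[OF bspec[OF s' that(1)], unfolded ball_coords] that(2-4) by blast+
  define D where "D = (\<lambda>i W p. smooth_fun M W p \<and> (\<forall>y\<in>W. s i y = rmul P (s' i y) (torus_of (p y))) \<and>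
    (\<forall>c y v. c \<in> M \<longrightarrow> y \<in> W \<longrightarrow> y \<in> cdom c \<longrightarrow>
      pullback1 (total P) (s' i) (conn P) c y v = pullback1 (total P) (s i) (conn P) c y v - d0 p c y v))"
  have Dp: "smooth_fun M W p" "\<And>y. y \<in> W \<Longrightarrow> s i y = rmul P (s' i y) (torus_of (p y))"
    "\<And>c y v. c \<in> M \<Longrightarrow> y \<in> W \<Longrightarrow> y \<in> cdom c \<Longrightarrow>
      pullback1 (total P) (s' i) (conn P) c y v = pullback1 (total P) (s i) (conn P) c y v - d0 p c y v"
    if "D i W p" for i W p
    using that unfolding D_def by blast+
  have ex: "\<exists>W p. open W \<and> x \<in> W \<and> W \<subseteq> i \<and> D i W p" if i: "i \<in> \<U>" and x: "x \<in> i" for i x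
  proof -
    obtain W p where "open W" "x \<in> W" "W \<subseteq> i" "smooth_fun M W p"
      "\<forall>y\<in>W. s i y = rmul P (s' i y) (torus_of (p y))"
      "\<forall>c y v. c \<in> M \<longrightarrow> y \<in> W \<longrightarrow> y \<in> cdom c \<longrightarrow>
        pullback1 (total P) (s' i) (conn P) c y v = pullback1 (total P) (s i) (conn P) c y v - d0 p c y v"
      using sections_differ[OF sec[OF i] sec'[OF i] x x] by (elim exE conjE)
    then show ?thesis unfolding D_def by (intro exI[of _ W] exI[of _ p] conjI)
  qed
  have mono: "D i V p" if D: "D i W p" and V: "V \<subseteq> W" for i V W p
    unfolding D_def
  proof (intro conjI ballI allI impI)
    show "smooth_fun M V p" by (rule smooth_fun_subset[OF Dp(1)[OF D] V])
    show "s i y = rmul P (s' i y) (torus_of (p y))" if "y \<in> V" for y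
      by (rule Dp(2)[OF D]) (use that V in blast)
    show "pullback1 (total P) (s' i) (conn P) c y v = pullback1 (total P) (s i) (conn P) c y v - d0 p c y v"
      if "c \<in> M" "y \<in> V" "y \<in> cdom c" for c y v
      by (rule Dp(3)[OF D that(1) _ that(3)]) (use that V in blast)
  qed
  have forms: "A' i c x v = A i c x v - d0 p c x v"
    if "i \<in> \<U>" "D i W p" "c \<in> M" "x \<in> W" "x \<in> i" "x \<in> cdom c" for i W p c x v
    unfolding As[OF that(1,3,5,6)] As'[OF that(1,3,5,6)] by (rule Dp(3)[OF that(2-4,6)])
  have integral: "a' i j x + p x - p' x - a i j x \<in> lattice"
    if i: "i \<in> \<U>" and j: "j \<in> \<U>" and D: "D i W p" "D j W' p'" and x: "x \<in> W" "x \<in> W'" "x \<in> i" "x \<in> j"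
    for i j W W' p p' x
  proof -
    have pt: "s' j x \<in> points (total P)" by (rule section_props(5)[OF sec'[OF j] x(4)])
    have "s i x = rmul P (s' i x) (torus_of (p x))" by (rule Dp(2)[OF D(1) x(1)])
    also have "s' i x = rmul P (s' j x) (torus_of (a' i j x))"
      using t' i j x by blast
    also have "rmul P (rmul P (s' j x) (torus_of (a' i j x))) (torus_of (p x)) =
        rmul P (s' j x) (torus_of (a' i j x + p x))"
      unfolding torus_of_add by (rule rmul_props(4)[OF pt])
    finally have 1: "s i x = rmul P (s' j x) (torus_of (a' i j x + p x))" .
    have "s i x = rmul P (s j x) (torus_of (a i j x))" using t i j x by blast
    also have "s j x = rmul P (s' j x) (torus_of (p' x))" by (rule Dp(2)[OF D(2) x(2)])
    also have "rmul P (rmul P (s' j x) (torus_of (p' x))) (torus_of (a i j x)) =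
        rmul P (s' j x) (torus_of (p' x + a i j x))"
      unfolding torus_of_add by (rule rmul_props(4)[OF pt])
    finally have "torus_of (a' i j x + p x) = torus_of (p' x + a i j x)"
      using action_free[OF pt] 1 by metis
    then show ?thesis unfolding torus_of_eq_iff by (simp add: algebra_simps)
  qed
  show ?thesis
  proof (rule exI[of _ D], intro conjI ballI allI impI)
    show "\<exists>W p. open W \<and> x \<in> W \<and> W \<subseteq> i \<and> D i W p" if "i \<in> \<U>" "x \<in> i" for i x
      by (rule ex[OF that])
    show "smooth_fun M W p" if "D i W p" for i W p by (rule Dp(1)[OF that])
    show "D i V p" if "D i W p" "V \<subseteq> W" for i W p V by (rule mono[OF that])
    show "A' i c x v = A i c x v - d0 p c x v"
      if "i \<in> \<U>" "D i W p" "c \<in> M" "x \<in> W" "x \<in> i" "x \<in> cdom c" for i W p c x v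
      by (rule forms[OF that])
    show "a' i j x + p x - p' x - a i j x \<in> lattice"
      if "i \<in> \<U>" "j \<in> \<U>" "D i W p" "D j W' p'" "x \<in> W \<inter> W' \<inter> i \<inter> j" for i j W W' p p' x
      by (rule integral[OF that(1-4)]) (use that(5) in auto)
  qed
qed

end

context manifold begin

text \<open>Each overlap lies in a connected member on which the function is still defined.\<close>

lemma integers_constant:
  fixes f :: "'x set \<Rightarrow> 'x set \<Rightarrow> 'x \<Rightarrow> real^'n"
  assumes V: "open_cover M \<V>" and conn: "\<And>i. i \<in> \<V> \<Longrightarrow> connected i" and r: "\<And>i. i \<in> \<V> \<Longrightarrow> i \<subseteq> r i"
    and meet: "\<And>i j. i \<in> \<V> \<Longrightarrow> j \<in> \<V> \<Longrightarrow> i \<inter> j \<noteq> {} \<Longrightarrow> i \<subseteq> r j \<or> j \<subseteq> r i"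
    and f: "\<And>i j. i \<in> \<V> \<Longrightarrow> j \<in> \<V> \<Longrightarrow> smooth_fun M (r i \<inter> r j) (f i j)"
    and l: "\<And>i j x. i \<in> \<V> \<Longrightarrow> j \<in> \<V> \<Longrightarrow> x \<in> r i \<inter> r j \<Longrightarrow> f i j x \<in> lattice"
  shows "\<exists>q. \<forall>i\<in>\<V>. \<forall>j\<in>\<V>. q i j \<in> lattice \<and> (\<forall>x\<in>i \<inter> j. f i j x = q i j)"
proof -
  have const: "f i j x = f i j y" if i: "i \<in> \<V>" and j: "j \<in> \<V>" and x: "x \<in> i \<inter> j" "y \<in> i \<inter> j" for i j x y
  proof -
    have "i \<subseteq> r i \<inter> r j \<or> j \<subseteq> r i \<inter> r j" using meet[OF i j] x(1) r[OF i] r[OF j] by blast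
    then obtain k where k: "k \<in> \<V>" "k \<subseteq> r i \<inter> r j" "x \<in> k" "y \<in> k" using i j x by blast
    show ?thesis
    proof (rule lattice_valued_constant[OF conn[OF k(1)] _ _ k(3,4)])
      show "continuous_on k (f i j)"
        by (rule smooth_fun_continuous[OF open_coverD(2,1)[OF V k(1)] smooth_fun_subset[OF f[OF i j] k(2)]])
      show "f i j z \<in> lattice" if "z \<in> k" for z by (rule l[OF i j]) (use that k(2) in blast)
    qed
  qed
  define q where "q = (\<lambda>i j. if i \<inter> j = {} then 0 else f i j (SOME x. x \<in> i \<inter> j))"
  have "q i j \<in> lattice \<and> (\<forall>x\<in>i \<inter> j. f i j x = q i j)" if i: "i \<in> \<V>" and j: "j \<in> \<V>" for i j
  proof (cases "i \<inter> j = {}")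
    case False
    then have s: "(SOME x. x \<in> i \<inter> j) \<in> i \<inter> j" by (simp only: some_in_eq not_False_eq_True)
    moreover have "i \<inter> j \<subseteq> r i \<inter> r j" using r[OF i] r[OF j] by blast
    ultimately have "f i j (SOME x. x \<in> i \<inter> j) \<in> lattice" by (intro l[OF i j]) blast
    moreover have "f i j x = f i j (SOME x. x \<in> i \<inter> j)" if "x \<in> i \<inter> j" for x
      by (rule const[OF i j that s])
    ultimately show ?thesis using False unfolding q_def by simp
  qed (simp add: q_def)
  then show ?thesis by blast
qed

text \<open>The sets on which the sections of both bundles differ by functions form a cover.  On its connected refinement
  the integers relating the transition functions are constant on overlaps.\<close>

lemma difference_on_refinement:
  assumes P: "torus_bundle_with_connection M P" and Q: "torus_bundle_with_connection M Q"
    and U: "open_cover M \<U>" and z: "td_cocycle M \<U> z" and z': "td_cocycle M \<U> z'"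
    and dP: "local_data M \<U> P (tA z) (ta z)" "local_data M \<U> P (tA z') (ta z')"
    and dQ: "local_data M \<U> Q (tAh z) (tah z)" "local_data M \<U> Q (tAh z') (tah z')"
  shows "\<exists>\<V> r g. open_cover M \<V> \<and> refinement \<V> \<U> r \<and> deligne_cocycle M \<V> g \<and>
    td_equiv M \<V> (td_shift g (td_pull r z)) (td_pull r z')"
proof -
  interpret P: torus_bundle_connection M P by unfold_locales (rule P)
  interpret Q: torus_bundle_connection M Q by unfold_locales (rule Q)
  obtain D where D1: "\<forall>i\<in>\<U>. \<forall>x\<in>i. \<exists>W p. open W \<and> x \<in> W \<and> W \<subseteq> i \<and> D i W p"
    and D2: "\<forall>i\<in>\<U>. \<forall>W p. D i W p \<longrightarrow> smooth_fun M W p \<and> (\<forall>V. V \<subseteq> W \<longrightarrow> D i V p) \<and>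
      (\<forall>c x v. c \<in> M \<longrightarrow> x \<in> W \<longrightarrow> x \<in> i \<longrightarrow> x \<in> cdom c \<longrightarrow> tA z' i c x v = tA z i c x v - d0 p c x v)"
    and D3: "\<forall>i\<in>\<U>. \<forall>j\<in>\<U>. \<forall>W W' p p'. D i W p \<longrightarrow> D j W' p' \<longrightarrow>
      (\<forall>x\<in>W \<inter> W' \<inter> i \<inter> j. ta z' i j x + p x - p' x - ta z i j x \<in> lattice)"
    using P.local_data_differ[OF dP] by (elim exE conjE)
  obtain E where E1: "\<forall>i\<in>\<U>. \<forall>x\<in>i. \<exists>W p. open W \<and> x \<in> W \<and> W \<subseteq> i \<and> E i W p"
    and E2: "\<forall>i\<in>\<U>. \<forall>W p. E i W p \<longrightarrow> smooth_fun M W p \<and> (\<forall>V. V \<subseteq> W \<longrightarrow> E i V p) \<and>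
      (\<forall>c x v. c \<in> M \<longrightarrow> x \<in> W \<longrightarrow> x \<in> i \<longrightarrow> x \<in> cdom c \<longrightarrow> tAh z' i c x v = tAh z i c x v - d0 p c x v)"
    and E3: "\<forall>i\<in>\<U>. \<forall>j\<in>\<U>. \<forall>W W' p p'. E i W p \<longrightarrow> E j W' p' \<longrightarrow>
      (\<forall>x\<in>W \<inter> W' \<inter> i \<inter> j. tah z' i j x + p x - p' x - tah z i j x \<in> lattice)"
    using Q.local_data_differ[OF dQ] by (elim exE conjE)
  define \<W> where "\<W> = {W. open W \<and> (\<exists>i p ph. i \<in> \<U> \<and> W \<subseteq> i \<and> D i W p \<and> E i W ph)}"
  have W: "open_cover M \<W>"
    unfolding open_cover_def
  proof
    show "\<forall>U\<in>\<W>. open U" unfolding \<W>_def by blast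
    show "\<Union>\<W> = points M"
    proof
      show "\<Union>\<W> \<subseteq> points M" unfolding \<W>_def using open_coverD(2)[OF U] by blast
      show "points M \<subseteq> \<Union>\<W>"
      proof
        fix x assume "x \<in> points M"
        then obtain i where i: "i \<in> \<U>" "x \<in> i" using U unfolding open_cover_def by blast
        obtain W1 p where W1: "open W1" "x \<in> W1" "W1 \<subseteq> i" "D i W1 p"
          using bspec[OF bspec[OF D1 i(1)] i(2)] by (elim exE conjE)
        obtain W2 ph where W2: "open W2" "x \<in> W2" "W2 \<subseteq> i" "E i W2 ph"
          using bspec[OF bspec[OF E1 i(1)] i(2)] by (elim exE conjE)
        have "D i (W1 \<inter> W2) p" using bspec[OF D2 i(1)] W1(4) by blast
        moreover have "E i (W1 \<inter> W2) ph" using bspec[OF E2 i(1)] W2(4) by blast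
        moreover have "open (W1 \<inter> W2)" "W1 \<inter> W2 \<subseteq> i" using W1 W2 by auto
        ultimately have "W1 \<inter> W2 \<in> \<W>" unfolding \<W>_def using i(1) by blast
        then show "x \<in> \<Union>\<W>" using W1(2) W2(2) by blast
      qed
    qed
  qed
  have "\<forall>W\<in>\<W>. \<exists>i p ph. i \<in> \<U> \<and> W \<subseteq> i \<and> D i W p \<and> E i W ph" unfolding \<W>_def by blast
  then obtain r0 p0 ph0 where r0: "\<And>W. W \<in> \<W> \<Longrightarrow> r0 W \<in> \<U> \<and> W \<subseteq> r0 W \<and> D (r0 W) W (p0 W) \<and> E (r0 W) W (ph0 W)"
    by metis
  obtain \<V> r1 where V: "open_cover M \<V>" and r1: "refinement \<V> \<W> r1" and conn: "\<forall>i\<in>\<V>. connected i"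
    and meet: "\<forall>i\<in>\<V>. \<forall>j\<in>\<V>. i \<inter> j \<noteq> {} \<longrightarrow> i \<subseteq> r1 j \<or> j \<subseteq> r1 i"
    using connected_refinement[OF W] by (elim exE conjE)
  note R1 = refinementD(1)[OF r1] and T1 = refinementD(3)[OF r1]
  define r where "r = r0 \<circ> r1"
  define p where "p = (\<lambda>i. p0 (r1 i))"
  define ph where "ph = (\<lambda>i. ph0 (r1 i))"
  have ri: "r i \<in> \<U>" "r1 i \<subseteq> r i" "D (r i) (r1 i) (p i)" "E (r i) (r1 i) (ph i)" if "i \<in> \<V>" for i
    using r0[OF R1[OF that]] unfolding r_def p_def ph_def by auto
  have r: "refinement \<V> \<U> r"
    unfolding refinement_def using ri(1,2) T1 by blast
  have o1: "open (r1 i)" if "i \<in> \<V>" for i using open_coverD(1)[OF W R1[OF that]] .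
  have Di: "smooth_fun M (r1 i) (p i)"
      "\<And>c x v. c \<in> M \<Longrightarrow> x \<in> r1 i \<Longrightarrow> x \<in> cdom c \<Longrightarrow> tA z' (r i) c x v = tA z (r i) c x v - d0 (p i) c x v"
    if i: "i \<in> \<V>" for i
    using bspec[OF D2 ri(1)[OF i]] ri(2,3)[OF i] by blast+
  have Ei: "smooth_fun M (r1 i) (ph i)"
      "\<And>c x v. c \<in> M \<Longrightarrow> x \<in> r1 i \<Longrightarrow> x \<in> cdom c \<Longrightarrow> tAh z' (r i) c x v = tAh z (r i) c x v - d0 (ph i) c x v"
    if i: "i \<in> \<V>" for i
    using bspec[OF E2 ri(1)[OF i]] ri(2,4)[OF i] by blast+
  have l: "ta z' (r i) (r j) x + p i x - p j x - ta z (r i) (r j) x \<in> lattice"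
      "tah z' (r i) (r j) x + ph i x - ph j x - tah z (r i) (r j) x \<in> lattice"
    if i: "i \<in> \<V>" and j: "j \<in> \<V>" and x: "x \<in> r1 i \<inter> r1 j" for i j x
  proof -
    have x': "x \<in> r1 i \<inter> r1 j \<inter> r i \<inter> r j" using x ri(2)[OF i] ri(2)[OF j] by blast
    show "ta z' (r i) (r j) x + p i x - p j x - ta z (r i) (r j) x \<in> lattice"
      using bspec[OF bspec[OF D3 ri(1)[OF i]] ri(1)[OF j]] ri(3)[OF i] ri(3)[OF j] x' by blast
    show "tah z' (r i) (r j) x + ph i x - ph j x - tah z (r i) (r j) x \<in> lattice"
      using bspec[OF bspec[OF E3 ri(1)[OF i]] ri(1)[OF j]] ri(4)[OF i] ri(4)[OF j] x' by blast
  qed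
  have sm: "smooth_fun M (r1 i \<inter> r1 j) (\<lambda>x. a' x + f i x - f j x - b x)"
    if i: "i \<in> \<V>" and j: "j \<in> \<V>" and f: "\<And>k. k \<in> \<V> \<Longrightarrow> smooth_fun M (r1 k) (f k)"
      and ab: "smooth_fun M (r i \<inter> r j) a'" "smooth_fun M (r i \<inter> r j) b"
    for i j and f :: "'x set \<Rightarrow> 'x \<Rightarrow> real^'n" and a' b
  proof -
    have o: "open (r1 i \<inter> r1 j)" using o1[OF i] o1[OF j] by blast
    have sub: "r1 i \<inter> r1 j \<subseteq> r i \<inter> r j" using ri(2)[OF i] ri(2)[OF j] by blast
    have "smooth_fun M (r1 i \<inter> r1 j) (f i)" "smooth_fun M (r1 i \<inter> r1 j) (f j)"
      by (rule smooth_fun_subset[OF f[OF i]], simp) (rule smooth_fun_subset[OF f[OF j]], simp)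
    then show ?thesis
      by (intro smooth_fun_diff[OF o] smooth_fun_add[OF o] smooth_fun_subset[OF ab(1) sub]
          smooth_fun_subset[OF ab(2) sub])
  qed
  have integers: "\<exists>q. \<forall>i\<in>\<V>. \<forall>j\<in>\<V>. q i j \<in> lattice \<and> (\<forall>x\<in>i \<inter> j. f i j x = q i j)"
    if f: "\<And>i j. i \<in> \<V> \<Longrightarrow> j \<in> \<V> \<Longrightarrow> smooth_fun M (r1 i \<inter> r1 j) (f i j)"
      and fl: "\<And>i j x. i \<in> \<V> \<Longrightarrow> j \<in> \<V> \<Longrightarrow> x \<in> r1 i \<inter> r1 j \<Longrightarrow> f i j x \<in> lattice"
    for f :: "'x set \<Rightarrow> 'x set \<Rightarrow> 'x \<Rightarrow> real^'n"
  proof (rule integers_constant[OF V, where r = r1])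
    show "connected i" if "i \<in> \<V>" for i using conn that by blast
    show "i \<subseteq> r1 i" if "i \<in> \<V>" for i by (rule T1[OF that])
    show "i \<subseteq> r1 j \<or> j \<subseteq> r1 i" if "i \<in> \<V>" "j \<in> \<V>" "i \<inter> j \<noteq> {}" for i j
      using meet that by blast
    show "smooth_fun M (r1 i \<inter> r1 j) (f i j)" if "i \<in> \<V>" "j \<in> \<V>" for i j by (rule f[OF that])
    show "f i j x \<in> lattice" if "i \<in> \<V>" "j \<in> \<V>" "x \<in> r1 i \<inter> r1 j" for i j x by (rule fl[OF that])
  qed
  have "\<exists>q. \<forall>i\<in>\<V>. \<forall>j\<in>\<V>. q i j \<in> lattice \<and>
      (\<forall>x\<in>i \<inter> j. ta z' (r i) (r j) x + p i x - p j x - ta z (r i) (r j) x = q i j)"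
  proof (rule integers)
    fix i j assume i: "i \<in> \<V>" and j: "j \<in> \<V>"
    show "smooth_fun M (r1 i \<inter> r1 j) (\<lambda>x. ta z' (r i) (r j) x + p i x - p j x - ta z (r i) (r j) x)"
      by (rule sm[OF i j _ td_cocycleD(5)[OF z' ri(1)[OF i] ri(1)[OF j]]
            td_cocycleD(5)[OF z ri(1)[OF i] ri(1)[OF j]]]) (rule Di(1))
  qed (rule l(1))
  then obtain q where q: "\<forall>i\<in>\<V>. \<forall>j\<in>\<V>. q i j \<in> lattice \<and>
      (\<forall>x\<in>i \<inter> j. ta z' (r i) (r j) x + p i x - p j x - ta z (r i) (r j) x = q i j)" by (elim exE)
  have "\<exists>q. \<forall>i\<in>\<V>. \<forall>j\<in>\<V>. q i j \<in> lattice \<and>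
      (\<forall>x\<in>i \<inter> j. tah z' (r i) (r j) x + ph i x - ph j x - tah z (r i) (r j) x = q i j)"
  proof (rule integers)
    fix i j assume i: "i \<in> \<V>" and j: "j \<in> \<V>"
    show "smooth_fun M (r1 i \<inter> r1 j) (\<lambda>x. tah z' (r i) (r j) x + ph i x - ph j x - tah z (r i) (r j) x)"
      by (rule sm[OF i j _ td_cocycleD(6)[OF z' ri(1)[OF i] ri(1)[OF j]]
            td_cocycleD(6)[OF z ri(1)[OF i] ri(1)[OF j]]]) (rule Ei(1))
  qed (rule l(2))
  then obtain qh where qh: "\<forall>i\<in>\<V>. \<forall>j\<in>\<V>. qh i j \<in> lattice \<and>
      (\<forall>x\<in>i \<inter> j. tah z' (r i) (r j) x + ph i x - ph j x - tah z (r i) (r j) x = qh i j)" by (elim exE)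
  have "\<exists>g. deligne_cocycle M \<V> g \<and> td_equiv M \<V> (td_shift g (td_pull r z)) (td_pull r z')"
  proof (rule difference_gerbe[OF V td_cocycle_pull[OF U V r z] td_cocycle_pull[OF U V r z'],
        where p = p and ph = ph and q = q and qh = qh]; (unfold td_pull_def td.simps)?)
    fix i assume i: "i \<in> \<V>"
    show "smooth_fun M i (p i)" by (rule smooth_fun_subset[OF Di(1)[OF i] T1[OF i]])
    show "smooth_fun M i (ph i)" by (rule smooth_fun_subset[OF Ei(1)[OF i] T1[OF i]])
    show "tA z' (r i) c x v = tA z (r i) c x v - d0 (p i) c x v"
      if "c \<in> M" "x \<in> i" "x \<in> cdom c" for c x v
      by (rule Di(2)[OF i that(1) _ that(3)]) (use that(2) T1[OF i] in blast)
    show "tAh z' (r i) c x v = tAh z (r i) c x v - d0 (ph i) c x v"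
      if "c \<in> M" "x \<in> i" "x \<in> cdom c" for c x v
      by (rule Ei(2)[OF i that(1) _ that(3)]) (use that(2) T1[OF i] in blast)
    fix j assume j: "j \<in> \<V>"
    note qij = bspec[OF bspec[OF q i] j] and qhij = bspec[OF bspec[OF qh i] j]
    show "q i j \<in> lattice" "qh i j \<in> lattice" by (rule conjunct1[OF qij], rule conjunct1[OF qhij])
    fix x assume x: "x \<in> i" "x \<in> j"
    show "ta z' (r i) (r j) x + p i x = q i j + p j x + ta z (r i) (r j) x"
      using bspec[OF conjunct2[OF qij] IntI[OF x]] by (simp add: algebra_simps)
    show "tah z' (r i) (r j) x + ph i x = qh i j + ph j x + tah z (r i) (r j) x"
      using bspec[OF conjunct2[OF qhij] IntI[OF x]] by (simp add: algebra_simps)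
  qed
  then show ?thesis using V r by blast
qed

lemma td_rel_same_cover:
  assumes "(\<U>, z) \<in> td_cocycles M" "(\<U>, z') \<in> td_cocycles M" "td_equiv M \<U> z z'"
  shows "((\<U>, z), (\<U>, z')) \<in> td_rel M"
proof -
  have "td_pull id w = w" for w :: "('x, 'e, 'b::finite) td" by (simp add: td_pull_def)
  then show ?thesis
    unfolding td_rel_iff using assms refinement_id td_cocycles_iff by metis
qed

lemma td_fibreE:
  assumes "L \<in> td_fibre M P Q"
  obtains \<U> z where "open_cover M \<U>" "(\<U>, z) \<in> td_cocycles M" "L = td_rel M `` {(\<U>, z)}"
    "local_data M \<U> P (tA z) (ta z)" "local_data M \<U> Q (tAh z) (tah z)"
proof -
  from assms obtain \<U> z where L: "L \<in> H1TD M" "(\<U>, z) \<in> L"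
    and d: "local_data M \<U> P (tA z) (ta z)" "local_data M \<U> Q (tAh z) (tah z)"
    unfolding td_fibre_def by blast
  have "L \<in> td_cocycles M // td_rel M" using L(1) unfolding H1TD_def .
  then obtain y where y: "L = td_rel M `` {y}" by (rule quotientE)
  have "(y, (\<U>, z)) \<in> td_rel M" using L(2) unfolding y by blast
  then have "L = td_rel M `` {(\<U>, z)}" unfolding y by (rule equiv_class_eq[OF equiv_td_rel])
  moreover have "(\<U>, z) \<in> td_cocycles M" using \<open>(y, (\<U>, z)) \<in> td_rel M\<close> unfolding td_rel_def by blast
  ultimately show ?thesis using that d td_cocycles_iff by blast
qed

lemma td_fibreI:
  assumes "(\<U>, z) \<in> td_cocycles M" "local_data M \<U> P (tA z) (ta z)" "local_data M \<U> Q (tAh z) (tah z)"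
  shows "td_rel M `` {(\<U>, z)} \<in> td_fibre M P Q"
  unfolding td_fibre_def using H1TD_I[OF assms(1)] equiv_class_self[OF equiv_td_rel assms(1)] assms(2,3)
  by blast

lemma local_data_td_pull:
  assumes "open_cover M \<V>" "refinement \<V> \<U> r"
  shows "local_data M \<U> P (tA z) (ta z) \<Longrightarrow> local_data M \<V> P (tA (td_pull r z)) (ta (td_pull r z))"
    and "local_data M \<U> P (tAh z) (tah z) \<Longrightarrow> local_data M \<V> P (tAh (td_pull r z)) (tah (td_pull r z))"
  using local_data_pull[OF assms] by (simp_all add: td_pull_def)

lemma td_fibre_subset: "td_fibre M P Q \<subseteq> H1TD M"
  unfolding td_fibre_def by blast

lemma td_act_fibre:
  assumes K: "K \<in> carrier (H3 M)" and L: "L \<in> td_fibre M P Q"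
  shows "td_act M K L \<in> td_fibre M P Q"
proof -
  obtain \<U> z where z: "open_cover M \<U>" "(\<U>, z) \<in> td_cocycles M" "L = td_rel M `` {(\<U>, z)}"
    "local_data M \<U> P (tA z) (ta z)" "local_data M \<U> Q (tAh z) (tah z)"
    by (rule td_fibreE[OF L])
  obtain \<V> g where g: "open_cover M \<V>" "(\<V>, g) \<in> deligne_cocycles M" "K = deligne_rel M `` {(\<V>, g)}"
    by (rule H3_carrierE[OF K])
  obtain \<W> r s where W: "open_cover M \<W>" "refinement \<W> \<U> r" "refinement \<W> \<V> s"
    by (rule common_refinement[OF z(1) g(1)])
  note co = deligne_cocycles_pull[OF g(2) W(1,3)] td_cocycles_pull[OF z(2) W(1,2)]
  show ?thesis
    unfolding z(3) g(3) td_class_pull[OF z(2) W(1,2)] deligne_class_pull[OF g(2) W(1,3)] td_act_class[OF co]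
    by (rule td_fibreI[OF td_cocycles_shift[OF co]])
      (simp_all add: local_data_td_pull(1)[OF W(1,2) z(4)] local_data_td_pull(2)[OF W(1,2) z(5)])
qed

lemma td_act_transitive:
  assumes P: "torus_bundle_with_connection M P" and Q: "torus_bundle_with_connection M Q"
    and L: "L \<in> td_fibre M P Q" and L': "L' \<in> td_fibre M P Q"
  shows "\<exists>K\<in>carrier (H3 M). td_act M K L = L'"
proof -
  obtain \<U> z where z: "open_cover M \<U>" "(\<U>, z) \<in> td_cocycles M" "L = td_rel M `` {(\<U>, z)}"
    "local_data M \<U> P (tA z) (ta z)" "local_data M \<U> Q (tAh z) (tah z)"
    by (rule td_fibreE[OF L])
  obtain \<U>' z' where z': "open_cover M \<U>'" "(\<U>', z') \<in> td_cocycles M" "L' = td_rel M `` {(\<U>', z')}"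
    "local_data M \<U>' P (tA z') (ta z')" "local_data M \<U>' Q (tAh z') (tah z')"
    by (rule td_fibreE[OF L'])
  obtain \<W> s s' where W: "open_cover M \<W>" "refinement \<W> \<U> s" "refinement \<W> \<U>' s'"
    by (rule common_refinement[OF z(1) z'(1)])
  let ?w = "td_pull s z" and ?w' = "td_pull s' z'"
  note co = td_cocycles_pull[OF z(2) W(1,2)] and co' = td_cocycles_pull[OF z'(2) W(1,3)]
  have w: "td_cocycle M \<W> ?w" "td_cocycle M \<W> ?w'" using co co' unfolding td_cocycles_iff by auto
  obtain \<V> r g where V: "open_cover M \<V>" "refinement \<V> \<W> r" and g: "deligne_cocycle M \<V> g"
    and eq: "td_equiv M \<V> (td_shift g (td_pull r ?w)) (td_pull r ?w')"
    using difference_on_refinement[OF P Q W(1) w local_data_td_pull(1)[OF W(1,2) z(4)]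
        local_data_td_pull(1)[OF W(1,3) z'(4)] local_data_td_pull(2)[OF W(1,2) z(5)]
        local_data_td_pull(2)[OF W(1,3) z'(5)]] by (elim exE conjE)
  have gc: "(\<V>, g) \<in> deligne_cocycles M" using V(1) g unfolding deligne_cocycles_iff by blast
  note c = td_cocycles_pull[OF co V] and c' = td_cocycles_pull[OF co' V]
  have "td_act M (deligne_rel M `` {(\<V>, g)}) L = td_rel M `` {(\<V>, td_shift g (td_pull r ?w))}"
    unfolding z(3) td_class_pull[OF z(2) W(1,2)] td_class_pull[OF co V] by (rule td_act_class[OF gc c])
  also have "\<dots> = td_rel M `` {(\<V>, td_pull r ?w')}"
    using td_class_eq_iff[OF td_cocycles_shift[OF gc c] c']
      td_rel_same_cover[OF td_cocycles_shift[OF gc c] c' eq] by blast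
  also have "\<dots> = L'" unfolding z'(3) td_class_pull[OF z'(2) W(1,3)] td_class_pull[OF co' V] ..
  finally show ?thesis using H3_carrierI[OF gc] by blast
qed

section \<open>The stabilizer\<close>

lemma flux_form:
  fixes F Fh :: "('x, 'e, real^'n) form2"
  assumes "is_form2 M (points M) F" "is_form2 M (points M) Fh"
  shows "is_form2 M (points M) (\<lambda>c x v w. y \<bullet> Fh c x v w + yh \<bullet> F c x v w)"
  by (intro is_form2_add is_form2_inner_fun[where f = "\<lambda>x. y"] is_form2_inner_fun[where f = "\<lambda>x. yh"]
      smooth_fun_const open_points assms)

lemma flux_subgroup_subgroup:
  assumes F: "is_form2 M (points M) F" and Fh: "is_form2 M (points M) Fh"
  shows "subgroup (flux_subgroup M F Fh) (H3 M)"
proof -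
  interpret comm_group "H3 M" by (rule H3_comm_group)
  let ?I = "\<lambda>y yh. trivial_gerbe M (\<lambda>c x v w. y \<bullet> Fh c x v w + yh \<bullet> F c x v w)"
  have carr: "?I y yh \<in> carrier (H3 M)" for y yh
    by (rule trivial_gerbe_carrier[OF flux_form[OF F Fh]])
  have mult: "?I y yh \<otimes>\<^bsub>H3 M\<^esub> ?I y' yh' = ?I (y + y') (yh + yh')" for y yh y' yh'
    using trivial_gerbe_mult[OF flux_form[OF F Fh, of y yh] flux_form[OF F Fh, of y' yh']]
    by (simp add: inner_add_left algebra_simps)
  have one: "?I 0 0 = \<one>\<^bsub>H3 M\<^esub>" by (simp add: H3_def)
  have inv: "inv\<^bsub>H3 M\<^esub> (?I y yh) = ?I (- y) (- yh)" for y yh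
    by (rule inv_equality[OF _ carr carr]) (unfold mult left_minus, rule one)
  show ?thesis
  proof (rule subgroupI)
    show "flux_subgroup M F Fh \<subseteq> carrier (H3 M)" unfolding flux_subgroup_def using carr by blast
    show "flux_subgroup M F Fh \<noteq> {}" unfolding flux_subgroup_def by blast
    show "inv\<^bsub>H3 M\<^esub> K \<in> flux_subgroup M F Fh" if "K \<in> flux_subgroup M F Fh" for K
      using that inv unfolding flux_subgroup_def by blast
    show "K \<otimes>\<^bsub>H3 M\<^esub> L \<in> flux_subgroup M F Fh"
      if "K \<in> flux_subgroup M F Fh" "L \<in> flux_subgroup M F Fh" for K L
      using that mult unfolding flux_subgroup_def by blast
  qed
qed

text \<open>Both inclusions reduce to statements about one cocycle with local data of the bundles, since the differential
  of its connection forms is the curvature.  For a stabilizing gerbe the equivalence is first restricted along a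
  single map to a cover by connected sets.\<close>

lemma stabilizer_eq_flux_subgroup:
  assumes P: "torus_bundle_with_connection M P" and Q: "torus_bundle_with_connection M Q"
    and F: "is_curvature M P F" and Fh: "is_curvature M Q Fh" and M: "connected (points M)"
    and L: "L \<in> td_fibre M P Q"
  shows "stabilizer (H3 M) (td_act M) L = flux_subgroup M F Fh"
proof -
  interpret P: torus_bundle_connection M P by unfold_locales (rule P)
  interpret Q: torus_bundle_connection M Q by unfold_locales (rule Q)
  have form: "is_form2 M (points M) F" "is_form2 M (points M) Fh"
    using F Fh unfolding is_curvature_def by blast+
  note \<beta> = flux_form[OF form]
  obtain \<U> z where z: "open_cover M \<U>" "(\<U>, z) \<in> td_cocycles M" "L = td_rel M `` {(\<U>, z)}"
    "local_data M \<U> P (tA z) (ta z)" "local_data M \<U> Q (tAh z) (tah z)"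
    by (rule td_fibreE[OF L])
  show ?thesis
  proof (rule subset_antisym; rule subsetI)
    fix K assume "K \<in> flux_subgroup M F Fh"
    then obtain y yh where K: "K = trivial_gerbe M (\<lambda>c x v w. y \<bullet> Fh c x v w + yh \<bullet> F c x v w)"
      unfolding flux_subgroup_def by blast
    have zc: "td_cocycle M \<U> z" using z(2) unfolding td_cocycles_iff by blast
    note t = trivial_deligne_cocycles[OF z(1) \<beta>[of y yh]]
    note sh = td_cocycles_shift[OF t z(2)]
    have eq: "td_equiv M \<U> (td_shift (trivial_deligne (\<lambda>c x v w. y \<bullet> Fh c x v w + yh \<bullet> F c x v w)) z) z"
      by (rule flux_gerbe_acts_trivially[OF z(1) zc];
          rule P.curvature_local_data[OF F z(4,1)] Q.curvature_local_data[OF Fh z(5,1)]; assumption)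
    have "td_act M K L = td_rel M `` {(\<U>, td_shift (trivial_deligne (\<lambda>c x v w. y \<bullet> Fh c x v w + yh \<bullet> F c x v w)) z)}"
      unfolding K z(3) trivial_gerbe_eq[OF z(1) \<beta>] by (rule td_act_class[OF t z(2)])
    also have "\<dots> = L"
      unfolding z(3)
      using td_class_eq_iff[OF sh z(2)] td_rel_same_cover[OF sh z(2) eq] by blast
    finally have "td_act M K L = L" .
    moreover have "K \<in> carrier (H3 M)" unfolding K by (rule trivial_gerbe_carrier[OF \<beta>])
    ultimately show "K \<in> stabilizer (H3 M) (td_act M) L" unfolding stabilizer_def by simp
  next
    fix K assume "K \<in> stabilizer (H3 M) (td_act M) L"
    then have K: "K \<in> carrier (H3 M)" "td_act M K L = L" unfolding stabilizer_def by auto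
    obtain \<V> g where g: "open_cover M \<V>" "(\<V>, g) \<in> deligne_cocycles M" "K = deligne_rel M `` {(\<V>, g)}"
      by (rule H3_carrierE[OF K(1)])
    obtain \<W> r s where W: "open_cover M \<W>" "refinement \<W> \<U> r" "refinement \<W> \<V> s"
      by (rule common_refinement[OF z(1) g(1)])
    let ?z = "td_pull r z" and ?g = "deligne_pull s g"
    note cg = deligne_cocycles_pull[OF g(2) W(1,3)] and cz = td_cocycles_pull[OF z(2) W(1,2)]
    note KW = g(3)[unfolded deligne_class_pull[OF g(2) W(1,3)]]
      and LW = z(3)[unfolded td_class_pull[OF z(2) W(1,2)]]
    have "td_rel M `` {(\<W>, td_shift ?g ?z)} = td_rel M `` {(\<W>, ?z)}"
      using K(2) unfolding KW LW td_act_class[OF cg cz] .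
    then have rel: "((\<W>, td_shift ?g ?z), (\<W>, ?z)) \<in> td_rel M"
      using td_class_eq_iff[OF td_cocycles_shift[OF cg cz] cz] by blast
    obtain \<X> t t' where X: "open_cover M \<X>" "refinement \<X> \<W> t" "refinement \<X> \<W> t'"
      "\<forall>\<Y> s t t'. open_cover M \<Y> \<longrightarrow> refinement \<Y> \<X> s \<longrightarrow> refinement \<Y> \<W> t \<longrightarrow> refinement \<Y> \<W> t' \<longrightarrow>
        td_equiv M \<Y> (td_pull t (td_shift ?g ?z)) (td_pull t' ?z)"
      using td_rel_on_refinements[OF rel] by (elim exE conjE)
    obtain \<Y> u where Y: "open_cover M \<Y>" "refinement \<Y> \<X> u" and conn: "\<forall>i\<in>\<Y>. connected i"
      using connected_refinement[OF X(1)] by (elim exE conjE)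
    note v = refinement_comp[OF Y(2) X(2)]
    let ?v = "t \<circ> u"
    have eq: "td_equiv M \<Y> (td_shift (deligne_pull ?v ?g) (td_pull ?v ?z)) (td_pull ?v ?z)"
      using X(4)[rule_format, OF Y v v] unfolding td_pull_shift .
    note cy = td_cocycles_pull[OF cz Y(1) v]
    then have zy: "td_cocycle M \<Y> (td_pull ?v ?z)" unfolding td_cocycles_iff by blast
    note dP = local_data_td_pull(1)[OF Y(1) v local_data_td_pull(1)[OF W(1,2) z(4)]]
      and dQ = local_data_td_pull(2)[OF Y(1) v local_data_td_pull(2)[OF W(1,2) z(5)]]
    have "\<exists>y yh. deligne_equiv M \<Y>
        (trivial_deligne (\<lambda>c x v w. y \<bullet> Fh c x v w + yh \<bullet> F c x v w)) (deligne_pull ?v ?g)"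
    proof (rule stabilizing_gerbe_is_trivial[OF Y(1) _ M zy eq])
      show "connected i" if "i \<in> \<Y>" for i using conn that by blast
    qed (rule P.curvature_local_data[OF F dP Y(1)] Q.curvature_local_data[OF Fh dQ Y(1)]; assumption)+
    then obtain y yh where triv: "deligne_equiv M \<Y>
        (trivial_deligne (\<lambda>c x v w. y \<bullet> Fh c x v w + yh \<bullet> F c x v w)) (deligne_pull ?v ?g)"
      by (elim exE)
    note cgy = deligne_cocycles_pull[OF cg Y(1) v] and ct = trivial_deligne_cocycles[OF Y(1) \<beta>[of y yh]]
    have "deligne_pull id h = h" for h :: "('x, 'e) deligne" by (simp add: deligne_pull_def)
    then have "((\<Y>, trivial_deligne (\<lambda>c x v w. y \<bullet> Fh c x v w + yh \<bullet> F c x v w)), (\<Y>, deligne_pull ?v ?g))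
        \<in> deligne_rel M"
      unfolding deligne_rel_iff using ct cgy Y(1) triv
      by (intro conjI exI[of _ \<Y>] exI[of _ id] refinement_id) simp_all
    then have "trivial_gerbe M (\<lambda>c x v w. y \<bullet> Fh c x v w + yh \<bullet> F c x v w) = K"
      unfolding KW deligne_class_pull[OF cg Y(1) v] trivial_gerbe_eq[OF Y(1) \<beta>]
      using deligne_class_eq_iff[OF ct cgy] by blast
    then show "K \<in> flux_subgroup M F Fh" unfolding flux_subgroup_def by blast
  qed
qed

end

theorem proposition6p2p6:
  fixes M :: "('x::{t2_space,second_countable_topology}, 'e::{real_normed_vector,heine_borel}) atlas"
    and P :: "('x, 'p::{t2_space,second_countable_topology}, 'e, 'n::finite) torus_bundle"
    and Q :: "('x, 'q::{t2_space,second_countable_topology}, 'e, 'n) torus_bundle"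
  assumes "smooth_manifold M"
    and "torus_bundle_with_connection M P"
    and "torus_bundle_with_connection M Q"
  shows "group_action (H3 M) (H1TD M :: ('x set set \<times> ('x, 'e, 'n) td) set set) (td_act M) \<and>
    transitive_action (H3 M) (td_fibre M P Q) (\<lambda>K. restrict (td_act M K) (td_fibre M P Q)) \<and>
    (\<forall>F Fh. is_curvature M P F \<and> is_curvature M Q Fh \<and> connected (points M) \<longrightarrow>
      subgroup (flux_subgroup M F Fh) (H3 M) \<and>
      (\<forall>L \<in> td_fibre M P Q. stabilizer (H3 M) (td_act M) L = flux_subgroup M F Fh) \<and>
      transitive_action (H3 M Mod flux_subgroup M F Fh) (td_fibre M P Q)
        (coset_act (td_act M) (td_fibre M P Q)) \<and>
      (\<forall>L \<in> td_fibre M P Q.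
        stabilizer (H3 M Mod flux_subgroup M F Fh) (coset_act (td_act M) (td_fibre M P Q)) L =
        {\<one>\<^bsub>H3 M Mod flux_subgroup M F Fh\<^esub>}))"
proof -
  interpret manifold M by unfold_locales (rule assms(1))
  interpret comm_group "H3 M" by (rule H3_comm_group)
  let ?E = "td_fibre M P Q"
  note sub = subsetD[OF td_fibre_subset]
  have one: "td_act M \<one>\<^bsub>H3 M\<^esub> L = L" if "L \<in> ?E" for L by (rule td_act_one[OF sub[OF that]])
  have mult: "td_act M (K \<otimes>\<^bsub>H3 M\<^esub> K') L = td_act M K (td_act M K' L)"
    if "K \<in> carrier (H3 M)" "K' \<in> carrier (H3 M)" "L \<in> ?E" for K K' L
    by (rule td_act_mult[OF that(1,2) sub[OF that(3)]])
  note trans = td_act_transitive[OF assms(2,3)]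
  have "group_action (H3 M) ?E (\<lambda>K. restrict (td_act M K) ?E)"
    by (rule group_actionI[OF is_group]) (simp_all add: td_act_fibre one mult)
  then have tr: "transitive_action (H3 M) ?E (\<lambda>K. restrict (td_act M K) ?E)"
    using trans by (simp add: transitive_action_def transitive_action_axioms_def)
  have "subgroup (flux_subgroup M F Fh) (H3 M) \<and>
      (\<forall>L \<in> ?E. stabilizer (H3 M) (td_act M) L = flux_subgroup M F Fh) \<and>
      transitive_action (H3 M Mod flux_subgroup M F Fh) ?E (coset_act (td_act M) ?E) \<and>
      (\<forall>L \<in> ?E. stabilizer (H3 M Mod flux_subgroup M F Fh) (coset_act (td_act M) ?E) L =
        {\<one>\<^bsub>H3 M Mod flux_subgroup M F Fh\<^esub>})"
    if F: "is_curvature M P F" "is_curvature M Q Fh" "connected (points M)" for F Fh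
  proof -
    have sg: "subgroup (flux_subgroup M F Fh) (H3 M)"
      by (rule flux_subgroup_subgroup) (use F in \<open>simp_all add: is_curvature_def\<close>)
    note N = subgroup_imp_normal[OF sg]
    note st = stabilizer_eq_flux_subgroup[OF assms(2,3) F]
    note quot = quotient_by_common_stabilizer[OF N td_act_fibre one mult trans st]
    show ?thesis using sg st quot by blast
  qed
  then show ?thesis using td_act_group_action tr by blast
qed

end
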